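(* There exists an algorithm that, given two graphs $G_1$ and $G_2$ of order $n$ on the same vertex set, decides whether $G_1$ and $G_2$ are LU-equivalent, with runtime $n^{\log_2(n)+O(1)}$.
   Context: All graphs are finite, simple and undirected, on a totally ordered vertex set $V$; the order of a graph is $n=|V|$. The graph state of $G$ is the $n$-qubit state $|G\rangle=\frac{1}{\sqrt{2^n}}\sum_{x\in\{0,1\}^n}(-1)^{|G[x]|}|x\rangle$, where qubits are indexed by $V$, $x$ is identified with the subset of vertices of which it is the indicator, and $|G[x]|$ is the number of edges of the subgraph of $G$ induced by $x$. Two graphs $G_1,G_2$ on the same vertex set are LU-equivalent if there is a local unitary $U=\bigotimes_{u\in V}U_u$, each $U_u$ being a single-qubit unitary, such that $|G_2\rangle=U|G_1\rangle$. *)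

theory Defs
  imports
    Complex_Main
    "HOL-Library.Landau_Symbols"
    "HOL-Library.Log_Nat"
    "Jordan_Normal_Form.Schur_Decomposition"
begin

section \<open>Graphs and graph states\<close>

text \<open>Vertices are natural numbers, carrying their usual order; the vertex set is an arbitrary
  finite set of them. The edges are two-element sets of vertices.\<close>

definition simple_graph :: "nat set \<Rightarrow> nat set set \<Rightarrow> bool" where
  "simple_graph V E \<longleftrightarrow> finite V \<and> (\<forall>e\<in>E. e \<subseteq> V \<and> card e = 2)"

definition induced_edges :: "nat set set \<Rightarrow> nat set \<Rightarrow> nat set set" where
  "induced_edges E x = {e \<in> E. e \<subseteq> x}"

text \<open>A state of the qubits indexed by \<open>V\<close> is given by its amplitudes in the computational basis.
  The basis vector \<open>x \<in> {0,1}\<^sup>V\<close> is identified with a subset of \<open>V\<close>; only the arguments in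
  \<open>Pow V\<close> are meaningful.\<close>

type_synonym qstate = "nat set \<Rightarrow> complex"

definition graph_state :: "nat set \<Rightarrow> nat set set \<Rightarrow> qstate" where
  "graph_state V E x =
     (- 1) ^ card (induced_edges E x) / complex_of_real (sqrt (2 ^ card V))"

definition unitary_mat :: "nat \<Rightarrow> complex mat \<Rightarrow> bool" where
  "unitary_mat d U \<longleftrightarrow>
     U \<in> carrier_mat d d \<and> mat_adjoint U * U = 1\<^sub>m d \<and> U * mat_adjoint U = 1\<^sub>m d"

text \<open>The operator \<open>\<Otimes>\<^sub>u U\<^sub>u\<close>, whose \<open>(y, x)\<close> entry is the product of
  the \<open>(y\<^sub>u, x\<^sub>u)\<close> entries of the \<open>U\<^sub>u\<close>, applied to a state.\<close>

definition apply_local :: "nat set \<Rightarrow> (nat \<Rightarrow> complex mat) \<Rightarrow> qstate \<Rightarrow> qstate" where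
  "apply_local V U \<psi> y =
     (\<Sum>x\<in>Pow V. (\<Prod>u\<in>V. U u $$ (of_bool (u \<in> y), of_bool (u \<in> x))) * \<psi> x)"

definition LU_equivalent :: "nat set \<Rightarrow> nat set set \<Rightarrow> nat set set \<Rightarrow> bool" where
  "LU_equivalent V E1 E2 \<longleftrightarrow>
     (\<exists>U. (\<forall>u\<in>V. unitary_mat 2 (U u)) \<and>
          (\<forall>y\<in>Pow V. graph_state V E2 y = apply_local V U (graph_state V E1) y))"


section \<open>Random access machines with logarithmic cost\<close>

text \<open>Algorithms are programs of a random access machine, written with structured control flow.
  A state consists of registers, which a program addresses by constants, and of a memory,
  which is addressed indirectly through registers. Arithmetic is limited to
  addition and (truncated) subtraction, and every operation is charged the bit lengths of the
  numbers and memory addresses it handles, so that no work can be hidden in large numbers.\<close>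

type_synonym ram_state = "(nat \<Rightarrow> nat) \<times> (nat \<Rightarrow> nat)"

datatype ram =
    Skip
  | Const nat nat      \<comment> \<open>\<open>Const i k\<close>: \<open>R[i] := k\<close>\<close>
  | Add nat nat nat    \<comment> \<open>\<open>Add i j k\<close>: \<open>R[i] := R[j] + R[k]\<close>\<close>
  | Sub nat nat nat    \<comment> \<open>\<open>Sub i j k\<close>: \<open>R[i] := R[j] - R[k]\<close>\<close>
  | Load nat nat       \<comment> \<open>\<open>Load i j\<close>: \<open>R[i] := M[R[j]]\<close>\<close>
  | Store nat nat      \<comment> \<open>\<open>Store i j\<close>: \<open>M[R[i]] := R[j]\<close>\<close>
  | Seq ram ram
  | IfNZ nat ram ram
  | WhileNZ nat ram

abbreviation bit_length :: "nat \<Rightarrow> nat" where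
  "bit_length \<equiv> floorlog 2"

text \<open>\<open>exec p s t s'\<close>: started in state \<open>s\<close>, the program \<open>p\<close> halts in state \<open>s'\<close>
  after a computation of total cost \<open>t\<close>.\<close>

inductive exec :: "ram \<Rightarrow> ram_state \<Rightarrow> nat \<Rightarrow> ram_state \<Rightarrow> bool" where
  Skip: "exec Skip s 1 s"
| Const: "exec (Const i k) (R, M) (1 + bit_length k) (R(i := k), M)"
| Add: "exec (Add i j k) (R, M) (1 + bit_length (R j) + bit_length (R k)) (R(i := R j + R k), M)"
| Sub: "exec (Sub i j k) (R, M) (1 + bit_length (R j) + bit_length (R k)) (R(i := R j - R k), M)"
| Load: "exec (Load i j) (R, M) (1 + bit_length (R j) + bit_length (M (R j))) (R(i := M (R j)), M)"
| Store: "exec (Store i j) (R, M) (1 + bit_length (R i) + bit_length (R j)) (R, M(R i := R j))"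
| Seq: "exec p s t s' \<Longrightarrow> exec q s' t' s'' \<Longrightarrow> exec (Seq p q) s (t + t') s''"
| IfTrue: "R i \<noteq> 0 \<Longrightarrow> exec p (R, M) t s' \<Longrightarrow>
    exec (IfNZ i p q) (R, M) (1 + bit_length (R i) + t) s'"
| IfFalse: "R i = 0 \<Longrightarrow> exec q (R, M) t s' \<Longrightarrow>
    exec (IfNZ i p q) (R, M) (1 + bit_length (R i) + t) s'"
| WhileTrue: "R i \<noteq> 0 \<Longrightarrow> exec p (R, M) t s' \<Longrightarrow> exec (WhileNZ i p) s' t' s'' \<Longrightarrow>
    exec (WhileNZ i p) (R, M) (1 + bit_length (R i) + t + t') s''"
| WhileFalse: "R i = 0 \<Longrightarrow> exec (WhileNZ i p) (R, M) (1 + bit_length (R i)) (R, M)"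

inductive_cases Seq_execE: "exec (Seq p q) s t s'"
inductive_cases IfNZ_execE: "exec (IfNZ i p q) s t s'"
inductive_cases WhileNZ_execE: "exec (WhileNZ i p) s t s'"

lemma exec_deterministic:
  "exec p s t s' \<Longrightarrow> exec p s u s'' \<Longrightarrow> t = u \<and> s' = s''"
proof (induction arbitrary: u s'' rule: exec.induct)
  case (Seq p s t s' q t' s2)
  from Seq.prems show ?case by (rule Seq_execE) (use Seq.IH in blast)
next
  case (IfTrue R i p M t s' q)
  from IfTrue.prems show ?case
    by (rule IfNZ_execE) (use IfTrue.hyps(1) IfTrue.IH in auto)
next
  case (IfFalse R i q M t s' p)
  from IfFalse.prems show ?case
    by (rule IfNZ_execE) (use IfFalse.hyps(1) IfFalse.IH in auto)
next
  case (WhileTrue R i p M t s' t' s2)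
  from WhileTrue.prems obtain v v' s3
    where "u = 1 + bit_length (R i) + v + v'" "exec p (R, M) v s3"
      and "exec (WhileNZ i p) s3 v' s''"
    by (rule WhileNZ_execE) (use WhileTrue.hyps(1) in simp_all)
  with WhileTrue.IH show ?case by blast
next
  case (WhileFalse R i M p)
  from WhileFalse.prems show ?case
    by (rule WhileNZ_execE) (use WhileFalse.hyps in simp_all)
qed (erule exec.cases; simp)+


section \<open>Encoding of the instances\<close>

text \<open>The algorithm receives the order \<open>n\<close> in register 0. The memory cells \<open>0, \<dots>, n\<^sup>2 - 1\<close>
  hold the adjacency matrix of the first graph, and the cells \<open>n\<^sup>2, \<dots>, 2n\<^sup>2 - 1\<close> that of the
  second one, both row by row and with respect to the increasing enumeration of \<open>V\<close>.\<close>

definition adjacency :: "nat set \<Rightarrow> nat set set \<Rightarrow> nat \<Rightarrow> nat \<Rightarrow> nat" where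
  "adjacency V E i j = of_bool ({sorted_list_of_set V ! i, sorted_list_of_set V ! j} \<in> E)"

definition input_memory :: "nat set \<Rightarrow> nat set set \<Rightarrow> nat set set \<Rightarrow> nat \<Rightarrow> nat" where
  "input_memory V E1 E2 k =
     (let n = card V in
        if k < n\<^sup>2 then adjacency V E1 (k div n) (k mod n)
        else if k < 2 * n\<^sup>2 then adjacency V E2 ((k - n\<^sup>2) div n) ((k - n\<^sup>2) mod n)
        else 0)"

definition input_state :: "nat set \<Rightarrow> nat set set \<Rightarrow> nat set set \<Rightarrow> ram_state" where
  "input_state V E1 E2 = ((\<lambda>_. 0)(0 := card V), input_memory V E1 E2)"

definition accepting :: "ram_state \<Rightarrow> bool" where
  "accepting s \<longleftrightarrow> fst s 0 \<noteq> 0"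

definition decides_LU_equivalence :: "ram \<Rightarrow> bool" where
  "decides_LU_equivalence p \<longleftrightarrow>
     (\<forall>V E1 E2. simple_graph V E1 \<longrightarrow> simple_graph V E2 \<longrightarrow>
        (\<exists>t s. exec p (input_state V E1 E2) t s \<and>
               (accepting s \<longleftrightarrow> LU_equivalent V E1 E2)))"

text \<open>The runtime is bounded for orders \<open>n \<ge> 2\<close> only, since the bounds of interest are
  powers of \<open>n\<close>, which are constant for \<open>n \<le> 1\<close>.\<close>

definition runtime_bounded_by :: "ram \<Rightarrow> (nat \<Rightarrow> real) \<Rightarrow> bool" where
  "runtime_bounded_by p T \<longleftrightarrow>
     (\<forall>V E1 E2 t s. simple_graph V E1 \<longrightarrow> simple_graph V E2 \<longrightarrow> card V \<ge> 2 \<longrightarrow>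
        exec p (input_state V E1 E2) t s \<longrightarrow> real t \<le> T (card V))"

end

theory Submission
  imports Defs
begin

text \<open>The stabilizer elements of a graph state correspond to the sets of vertices. A local unitary that maps one
  graph state to another acts at each vertex on the Pauli operators by a rotation and transports the
  correlations. Consider the stabilizer elements that satisfy given constraints at some vertices whose axes are
  already known to correspond: if their tensor factors at a further vertex are confined to one axis, then the
  rotation maps this axis to the one obtained in the same way for the second graph. Starting from a root, where
  nine pairs of axes are tried, these inferences reach the whole connected component, since otherwise the stabilizer
  group would be a product and the component would be disconnected.

  When one pair of axes is known at every vertex, fixed Clifford operators turn all of them into \<open>Z\<close> axes, and the
  local unitary is diagonal up to Pauli operators. What remains is a system of linear equations for the rotation
  angles, one for each vertex \<open>k\<close> and each set \<open>J\<close> of vertices, in which the coefficients are multiples of \<open>2 ^ card J\<close>.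
  By the minimum distance of Reed--Muller codes a solution can be chosen with all angles multiples of
  \<open>2\<pi> / 2 ^ r\<close> as soon as \<open>2 ^ r > n\<close>. The equations modulo \<open>2 ^ r\<close> are trivial for \<open>card J > r\<close>, so about
  \<open>n ^ log 2 n\<close> of them are left, and a generating system of the solutions is updated for each of them
  in polynomial time.\<close>

section \<open>Local operators\<close>

text \<open>A local unitary need not carry Pauli operators to Pauli operators, so the stabilizer
  elements of the two graphs cannot be matched individually. What it does preserve is the number of
  stabilizer elements under matched local constraints: correlations of a graph state have modulus 0
  or 1, and conjugation acts on the Pauli basis by a unitary matrix. Every inference about axes is
  drawn from such counts. The exception is an isolated edge, where a local unitary may preserve no
  axis; there both graphs turn out equal, and the identity replaces the given unitary.

  The angles obtained from a unitary are arbitrary reals. They enter the equations only through sums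
  over classes of vertices that lie in the same supports. There are at most \<open>n\<close>
  classes, which is why \<open>n < 2 ^ r\<close> bounds the denominators, and a class sum can be
  placed on a single vertex. The signs of the generators stay out of the linear system: they are
  corrected afterwards by operators \<open>Z\<close>, so the algorithm handles no amplitudes at
  all.\<close>

definition lap :: "nat set => (nat => bool => bool => complex) => (nat set => complex) => nat set => complex" where
 "lap V m \<psi> y = (\<Sum>x\<in>Pow V. (\<Prod>u\<in>V. m u (u \<in> y) (u \<in> x)) * \<psi> x)"

lemma sum_Pow_prod:
 fixes f :: "nat => bool => complex"
 assumes "finite V"
 shows "(\<Sum>x\<in>Pow V. \<Prod>u\<in>V. f u (u \<in> x)) = (\<Prod>u\<in>V. f u True + f u False)"
proof -
 have "(\<Prod>u\<in>V. f u (u \<in> x)) = (\<Prod>u\<in>x. f u True) * (\<Prod>u\<in>V - x. f u False)" if "x \<subseteq> V" for x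
 proof -
  have "(\<Prod>u\<in>V. f u (u \<in> x)) = (\<Prod>u\<in>x \<union> (V - x). f u (u \<in> x))"
   using that by (simp add: Un_absorb1)
  also have "... = (\<Prod>u\<in>x. f u (u \<in> x)) * (\<Prod>u\<in>V - x. f u (u \<in> x))"
   by (rule prod.union_disjoint) (use that assms finite_subset in auto)
  also have "... = (\<Prod>u\<in>x. f u True) * (\<Prod>u\<in>V - x. f u False)" by simp
  finally show ?thesis .
 qed
 thus ?thesis
  by (subst prod_add[OF assms]) (auto intro!: sum.cong)
qed

section \<open>Two-by-two matrices indexed by bits\<close>

definition mmul :: "(bool => bool => complex) => (bool => bool => complex) => bool => bool => complex" where
 "mmul a b i j = a i True * b True j + a i False * b False j"

definition mone :: "bool => bool => complex" where
 "mone i j = of_bool (i = j)"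

definition madj :: "(bool => bool => complex) => bool => bool => complex" where
 "madj a i j = cnj (a j i)"

definition uni :: "(bool => bool => complex) => bool" where
 "uni a \<longleftrightarrow> mmul (madj a) a = mone & mmul a (madj a) = mone"

lemma mmul_assoc: "mmul (mmul a b) c = mmul a (mmul b c)"
 by (intro ext) (simp add: mmul_def algebra_simps)

lemma mmul_one [simp]: "mmul mone a = a" "mmul a mone = a"
 by (intro ext; simp add: mmul_def mone_def)+

lemma madj_madj [simp]: "madj (madj a) = a"
 by (intro ext) (simp add: madj_def)

lemma madj_mmul: "madj (mmul a b) = mmul (madj b) (madj a)"
 by (intro ext) (simp add: madj_def mmul_def mult.commute)

lemma uni_mmul: assumes "uni a" "uni b" shows "uni (mmul a b)"
proof -
 have "mmul (mmul (madj b) (madj a)) (mmul a b) = mmul (madj b) (mmul (mmul (madj a) a) b)"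
  by (simp add: mmul_assoc)
 moreover have "mmul (mmul a b) (mmul (madj b) (madj a)) = mmul a (mmul (mmul b (madj b)) (madj a))"
  by (simp add: mmul_assoc)
 ultimately show ?thesis using assms by (simp add: uni_def madj_mmul)
qed

lemma uni_madj: "uni a ==> uni (madj a)"
 by (simp add: uni_def)

lemma uni_mone [simp]: "uni mone"
proof -
 have "madj mone = mone" by (intro ext) (auto simp: madj_def mone_def)
 thus ?thesis by (simp add: uni_def)
qed

lemma lap_cong:
 assumes "!!u. u \<in> V ==> m u = m' u" "!!x. x \<subseteq> V ==> \<psi> x = \<psi>' x"
 shows "lap V m \<psi> y = lap V m' \<psi>' y"
 unfolding lap_def
proof (rule sum.cong[OF refl])
 fix x assume "x \<in> Pow V"
 have "(\<Prod>u\<in>V. m u (u \<in> y) (u \<in> x)) = (\<Prod>u\<in>V. m' u (u \<in> y) (u \<in> x))"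
  by (rule prod.cong) (simp_all add: assms(1))
 thus "(\<Prod>u\<in>V. m u (u \<in> y) (u \<in> x)) * \<psi> x = (\<Prod>u\<in>V. m' u (u \<in> y) (u \<in> x)) * \<psi>' x"
  using assms(2) \<open>x \<in> Pow V\<close> by simp
qed

lemma lap_lap:
 assumes "finite V"
 shows "lap V a (lap V b \<psi>) y = lap V (%u. mmul (a u) (b u)) \<psi> y"
proof -
 have "lap V a (lap V b \<psi>) y =
   (\<Sum>x\<in>Pow V. \<Sum>w\<in>Pow V. (\<Prod>u\<in>V. a u (u \<in> y) (u \<in> x) * b u (u \<in> x) (u \<in> w)) * \<psi> w)"
  unfolding lap_def by (simp add: sum_distrib_left prod.distrib mult.assoc)
 also have "... = (\<Sum>w\<in>Pow V. (\<Sum>x\<in>Pow V. \<Prod>u\<in>V. a u (u \<in> y) (u \<in> x) * b u (u \<in> x) (u \<in> w)) * \<psi> w)"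
  by (subst sum.swap) (simp add: sum_distrib_right)
 also have "... = lap V (%u. mmul (a u) (b u)) \<psi> y"
  unfolding lap_def
  by (subst sum_Pow_prod[OF assms, where f = "%u c. a u (u \<in> y) c * b u c (u \<in> _)"])
    (simp add: mmul_def)
 finally show ?thesis .
qed

text \<open>A monomial factor has one nonzero entry per column, so the only contribution to the
  amplitude at \<open>sym_diff y f\<close> comes from \<open>y\<close>: any other \<open>x\<close>
  meets a zero entry at a vertex where it differs from \<open>y\<close>. Pauli operators
  (\<open>f\<close> is the X part), diagonal operators and, in suitable frames, the unitary itself
  are of this kind.\<close>

lemma lap_monomial:
 assumes "finite V" "y \<subseteq> V" "f \<subseteq> V"
  and "!!u b c. u \<in> V ==> m u b c = (if b = (c ~= (u \<in> f)) then k u c else 0)"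
 shows "lap V m \<psi> (sym_diff y f) = (\<Prod>u\<in>V. k u (u \<in> y)) * \<psi> y"
proof -
 have "lap V m \<psi> (sym_diff y f) = (\<Sum>x\<in>{y}. (\<Prod>u\<in>V. m u (u \<in> sym_diff y f) (u \<in> x)) * \<psi> x)"
  unfolding lap_def
 proof (rule sum.mono_neutral_right)
  show "\<forall>x\<in>Pow V - {y}. (\<Prod>u\<in>V. m u (u \<in> sym_diff y f) (u \<in> x)) * \<psi> x = 0"
  proof
   fix x assume "x \<in> Pow V - {y}"
   then obtain u where "u \<in> V" "(u \<in> x) ~= (u \<in> y)" using assms(2) by auto
   hence "m u (u \<in> sym_diff y f) (u \<in> x) = 0" using assms(4) by auto
   with \<open>u \<in> V\<close> assms(1) have "(\<Prod>u\<in>V. m u (u \<in> sym_diff y f) (u \<in> x)) = 0"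
    by (meson prod_zero)
   thus "(\<Prod>u\<in>V. m u (u \<in> sym_diff y f) (u \<in> x)) * \<psi> x = 0" by simp
  qed
 qed (use assms in auto)
 also have "... = (\<Prod>u\<in>V. k u (u \<in> y)) * \<psi> y"
  using assms(4) by (auto intro!: prod.cong)
 finally show ?thesis .
qed

lemma lap_mone: "finite V ==> y \<subseteq> V ==> lap V (%_. mone) \<psi> y = \<psi> y"
 using lap_monomial[of V y "{}" "%_. mone" "%_ _. 1" \<psi>] by (simp add: mone_def)

lemma lap_uni_inverse:
 assumes "finite V" "!!u. u \<in> V ==> uni (m u)" "y \<subseteq> V"
 shows "lap V m (lap V (%u. madj (m u)) \<psi>) y = \<psi> y"
  and "lap V (%u. madj (m u)) (lap V m \<psi>) y = \<psi> y"
proof -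
 have "lap V m (lap V (%u. madj (m u)) \<psi>) y = lap V (%_. mone) \<psi> y"
  unfolding lap_lap[OF assms(1)] by (rule lap_cong) (use assms(2) in "auto simp: uni_def")
 thus "lap V m (lap V (%u. madj (m u)) \<psi>) y = \<psi> y" using lap_mone assms by simp
 have "lap V (%u. madj (m u)) (lap V m \<psi>) y = lap V (%_. mone) \<psi> y"
  unfolding lap_lap[OF assms(1)] by (rule lap_cong) (use assms(2) in "auto simp: uni_def")
 thus "lap V (%u. madj (m u)) (lap V m \<psi>) y = \<psi> y" using lap_mone assms by simp
qed

lemma lap_scale: "lap V m (%x. c * \<psi> x) y = c * lap V m \<psi> y"
 by (simp add: lap_def sum_distrib_left algebra_simps)

section \<open>The inner product of states\<close>

definition ip :: "nat set => (nat set => complex) => (nat set => complex) => complex" where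
 "ip V \<phi> \<psi> = (\<Sum>y\<in>Pow V. cnj (\<phi> y) * \<psi> y)"

lemma ip_cong:
 "(!!y. y \<subseteq> V ==> \<phi> y = \<phi>' y) ==> (!!y. y \<subseteq> V ==> \<psi> y = \<psi>' y) ==> ip V \<phi> \<psi> = ip V \<phi>' \<psi>'"
 unfolding ip_def by (rule sum.cong) simp_all

lemma ip_lap_right: "ip V \<phi> (lap V m \<psi>) = ip V (lap V (%u. madj (m u)) \<phi>) \<psi>"
proof -
 have "ip V \<phi> (lap V m \<psi>) =
   (\<Sum>y\<in>Pow V. \<Sum>x\<in>Pow V. cnj (\<phi> y) * (\<Prod>u\<in>V. m u (u \<in> y) (u \<in> x)) * \<psi> x)"
  by (simp add: ip_def lap_def sum_distrib_left algebra_simps)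
 also have "... = (\<Sum>x\<in>Pow V. \<Sum>y\<in>Pow V. cnj (\<phi> y) * (\<Prod>u\<in>V. m u (u \<in> y) (u \<in> x)) * \<psi> x)"
  by (rule sum.swap)
 also have "... = ip V (lap V (%u. madj (m u)) \<phi>) \<psi>"
  by (simp add: ip_def lap_def sum_distrib_left sum_distrib_right madj_def algebra_simps)
 finally show ?thesis .
qed

lemma ip_lap_uni:
 assumes "finite V" "!!u. u \<in> V ==> uni (m u)"
 shows "ip V (lap V m \<phi>) (lap V m \<psi>) = ip V \<phi> \<psi>"
proof -
 have "ip V (lap V m \<phi>) (lap V m \<psi>) = ip V (lap V (%u. madj (m u)) (lap V m \<phi>)) \<psi>"
  by (rule ip_lap_right)
 also have "... = ip V \<phi> \<psi>"
  by (rule ip_cong) (use lap_uni_inverse(2)[OF assms] in auto)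
 finally show ?thesis .
qed

section \<open>Graph states up to a scalar factor\<close>

definition sgn_st :: "nat set set => nat set => complex" where
 "sgn_st E x = (- 1) ^ card (induced_edges E x)"

text \<open>The free scalar absorbs normalization and global phase, so that graph states can be
  replaced by their sign functions \<open>sgn_st\<close>.\<close>

definition LUc :: "nat set => nat set set => nat set set => bool" where
 "LUc V E1 E2 \<longleftrightarrow> (\<exists>m c. c ~= 0 & (\<forall>u\<in>V. uni (m u)) \<and>
   (\<forall>y\<in>Pow V. lap V m (sgn_st E1) y = c * sgn_st E2 y))"

lemma sgn_st_ne_0 [simp]: "sgn_st E x ~= 0"
 by (simp add: sgn_st_def)

lemma sgn_st_sq [simp]: "sgn_st E x * sgn_st E x = 1"
 by (simp add: sgn_st_def flip: power_mult_distrib)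

lemma cnj_sgn_st [simp]: "cnj (sgn_st E x) = sgn_st E x"
 by (simp add: sgn_st_def)

lemma ip_sgn_st: "finite V ==> ip V (sgn_st E) (sgn_st E) = 2 ^ card V"
 by (simp add: ip_def card_Pow)

section \<open>Passage to and from library matrices\<close>

definition of_mat :: "complex mat => bool => bool => complex" where
 "of_mat U i j = U $$ (of_bool i, of_bool j)"

definition to_mat :: "(bool => bool => complex) => complex mat" where
 "to_mat m = mat 2 2 (%(i, j). m (i = 1) (j = 1))"

lemma of_to_mat [simp]: "of_mat (to_mat m) = m"
 by (intro ext) (auto simp: of_mat_def to_mat_def)

lemma mat2_eq_iff:
 assumes "A \<in> carrier_mat 2 2" "B \<in> carrier_mat 2 2"
 shows "A = B \<longleftrightarrow> of_mat A = of_mat B"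
proof
 assume eq: "of_mat A = of_mat B"
 show "A = B"
 proof (rule eq_matI)
  fix i j assume "i < dim_row B" "j < dim_col B"
  hence ij: "i = of_bool (i = 1)" "j = of_bool (j = 1)" using assms by auto
  have "of_mat A (i = 1) (j = 1) = of_mat B (i = 1) (j = 1)" using eq by simp
  thus "A $$ (i, j) = B $$ (i, j)" unfolding of_mat_def using ij by simp
 qed (use assms in auto)
qed simp

lemma of_mat_mult:
 assumes "A \<in> carrier_mat 2 2" "B \<in> carrier_mat 2 2"
 shows "of_mat (A * B) = mmul (of_mat A) (of_mat B)"
proof (intro ext)
 fix i j :: bool
 have "of_bool i < (2::nat)" "of_bool j < (2::nat)" by auto
 thus "of_mat (A * B) i j = mmul (of_mat A) (of_mat B) i j"
  using assms by (simp add: of_mat_def mmul_def scalar_prod_def numeral_2_eq_2)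
qed

lemma of_mat_adjoint:
 assumes "A \<in> carrier_mat 2 2"
 shows "of_mat (mat_adjoint A) = madj (of_mat A)"
proof (intro ext)
 fix i j :: bool
 have "of_bool i < (2::nat)" "of_bool j < (2::nat)" by auto
 thus "of_mat (mat_adjoint A) i j = madj (of_mat A) i j"
  using assms by (simp add: of_mat_def madj_def mat_adjoint_def mat_of_rows_def)
qed

lemma mat_adjoint_carrier2: "A \<in> carrier_mat 2 2 ==> mat_adjoint A \<in> carrier_mat 2 2"
 by (rule carrier_matI) (simp_all add: mat_adjoint_def mat_of_rows_def)

lemma of_mat_one: "of_mat (1\<^sub>m 2) = mone"
 by (intro ext) (auto simp: of_mat_def mone_def)

lemma unitary_mat_iff: "unitary_mat 2 U \<longleftrightarrow> U \<in> carrier_mat 2 2 & uni (of_mat U)"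
proof (cases "U \<in> carrier_mat 2 2")
 case True
 note adj = mat_adjoint_carrier2[OF True]
 show ?thesis
  using True mat2_eq_iff[OF mult_carrier_mat[OF adj True] one_carrier_mat]
   mat2_eq_iff[OF mult_carrier_mat[OF True adj] one_carrier_mat]
  by (simp add: unitary_mat_def uni_def of_mat_mult adj of_mat_adjoint of_mat_one)
qed (simp add: unitary_mat_def)

lemma to_mat_unitary: "uni m ==> unitary_mat 2 (to_mat m)"
 by (simp add: unitary_mat_iff) (simp add: to_mat_def)

lemma apply_local_lap: "apply_local V U \<psi> y = lap V (%u. of_mat (U u)) \<psi> y"
 by (simp add: apply_local_def lap_def of_mat_def)

lemma graph_state_sgn: "graph_state V E x = inverse (complex_of_real (sqrt (2 ^ card V))) * sgn_st E x"
 by (simp add: graph_state_def sgn_st_def divide_inverse)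

lemma sgn_st_empty: "{} \<notin> E ==> sgn_st E {} = 1"
proof -
 assume "{} \<notin> E"
 hence "induced_edges E {} = {}" by (auto simp: induced_edges_def)
 thus ?thesis by (simp add: sgn_st_def)
qed

lemma simple_graph_no_empty: "simple_graph V E ==> {} \<notin> E"
 by (auto simp: simple_graph_def)

lemma LU_iff_LUc:
 assumes "simple_graph V E1" "simple_graph V E2"
 shows "LU_equivalent V E1 E2 \<longleftrightarrow> LUc V E1 E2"
proof
 have fin: "finite V" using assms by (simp add: simple_graph_def)
 define k where "k = inverse (complex_of_real (sqrt (2 ^ card V)))"
 have k0: "k ~= 0" by (simp add: k_def)
 have gs: "graph_state V E = (%x. k * sgn_st E x)" for E
  by (intro ext) (simp add: graph_state_sgn k_def)
 {
  assume "LU_equivalent V E1 E2"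
  then obtain U where U: "!!u. u \<in> V ==> unitary_mat 2 (U u)"
   "!!y. y \<in> Pow V ==> graph_state V E2 y = apply_local V U (graph_state V E1) y"
   unfolding LU_equivalent_def by blast
  have "lap V (%u. of_mat (U u)) (sgn_st E1) y = 1 * sgn_st E2 y" if "y \<in> Pow V" for y
   using U(2)[OF that] k0 unfolding apply_local_lap gs lap_scale by simp
  thus "LUc V E1 E2" unfolding LUc_def
   using U(1) by (intro exI[of _ "%u. of_mat (U u)"] exI[of _ 1]) (auto simp: unitary_mat_iff)
 }
 {
  assume "LUc V E1 E2"
  then obtain m c where c: "c ~= 0" and m: "!!u. u \<in> V ==> uni (m u)"
   and eq: "!!y. y \<in> Pow V ==> lap V m (sgn_st E1) y = c * sgn_st E2 y"
   unfolding LUc_def by blast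
  \<comment> \<open>Comparing norms shows that \<open>c\<close> is a phase; \<open>cnj c\<close> can
    then be multiplied into the factor at one vertex \<open>u0\<close>, if there is a vertex at
    all.\<close>
  have "2 ^ card V = ip V (lap V m (sgn_st E1)) (lap V m (sgn_st E1))"
   using ip_lap_uni[OF fin m] ip_sgn_st[OF fin] by simp
  also have "... = ip V (%y. c * sgn_st E2 y) (%y. c * sgn_st E2 y)"
   by (rule ip_cong) (use eq in auto)
  also have "... = cnj c * c * ip V (sgn_st E2) (sgn_st E2)"
   by (simp add: ip_def sum_distrib_left mult.assoc mult.left_commute)
  finally have cc: "cnj c * c = 1" using ip_sgn_st[OF fin, of E2] by simp
  have "\<exists>m. (\<forall>u\<in>V. uni (m u)) & (\<forall>y\<in>Pow V. lap V m (sgn_st E1) y = sgn_st E2 y)"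
  proof (cases "V = {}")
   case True
   thus ?thesis
    using sgn_st_empty simple_graph_no_empty assms by (intro exI[of _ "%_. mone"]) (simp add: lap_def)
  next
   case False
   then obtain u0 where u0: "u0 \<in> V" by auto
   define m' where "m' u = (if u = u0 then (%i j. cnj c * m u i j) else m u)" for u
   have "uni (m' u)" if "u \<in> V" for u
   proof (cases "u = u0")
    case True
    have e: "mmul (madj (m' u)) (m' u) = (%i j. (cnj c * c) * mmul (madj (m u)) (m u) i j)"
     "mmul (m' u) (madj (m' u)) = (%i j. (cnj c * c) * mmul (m u) (madj (m u)) i j)"
     using True by (intro ext; simp add: m'_def mmul_def madj_def algebra_simps)+
    show ?thesis using m[OF that] unfolding uni_def e cc by (simp add: eta_contract_eq)
   qed (use m[OF that] m'_def in simp)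
   moreover have "lap V m' (sgn_st E1) y = sgn_st E2 y" if "y \<in> Pow V" for y
   proof -
    have "(\<Prod>u\<in>V. m' u (u \<in> y) (u \<in> x)) = cnj c * (\<Prod>u\<in>V. m u (u \<in> y) (u \<in> x))" for x
    proof -
     have "(\<Prod>u\<in>V. m' u (u \<in> y) (u \<in> x)) = m' u0 (u0 \<in> y) (u0 \<in> x) * (\<Prod>u\<in>V - {u0}. m' u (u \<in> y) (u \<in> x))"
      by (rule prod.remove[OF fin u0])
     also have "(\<Prod>u\<in>V - {u0}. m' u (u \<in> y) (u \<in> x)) = (\<Prod>u\<in>V - {u0}. m u (u \<in> y) (u \<in> x))"
      by (intro prod.cong) (auto simp: m'_def)
     finally show ?thesis using prod.remove[OF fin u0, of "%u. m u (u \<in> y) (u \<in> x)"]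
      by (simp add: m'_def)
    qed
    hence "lap V m' (sgn_st E1) y = cnj c * lap V m (sgn_st E1) y"
     by (simp add: lap_def sum_distrib_left mult.assoc)
    thus ?thesis using eq[OF that] cc by (simp flip: mult.assoc)
   qed
   ultimately show ?thesis by blast
  qed
  then obtain m' where m': "!!u. u \<in> V ==> uni (m' u)"
   "!!y. y \<in> Pow V ==> lap V m' (sgn_st E1) y = sgn_st E2 y" by blast
  show "LU_equivalent V E1 E2" unfolding LU_equivalent_def
  proof (intro exI[of _ "%u. to_mat (m' u)"] conjI ballI)
   fix y assume "y \<in> Pow V"
   thus "graph_state V E2 y = apply_local V (%u. to_mat (m' u)) (graph_state V E1) y"
    unfolding apply_local_lap gs lap_scale by (simp add: m')
  qed (use m' to_mat_unitary in auto)
 }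
qed

lemma LUc_refl: "finite V ==> LUc V E E"
 unfolding LUc_def by (intro exI[of _ "%_. mone"] exI[of _ 1]) (simp add: lap_mone)

lemma LUc_trans:
 assumes "finite V" "LUc V E1 E2" "LUc V E2 E3"
 shows "LUc V E1 E3"
proof -
 obtain m c where m: "c ~= 0" "!!u. u \<in> V ==> uni (m u)"
  "!!y. y \<in> Pow V ==> lap V m (sgn_st E1) y = c * sgn_st E2 y"
  using assms(2) unfolding LUc_def by blast
 obtain m' c' where m': "c' ~= 0" "!!u. u \<in> V ==> uni (m' u)"
  "!!y. y \<in> Pow V ==> lap V m' (sgn_st E2) y = c' * sgn_st E3 y"
  using assms(3) unfolding LUc_def by blast
 show ?thesis unfolding LUc_def
 proof (intro exI[of _ "%u. mmul (m' u) (m u)"] exI[of _ "c * c'"] conjI ballI)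
  fix y assume y: "y \<in> Pow V"
  have "lap V (%u. mmul (m' u) (m u)) (sgn_st E1) y = lap V m' (lap V m (sgn_st E1)) y"
   by (simp add: lap_lap assms)
  also have "... = lap V m' (%x. c * sgn_st E2 x) y"
   by (rule lap_cong) (use m in auto)
  finally show "lap V (%u. mmul (m' u) (m u)) (sgn_st E1) y = c * c' * sgn_st E3 y"
   using m'(3)[OF y] by (simp add: lap_scale)
 qed (use m m' uni_mmul in auto)
qed

section \<open>Pauli correlations of graph states\<close>

text \<open>The pair \<open>(a, c)\<close> of bits stands for the single-qubit Pauli operator \<open>X\<^sup>a Z\<^sup>c\<close>.\<close>

definition tau :: "bool \<times> bool => bool => bool => complex" where
 "tau p b b' = (if b = (b' ~= fst p) then (if snd p & b' then - 1 else 1) else 0)"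

definition nbr :: "nat set set => nat => nat set" where
 "nbr E u = {v. {u, v} \<in> E}"

text \<open>The stabilizer elements of a graph state correspond to the sets of vertices: \<open>cmp E x u\<close> is
  the tensor factor at \<open>u\<close> of the product of the generators \<open>X\<^sub>v Z\<^bsub>N(v)\<^esub>\<close> with \<open>v \<in> x\<close>.\<close>

definition cmp :: "nat set set => nat set => nat => bool \<times> bool" where
 "cmp E x u = (u \<in> x, odd (card (nbr E u \<inter> x)))"

lemma nbr_sym: "v \<in> nbr E u \<longleftrightarrow> u \<in> nbr E v"
 by (simp add: nbr_def insert_commute)

lemma nbr_irrefl: "simple_graph V E ==> u \<notin> nbr E u"
 by (auto simp: nbr_def simple_graph_def)

lemma nbr_subset: "simple_graph V E ==> nbr E u \<subseteq> V"
 by (auto simp: nbr_def simple_graph_def)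

lemma simple_graph_edge:
 assumes "simple_graph V E" "e \<in> E" "j \<in> e"
 obtains v where "e = {j, v}" "v ~= j" "v \<in> nbr E j"
proof -
 have "card e = 2" using assms by (auto simp: simple_graph_def)
 then obtain a b where "e = {a, b}" "a ~= b" by (auto simp: card_2_iff)
 with assms(2,3) that show ?thesis by (auto simp: nbr_def insert_commute)
qed

lemma even_card_sym_diff:
 assumes "finite a" "finite b"
 shows "even (card (sym_diff a b)) \<longleftrightarrow> (even (card a) \<longleftrightarrow> even (card b))"
proof -
 have "card (a - b) + card (a \<inter> b) = card a" "card (b - a) + card (a \<inter> b) = card b"
  using assms by (metis card_Diff_subset_Int card_mono finite_Int inf_commute inf_le1 le_add_diff_inverse2)+
 moreover have "card (sym_diff a b) = card (a - b) + card (b - a)"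
  using assms by (intro card_Un_disjoint) auto
 ultimately show ?thesis by presburger
qed

lemma odd_card_Int_sym_diff:
 assumes "finite x" "finite y"
 shows "odd (card (N \<inter> sym_diff x y)) \<longleftrightarrow> odd (card (N \<inter> x)) ~= odd (card (N \<inter> y))"
proof -
 have "N \<inter> sym_diff x y = sym_diff (N \<inter> x) (N \<inter> y)" by blast
 thus ?thesis using even_card_sym_diff[of "N \<inter> x" "N \<inter> y"] assms by simp
qed

lemma sgn_st_insert:
 assumes "simple_graph V E" "j \<notin> y" "y \<subseteq> V"
 shows "sgn_st E (insert j y) = (- 1) ^ card (nbr E j \<inter> y) * sgn_st E y"
proof -
 have finV: "finite V" "finite y" using assms finite_subset by (auto simp: simple_graph_def)
 have finE: "finite E"
  by (rule finite_subset[of _ "Pow V"]) (use assms(1) finV in "auto simp: simple_graph_def")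
 have eq: "induced_edges E (insert j y) = induced_edges E y \<union> (%v. {j, v}) ` (nbr E j \<inter> y)"
  (is "_ = ?A \<union> ?B")
 proof (intro equalityI subsetI)
  fix e assume e: "e \<in> induced_edges E (insert j y)"
  show "e \<in> ?A \<union> ?B"
  proof (cases "j \<in> e")
   case True
   then obtain v where "e = {j, v}" "v ~= j" "v \<in> nbr E j"
    using simple_graph_edge[OF assms(1)] e by (auto simp: induced_edges_def)
   with e show ?thesis by (auto simp: induced_edges_def)
  qed (use e in "auto simp: induced_edges_def")
 qed (auto simp: induced_edges_def nbr_def)
 have inj: "inj_on (%v. {j, v}) (nbr E j \<inter> y)"
  by (auto simp: inj_on_def doubleton_eq_iff)
 have "card (induced_edges E (insert j y)) = card ?A + card ?B"
  unfolding eq by (rule card_Un_disjoint) (use finE finV assms(2) in "auto simp: induced_edges_def")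
 thus ?thesis by (simp add: sgn_st_def card_image[OF inj] power_add mult.commute)
qed

lemma sgn_st_flip:
 assumes "simple_graph V E" "j \<in> V" "y \<subseteq> V"
 shows "sgn_st E (sym_diff y {j}) = (- 1) ^ card (nbr E j \<inter> y) * sgn_st E y"
proof (cases "j \<in> y")
 case False
 hence "sym_diff y {j} = insert j y" by auto
 thus ?thesis using sgn_st_insert[OF assms(1) False assms(3)] by simp
next
 case True
 hence "sym_diff y {j} = y - {j}" "insert j (y - {j}) = y" by auto
 moreover have "nbr E j \<inter> (y - {j}) = nbr E j \<inter> y" using nbr_irrefl[OF assms(1)] by auto
 moreover have "(- 1) ^ k * ((- 1) ^ k * c) = (c::complex)" for k c
  by (simp flip: mult.assoc power_mult_distrib)
 moreover have "sgn_st E (insert j (y - {j})) = (- 1) ^ card (nbr E j \<inter> (y - {j})) * sgn_st E (y - {j})"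
  using sgn_st_insert[OF assms(1), of j "y - {j}"] assms(3) by auto
 ultimately show ?thesis by metis
qed

text \<open>The exponent of the sign is a quadratic form over GF(2). Its polarization is the number
  of adjacent pairs between \<open>x\<close> and \<open>y\<close> modulo 2, grouped here by the
  member of \<open>y\<close>; the induction adds one vertex of \<open>y\<close> at a time.\<close>

lemma sgn_st_sym_diff:
 assumes G: "simple_graph V E" and xy: "x \<subseteq> V" "y \<subseteq> V"
 shows "sgn_st E (sym_diff y x) =
  sgn_st E x * sgn_st E y * (\<Prod>u\<in>V. if u \<in> y & odd (card (nbr E u \<inter> x)) then - 1 else 1)"
proof -
 have finV: "finite V" using G by (simp add: simple_graph_def)
 hence fin: "finite y" "finite x" using xy finite_subset by auto
 from fin(1) xy(2) show ?thesis
 proof (induction y rule: finite_induct)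
  case empty
  thus ?case using sgn_st_empty[OF simple_graph_no_empty[OF G]] by simp
 next
  case (insert j y)
  let ?f = "%y u. if u \<in> y & odd (card (nbr E u \<inter> x)) then - 1 else (1::complex)"
  have jV: "j \<in> V" "y \<subseteq> V" using insert.prems by auto
  have "sym_diff (insert j y) x = sym_diff (sym_diff y x) {j}" using insert.hyps by auto
  hence "sgn_st E (sym_diff (insert j y) x) =
    (- 1) ^ card (nbr E j \<inter> sym_diff y x) * sgn_st E (sym_diff y x)"
   using sgn_st_flip[OF G jV(1), of "sym_diff y x"] jV xy by auto
  also have "(- 1) ^ card (nbr E j \<inter> sym_diff y x) =
    (- 1) ^ card (nbr E j \<inter> y) * (if odd (card (nbr E j \<inter> x)) then - 1 else (1::complex))"
   using odd_card_Int_sym_diff[OF insert.hyps(1) fin(2), of "nbr E j"]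
   by (simp add: minus_one_power_iff)
  also have "... * sgn_st E (sym_diff y x) = sgn_st E x * ((- 1) ^ card (nbr E j \<inter> y) * sgn_st E y)
    * ((if odd (card (nbr E j \<inter> x)) then - 1 else 1) * (\<Prod>u\<in>V. ?f y u))"
   using insert.IH jV by (simp add: mult_ac)
  also have "(- 1) ^ card (nbr E j \<inter> y) * sgn_st E y = sgn_st E (insert j y)"
   using sgn_st_insert[OF G insert.hyps(2) jV(2)] by simp
  also have "(if odd (card (nbr E j \<inter> x)) then - 1 else 1) * (\<Prod>u\<in>V. ?f y u) = (\<Prod>u\<in>V. ?f (insert j y) u)"
  proof -
   have "(\<Prod>u\<in>V. ?f (insert j y) u) = ?f (insert j y) j * (\<Prod>u\<in>V - {j}. ?f (insert j y) u)"
    by (rule prod.remove[OF finV jV(1)])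
   also have "(\<Prod>u\<in>V - {j}. ?f (insert j y) u) = (\<Prod>u\<in>V - {j}. ?f y u)"
    by (rule prod.cong) auto
   also have "... = (\<Prod>u\<in>V. ?f y u)"
    using prod.remove[OF finV jV(1), of "?f y"] insert.hyps by simp
   finally show ?thesis by simp
  qed
  finally show ?case .
 qed
qed

section \<open>Correlations and stabilizer elements\<close>

definition cor :: "nat set => nat set set => (nat => bool \<times> bool) => complex" where
 "cor V E P = ip V (sgn_st E) (lap V (%u. tau (P u)) (sgn_st E)) / 2 ^ card V"

lemma bij_betw_sym_diff: "x \<subseteq> V ==> bij_betw (%y. sym_diff y x) (Pow V) (Pow V)"
 by (rule bij_betw_byWitness[where f' = "%y. sym_diff y x"]) auto

text \<open>The X part of \<open>P\<close> fixes the only possible stabilizer element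
  \<open>x P\<close>. After reindexing, the signs of the summands multiply over the vertices, so the
  sum over \<open>y\<close> factorizes, and a vertex where the Z part of \<open>P\<close> is wrong
  contributes \<open>- 1 + 1 = 0\<close>. Squaring the modulus forgets the sign of the stabilizer
  element.\<close>

lemma cor_norm:
 assumes G: "simple_graph V E"
 defines "x \<equiv> %P. {u \<in> V. fst (P u)}"
 shows "(cmod (cor V E P))\<^sup>2 = (if \<forall>u\<in>V. P u = cmp E (x P) u then 1 else 0)"
proof -
 have finV: "finite V" using G by (simp add: simple_graph_def)
 have xV: "x P \<subseteq> V" by (auto simp: x_def)
 let ?k = "%u c. if snd (P u) & c then - 1 else (1::complex)"
 let ?mis = "%u. snd (P u) ~= odd (card (nbr E u \<inter> x P))"
 have lapv: "lap V (%u. tau (P u)) (sgn_st E) (sym_diff y (x P)) = (\<Prod>u\<in>V. ?k u (u \<in> y)) * sgn_st E y"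
  if "y \<subseteq> V" for y
  by (rule lap_monomial[OF finV that xV]) (auto simp: tau_def x_def)
 have "ip V (sgn_st E) (lap V (%u. tau (P u)) (sgn_st E)) =
   (\<Sum>y\<in>Pow V. sgn_st E (sym_diff y (x P)) * ((\<Prod>u\<in>V. ?k u (u \<in> y)) * sgn_st E y))"
  unfolding ip_def
  by (subst sum.reindex_bij_betw[OF bij_betw_sym_diff[OF xV], symmetric]) (simp add: lapv)
 also have "... = (\<Sum>y\<in>Pow V. sgn_st E (x P) * (\<Prod>u\<in>V. if (u \<in> y) & ?mis u then - 1 else 1))"
 proof (rule sum.cong[OF refl])
  fix y assume "y \<in> Pow V"
  hence "sgn_st E (sym_diff y (x P)) * ((\<Prod>u\<in>V. ?k u (u \<in> y)) * sgn_st E y) =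
   sgn_st E (x P) * (sgn_st E y * sgn_st E y) *
    (\<Prod>u\<in>V. (if u \<in> y & odd (card (nbr E u \<inter> x P)) then - 1 else 1) * ?k u (u \<in> y))"
   using sgn_st_sym_diff[OF G xV, of y] by (simp only: Pow_iff prod.distrib mult_ac)
  also have "(\<Prod>u\<in>V. (if u \<in> y & odd (card (nbr E u \<inter> x P)) then - 1 else 1) * ?k u (u \<in> y))
    = (\<Prod>u\<in>V. if (u \<in> y) & ?mis u then - 1 else 1)"
   by (rule prod.cong) auto
  finally show "sgn_st E (sym_diff y (x P)) * ((\<Prod>u\<in>V. ?k u (u \<in> y)) * sgn_st E y) =
   sgn_st E (x P) * (\<Prod>u\<in>V. if (u \<in> y) & ?mis u then - 1 else 1)" by simp
 qed
 also have "... = sgn_st E (x P) * (\<Prod>u\<in>V. (if ?mis u then - 1 else 1) + 1)"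
  unfolding sum_distrib_left[symmetric]
  using sum_Pow_prod[OF finV, of "%u c. if c & ?mis u then - 1 else 1"] by simp
 finally have eq: "cor V E P = sgn_st E (x P) * (\<Prod>u\<in>V. (if ?mis u then - 1 else 1) + 1) / 2 ^ card V"
  by (simp add: cor_def)
 have cond: "(\<forall>u\<in>V. P u = cmp E (x P) u) \<longleftrightarrow> (\<forall>u\<in>V. \<not> ?mis u)"
  unfolding cmp_def x_def by (auto simp: prod_eq_iff)
 have nrm: "cmod (sgn_st E (x P)) = 1" by (simp add: sgn_st_def norm_power)
 show ?thesis
 proof (cases "\<forall>u\<in>V. \<not> ?mis u")
  case True
  hence "(\<Prod>u\<in>V. (if ?mis u then - 1 else 1) + 1) = (2::complex) ^ card V" by simp
  with True show ?thesis unfolding eq cond by (simp add: norm_mult norm_divide norm_power nrm)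
 next
  case False
  hence "(\<Prod>u\<in>V. (if ?mis u then - 1 else 1) + 1) = (0::complex)"
   by (intro prod_zero[OF finV]) auto
  with False show ?thesis unfolding eq cond by simp
 qed
qed

section \<open>Expansion in Pauli operators\<close>

lemma sum_UNIV_pauli:
 "(\<Sum>p\<in>UNIV. f p) = f (False, False) + f (False, True) + f (True, False) + f (True, True)"
proof -
 have eq: "(UNIV :: (bool \<times> bool) set) = {(False, False), (False, True), (True, False), (True, True)}"
  by auto
 show ?thesis unfolding eq by (simp add: add.assoc)
qed

text \<open>Half the trace of \<open>madj (tau p)\<close> times \<open>a\<close>, that is the
  coefficient of \<open>a\<close> along \<open>tau p\<close>, written out so that it can be
  evaluated by cases.\<close>

definition pco :: "(bool => bool => complex) => bool \<times> bool => complex" where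
 "pco a p = (cnj (tau p True True) * a True True + cnj (tau p True False) * a True False
   + cnj (tau p False True) * a False True + cnj (tau p False False) * a False False) / 2"

lemma pauli_expansion: "a i j = (\<Sum>p\<in>UNIV. pco a p * tau p i j)"
 by (cases i; cases j) (simp_all add: sum_UNIV_pauli pco_def tau_def field_simps)

text \<open>The matrix of the action of conjugation by \<open>m\<close> on the Pauli operators.\<close>

definition pt :: "(bool => bool => complex) => bool \<times> bool => bool \<times> bool => complex" where
 "pt m q p = pco (mmul (madj m) (mmul (tau q) m)) p"

lemma lap_pauli_expansion:
 assumes "finite V"
 shows "lap V a \<psi> y = (\<Sum>P\<in>PiE V (%_. UNIV). (\<Prod>u\<in>V. pco (a u) (P u)) * lap V (%u. tau (P u)) \<psi> y)"
proof -
 have "lap V a \<psi> y = (\<Sum>x\<in>Pow V. (\<Prod>u\<in>V. \<Sum>p\<in>UNIV. pco (a u) p * tau p (u \<in> y) (u \<in> x)) * \<psi> x)"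
  unfolding lap_def by (simp flip: pauli_expansion)
 also have "... = (\<Sum>x\<in>Pow V. \<Sum>P\<in>PiE V (%_. UNIV).
   (\<Prod>u\<in>V. pco (a u) (P u)) * ((\<Prod>u\<in>V. tau (P u) (u \<in> y) (u \<in> x)) * \<psi> x))"
  by (subst prod_sum_PiE[OF assms]) (auto simp: sum_distrib_right prod.distrib mult.assoc)
 also have "... = (\<Sum>P\<in>PiE V (%_. UNIV). (\<Prod>u\<in>V. pco (a u) (P u)) * lap V (%u. tau (P u)) \<psi> y)"
  unfolding lap_def sum_distrib_left by (rule sum.swap)
 finally show ?thesis .
qed

lemma ip_lap_pauli:
 assumes "finite V"
 shows "ip V \<phi> (lap V a \<psi>) = (\<Sum>P\<in>PiE V (%_. UNIV). (\<Prod>u\<in>V. pco (a u) (P u)) * ip V \<phi> (lap V (%u. tau (P u)) \<psi>))"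
proof -
 have "ip V \<phi> (lap V a \<psi>) = (\<Sum>y\<in>Pow V. \<Sum>P\<in>PiE V (%_. UNIV).
   (\<Prod>u\<in>V. pco (a u) (P u)) * (cnj (\<phi> y) * lap V (%u. tau (P u)) \<psi> y))"
  unfolding ip_def by (subst lap_pauli_expansion[OF assms]) (simp add: sum_distrib_left mult_ac)
 thus ?thesis unfolding ip_def sum_distrib_left by (subst (asm) sum.swap)
qed

lemma lap_lap_fun: "finite V ==> lap V a (lap V b \<psi>) = lap V (%u. mmul (a u) (b u)) \<psi>"
 by (intro ext) (rule lap_lap)

lemma LUc_unit:
 assumes "finite V" "!!u. u \<in> V ==> uni (m u)"
  and eq: "!!y. y \<in> Pow V ==> lap V m (sgn_st E1) y = c * sgn_st E2 y"
 shows "cnj c * c = 1"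
proof -
 have "2 ^ card V = ip V (lap V m (sgn_st E1)) (lap V m (sgn_st E1))"
  using ip_lap_uni[OF assms(1,2)] ip_sgn_st[OF assms(1)] by simp
 also have "... = ip V (%y. c * sgn_st E2 y) (%y. c * sgn_st E2 y)"
  by (rule ip_cong) (use eq in auto)
 also have "... = cnj c * c * ip V (sgn_st E2) (sgn_st E2)"
  by (simp add: ip_def sum_distrib_left mult.assoc mult.left_commute)
 finally show ?thesis using ip_sgn_st[OF assms(1), of E2] by simp
qed

text \<open>The correlation of \<open>Q\<close> in the transformed state is the expectation in the
  original state of \<open>Q\<close> conjugated factor by factor, and each conjugated factor expands
  in Pauli operators with coefficients \<open>pt\<close>. The scalar drops out by
  \<open>LUc_unit\<close>.\<close>

lemma cor_transform:
 assumes "finite V" "!!u. u \<in> V ==> uni (m u)"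
  and eq: "!!y. y \<in> Pow V ==> lap V m (sgn_st E1) y = c * sgn_st E2 y"
 shows "cor V E2 Q = (\<Sum>P\<in>PiE V (%_. UNIV). (\<Prod>u\<in>V. pt (m u) (Q u) (P u)) * cor V E1 P)"
proof -
 let ?\<phi> = "%y. c * sgn_st E2 y"
 have "ip V ?\<phi> (lap V (%u. tau (Q u)) ?\<phi>) = cnj c * c * ip V (sgn_st E2) (lap V (%u. tau (Q u)) (sgn_st E2))"
  by (simp add: ip_def lap_scale sum_distrib_left mult.assoc mult.left_commute)
 hence "ip V (sgn_st E2) (lap V (%u. tau (Q u)) (sgn_st E2)) = ip V ?\<phi> (lap V (%u. tau (Q u)) ?\<phi>)"
  using LUc_unit[OF assms] by simp
 also have "... = ip V (lap V m (sgn_st E1)) (lap V (%u. tau (Q u)) (lap V m (sgn_st E1)))"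
 proof (rule ip_cong)
  fix y assume "y \<subseteq> V"
  show "lap V (%u. tau (Q u)) ?\<phi> y = lap V (%u. tau (Q u)) (lap V m (sgn_st E1)) y"
   by (rule lap_cong) (use eq in auto)
 qed (use eq in auto)
 also have "... = ip V (lap V (%u. madj (madj (m u))) (sgn_st E1)) (lap V (%u. mmul (tau (Q u)) (m u)) (sgn_st E1))"
  by (simp add: lap_lap_fun[OF assms(1)])
 also have "... = ip V (sgn_st E1) (lap V (%u. madj (m u)) (lap V (%u. mmul (tau (Q u)) (m u)) (sgn_st E1)))"
  by (subst ip_lap_right[symmetric]) simp
 also have "... = ip V (sgn_st E1) (lap V (%u. mmul (madj (m u)) (mmul (tau (Q u)) (m u))) (sgn_st E1))"
  by (simp add: lap_lap_fun[OF assms(1)])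
 also have "... = (\<Sum>P\<in>PiE V (%_. UNIV). (\<Prod>u\<in>V. pt (m u) (Q u) (P u)) * ip V (sgn_st E1) (lap V (%u. tau (P u)) (sgn_st E1)))"
  by (subst ip_lap_pauli[OF assms(1)]) (simp add: pt_def)
 finally show ?thesis
  by (simp add: cor_def sum_divide_distrib)
qed

section \<open>The action of a unitary on the Pauli basis\<close>

abbreviation pI :: "bool \<times> bool" where "pI \<equiv> (False, False)"

definition padd :: "bool \<times> bool => bool \<times> bool => bool \<times> bool" where
 "padd p q = (fst p ~= fst q, snd p ~= snd q)"

lemma padd_simps [simp]: "padd p p = pI" "padd p pI = p" "padd pI p = p" "padd (padd p q) q = p"
 "padd p q = pI \<longleftrightarrow> p = q"
 by (auto simp: padd_def prod_eq_iff)

definition mtr :: "(bool => bool => complex) => complex" where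
 "mtr a = a True True + a False False"

lemma mtr_cyc: "mtr (mmul a b) = mtr (mmul b a)"
 by (simp add: mtr_def mmul_def algebra_simps)

lemma mtr_madj: "mtr (madj a) = cnj (mtr a)"
 by (simp add: mtr_def madj_def)

lemma pco_mtr: "pco a p = mtr (mmul (madj (tau p)) a) / 2"
 by (simp add: pco_def mtr_def mmul_def madj_def)

lemma pco_parseval: "(\<Sum>p\<in>UNIV. pco a p * cnj (pco b p)) = mtr (mmul (madj b) a) / 2"
 by (simp add: sum_UNIV_pauli pco_def mtr_def mmul_def madj_def tau_def field_simps)

lemma uni_tau: "uni (tau p)"
 unfolding uni_def by (cases p) (auto intro!: ext simp: mmul_def madj_def tau_def mone_def)

lemma mtr_tau: "mtr (mmul (madj (tau p)) (tau q)) = (if p = q then 2 else 0)"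
 by (cases p; cases q) (auto simp: mtr_def mmul_def madj_def tau_def)

lemma tau_pI: "tau pI = mone"
 by (intro ext) (auto simp: tau_def mone_def)

text \<open>By cyclicity of the trace the same number is a coefficient of \<open>tau p\<close>
  conjugated the other way round; the columns of \<open>pt m\<close> thus become accessible to
  Parseval just as the rows are.\<close>

lemma pt_eq:
 assumes "uni m"
 shows "pt m q p = cnj (pco (mmul m (mmul (tau p) (madj m))) q)"
proof -
 have "pt m q p = mtr (mmul (mmul (madj (tau p)) (madj m)) (mmul (tau q) m)) / 2"
  by (simp add: pt_def pco_mtr mmul_assoc)
 also have "... = mtr (mmul (mmul (mmul m (madj (tau p))) (madj m)) (tau q)) / 2"
  by (subst mtr_cyc) (simp add: mmul_assoc, metis mmul_assoc mtr_cyc)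
 also have "mmul (mmul (mmul m (madj (tau p))) (madj m)) (tau q)
   = madj (mmul (madj (tau q)) (mmul m (mmul (tau p) (madj m))))"
  by (simp add: madj_mmul mmul_assoc)
 finally show ?thesis by (simp add: mtr_madj pco_mtr)
qed

text \<open>Parseval turns the sum into the trace inner product of two conjugated Pauli operators,
  and conjugation leaves that inner product unchanged.\<close>

lemma pt_columns:
 assumes "uni m"
 shows "(\<Sum>q\<in>UNIV. pt m q p * cnj (pt m q p')) = of_bool (p = p')"
proof -
 let ?B = "%p. mmul m (mmul (tau p) (madj m))"
 have "(\<Sum>q\<in>UNIV. pt m q p * cnj (pt m q p')) = (\<Sum>q\<in>UNIV. pco (?B p') q * cnj (pco (?B p) q))"
  by (simp add: pt_eq[OF assms] mult.commute)
 also have "... = mtr (mmul (madj (?B p)) (?B p')) / 2" by (rule pco_parseval)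
 also have "mmul (madj (?B p)) (?B p') = mmul m (mmul (mmul (madj (tau p)) (tau p')) (madj m))"
 proof -
  have "mmul (madj (?B p)) (?B p') =
   mmul m (mmul (madj (tau p)) (mmul (mmul (madj m) m) (mmul (tau p') (madj m))))"
   by (simp add: madj_mmul mmul_assoc)
  also have "mmul (madj m) m = mone" using assms by (simp add: uni_def)
  finally show ?thesis by (simp add: mmul_assoc)
 qed
 also have "mtr ... = mtr (mmul (mmul (madj (tau p)) (tau p')) (mmul (madj m) m))"
  by (subst mtr_cyc) (simp add: mmul_assoc)
 also have "... = (if p = p' then 2 else 0)"
  using assms by (simp add: uni_def mtr_tau)
 also have "(if p = p' then 2 else 0) / 2 = (of_bool (p = p') :: complex)" by simp
 finally show ?thesis .
qed

lemma pt_rows: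
 assumes "uni m"
 shows "(\<Sum>p\<in>UNIV. pt m q p * cnj (pt m q p)) = 1"
proof -
 let ?A = "mmul (madj m) (mmul (tau q) m)"
 have "uni ?A" using assms uni_tau uni_madj uni_mmul by blast
 hence "mtr (mmul (madj ?A) ?A) = 2" by (simp add: uni_def mtr_def mone_def)
 thus ?thesis using pco_parseval[of ?A ?A] by (simp add: pt_def)
qed

lemma pt_I_left:
 assumes "uni m" shows "pt m pI p = of_bool (p = pI)"
proof -
 have "mmul (madj m) (mmul (tau pI) m) = mone" using assms by (simp add: tau_pI uni_def)
 thus ?thesis using mtr_tau[of p pI] by (simp add: pt_def pco_mtr tau_pI)
qed

lemma pt_I_right:
 assumes "uni m" shows "pt m q pI = of_bool (q = pI)"
proof -
 have "mmul m (mmul (tau pI) (madj m)) = mone" using assms by (simp add: tau_pI uni_def)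
 thus ?thesis using mtr_tau[of q pI] by (simp add: pt_eq[OF assms] pco_mtr tau_pI)
qed

lemma pt_columns_norm:
 assumes "uni m" shows "(\<Sum>q\<in>UNIV. (cmod (pt m q p))\<^sup>2) = 1"
proof -
 have "complex_of_real (\<Sum>q\<in>UNIV. (cmod (pt m q p))\<^sup>2) = 1"
  using pt_columns[OF assms, of p p] by (simp only: of_real_sum complex_norm_square) simp
 thus ?thesis using of_real_eq_1_iff by blast
qed

lemma pt_rows_norm:
 assumes "uni m" shows "(\<Sum>p\<in>UNIV. (cmod (pt m q p))\<^sup>2) = 1"
proof -
 have "complex_of_real (\<Sum>p\<in>UNIV. (cmod (pt m q p))\<^sup>2) = 1"
  using pt_rows[OF assms, of q] by (simp only: of_real_sum complex_norm_square)
 thus ?thesis using of_real_eq_1_iff by blast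
qed

text \<open>An entry of modulus 1 exhausts a unit vector. Applied to rows and columns of
  \<open>pt\<close>, it lets a single entry certify that one axis is rotated onto another.\<close>

lemma sum_norm_one_unique:
 fixes f :: "bool \<times> bool => complex"
 assumes "(\<Sum>q\<in>UNIV. (cmod (f q))\<^sup>2) = 1" "cmod (f b) = 1" "q ~= b"
 shows "f q = 0"
proof -
 have "(\<Sum>q\<in>UNIV. (cmod (f q))\<^sup>2) = (cmod (f b))\<^sup>2 + (\<Sum>q\<in>UNIV - {b}. (cmod (f q))\<^sup>2)"
  by (rule sum.remove) auto
 with assms have "(\<Sum>q\<in>UNIV - {b}. (cmod (f q))\<^sup>2) = 0" by simp
 with assms(3) show ?thesis by (subst (asm) sum_nonneg_eq_0_iff) auto
qed

lemma pt_axis_row: "uni m ==> cmod (pt m b a) = 1 ==> p ~= a ==> pt m b p = 0"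
 using sum_norm_one_unique[of "%p. pt m b p" a p] pt_rows_norm by simp

lemma pt_axis_column: "uni m ==> cmod (pt m b a) = 1 ==> q ~= b ==> pt m q a = 0"
 using sum_norm_one_unique[of "%q. pt m q a" b q] pt_columns_norm by simp

lemma norm_one_if_others_zero:
 fixes f :: "bool \<times> bool => complex"
 assumes "(\<Sum>q\<in>UNIV. (cmod (f q))\<^sup>2) = 1" "!!q. q ~= b ==> f q = 0"
 shows "cmod (f b) = 1"
proof -
 have "(\<Sum>q\<in>UNIV. (cmod (f q))\<^sup>2) = (\<Sum>q\<in>{b}. (cmod (f q))\<^sup>2)"
  by (rule sum.mono_neutral_right) (use assms(2) in auto)
 with assms(1) show ?thesis by (simp add: power2_eq_1_iff) (smt (verit) norm_ge_zero)
qed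

section \<open>Stabilizer elements with prescribed local factors\<close>

definition SW :: "nat set => nat set set => (nat => (bool \<times> bool) set) => nat set set" where
 "SW V E W = {x \<in> Pow V. \<forall>u\<in>V. cmp E x u \<in> W u}"

lemma cmp_sym_diff:
 assumes "finite V" "x \<subseteq> V" "y \<subseteq> V"
 shows "cmp E (sym_diff x y) u = padd (cmp E x u) (cmp E y u)"
proof -
 have "finite x" "finite y" using assms finite_subset by auto
 from odd_card_Int_sym_diff[OF this, of "nbr E u"] show ?thesis
  by (auto simp: cmp_def padd_def)
qed

lemma cmp_empty [simp]: "cmp E {} u = pI"
 by (simp add: cmp_def)

lemma cmp_inj: "x \<subseteq> V ==> y \<subseteq> V ==> (!!u. u \<in> V ==> cmp E x u = cmp E y u) ==> x = y"
 by (auto simp: cmp_def)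

lemma finite_SW: "finite V ==> finite (SW V E W)"
 unfolding SW_def by (rule finite_subset[of _ "Pow V"]) auto

text \<open>Squared moduli of correlations are the indicators of stabilizer elements. Expressing
  those of \<open>E2\<close> through those of \<open>E1\<close> gives a double sum over pairs of
  stabilizer elements, whose terms factorize over the vertices once the sum over \<open>Q\<close> is
  carried out. The hypothesis \<open>gram\<close> kills every pair of different elements, so the
  unknown phases of the correlations disappear.\<close>

lemma count_transform:
 assumes G: "simple_graph V E1" "simple_graph V E2" and uni: "!!u. u \<in> V ==> uni (m u)"
  and eq: "!!y. y \<in> Pow V ==> lap V m (sgn_st E1) y = c * sgn_st E2 y"
  and gram: "!!x x'. x \<subseteq> V ==> x' \<subseteq> V ==> x ~= x' ==>
   \<exists>u\<in>V. (\<Sum>q\<in>W u. pt (m u) q (cmp E1 x u) * cnj (pt (m u) q (cmp E1 x' u))) = 0"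
 shows "real (card (SW V E2 W)) = (\<Sum>x\<in>Pow V. \<Prod>u\<in>V. \<Sum>q\<in>W u. (cmod (pt (m u) q (cmp E1 x u)))\<^sup>2)"
proof -
 have fin: "finite V" using G by (simp add: simple_graph_def)
 let ?U = "PiE V (%_. UNIV :: (bool \<times> bool) set)"
 let ?c1 = "cor V E1" and ?c2 = "cor V E2"
 let ?r = "%E x. restrict (cmp E x) V"
 have finP: "finite (PiE V W)" for W :: "nat => (bool \<times> bool) set"
  by (rule finite_PiE[OF fin]) simp
 have supp: "P = ?r E {u \<in> V. fst (P u)} \<longleftrightarrow> (\<forall>u\<in>V. P u = cmp E {u \<in> V. fst (P u)} u)" if "P \<in> ?U" for P E
  using that by (auto simp: fun_eq_iff PiE_def extensional_def restrict_def)
 have fstc: "{u \<in> V. fst (?r E x u)} = x" if "x \<subseteq> V" for E x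
  using that by (auto simp: cmp_def)
 have nrm: "(cmod (cor V E P))\<^sup>2 = (if P \<in> ?r E ` Pow V then 1 else 0)" if P: "P \<in> ?U" and E: "simple_graph V E" for P E
 proof -
  have "P = ?r E {u \<in> V. fst (P u)} \<longleftrightarrow> P \<in> ?r E ` Pow V"
  proof
   assume "P = ?r E {u \<in> V. fst (P u)}"
   thus "P \<in> ?r E ` Pow V" by (rule image_eqI) auto
  next
   assume "P \<in> ?r E ` Pow V"
   then obtain x where x: "x \<subseteq> V" "P = ?r E x" by auto
   show "P = ?r E {u \<in> V. fst (P u)}" unfolding x(2) fstc[OF x(1)] ..
  qed
  thus ?thesis using cor_norm[OF E, of P] supp[OF P, of E] by simp
 qed
 have inj: "inj_on (?r E) (Pow V)" for E
  by (rule inj_on_inverseI[where g = "%P. {u \<in> V. fst (P u)}"]) (use fstc in auto)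
 have sumr: "(\<Sum>P\<in>PiE V W. (if P \<in> ?r E ` Pow V then 1 else 0) * h P) = (\<Sum>x\<in>SW V E W. h (?r E x))"
  for W E and h :: "(nat => bool \<times> bool) => real"
 proof -
  have "(\<Sum>P\<in>PiE V W. (if P \<in> ?r E ` Pow V then 1 else 0) * h P)
    = (\<Sum>P\<in>PiE V W. if P \<in> ?r E ` Pow V then h P else 0)"
   by (rule sum.cong) auto
  also have "... = sum h (PiE V W \<inter> ?r E ` Pow V)"
   by (rule sum.inter_restrict[OF finP, symmetric])
  also have "PiE V W \<inter> ?r E ` Pow V = ?r E ` SW V E W"
   by (auto simp: SW_def PiE_iff)
  also have "sum h (?r E ` SW V E W) = (\<Sum>x\<in>SW V E W. h (?r E x))"
   by (subst sum.reindex) (auto intro: inj_on_subset[OF inj] simp: SW_def)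
  finally show ?thesis .
 qed
 let ?O = "%Q P. \<Prod>u\<in>V. pt (m u) (Q u) (P u)"
 have tr: "?c2 Q = (\<Sum>P\<in>?U. ?O Q P * ?c1 P)" for Q
  by (rule cor_transform[OF fin uni eq])
 have "complex_of_real (real (card (SW V E2 W))) = (\<Sum>Q\<in>PiE V W. of_real ((cmod (?c2 Q))\<^sup>2))"
 proof -
  have "(\<Sum>Q\<in>PiE V W. (cmod (?c2 Q))\<^sup>2) = (\<Sum>Q\<in>PiE V W. (if Q \<in> ?r E2 ` Pow V then 1 else 0) * 1)"
   by (rule sum.cong) (use nrm[OF _ G(2)] in "auto simp: PiE_def")
  also have "... = real (card (SW V E2 W))"
   unfolding sumr[where h = "%_. 1"] by simp
  finally show ?thesis by (metis of_real_sum)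
 qed
 also have "... = (\<Sum>Q\<in>PiE V W. \<Sum>P\<in>?U. \<Sum>P'\<in>?U. ?c1 P * cnj (?c1 P') * (\<Prod>u\<in>V. pt (m u) (Q u) (P u) * cnj (pt (m u) (Q u) (P' u))))"
 proof (rule sum.cong[OF refl])
  fix Q
  have "of_real ((cmod (?c2 Q))\<^sup>2) = ?c2 Q * cnj (?c2 Q)" by (rule complex_norm_square)
  also have "... = (\<Sum>P\<in>?U. \<Sum>P'\<in>?U. (?O Q P * ?c1 P) * cnj (?O Q P' * ?c1 P'))"
   unfolding tr[of Q] by (simp add: sum_product)
  also have "... = (\<Sum>P\<in>?U. \<Sum>P'\<in>?U. ?c1 P * cnj (?c1 P') * (\<Prod>u\<in>V. pt (m u) (Q u) (P u) * cnj (pt (m u) (Q u) (P' u))))"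
   by (simp add: prod.distrib mult_ac)
  finally show "of_real ((cmod (?c2 Q))\<^sup>2) = (\<Sum>P\<in>?U. \<Sum>P'\<in>?U. ?c1 P * cnj (?c1 P') * (\<Prod>u\<in>V. pt (m u) (Q u) (P u) * cnj (pt (m u) (Q u) (P' u))))" .
 qed
 also have "... = (\<Sum>P\<in>?U. \<Sum>P'\<in>?U. \<Sum>Q\<in>PiE V W. ?c1 P * cnj (?c1 P') * (\<Prod>u\<in>V. pt (m u) (Q u) (P u) * cnj (pt (m u) (Q u) (P' u))))"
  by (subst sum.swap, rule sum.cong[OF refl], rule sum.swap)
 also have "... = (\<Sum>P\<in>?U. \<Sum>P'\<in>?U. ?c1 P * cnj (?c1 P') * (\<Prod>u\<in>V. \<Sum>q\<in>W u. pt (m u) q (P u) * cnj (pt (m u) q (P' u))))"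
  by (subst prod_sum_PiE[OF fin]) (auto simp: sum_distrib_left)
 also have "... = (\<Sum>P\<in>?U. ?c1 P * cnj (?c1 P) * (\<Prod>u\<in>V. \<Sum>q\<in>W u. pt (m u) q (P u) * cnj (pt (m u) q (P u))))"
 proof (rule sum.cong[OF refl])
  fix P assume P: "P \<in> ?U"
  let ?g = "%P'. ?c1 P * cnj (?c1 P') * (\<Prod>u\<in>V. \<Sum>q\<in>W u. pt (m u) q (P u) * cnj (pt (m u) q (P' u)))"
  have "sum ?g ?U = sum ?g {P}"
  proof (rule sum.mono_neutral_right[OF finP])
   show "\<forall>P'\<in>?U - {P}. ?g P' = 0"
   proof
    fix P' assume P': "P' \<in> ?U - {P}"
    show "?g P' = 0"
    proof (cases "P \<in> ?r E1 ` Pow V & P' \<in> ?r E1 ` Pow V")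
     case True
     then obtain x x' where x: "x \<subseteq> V" "x' \<subseteq> V" "P = ?r E1 x" "P' = ?r E1 x'" by auto
     hence "x ~= x'" using P' by auto
     from gram[OF x(1,2) this] obtain u where "u \<in> V"
      "(\<Sum>q\<in>W u. pt (m u) q (P u) * cnj (pt (m u) q (P' u))) = 0" using x by auto
     hence "(\<Prod>u\<in>V. \<Sum>q\<in>W u. pt (m u) q (P u) * cnj (pt (m u) q (P' u))) = 0"
      by (intro prod_zero[OF fin] bexI[of _ u])
     thus ?thesis by simp
    next
     case False
     have P'U: "P' \<in> ?U" using P' by simp
     have "?c1 P = 0" if "P \<notin> ?r E1 ` Pow V" using nrm[OF P G(1)] that by simp
     moreover have "?c1 P' = 0" if "P' \<notin> ?r E1 ` Pow V" using nrm[OF P'U G(1)] that by simp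
     ultimately have "?c1 P = 0 \<or> ?c1 P' = 0" using False by metis
     thus ?thesis by (elim disjE) simp_all
    qed
   qed
  qed (use P in auto)
  thus "sum ?g ?U = ?g P" by simp
 qed
 also have "... = of_real (\<Sum>P\<in>?U. (cmod (?c1 P))\<^sup>2 * (\<Prod>u\<in>V. \<Sum>q\<in>W u. (cmod (pt (m u) q (P u)))\<^sup>2))"
  by (simp only: of_real_sum of_real_mult of_real_prod complex_norm_square)
 also have "(\<Sum>P\<in>?U. (cmod (?c1 P))\<^sup>2 * (\<Prod>u\<in>V. \<Sum>q\<in>W u. (cmod (pt (m u) q (P u)))\<^sup>2)) =
   (\<Sum>P\<in>?U. (if P \<in> ?r E1 ` Pow V then 1 else 0) * (\<Prod>u\<in>V. \<Sum>q\<in>W u. (cmod (pt (m u) q (P u)))\<^sup>2))"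
  by (rule sum.cong[OF refl]) (simp add: nrm[OF _ G(1)])
 also have "... = (\<Sum>x\<in>Pow V. \<Prod>u\<in>V. \<Sum>q\<in>W u. (cmod (pt (m u) q (cmp E1 x u)))\<^sup>2)"
  unfolding sumr[where h = "%P. \<Prod>u\<in>V. \<Sum>q\<in>W u. (cmod (pt (m u) q (P u)))\<^sup>2"]
  by (simp add: SW_def Pow_def)
 finally show ?thesis by (simp only: of_real_eq_iff)
qed

text \<open>Local constraints on stabilizer elements: at each vertex, no restriction, the Pauli operators along an axis, or
  the identity only, according to \<open>k\<close>.\<close>

definition kset :: "(nat => nat) => (nat => bool \<times> bool) => nat => (bool \<times> bool) set" where
 "kset k ax v = (if k v = 0 then {pI} else if k v = 1 then {pI, ax v} else UNIV)"

definition img :: "nat set => nat set set => (nat => (bool \<times> bool) set) => nat => (bool \<times> bool) set" where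
 "img V E W u = (%x. cmp E x u) ` SW V E W"

lemma pI_kset [simp]: "pI \<in> kset k ax u"
 by (simp add: kset_def)

lemma padd_kset: "p \<in> kset k ax u ==> q \<in> kset k ax u ==> padd p q \<in> kset k ax u"
 by (auto simp: kset_def split: if_splits)

lemma SW_kset_sym_diff:
 assumes "finite V" "x \<in> SW V E (kset k ax)" "y \<in> SW V E (kset k ax)"
 shows "sym_diff x y \<in> SW V E (kset k ax)"
proof -
 have xy: "x \<subseteq> V" "y \<subseteq> V" using assms by (auto simp: SW_def)
 hence "sym_diff x y \<subseteq> V" by auto
 moreover have "cmp E (sym_diff x y) u \<in> kset k ax u" if "u \<in> V" for u
  unfolding cmp_sym_diff[OF assms(1) xy] using assms(2,3) that by (auto simp: SW_def intro: padd_kset)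
 ultimately show ?thesis by (simp add: SW_def)
qed

lemma empty_SW_kset [simp]: "{} \<in> SW V E (kset k ax)"
 by (simp add: SW_def)

lemma sym_diff_cancel [simp]: "sym_diff (sym_diff x y) y = x"
 by auto

text \<open>The constraint sets are groups, so nonempty fibres are cosets: translation by
  \<open>x0\<close> carries the fibre of \<open>x0\<close> to that of the identity.\<close>

lemma SW_kset_fibre_card:
 assumes "finite V" "x0 \<in> SW V E (kset k ax)"
 shows "card {x \<in> SW V E (kset k ax). cmp E x u = cmp E x0 u}
    = card {x \<in> SW V E (kset k ax). cmp E x u = pI}" (is "card ?A = card ?B")
proof -
 have sub: "x \<subseteq> V" if "x \<in> SW V E (kset k ax)" for x using that by (simp add: SW_def)
 have "bij_betw (%x. sym_diff x x0) ?A ?B"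
 proof (rule bij_betw_byWitness[where f' = "%x. sym_diff x x0"])
  show "(%x. sym_diff x x0) ` ?A \<subseteq> ?B" "(%x. sym_diff x x0) ` ?B \<subseteq> ?A"
   using SW_kset_sym_diff[OF assms(1) _ assms(2)] cmp_sym_diff[OF assms(1) sub sub[OF assms(2)]]
   by (auto simp del: Un_iff)
 qed auto
 thus ?thesis by (rule bij_betw_same_card)
qed

lemma SW_kset_card:
 assumes "finite V"
 shows "card (SW V E (kset k ax)) = card (img V E (kset k ax) u) * card {x \<in> SW V E (kset k ax). cmp E x u = pI}"
proof -
 let ?S = "SW V E (kset k ax)"
 have "card ?S = (\<Sum>p\<in>img V E (kset k ax) u. card {x \<in> ?S. cmp E x u = p})"
  using sum.image_gen[OF finite_SW[OF assms], where h = "%_. 1::nat" and g = "%x. cmp E x u"]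
  by (simp add: img_def)
 also have "... = (\<Sum>p\<in>img V E (kset k ax) u. card {x \<in> ?S. cmp E x u = pI})"
  by (rule sum.cong) (use SW_kset_fibre_card[OF assms] in "auto simp: img_def")
 finally show ?thesis by simp
qed

text \<open>The image is a subgroup of the Klein four-group of Pauli operators modulo phases; two
  different nontrivial elements, their product and the identity already exhaust it.\<close>

lemma img_kset_cases:
 assumes "finite V"
 obtains "img V E (kset k ax) u = {pI}" | "img V E (kset k ax) u = UNIV"
  | P where "P ~= pI" "img V E (kset k ax) u = {pI, P}"
proof -
 let ?I = "img V E (kset k ax) u"
 have pI: "pI \<in> ?I" unfolding img_def by (rule image_eqI[of _ _ "{}"]) auto
 have add: "padd p q \<in> ?I" if pq: "p \<in> ?I" "q \<in> ?I" for p q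
 proof -
  obtain x where x: "x \<in> SW V E (kset k ax)" "p = cmp E x u" using pq(1) unfolding img_def by blast
  obtain y where y: "y \<in> SW V E (kset k ax)" "q = cmp E y u" using pq(2) unfolding img_def by blast
  have "x \<subseteq> V" "y \<subseteq> V" using x y by (auto simp: SW_def)
  hence "padd p q = cmp E (sym_diff x y) u" using cmp_sym_diff[OF assms] x y by simp
  thus ?thesis unfolding img_def using SW_kset_sym_diff[OF assms x(1) y(1)] by (rule image_eqI)
 qed
 show ?thesis
 proof (cases "\<exists>p q. p \<in> ?I & q \<in> ?I & p ~= pI & q ~= pI & p ~= q")
  case True
  then obtain p q where pq: "p \<in> ?I" "q \<in> ?I" "p ~= pI" "q ~= pI" "p ~= q" by blast
  have "x \<in> {pI, p, q, padd p q}" for x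
   using pq(3-5) by (cases x; cases p; cases q) (auto simp: padd_def)
  hence "x \<in> ?I" for x
   using pI pq(1,2) add[OF pq(1,2)] by (metis empty_iff insert_iff)
  hence "UNIV = ?I" by (rule UNIV_eq_I)
  thus ?thesis by (intro that(2)) simp
 next
  case False
  show ?thesis
  proof (cases "?I = {pI}")
   case F: False
   then obtain p where "p \<in> ?I" "p ~= pI" using pI by auto
   moreover have "q \<in> {pI, p}" if "q \<in> ?I" for q using False calculation that by (metis insertCI)
   hence "?I = {pI, p}" using pI \<open>p \<in> ?I\<close> by (intro equalityI subsetI) auto
   ultimately show ?thesis by (intro that(3)[of p])
  qed (rule that(1))
 qed
qed

section \<open>Inferences from a fixed local unitary\<close>

locale lu_pair =
 fixes V :: "nat set" and E1 E2 :: "nat set set" and m :: "nat => bool => bool => complex" and c :: complex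
 assumes G1: "simple_graph V E1" and G2: "simple_graph V E2"
  and uni: "u \<in> V ==> uni (m u)"
  and eq: "y \<in> Pow V ==> lap V m (sgn_st E1) y = c * sgn_st E2 y"
begin

lemma fin: "finite V"
 using G1 by (simp add: simple_graph_def)

text \<open>Only the modulus is prescribed: the rotation may reverse the axis.\<close>

definition axis_map :: "nat => bool \<times> bool => bool \<times> bool => bool" where
 "axis_map u a b \<longleftrightarrow> a ~= pI & b ~= pI & cmod (pt (m u) b a) = 1"

text \<open>Restricted to matched constraint sets, the columns of \<open>pt\<close> stay orthogonal
  and vanish outside \<open>kset k ax1 u\<close>. For a free vertex this is orthogonality of
  columns, for an axis it holds since the row of \<open>ax2 u\<close> is concentrated at
  \<open>ax1 u\<close>, and the identity is fixed by conjugation. \<open>kset_weight\<close> and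
  \<open>kset_weight0\<close> are the diagonal cases.\<close>

lemma kset_gram:
 assumes "u \<in> V" "k u = 1 ==> axis_map u (ax1 u) (ax2 u)" "p ~= p' \<or> p \<notin> kset k ax1 u"
 shows "(\<Sum>q\<in>kset k ax2 u. pt (m u) q p * cnj (pt (m u) q p')) = 0"
proof -
 note um = uni[OF assms(1)]
 have zI: "pt (m u) pI p * cnj (pt (m u) pI p') = 0" if "p ~= p' \<or> p ~= pI"
  using that by (auto simp: pt_I_left[OF um])
 consider "k u = 0" | "k u = 1" | "k u ~= 0" "k u ~= 1" by blast
 thus ?thesis
 proof cases
  case 1
  thus ?thesis using zI assms(3) by (auto simp: kset_def)
 next
  case 2
  hence b: "ax2 u ~= pI" "cmod (pt (m u) (ax2 u) (ax1 u)) = 1"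
   using assms(2) by (auto simp: axis_map_def)
  have "pt (m u) (ax2 u) p * cnj (pt (m u) (ax2 u) p') = 0"
   using pt_axis_row[OF um b(2)] assms(3) 2 by (cases "p = ax1 u") (auto simp: kset_def)
  moreover have "pt (m u) pI p * cnj (pt (m u) pI p') = 0"
   using zI assms(3) 2 by (auto simp: kset_def)
  ultimately show ?thesis using 2 b by (auto simp: kset_def)
 next
  case 3
  thus ?thesis using pt_columns[OF um, of p p'] assms(3) by (auto simp: kset_def)
 qed
qed

lemma kset_weight:
 assumes "u \<in> V" "k u = 1 ==> axis_map u (ax1 u) (ax2 u)" "p \<in> kset k ax1 u"
 shows "(\<Sum>q\<in>kset k ax2 u. (cmod (pt (m u) q p))\<^sup>2) = 1"
 using assms pt_columns_norm[OF uni[OF assms(1)], of p] pt_I_left[OF uni[OF assms(1)], of p]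
  pt_I_right[OF uni[OF assms(1)], of "ax2 u"]
 by (auto simp: kset_def axis_map_def split: if_splits)

lemma kset_weight0:
 assumes "u \<in> V" "k u = 1 ==> axis_map u (ax1 u) (ax2 u)" "p \<notin> kset k ax1 u"
 shows "(\<Sum>q\<in>kset k ax2 u. (cmod (pt (m u) q p))\<^sup>2) = 0"
 using assms pt_I_left[OF uni[OF assms(1)], of p] pt_axis_row[OF uni[OF assms(1)], of "ax2 u" "ax1 u" p]
 by (auto simp: kset_def axis_map_def split: if_splits)

text \<open>Outside \<open>T\<close> matched constraints act as a projection with weights 0 and 1,
  so only \<open>T\<close>, where the factor of the second graph is prescribed exactly, leaves
  genuine weights. Pairs that differ outside \<open>T\<close> are already killed there, and
  \<open>gram\<close> has to treat only pairs that agree outside \<open>T\<close>.\<close>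

lemma pair_count:
 fixes q :: "nat => bool \<times> bool"
 assumes T: "T \<subseteq> V" and ax: "!!u. u \<in> V - T ==> k u = 1 ==> axis_map u (ax1 u) (ax2 u)"
 defines "S \<equiv> SW V E1 (%u. if u \<in> T then UNIV else kset k ax1 u)"
 assumes gram: "!!x x'. x \<in> S ==> x' \<in> S ==> x ~= x' ==> (!!u. u \<in> V - T ==> cmp E1 x u = cmp E1 x' u) ==>
  \<exists>u\<in>T. pt (m u) (q u) (cmp E1 x u) = 0 \<or> pt (m u) (q u) (cmp E1 x' u) = 0"
 shows "real (card (SW V E2 (%u. if u \<in> T then {q u} else kset k ax2 u)))
  = (\<Sum>x\<in>S. \<Prod>u\<in>T. (cmod (pt (m u) (q u) (cmp E1 x u)))\<^sup>2)"
proof -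
 let ?W = "%u. if u \<in> T then {q u} else kset k ax2 u"
 let ?w = "%x u. \<Sum>q\<in>?W u. (cmod (pt (m u) q (cmp E1 x u)))\<^sup>2"
 have "real (card (SW V E2 ?W)) = (\<Sum>x\<in>Pow V. \<Prod>u\<in>V. ?w x u)"
 proof (rule count_transform[OF G1 G2 uni eq])
  fix x x' assume x: "x \<subseteq> V" "x' \<subseteq> V" "x ~= x'"
  show "\<exists>u\<in>V. (\<Sum>q\<in>?W u. pt (m u) q (cmp E1 x u) * cnj (pt (m u) q (cmp E1 x' u))) = 0"
  proof (cases "\<exists>u\<in>V - T. cmp E1 x u ~= cmp E1 x' u \<or> cmp E1 x u \<notin> kset k ax1 u")
   case True
   then obtain u where u: "u \<in> V" "u \<notin> T" "cmp E1 x u ~= cmp E1 x' u \<or> cmp E1 x u \<notin> kset k ax1 u" by blast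
   show ?thesis using kset_gram[of u k ax1 ax2, OF u(1) ax u(3)] u(1,2) by (intro bexI[of _ u]) auto
  next
   case False
   hence agree: "!!u. u \<in> V - T ==> cmp E1 x u = cmp E1 x' u" by blast
   have "x \<in> S" "x' \<in> S" using False x agree unfolding S_def SW_def by auto
   from gram[OF this x(3) agree] obtain u where u: "u \<in> T"
    "pt (m u) (q u) (cmp E1 x u) = 0 \<or> pt (m u) (q u) (cmp E1 x' u) = 0" by blast
   thus ?thesis using T by (intro bexI[of _ u]) auto
  qed
 qed
 also have "... = (\<Sum>x\<in>S. \<Prod>u\<in>V. ?w x u)"
 proof (rule sum.mono_neutral_right)
  show "\<forall>x\<in>Pow V - S. (\<Prod>u\<in>V. ?w x u) = 0"
  proof
   fix x assume "x \<in> Pow V - S"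
   then obtain u where u: "u \<in> V" "u \<notin> T" "cmp E1 x u \<notin> kset k ax1 u"
    unfolding S_def SW_def by (auto split: if_splits)
   hence "?w x u = 0" using kset_weight0[of u k ax1 ax2, OF u(1) ax u(3)] by simp
   thus "(\<Prod>u\<in>V. ?w x u) = 0" using u(1) by (intro prod_zero[OF fin] bexI[of _ u])
  qed
 qed (use fin in "auto simp: S_def SW_def")
 also have "... = (\<Sum>x\<in>S. \<Prod>u\<in>T. (cmod (pt (m u) (q u) (cmp E1 x u)))\<^sup>2)"
 proof (rule sum.cong[OF refl])
  fix x assume x: "x \<in> S"
  have "(\<Prod>u\<in>V. ?w x u) = (\<Prod>u\<in>T. ?w x u)"
  proof (rule prod.mono_neutral_right[OF fin T])
   show "\<forall>u\<in>V - T. ?w x u = 1"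
   proof
    fix u assume u: "u \<in> V - T"
    hence "cmp E1 x u \<in> kset k ax1 u" using x by (auto simp: S_def SW_def split: if_splits)
    thus "?w x u = 1" using kset_weight[of u k ax1 ax2, OF _ ax] u by simp
   qed
  qed
  thus "(\<Prod>u\<in>V. ?w x u) = (\<Prod>u\<in>T. (cmod (pt (m u) (q u) (cmp E1 x u)))\<^sup>2)" by simp
 qed
 finally show ?thesis .
qed

text \<open>The case \<open>T = {}\<close>, where elements that agree outside \<open>T\<close> are
  equal.\<close>

lemma kset_card_eq:
 assumes "!!u. u \<in> V ==> k u = 1 ==> axis_map u (ax1 u) (ax2 u)"
 shows "card (SW V E2 (kset k ax2)) = card (SW V E1 (kset k ax1))"
proof -
 have "real (card (SW V E2 (%u. if u \<in> {} then {undefined} else kset k ax2 u)))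
  = (\<Sum>x\<in>SW V E1 (%u. if u \<in> {} then UNIV else kset k ax1 u). \<Prod>u\<in>{}. (cmod (pt (m u) undefined (cmp E1 x u)))\<^sup>2)"
 proof (rule pair_count[where q = "%_. undefined"])
  fix x x'
  assume x: "x \<in> SW V E1 (%u. if u \<in> {} then UNIV else kset k ax1 u)"
   "x' \<in> SW V E1 (%u. if u \<in> {} then UNIV else kset k ax1 u)" "x ~= x'"
   "!!u. u \<in> V - {} ==> cmp E1 x u = cmp E1 x' u"
  hence "x \<subseteq> V" "x' \<subseteq> V" by (auto simp: SW_def)
  with x(3,4) have False using cmp_inj[of x V x' E1] by simp
  thus "\<exists>u\<in>{}. pt (m u) undefined (cmp E1 x u) = 0 \<or> pt (m u) undefined (cmp E1 x' u) = 0" ..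
 qed (use assms in auto)
 thus ?thesis by simp
qed

lemma SW_fibre:
 "u \<in> V ==> k u = 2 ==> {x \<in> SW V E (kset k ax). cmp E x u = q} = SW V E (%w. if w = u then {q} else kset k ax w)"
 by (auto simp: SW_def kset_def split: if_splits)

lemma fibre_I: "u \<in> V ==> k u = 2 ==> {x \<in> SW V E (kset k ax). cmp E x u = pI} = SW V E (kset (k(u := 0)) ax)"
 by (auto simp: SW_def kset_def split: if_splits)

text \<open>The number of elements of \<open>E2\<close> with factor \<open>q\<close> at
  \<open>u\<close> is \<open>M\<close> times a squared entry of column \<open>P\<close>. As a fibre
  of a group it is also 0 or \<open>M\<close>, the size of the identity fibre, which is the same for
  both graphs. Hence the entries of the column have modulus 0 or 1, and as a unit vector the column
  has exactly one of modulus 1.\<close>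

lemma axis_transfer:
 assumes ax: "!!u. u \<in> V ==> k u = 1 ==> axis_map u (ax1 u) (ax2 u)"
  and u: "u \<in> V" "k u = 2" and P: "P ~= pI" "img V E1 (kset k ax1) u = {pI, P}"
 obtains Q where "Q ~= pI" "img V E2 (kset k ax2) u = {pI, Q}" "axis_map u P Q"
proof -
 let ?S1 = "SW V E1 (kset k ax1)" and ?S2 = "SW V E2 (kset k ax2)"
 note um = uni[OF u(1)]
 have S1: "SW V E1 (%w. if w \<in> {u} then UNIV else kset k ax1 w) = ?S1"
  using u(2) by (auto simp: SW_def kset_def split: if_splits)
 have in1: "cmp E1 x u \<in> {pI, P}" if "x \<in> ?S1" for x
  using that P(2) unfolding img_def by blast
 define M where "M = card {x \<in> ?S1. cmp E1 x u = pI}"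
 have MP: "card {x \<in> ?S1. cmp E1 x u = P} = M"
 proof -
  have "P \<in> img V E1 (kset k ax1) u" using P by simp
  then obtain x0 where "x0 \<in> ?S1" "P = cmp E1 x0 u" unfolding img_def by blast
  thus ?thesis using SW_kset_fibre_card[OF fin, of x0 E1 k ax1 u] by (simp add: M_def)
 qed
 have M0: "M > 0" unfolding M_def
  using finite_SW[OF fin] by (subst card_gt_0_iff) (auto intro!: exI[of _ "{}"])
 have cnt: "real (card {y \<in> ?S2. cmp E2 y u = q}) = (cmod (pt (m u) q P))\<^sup>2 * M" if q: "q ~= pI" for q
 proof -
  have "real (card (SW V E2 (%w. if w \<in> {u} then {q} else kset k ax2 w)))
   = (\<Sum>x\<in>SW V E1 (%w. if w \<in> {u} then UNIV else kset k ax1 w). \<Prod>w\<in>{u}. (cmod (pt (m w) q (cmp E1 x w)))\<^sup>2)"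
  proof (rule pair_count[where q = "%_. q"])
   fix x x'
   assume x: "x \<in> SW V E1 (%w. if w \<in> {u} then UNIV else kset k ax1 w)"
    "x' \<in> SW V E1 (%w. if w \<in> {u} then UNIV else kset k ax1 w)"
    "x ~= x'" "!!w. w \<in> V - {u} ==> cmp E1 x w = cmp E1 x' w"
   have sub: "x \<subseteq> V" "x' \<subseteq> V" using x(1,2) by (auto simp: SW_def)
   \<comment> \<open>Two elements agreeing away from \<open>u\<close> must differ at
     \<open>u\<close>. Since only \<open>pI\<close> and \<open>P\<close> occur there, one of them
     has \<open>pI\<close>, and its entry vanishes because \<open>q\<close> is not the
     identity.\<close>
   have "cmp E1 x u ~= cmp E1 x' u" using cmp_inj[OF sub] x(3,4) by (metis DiffI singletonD)
   hence "cmp E1 x u = pI \<or> cmp E1 x' u = pI" using in1 x(1,2) unfolding S1 by blast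
   thus "\<exists>w\<in>{u}. pt (m w) q (cmp E1 x w) = 0 \<or> pt (m w) q (cmp E1 x' w) = 0"
    using pt_I_right[OF um, of q] q by auto
  qed (use u ax in auto)
  also have "... = (\<Sum>x\<in>?S1. (if cmp E1 x u = P then (cmod (pt (m u) q P))\<^sup>2 else 0))"
   unfolding S1 by (rule sum.cong[OF refl]) (use in1 pt_I_right[OF um, of q] q in fastforce)
  also have "... = (cmod (pt (m u) q P))\<^sup>2 * M"
   using MP finite_SW[OF fin] by (simp flip: sum.inter_filter)
  finally show ?thesis using SW_fibre[of u k E2 ax2 q] u by simp
 qed
 have cntI: "card {y \<in> ?S2. cmp E2 y u = pI} = M"
  unfolding M_def fibre_I[of u k, OF u] by (rule kset_card_eq) (use ax in "auto split: if_splits")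
 have zero_one: "pt (m u) q P = 0 & q \<notin> img V E2 (kset k ax2) u \<or> cmod (pt (m u) q P) = 1 & q \<in> img V E2 (kset k ax2) u"
  if q: "q ~= pI" for q
 proof (cases "q \<in> img V E2 (kset k ax2) u")
  case True
  then obtain y0 where "y0 \<in> ?S2" "q = cmp E2 y0 u" unfolding img_def by blast
  hence "card {y \<in> ?S2. cmp E2 y u = q} = M"
   using SW_kset_fibre_card[OF fin, of y0 E2 k ax2 u] cntI by simp
  hence "(cmod (pt (m u) q P))\<^sup>2 = 1" using cnt[OF q] M0 by simp
  hence "cmod (pt (m u) q P) = 1" by (simp add: power2_eq_1_iff) (smt (verit) norm_ge_zero)
  thus ?thesis using True by simp
 next
  case False
  hence "{y \<in> ?S2. cmp E2 y u = q} = {}" unfolding img_def by blast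
  hence "(cmod (pt (m u) q P))\<^sup>2 * M = 0" using cnt[OF q] by (metis card.empty of_nat_0)
  thus ?thesis using M0 False by simp
 qed
 have "\<exists>q. q ~= pI & pt (m u) q P ~= 0"
 proof (rule ccontr)
  assume "\<not> ?thesis"
  hence "!!q. pt (m u) q P = 0" using pt_I_left[OF um, of P] P(1) by (metis of_bool_eq(1))
  thus False using pt_columns_norm[OF um, of P] by simp
 qed
 then obtain Q where Q: "Q ~= pI" "cmod (pt (m u) Q P) = 1" "Q \<in> img V E2 (kset k ax2) u" using zero_one by blast
 moreover have "q \<notin> img V E2 (kset k ax2) u" if "q ~= pI" "q ~= Q" for q
 proof -
  have "pt (m u) q P = 0" using pt_axis_column[OF um Q(2)] that(2) by simp
  thus ?thesis using zero_one[OF that(1)] by auto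
 qed
 moreover have "pI \<in> img V E2 (kset k ax2) u" unfolding img_def by (rule image_eqI[of _ _ "{}"]) auto
 ultimately have "img V E2 (kset k ax2) u = {pI, Q}" by blast
 thus ?thesis using that Q P(1) by (simp add: axis_map_def)
qed

end

context lu_pair begin

text \<open>At every vertex some axis is mapped to an axis, except possibly in a component with two vertices:
  a minimal set of vertices on which the stabilizer acts at \<open>r\<close> by all Pauli operators gives,
  through one of its vertices \<open>v\<close>, a correlation tensor whose decomposition is unique.\<close>

lemma seed:
 assumes r: "r \<in> V"
 shows "(\<exists>P Q. axis_map r P Q) \<or>
  (\<exists>v\<in>V. nbr E1 r = {v} & nbr E1 v = {r} & nbr E2 r = {v} & nbr E2 v = {r})"
proof (rule ccontr)
 assume neg: "\<not> ?thesis"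
 define k where "k A v = (if v \<in> A then 2 else 0 :: nat)" for A :: "nat set" and v
 define W where "W A = kset (k A) (%_. pI)" for A
 have W: "W A v = (if v \<in> A then UNIV else {pI})" for A v by (simp add: W_def k_def kset_def)
 have inSW: "x \<in> SW V E (W A) \<longleftrightarrow> x \<subseteq> V & (\<forall>u\<in>V - A. cmp E x u = pI)" for x E A
  by (auto simp: SW_def W)
 have sub: "x \<subseteq> A" if "x \<in> SW V E (W A)" for x E A
  using that unfolding inSW by (auto simp: cmp_def)
 have card_eq: "card (SW V E2 (W A)) = card (SW V E1 (W A))" for A
  unfolding W_def by (rule kset_card_eq) (auto simp: k_def split: if_splits)
 \<comment> \<open>Constraints of the kinds 0 and 2 involve no axis, so \<open>axis_transfer\<close>
   applies without prior knowledge and would produce an axis if the image were a single one.\<close>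
 have dich: "img V E1 (W A) r = {pI} \<or> img V E1 (W A) r = UNIV" if "r \<in> A" for A
 proof (rule img_kset_cases[OF fin, of E1 "k A" "%_. pI" r])
  fix P assume "P ~= pI" "img V E1 (kset (k A) (%_. pI)) r = {pI, P}"
  note P = this
  have k: "k A r = 2" "!!u. k A u = 1 ==> axis_map u pI pI" using that by (auto simp: k_def split: if_splits)
  obtain Q where "axis_map r P Q"
   using axis_transfer[of "k A" "%_. pI" "%_. pI" r P, OF k(2) r k(1) P] .
  thus ?thesis using neg by blast
 qed (simp_all add: W_def)
 have finS: "finite (SW V E (W A))" for E A by (rule finite_SW[OF fin])
 have img_r: "img V E1 (W {r}) r = {pI}"
 proof (rule ccontr)
  assume "\<not> ?thesis"
  hence "img V E1 (W {r}) r = UNIV" using dich[of "{r}"] by simp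
  moreover have "SW V E1 (W {r}) \<subseteq> {{}, {r}}" using sub by blast
  hence "img V E1 (W {r}) r \<subseteq> {cmp E1 {} r, cmp E1 {r} r}" unfolding img_def by blast
  ultimately have "(UNIV :: (bool \<times> bool) set) \<subseteq> {pI, cmp E1 {r} r}" by simp
  hence "(True, True) \<in> {pI, cmp E1 {r} r}" "(True, False) \<in> {pI, cmp E1 {r} r}" by (meson UNIV_I subsetD)+
  thus False by (metis empty_iff insert_iff prod.inject)
 qed
 have "cmp E1 {r} r ~= pI" by (simp add: cmp_def)
 hence r_notin: "{r} \<notin> SW V E1 (W {r})" using img_r unfolding img_def by blast
 have nbr_sub: "nbr E u \<subseteq> A" if "{u} \<in> SW V E (W A)" "simple_graph V E" for E u A
 proof
  fix w assume w: "w \<in> nbr E u"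
  hence "w \<in> V" using nbr_subset[OF that(2)] by auto
  moreover have "nbr E w \<inter> {u} = {u}" using w nbr_sym by blast
  hence "cmp E {u} w ~= pI" by (simp add: cmp_def)
  ultimately show "w \<in> A" using that(1) unfolding inSW by auto
 qed
 have cmp_single: "cmp E {u} w = (w = u, w \<in> nbr E u)" for E u w
 proof -
  have "nbr E w \<inter> {u} = (if w \<in> nbr E u then {u} else {})" using nbr_sym by auto
  thus ?thesis by (auto simp: cmp_def)
 qed
 have nbr_r: "nbr E1 r ~= {}"
 proof
  assume "nbr E1 r = {}"
  hence "{r} \<in> SW V E1 (W {r})" using r by (simp add: inSW cmp_single)
  thus False using r_notin by blast
 qed
 then obtain w where w: "w \<in> nbr E1 r" by blast
 hence "w \<in> V" using nbr_subset[OF G1] by auto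
 hence "{w} \<in> SW V E1 (W V)" by (simp add: inSW)
 hence "cmp E1 {w} r \<in> img V E1 (W V) r" unfolding img_def by (rule imageI)
 moreover have "cmp E1 {w} r ~= pI" using w nbr_sym[of w E1 r] by (simp add: cmp_single)
 ultimately have imgV: "img V E1 (W V) r = UNIV" using dich[OF r] by (metis singletonD)
 obtain B where B: "B \<subseteq> V" "r \<in> B" "img V E1 (W B) r = UNIV"
  and minB: "!!A. A \<subset> B ==> r \<in> A ==> img V E1 (W A) r ~= UNIV"
 proof -
  define Bs where "Bs = {B. B \<subseteq> V & r \<in> B & img V E1 (W B) r = UNIV}"
  have f: "finite Bs" by (rule finite_subset[of _ "Pow V"]) (use fin in "auto simp: Bs_def")
  have "V \<in> Bs" using r imgV by (simp add: Bs_def)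
  from finite_has_minimal2[OF f this] obtain B
   where B: "B \<in> Bs" "\<forall>A\<in>Bs. A \<subseteq> B --> B = A" by blast
  show ?thesis
  proof (rule that[of B])
   fix A assume A: "A \<subset> B" "r \<in> A"
   show "img V E1 (W A) r ~= UNIV"
   proof
    assume "img V E1 (W A) r = UNIV"
    hence "A \<in> Bs" using A B(1) by (auto simp: Bs_def)
    hence "B = A" using B(2) A(1) by (simp add: less_imp_le)
    thus False using A(1) by simp
   qed
  qed (use B(1) in "simp_all add: Bs_def")
 qed
 have U1: "(UNIV :: (bool \<times> bool) set) ~= {pI}" by (metis UNIV_I prod.inject singletonD)
 hence "B ~= {r}" using B(3) img_r by metis
 then obtain v where v: "v \<in> B" "v ~= r" using B(2) by blast
 have vV: "v \<in> V" using v B(1) by auto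
 have imgBv: "img V E1 (W (B - {v})) r = {pI}"
  using minB[of "B - {v}"] dich[of "B - {v}"] v B(2) by (metis DiffI Diff_subset psubsetI insert_Diff insert_iff singletonD Diff_iff)
 \<comment> \<open>If two vertices alone carry all Pauli operators at \<open>r\<close>, the elements
   given by all four subsets of \<open>{r, v}\<close> are supported there, in both graphs by
   counting; this is the isolated edge. Otherwise elements supported on \<open>{r, v}\<close> are
   trivial at \<open>r\<close>, and the contradiction comes from the larger set
   \<open>B\<close>.\<close>
 show False
 proof (cases "\<exists>x\<in>SW V E1 (W {r, v}). cmp E1 x r ~= pI")
  case True
  hence "img V E1 (W {r, v}) r ~= {pI}" unfolding img_def by blast
  hence U: "img V E1 (W {r, v}) r = UNIV" using dich[of "{r, v}"] by blast
  have four: "SW V E (W {r, v}) \<subseteq> {{}, {r}, {v}, {r, v}}" for E using sub[of _ E "{r, v}"] by blast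
  have "card (UNIV :: (bool \<times> bool) set) <= card (SW V E1 (W {r, v}))"
   unfolding U[symmetric] img_def by (rule card_image_le[OF finS])
  hence c4: "card (SW V E1 (W {r, v})) \<ge> 4" by (simp add: card_cartesian_product flip: UNIV_Times_UNIV)
  have cc: "card {{}, {r}, {v}, {r, v}} = 4" using v by (auto simp: doubleton_eq_iff)
  have full: "SW V E (W {r, v}) = {{}, {r}, {v}, {r, v}}" if "E = E1 \<or> E = E2" for E
  proof (rule card_subset_eq[OF _ four])
   have "card (SW V E (W {r, v})) \<ge> 4" using c4 card_eq[of "{r, v}"] that by metis
   moreover have "card (SW V E (W {r, v})) <= card {{}, {r}, {v}, {r, v}}"
    by (rule card_mono[OF _ four]) simp
   ultimately show "card (SW V E (W {r, v})) = card {{}, {r}, {v}, {r, v}}" using cc by simp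
  qed simp
  have n: "nbr E r \<subseteq> {v}" "nbr E v \<subseteq> {r}" if "E = E1 \<or> E = E2" for E
  proof -
   have G: "simple_graph V E" using that G1 G2 by metis
   have "{r} \<in> SW V E (W {r, v})" "{v} \<in> SW V E (W {r, v})" unfolding full[OF that] by simp_all
   thus "nbr E r \<subseteq> {v}" "nbr E v \<subseteq> {r}"
    using nbr_sub[of r E "{r, v}", OF _ G] nbr_sub[of v E "{r, v}", OF _ G]
     nbr_irrefl[OF G, of r] nbr_irrefl[OF G, of v] by fast+
  qed
  have "nbr E1 r = {v}" using n(1)[of E1] nbr_r by auto
  moreover have "nbr E1 v = {r}" using n(2)[of E1] calculation nbr_sym[of v E1 r] by auto
  moreover have "nbr E2 r ~= {}"
  proof
   assume "nbr E2 r = {}"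
   hence "{{}, {r}} \<subseteq> SW V E2 (W {r})" using r by (simp add: inSW cmp_single)
   hence "card {{}, {r}} <= card (SW V E2 (W {r}))" by (rule card_mono[OF finS])
   moreover have "SW V E1 (W {r}) \<subseteq> {{}}"
   proof
    fix x assume x: "x \<in> SW V E1 (W {r})"
    hence "x \<subseteq> {r}" by (rule sub)
    moreover have "x ~= {r}" using x r_notin by metis
    ultimately show "x \<in> {{}}" by (simp add: subset_singleton_iff)
   qed
   hence "card (SW V E1 (W {r})) <= card {{} :: nat set}" by (intro card_mono) auto
   ultimately show False using card_eq[of "{r}"] by simp
  qed
  moreover have "nbr E2 r = {v}" using n(1)[of E2] calculation(3) by auto
  moreover have "nbr E2 v = {r}" using n(2)[of E2] calculation(4) nbr_sym[of v E2 r] by auto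
  ultimately show False using neg vV by blast
 next
  case False
  let ?S = "%E. SW V E (W B)"
  let ?Sr = "%E. SW V E (W (B - {r}))" and ?Sv = "%E. SW V E (W (B - {v}))"
   and ?Srv = "%E. SW V E (W (B - {r} - {v}))"
  have Sr: "?Sr E = {x \<in> ?S E. cmp E x r = pI}" for E using B(1,2) by (auto simp: inSW)
  have Sv: "?Sv E = {x \<in> ?S E. cmp E x v = pI}" for E using B(1) v by (auto simp: inSW)
  have Srv: "?Srv E = ?Sr E \<inter> ?Sv E" for E using B(1) v by (auto simp: inSW)
  have cardS: "card (?S E) = card (img V E (W B) u) * card {x \<in> ?S E. cmp E x u = pI}" for E u
   unfolding W_def by (rule SW_kset_card[OF fin])
  have U4: "card (UNIV :: (bool \<times> bool) set) = 4" by (simp add: card_cartesian_product flip: UNIV_Times_UNIV)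
  \<comment> \<open>By minimality of \<open>B\<close> an element trivial at \<open>v\<close> is
    trivial at \<open>r\<close>. There are four fibres at \<open>r\<close> and at most four at
    \<open>v\<close>, so the two subgroups coincide, and counting transfers this to
    \<open>E2\<close>: on \<open>?S\<close> the factors at \<open>r\<close> and \<open>v\<close>
    determine each other in both graphs.\<close>
  have "?Sv E1 \<subseteq> ?Sr E1"
  proof
   fix x assume x: "x \<in> ?Sv E1"
   hence "cmp E1 x r \<in> img V E1 (W (B - {v})) r" unfolding img_def by (rule imageI)
   hence "cmp E1 x r = pI" unfolding imgBv by (rule singletonD)
   thus "x \<in> ?Sr E1" using x unfolding Sr Sv by simp
  qed
  moreover have "card (?Sr E1) <= card (?Sv E1)"
  proof -
   have "card (img V E1 (W B) v) <= 4" using card_mono[of UNIV "img V E1 (W B) v"] U4 by simp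
   hence "card (?S E1) <= 4 * card (?Sv E1)" unfolding Sv cardS[of E1 v] by (rule mult_le_mono1)
   moreover have "card (?S E1) = 4 * card (?Sr E1)" unfolding Sr using cardS[of E1 r] B(3) U4 by simp
   ultimately show ?thesis by simp
  qed
  ultimately have eq1: "?Sr E1 = ?Sv E1" by (rule card_seteq[OF finS, symmetric])
  have "?Srv E1 = ?Sr E1" "?Srv E1 = ?Sv E1" using Srv[of E1] eq1 by simp_all
  hence c2: "card (?Srv E2) = card (?Sr E2)" "card (?Srv E2) = card (?Sv E2)"
   using card_eq[of "B - {r} - {v}"] card_eq[of "B - {r}"] card_eq[of "B - {v}"] by simp_all
  have "?Srv E2 = ?Sr E2" by (rule card_subset_eq[OF finS _ c2(1)]) (simp add: Srv)
  moreover have "?Srv E2 = ?Sv E2" by (rule card_subset_eq[OF finS _ c2(2)]) (simp add: Srv)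
  ultimately have eq2: "?Sr E2 = ?Sv E2" by simp
  have iff: "cmp E x r = pI \<longleftrightarrow> cmp E x v = pI" if "x \<in> ?S E" "E = E1 \<or> E = E2" for E x
  proof -
   have "x \<in> ?Sr E \<longleftrightarrow> x \<in> ?Sv E" using that(2) eq1 eq2 by metis
   thus ?thesis using that(1) unfolding Sr Sv by simp
  qed
  have agree: "cmp E x r = cmp E y r \<longleftrightarrow> cmp E x v = cmp E y v" if "x \<in> ?S E" "y \<in> ?S E" "E = E1 \<or> E = E2" for E x y
  proof -
   have "sym_diff x y \<in> ?S E" using that(1,2) unfolding W_def by (rule SW_kset_sym_diff[OF fin])
   moreover have "x \<subseteq> V" "y \<subseteq> V" using that(1,2) by (auto simp: inSW)
   ultimately show ?thesis using iff[of "sym_diff x y" E] that(3) cmp_sym_diff[OF fin, of x y E] by simp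
  qed
  have all2: "img V E2 (W B) r = UNIV"
  proof -
   have "{} \<in> ?Sr E2" by (simp add: inSW)
   hence "card (?Sr E2) > 0" using finS card_gt_0_iff by blast
   moreover have "card (?S E2) = 4 * card (?Sr E2)"
    using card_eq[of B] card_eq[of "B - {r}"] cardS[of E1 r] B(3) U4 Sr[of E1] by simp
   ultimately have "card (img V E2 (W B) r) = 4" using cardS[of E2 r] Sr[of E2] by simp
   thus ?thesis using U4 card_subset_eq[of UNIV "img V E2 (W B) r"] by simp
  qed
  have Wrv: "SW V E1 (%u. if u \<in> {r, v} then UNIV else kset (k B) (%_. pI) u) = ?S E1"
   using v(1) B(2) by (auto simp: SW_def W kset_def k_def)
  \<comment> \<open>If the pair \<open>p\<close>, \<open>q\<close> does not occur in
    \<open>E2\<close>, the count is 0 and so is each nonnegative term of its expansion. Since the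
    factor at \<open>r\<close> determines that at \<open>v\<close>, all but one \<open>q\<close> are
    excluded for given \<open>p\<close>, and conversely; this isolates single entries of modulus
    1.\<close>
  have vanish: "pt (m r) p (cmp E1 x r) = 0 \<or> pt (m v) q (cmp E1 x v) = 0"
   if x: "x \<in> ?S E1" and none: "!!y. y \<in> ?S E2 ==> cmp E2 y r = p ==> cmp E2 y v ~= q" for p q x
  proof -
   define qq where "qq u = (if u = r then p else q)" for u
   have "real (card (SW V E2 (%u. if u \<in> {r, v} then {qq u} else kset (k B) (%_. pI) u)))
    = (\<Sum>x\<in>SW V E1 (%u. if u \<in> {r, v} then UNIV else kset (k B) (%_. pI) u). \<Prod>u\<in>{r, v}. (cmod (pt (m u) (qq u) (cmp E1 x u)))\<^sup>2)"
   proof (rule pair_count)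
    fix x x' assume a: "x \<in> SW V E1 (%u. if u \<in> {r, v} then UNIV else kset (k B) (%_. pI) u)"
     "x' \<in> SW V E1 (%u. if u \<in> {r, v} then UNIV else kset (k B) (%_. pI) u)" "x ~= x'"
     "!!u. u \<in> V - {r, v} ==> cmp E1 x u = cmp E1 x' u"
    have sV: "x \<subseteq> V" "x' \<subseteq> V" using a(1,2) by (auto simp: SW_def)
    have d: "cmp E1 (sym_diff x x') u = pI" if "u \<in> V - {r, v}" for u
     using a(4)[OF that] cmp_sym_diff[OF fin sV] by simp
    moreover have "sym_diff x x' \<subseteq> V" using sV by auto
    ultimately have "sym_diff x x' \<in> SW V E1 (W {r, v})" unfolding inSW by simp
    hence "cmp E1 (sym_diff x x') r = pI" using False by metis
    hence "cmp E1 x r = cmp E1 x' r" using cmp_sym_diff[OF fin sV] by simp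
    moreover have "cmp E1 x v = cmp E1 x' v" using agree[of x E1 x'] calculation a(1,2) unfolding Wrv by simp
    ultimately have "cmp E1 x u = cmp E1 x' u" if "u \<in> V" for u
     using a(4)[of u] that by (cases "u \<in> {r, v}") auto
    hence "x = x'" by (rule cmp_inj[OF sV])
    thus "\<exists>u\<in>{r, v}. pt (m u) (qq u) (cmp E1 x u) = 0 \<or> pt (m u) (qq u) (cmp E1 x' u) = 0" using a(3) by metis
   qed (use r vV in "auto simp: k_def split: if_splits")
   moreover have "SW V E2 (%u. if u \<in> {r, v} then {qq u} else kset (k B) (%_. pI) u) = {}"
   proof (rule ccontr)
    assume "\<not> ?thesis"
    then obtain y where y: "y \<in> SW V E2 (%u. if u \<in> {r, v} then {qq u} else kset (k B) (%_. pI) u)"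
     unfolding ex_in_conv[symmetric] not_not by (rule exE)
    hence "y \<subseteq> V & (\<forall>u\<in>V. cmp E2 y u \<in> (if u \<in> {r, v} then {qq u} else W B u))"
     unfolding SW_def W_def mem_Collect_eq Pow_iff .
    hence y': "y \<subseteq> V" "!!u. u \<in> V ==> cmp E2 y u \<in> (if u \<in> {r, v} then {qq u} else W B u)"
     by (rule conjunct1, elim conjE) (erule (1) bspec)
    have "cmp E2 y u = pI" if "u \<in> V - B" for u
    proof -
     have "u \<notin> {r, v}" using that v(1) B(2) by auto
     thus ?thesis using y'(2)[of u] that by (simp add: W)
    qed
    hence "y \<in> ?S E2" using y'(1) by (simp add: inSW)
    moreover have "cmp E2 y r = p" "cmp E2 y v = q" using y'(2)[OF r] y'(2)[OF vV] v(2) by (simp_all add: qq_def)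
    ultimately show False using none by metis
   qed
   ultimately have "(\<Sum>x\<in>?S E1. \<Prod>u\<in>{r, v}. (cmod (pt (m u) (qq u) (cmp E1 x u)))\<^sup>2) = 0"
    unfolding Wrv by simp
   hence "(\<Prod>u\<in>{r, v}. (cmod (pt (m u) (qq u) (cmp E1 x u)))\<^sup>2) = 0"
    using x by (subst (asm) sum_nonneg_eq_0_iff[OF finS]) (auto intro: prod_nonneg)
   thus ?thesis using v(2) by (simp add: qq_def)
  qed
  define P where "P = (True, False)"
  have "P \<in> img V E1 (W B) r" using B(3) by simp
  then obtain x where x: "P = cmp E1 x r" "x \<in> ?S E1" unfolding img_def by (rule imageE)
  note x = x(2) x(1)[symmetric]
  have sI: "cmp E1 x v ~= pI" using iff[of x E1] x by (simp add: P_def)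
  note mr = uni[OF r] and mv = uni[OF vV]
  have "\<exists>P'. pt (m r) P' P ~= 0"
  proof (rule ccontr)
   assume "\<not> ?thesis"
   hence "(\<Sum>q\<in>UNIV. (cmod (pt (m r) q P))\<^sup>2) = 0" by (intro sum.neutral) simp
   thus False using pt_columns_norm[OF mr, of P] by simp
  qed
  then obtain P' where P': "pt (m r) P' P ~= 0" by blast
  have P'I: "P' ~= pI" using P' pt_I_left[OF mr, of P] by (auto simp: P_def)
  have "P' \<in> img V E2 (W B) r" using all2 by simp
  then obtain y where y: "P' = cmp E2 y r" "y \<in> ?S E2" unfolding img_def by (rule imageE)
  note y = y(2) y(1)[symmetric]
  define q' where "q' = cmp E2 y v"
  have "pt (m v) q (cmp E1 x v) = 0" if "q ~= q'" for q
  proof -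
   have "cmp E2 y' v ~= q" if "y' \<in> ?S E2" "cmp E2 y' r = P'" for y'
    using agree[of y' E2 y] that y \<open>q ~= q'\<close> by (simp add: q'_def)
   from vanish[of x P' q, OF x(1) this] P' x(2) show ?thesis by simp
  qed
  hence q'1: "cmod (pt (m v) q' (cmp E1 x v)) = 1"
   using norm_one_if_others_zero[of "%q. pt (m v) q (cmp E1 x v)" q'] pt_columns_norm[OF mv] by simp
  have "pt (m r) P'' P = 0" if "P'' ~= P'" for P''
  proof -
   have "cmp E2 y' v ~= q'" if "y' \<in> ?S E2" "cmp E2 y' r = P''" for y'
    using agree[of y' E2 y] that y \<open>P'' ~= P'\<close> by (simp add: q'_def)
   from vanish[of x P'' q', OF x(1) this] q'1 x(2) show ?thesis by auto
  qed
  hence "cmod (pt (m r) P' P) = 1"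
   using norm_one_if_others_zero[of "%q. pt (m r) q P" P'] pt_columns_norm[OF mr] by simp
  hence "axis_map r P P'" using P'I by (simp add: axis_map_def P_def)
  thus False using neg by metis
 qed
qed

end

section \<open>Bounding the denominators of the angles\<close>

text \<open>The minimum distance of Reed--Muller codes, in terms of families of sets.\<close>

lemma rm_distance:
 fixes F :: "'a set set"
 assumes "finite F" "F ~= {}" "!!J. finite J ==> card J <= \<rho> ==> even (card {N \<in> F. J \<subseteq> N})"
 shows "2 ^ (\<rho> + 1) <= card F"
 using assms
proof (induction \<rho> arbitrary: F)
 case 0
 from 0(3)[of "{}"] have "even (card F)" by simp
 moreover have "card F > 0" using 0 by (simp add: card_gt_0_iff)
 ultimately show ?case by (cases "card F = 1") auto
next
 case (Suc \<rho>)
 from Suc.prems(3)[of "{}"] have "even (card F)" by simp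
 obtain N1 where N1: "N1 \<in> F" using Suc.prems(2) by blast
 obtain N2 where N2: "N2 \<in> F" "N2 ~= N1"
 proof (rule ccontr)
  assume "\<not> thesis"
  hence "F = {N1}" using N1 that by auto
  thus False using \<open>even (card F)\<close> by simp
 qed
 \<comment> \<open>A coordinate on which two members differ splits \<open>F\<close> into two
   nonempty halves. Both inherit the parity condition with one degree less: the half containing
   \<open>e\<close> by enlarging \<open>J\<close>, the other as a difference.\<close>
 then obtain e where e: "e \<in> N1 \<longleftrightarrow> e \<notin> N2" by blast
 let ?A = "{N \<in> F. e \<in> N}" and ?B = "{N \<in> F. e \<notin> N}"
 have A: "2 ^ (\<rho> + 1) <= card ?A"
 proof (rule Suc.IH)
  fix J :: "'a set" assume "finite J" "card J <= \<rho>"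
  hence "finite (insert e J)" "card (insert e J) <= Suc \<rho>" by (auto simp: card_insert_if)
  from Suc.prems(3)[OF this] have "even (card {N \<in> F. insert e J \<subseteq> N})" .
  moreover have "{N \<in> F. insert e J \<subseteq> N} = {N \<in> ?A. J \<subseteq> N}" by blast
  ultimately show "even (card {N \<in> ?A. J \<subseteq> N})" by simp
 qed (use Suc.prems(1) e N1 N2 in auto)
 have B: "2 ^ (\<rho> + 1) <= card ?B"
 proof (rule Suc.IH)
  fix J :: "'a set" assume J: "finite J" "card J <= \<rho>"
  hence "finite (insert e J)" "card (insert e J) <= Suc \<rho>" by (auto simp: card_insert_if)
  from Suc.prems(3)[OF this] have 1: "even (card {N \<in> F. insert e J \<subseteq> N})" .
  have 2: "even (card {N \<in> F. J \<subseteq> N})" using Suc.prems(3)[OF J(1)] J(2) by simp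
  have "{N \<in> F. J \<subseteq> N} = {N \<in> F. insert e J \<subseteq> N} \<union> {N \<in> ?B. J \<subseteq> N}" by blast
  hence "card {N \<in> F. J \<subseteq> N} = card {N \<in> F. insert e J \<subseteq> N} + card {N \<in> ?B. J \<subseteq> N}"
   using Suc.prems(1) by (simp only:) (rule card_Un_disjoint, auto)
  thus "even (card {N \<in> ?B. J \<subseteq> N})" using 1 2 by simp
 qed (use Suc.prems(1) e N1 N2 in auto)
 have "F = ?A \<union> ?B" by blast
 hence "card F = card ?A + card ?B"
  using Suc.prems(1) by (metis (no_types, lifting) card_Un_disjoint disjoint_iff finite_Un mem_Collect_eq)
 thus ?case using A B by simp
qed

text \<open>The condition for the empty set is missing here. Restricting to the members that contain
  a fixed \<open>e\<close> supplies it, at the price of one unit of \<open>\<rho>\<close>.\<close>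

lemma rm_distance_punctured:
 fixes F :: "'a set set"
 assumes "finite F" "F ~= {}" "{} \<notin> F" "\<rho> \<ge> 1"
  and "!!J. finite J ==> J ~= {} ==> card J <= \<rho> ==> even (card {N \<in> F. J \<subseteq> N})"
 shows "2 ^ \<rho> <= card F"
proof -
 obtain N e where N: "N \<in> F" "e \<in> N" using assms(2,3) by (metis all_not_in_conv)
 have "2 ^ (\<rho> - 1 + 1) <= card {N \<in> F. e \<in> N}"
 proof (rule rm_distance)
  fix J :: "'a set" assume "finite J" "card J <= \<rho> - 1"
  hence "finite (insert e J)" "insert e J ~= {}" "card (insert e J) <= \<rho>"
   using assms(4) by (auto simp: card_insert_if)
  from assms(5)[OF this] have "even (card {N \<in> F. insert e J \<subseteq> N})" .
  moreover have "{N \<in> F. insert e J \<subseteq> N} = {N \<in> {N \<in> F. e \<in> N}. J \<subseteq> N}" by blast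
  ultimately show "even (card {N \<in> {N \<in> F. e \<in> N}. J \<subseteq> N})" by simp
 qed (use assms N in auto)
 also have "... <= card F" by (rule card_mono) (use assms in auto)
 finally show ?thesis using assms(4) by simp
qed

definition dyadic :: "real => bool" where
 "dyadic x \<longleftrightarrow> (\<exists>k. 2 ^ k * x \<in> \<int>)"

lemma Ints_power2_mono: "2 ^ k * x \<in> \<int> ==> k <= l ==> 2 ^ l * x \<in> (\<int> :: real set)"
proof -
 assume a: "2 ^ k * x \<in> \<int>" and kl: "k <= l"
 have "2 ^ l * x = 2 ^ (l - k) * (2 ^ k * x)"
  using kl by (metis le_add_diff_inverse2 mult.assoc power_add)
 also have "... \<in> \<int>" by (rule Ints_mult[OF _ a]) simp
 finally show ?thesis .
qed

lemma dyadic_add: assumes "dyadic x" "dyadic y" shows "dyadic (x + y)"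
proof -
 obtain k l where "2 ^ k * x \<in> \<int>" "2 ^ l * y \<in> \<int>" using assms by (auto simp: dyadic_def)
 hence "2 ^ (max k l) * x \<in> \<int>" "2 ^ (max k l) * y \<in> \<int>" by (auto intro: Ints_power2_mono)
 hence "2 ^ (max k l) * (x + y) \<in> \<int>" by (simp add: distrib_left)
 thus ?thesis unfolding dyadic_def by blast
qed

lemma dyadic_minus: "dyadic x ==> dyadic (- x)"
 by (simp add: dyadic_def)

lemma dyadic_sum: "(!!i. i \<in> A ==> dyadic (f i)) ==> dyadic (sum f A)"
proof (induction A rule: infinite_finite_induct)
 case (insert x F)
 thus ?case by (auto intro: dyadic_add)
qed (auto simp: dyadic_def)

text \<open>Subtracting the contributions of proper supersets makes each \<open>\<tau> N\<close>
  dyadic. If the least common exponent \<open>\<rho>\<close> exceeded \<open>r\<close>, the sets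
  \<open>N\<close> with \<open>2 ^ \<rho> * \<tau> N\<close> odd would satisfy the parity conditions
  of a punctured code, so there would be at least \<open>2 ^ \<rho>\<close> of them, more than
  \<open>T\<close> contains.\<close>

lemma bounded_denominator:
 fixes T :: "'a set set" and \<tau> :: "'a set => real"
 assumes T: "finite T" "!!N. N \<in> T ==> finite N" "{} \<notin> T"
  and H: "!!J. finite J ==> J ~= {} ==> 2 ^ max (card J - 1) 2 * (\<Sum>N | N \<in> T & J \<subseteq> N. \<tau> N) \<in> \<int>"
  and r: "card T < 2 ^ r" "r \<ge> 2" and "N \<in> T"
 shows "2 ^ r * \<tau> N \<in> \<int>"
proof -
 have dy: "dyadic (\<tau> N)" if "N \<in> T" for N
  using that
 proof (induction "card (\<Union>T) - card N" arbitrary: N rule: less_induct)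
  case less
  have finU: "finite (\<Union>T)" using T by blast
  let ?S = "{N' \<in> T. N \<subseteq> N'}"
  have "dyadic (\<Sum>N' | N' \<in> T & N \<subseteq> N'. \<tau> N')"
  proof -
   have "finite N" "N ~= {}" using T(2,3) less.prems by auto
   from H[OF this] show ?thesis unfolding dyadic_def by (rule exI)
  qed
  moreover have "(\<Sum>N' | N' \<in> T & N \<subseteq> N'. \<tau> N') = \<tau> N + sum \<tau> (?S - {N})"
   using less.prems T(1) by (subst sum.remove[of _ N]) auto
  moreover have "dyadic (sum \<tau> (?S - {N}))"
  proof (rule dyadic_sum)
   fix N' assume N': "N' \<in> ?S - {N}"
   hence "card N < card N'" using T(2) by (intro psubset_card_mono) auto
   moreover have "card N' <= card (\<Union>T)" using N' finU by (intro card_mono) auto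
   ultimately show "dyadic (\<tau> N')" using N' by (intro less.hyps) auto
  qed
  ultimately have "dyadic ((\<tau> N + sum \<tau> (?S - {N})) + - sum \<tau> (?S - {N}))"
   by (metis dyadic_add dyadic_minus)
  thus ?case by (simp only: add_uminus_conv_diff add_diff_cancel_right')
 qed
 have ex: "\<exists>\<rho>. \<forall>N\<in>T. 2 ^ \<rho> * \<tau> N \<in> \<int>"
 proof -
  from dy have "\<forall>N\<in>T. \<exists>k. 2 ^ k * \<tau> N \<in> \<int>" by (simp add: dyadic_def)
  then obtain k where k: "!!N. N \<in> T ==> 2 ^ k N * \<tau> N \<in> \<int>" by metis
  have "2 ^ (sum k T) * \<tau> N \<in> \<int>" if "N \<in> T" for N
   by (rule Ints_power2_mono[OF k[OF that]]) (rule member_le_sum[OF that _ T(1)], simp)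
  thus ?thesis by blast
 qed
 define \<rho> where "\<rho> = (LEAST \<rho>. \<forall>N\<in>T. 2 ^ \<rho> * \<tau> N \<in> \<int>)"
 have \<rho>: "!!N. N \<in> T ==> 2 ^ \<rho> * \<tau> N \<in> \<int>" using LeastI_ex[OF ex] unfolding \<rho>_def by blast
 have "\<rho> <= r"
 proof (rule ccontr)
  assume "\<not> \<rho> <= r"
  \<comment> \<open>From \<open>\<rho> \<ge> 3\<close> on, \<open>max (card J - 1) 2\<close> is at
    most \<open>\<rho> - 1\<close> for all \<open>J\<close> with at most \<open>\<rho>\<close>
    elements; the assumption \<open>r \<ge> 2\<close> provides this.\<close>
  hence r\<rho>: "r < \<rho>" "\<rho> \<ge> 3" using r(2) by auto
  define s where "s N = \<lfloor>2 ^ \<rho> * \<tau> N\<rfloor>" for N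
  have s: "real_of_int (s N) = 2 ^ \<rho> * \<tau> N" if "N \<in> T" for N
   using \<rho>[OF that] unfolding s_def by (auto elim: Ints_cases)
  let ?F = "{N \<in> T. odd (s N)}"
  have "?F ~= {}"
  proof
   assume "?F = {}"
   have "2 ^ (\<rho> - 1) * \<tau> N \<in> \<int>" if N: "N \<in> T" for N
   proof -
    have "even (s N)" using \<open>?F = {}\<close> N by blast
    then obtain z where "s N = 2 * z" by (elim evenE)
    hence "2 ^ (\<rho> - 1) * \<tau> N = real_of_int z"
     using s[OF N] r\<rho>(2) by (cases \<rho>) auto
    thus ?thesis by simp
   qed
   hence "\<rho> <= \<rho> - 1" unfolding \<rho>_def by (intro Least_le) blast
   thus False using r\<rho>(2) by simp
  qed
  moreover have "even (card {N \<in> ?F. J \<subseteq> N})" if J: "finite J" "J ~= {}" "card J <= \<rho>" for J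
  proof -
   have "2 ^ (\<rho> - 1) * (\<Sum>N | N \<in> T & J \<subseteq> N. \<tau> N) \<in> \<int>"
    by (rule Ints_power2_mono[OF H[OF J(1,2)]]) (use J(3) r\<rho>(2) in auto)
   then obtain z where z: "2 ^ (\<rho> - 1) * (\<Sum>N | N \<in> T & J \<subseteq> N. \<tau> N) = real_of_int z"
    by (elim Ints_cases)
   have "real_of_int (\<Sum>N | N \<in> T & J \<subseteq> N. s N) = 2 ^ \<rho> * (\<Sum>N | N \<in> T & J \<subseteq> N. \<tau> N)"
    using s by (simp add: sum_distrib_left)
   also have "... = real_of_int (2 * z)" using z r\<rho>(2) by (cases \<rho>) auto
   finally have "(\<Sum>N | N \<in> T & J \<subseteq> N. s N) = 2 * z" by (simp only: of_int_eq_iff)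
   hence "even (\<Sum>N | N \<in> T & J \<subseteq> N. s N)" by simp
   hence "even (card {N \<in> {N \<in> T. J \<subseteq> N}. odd (s N)})"
    using T(1) by (subst (asm) even_sum_iff) auto
   moreover have "{N \<in> {N \<in> T. J \<subseteq> N}. odd (s N)} = {N \<in> ?F. J \<subseteq> N}" by blast
   ultimately show ?thesis by simp
  qed
  ultimately have "2 ^ \<rho> <= card ?F"
   using T(1,3) r\<rho>(2) by (intro rm_distance_punctured) auto
  also have "... <= card T" by (rule card_mono) (use T(1) in auto)
  also have "... < 2 ^ r" by (rule r(1))
  finally show False using r\<rho>(1) by simp
 qed
 thus ?thesis using Ints_power2_mono[OF \<rho>[OF \<open>N \<in> T\<close>]] by blast
qed

section \<open>The linear system for the angles\<close>

text \<open>The linear span over GF(2), with sets as vectors and \<open>sym_diff\<close> as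
  addition.\<close>

inductive_set spn :: "nat set => (nat => nat set) => nat set set" for V a where
 empty: "{} \<in> spn V a"
| step: "c \<in> spn V a ==> j \<in> V ==> sym_diff c (a j) \<in> spn V a"

lemma spn_gen: "j \<in> V ==> a j \<in> spn V a"
 using spn.step[OF spn.empty, of j V a] by simp

lemma spn_sym_diff:
 assumes "c \<in> spn V a" "c' \<in> spn V a"
 shows "sym_diff c c' \<in> spn V a"
 using assms(2,1)
proof (induction c' rule: spn.induct)
 case (step c' j)
 have "sym_diff c (sym_diff c' (a j)) = sym_diff (sym_diff c c') (a j)" by blast
 thus ?case using spn.step[OF step.IH[OF step.prems] step.hyps(2)] by simp
qed simp

lemma spn_subset:
 assumes "!!j. j \<in> V ==> a j \<subseteq> X" "c \<in> spn V a"
 shows "c \<subseteq> X"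
 using assms(2,1) by (induction c rule: spn.induct) (simp, blast)

text \<open>The unknowns are the rotation angles in units of \<open>2\<pi> / M\<close>. The equations express that
  the phases \<open>\<theta>\<^sub>u\<close> restricted to the support of the state have the second differences \<open>0\<close> or \<open>\<pi>\<close>
 prescribed by the commutation of generators.\<close>

definition lin_ok :: "nat set => int => (nat => nat set) => (nat => nat set) =>
  (nat => nat set) => (nat => nat set) => (nat => int) => bool" where
 "lin_ok V M a c b d s \<longleftrightarrow> (\<forall>k\<in>V. \<forall>J. J \<subseteq> V --> J ~= {} -->
   M dvd 2 ^ card J * (\<Sum>u\<in>{u \<in> b k. \<forall>j\<in>J. u \<in> a j}. s u)
    - (if \<exists>j. J = {j} & odd (card (a j \<inter> d k) + card (c j \<inter> b k)) then M div 2 else 0))"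

text \<open>This is \<open>x + y - 2 * x * y\<close> for indicator functions; its factor 2 is the
  origin of the powers of two in the system.\<close>

lemma sum_Int_sym_diff:
 fixes t :: "nat => real"
 assumes "finite X"
 shows "sum t (X \<inter> sym_diff c c') = sum t (X \<inter> c) + sum t (X \<inter> c') - 2 * sum t (X \<inter> c \<inter> c')"
proof -
 have I: "sum t (X \<inter> Y) = (\<Sum>u\<in>X. if u \<in> Y then t u else 0)" for Y
  using assms by (rule sum.inter_restrict)
 have "sum t (X \<inter> sym_diff c c') = (\<Sum>u\<in>X. (if u \<in> c then t u else 0) + (if u \<in> c' then t u else 0)
   - 2 * (if u \<in> c \<inter> c' then t u else 0))"
  unfolding I by (rule sum.cong) auto
 also have "... = sum t (X \<inter> c) + sum t (X \<inter> c') - 2 * sum t (X \<inter> (c \<inter> c'))"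
  unfolding I by (simp only: sum.distrib sum_subtractf sum_distrib_left)
 finally show ?thesis by (simp only: Int_assoc)
qed

text \<open>Comparing \<open>H\<close> for various \<open>e\<close> shows that every further
  intersection with a span element costs only one more factor 2. Because both spans agree, the sets
  \<open>b k\<close> can be traded for sets \<open>a j\<close>, and
  \<open>bounded_denominator\<close> applies to the sums of \<open>t\<close> over classes of
  vertices with the same memberships in the sets \<open>a j\<close>.\<close>

lemma dyadic_system_solution:
 fixes a c b d :: "nat => nat set" and t :: "nat => real" and r :: nat
 assumes fin: "finite V" and aV: "!!j. j \<in> V ==> a j \<subseteq> V" and bV: "!!k. k \<in> V ==> b k \<subseteq> V"
  and spn: "spn V a = spn V b"
  and H: "!!j k e. j \<in> V ==> k \<in> V ==> e \<in> spn V a ==>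
   4 * sum t (a j \<inter> b k \<inter> e) - 2 * sum t (a j \<inter> b k)
    - (if odd (card (a j \<inter> d k) + card (c j \<inter> b k)) then 1 / 2 else 0) \<in> \<int>"
  and r: "card V < 2 ^ r" "r \<ge> 2"
 shows "\<exists>s. lin_ok V (2 ^ r) a c b d s"
proof -
 let ?S = "spn V a"
 let ?par = "%j k. odd (card (a j \<inter> d k) + card (c j \<inter> b k))"
 let ?h = "%j k. if ?par j k then 1 / 2 else (0::real)"
 define Dyn where "Dyn X m \<longleftrightarrow> (\<forall>e\<in>?S. 2 ^ m * sum t (X \<inter> e) \<in> \<int>)" for X and m :: nat
 have finS: "finite e" if "e \<in> ?S" for e
  using spn_subset[of V a V e] aV that fin finite_subset by blast
 have fina: "finite (a j)" if "j \<in> V" for j using aV[OF that] fin finite_subset by blast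
 have Dyn_Int: "Dyn (X \<inter> e') (Suc m)" if "Dyn X m" "e' \<in> ?S" "finite X" for X e' m
  unfolding Dyn_def
 proof
  fix e assume e: "e \<in> ?S"
  have "2 ^ m * sum t (X \<inter> e') + 2 ^ m * sum t (X \<inter> e) - 2 ^ m * sum t (X \<inter> sym_diff e' e) \<in> \<int>"
   using that(1,2) e spn_sym_diff[OF that(2) e] unfolding Dyn_def by (intro Ints_diff Ints_add) auto
  thus "2 ^ Suc m * sum t (X \<inter> e' \<inter> e) \<in> \<int>"
   unfolding sum_Int_sym_diff[OF that(3)] by (simp add: algebra_simps)
 qed
 have Dyn_INT: "Dyn (X \<inter> {u. \<forall>j\<in>J. u \<in> a j}) (m + card J)"
  if "Dyn X m" "finite X" "J \<subseteq> V" for X J m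
 proof -
  have "finite J" using that(3) fin finite_subset by blast
  from this that(3) show ?thesis
  proof (induction J rule: finite_induct)
   case (insert j J)
   have "Dyn (X \<inter> {u. \<forall>j\<in>J. u \<in> a j} \<inter> a j) (Suc (m + card J))"
    using insert that(2) by (intro Dyn_Int spn_gen) auto
   moreover have "X \<inter> {u. \<forall>j\<in>J. u \<in> a j} \<inter> a j = X \<inter> {u. \<forall>j\<in>insert j J. u \<in> a j}" by blast
   ultimately show ?case using insert.hyps by simp
  qed (use that(1) in simp)
 qed
 have two: "2 * sum t (a j \<inter> b k) + ?h j k \<in> \<int>" if "j \<in> V" "k \<in> V" for j k
 proof -
  have "- (2 * sum t (a j \<inter> b k)) - ?h j k \<in> \<int>"
   using H[OF that spn.empty] by (simp only: Int_empty_right sum.empty mult_zero_right diff_0)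
  from Ints_minus[OF this] show ?thesis by (simp only: minus_diff_eq diff_minus_eq_add add.commute)
 qed
 have base: "Dyn (a j \<inter> b k) 2" if "j \<in> V" "k \<in> V" for j k
  unfolding Dyn_def
 proof
  fix e assume "e \<in> ?S"
  from Ints_add[OF H[OF that this] two[OF that]] show "2\<^sup>2 * sum t (a j \<inter> b k \<inter> e) \<in> \<int>" by simp
 qed
 \<comment> \<open>The exponent does not grow along the span of \<open>b\<close>: the correction
   term is an intersection with one more span element and carries the coefficient
   \<open>2 ^ 3\<close>, which is what \<open>Dyn_Int\<close> can handle.\<close>
 have gen: "Dyn (a j \<inter> b') 2" if "j \<in> V" "b' \<in> spn V b" for j b'
  using that(2)
 proof (induction b' rule: spn.induct)
  case (step b' k)
  have b'S: "b' \<in> ?S" using step.hyps(1) spn by simp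
  note aj = fina[OF that(1)]
  have D: "Dyn (a j \<inter> b k \<inter> b') 3"
   using Dyn_Int[OF base[OF that(1) step.hyps(2)] b'S] aj by (simp add: numeral_3_eq_3)
  show ?case unfolding Dyn_def
  proof
   fix e assume e: "e \<in> ?S"
   have fe: "finite (a j \<inter> e)" using aj by simp
   have "a j \<inter> sym_diff b' (b k) \<inter> e = (a j \<inter> e) \<inter> sym_diff b' (b k)" by blast
   hence "sum t (a j \<inter> sym_diff b' (b k) \<inter> e) =
     sum t (a j \<inter> e \<inter> b') + sum t (a j \<inter> e \<inter> b k) - 2 * sum t (a j \<inter> e \<inter> b' \<inter> b k)"
    by (simp only: sum_Int_sym_diff[OF fe])
   moreover have "sum t (a j \<inter> e \<inter> b') = sum t (a j \<inter> b' \<inter> e)"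
    "sum t (a j \<inter> e \<inter> b k) = sum t (a j \<inter> b k \<inter> e)"
    "sum t (a j \<inter> e \<inter> b' \<inter> b k) = sum t (a j \<inter> b k \<inter> b' \<inter> e)"
    by (rule arg_cong[of _ _ "sum t"], blast)+
   ultimately have eq: "2\<^sup>2 * sum t (a j \<inter> sym_diff b' (b k) \<inter> e) =
     2\<^sup>2 * sum t (a j \<inter> b' \<inter> e) + 2\<^sup>2 * sum t (a j \<inter> b k \<inter> e) - 2 ^ 3 * sum t (a j \<inter> b k \<inter> b' \<inter> e)"
    unfolding power2_eq_square power3_eq_cube by linarith
   show "2\<^sup>2 * sum t (a j \<inter> sym_diff b' (b k) \<inter> e) \<in> \<int>"
    unfolding eq using step.IH base[OF that(1) step.hyps(2)] D e unfolding Dyn_def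
    by (intro Ints_diff Ints_add) auto
  qed
 qed (simp add: Dyn_def)
 have gen_a: "Dyn (a j \<inter> a j') 2" if "j \<in> V" "j' \<in> V" for j j'
  using gen[OF that(1), of "a j'"] spn_gen[OF that(2), of a] spn by simp
 let ?X = "%J. {u \<in> V. \<forall>j\<in>J. u \<in> a j}"
 \<comment> \<open>For \<open>card J \<ge> 3\<close>, two members of \<open>J\<close> cost
   \<open>2 ^ 2\<close> by \<open>gen_a\<close>, one more is used as the span element
   \<open>e\<close>, and each of the other \<open>card J - 3\<close> costs a factor 2: in total
   \<open>2 ^ (card J - 1)\<close>.\<close>
 have cJ: "2 ^ max (card J - 1) 2 * sum t (?X J) \<in> \<int>" if J: "J \<subseteq> V" "J ~= {}" for J
 proof -
  obtain j where j: "j \<in> J" using J(2) by blast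
  hence jV: "j \<in> V" using J(1) by blast
  have finJ: "finite J" using J(1) fin finite_subset by blast
  show ?thesis
  proof (cases "J = {j}")
   case True
   have "?X J = a j \<inter> a j \<inter> a j" using True aV[OF jV] by blast
   moreover have "2\<^sup>2 * sum t (a j \<inter> a j \<inter> a j) \<in> \<int>"
    using gen_a[OF jV jV] spn_gen[OF jV, of a] unfolding Dyn_def by blast
   moreover have "card J = 1" using True by simp
   ultimately show ?thesis by simp
  next
   case False
   then obtain j' where j': "j' \<in> J" "j' ~= j" using j by blast
   hence j'V: "j' \<in> V" using J(1) by blast
   show ?thesis
   proof (cases "J = {j, j'}")
    case True
    have "?X J = a j \<inter> a j' \<inter> a j" using True aV[OF jV] by blast
    moreover have "2\<^sup>2 * sum t (a j \<inter> a j' \<inter> a j) \<in> \<int>"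
     using gen_a[OF jV j'V] spn_gen[OF jV, of a] unfolding Dyn_def by blast
    moreover have "card J = 2" using True j'(2) by simp
    ultimately show ?thesis by simp
   next
    case False
    then obtain i where i: "i \<in> J" "i ~= j" "i ~= j'" using j j' by blast
    let ?J = "J - {j, j', i}"
    have iV: "i \<in> V" using i J(1) by blast
    have cardJ: "card J = card ?J + 3"
    proof -
     have "card {j, j', i} = 3" "{j, j', i} \<subseteq> J" using i j j' by auto
     thus ?thesis using card_Diff_subset[of "{j, j', i}" J] card_mono[OF finJ, of "{j, j', i}"] by simp
    qed
    have "Dyn (a j \<inter> a j' \<inter> {u. \<forall>j\<in>?J. u \<in> a j}) (2 + card ?J)"
     using gen_a[OF jV j'V] fina[OF jV] J(1) by (intro Dyn_INT) auto
    hence "2 ^ (2 + card ?J) * sum t (a j \<inter> a j' \<inter> {u. \<forall>j\<in>?J. u \<in> a j} \<inter> a i) \<in> \<int>"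
     using spn_gen[OF iV, of a] unfolding Dyn_def by blast
    moreover have "a j \<inter> a j' \<inter> {u. \<forall>j\<in>?J. u \<in> a j} \<inter> a i = ?X J"
     using aV[OF jV] j j'(1) i(1) by blast
    moreover have "max (card J - 1) 2 = 2 + card ?J" using cardJ by simp
    ultimately show ?thesis by simp
   qed
  qed
 qed
 define colt where "colt u = {j \<in> V. u \<in> a j}" for u
 define T where "T = colt ` V - {{}}"
 define \<tau> where "\<tau> N = sum t {u \<in> V. colt u = N}" for N
 have finT: "finite T" by (simp add: T_def fin)
 have \<tau>_int: "2 ^ r * \<tau> N \<in> \<int>" if "N \<in> T" for N
 proof (rule bounded_denominator[OF finT _ _ _ _ r(2) that])
  show "finite N" if "N \<in> T" for N using that fin by (auto simp: T_def colt_def)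
  show "{} \<notin> T" by (simp add: T_def)
  have "card T <= card (colt ` V)" unfolding T_def by (rule card_mono) (use fin in auto)
  thus "card T < 2 ^ r" using card_image_le[OF fin, of colt] r(1) by linarith
 next
  fix J :: "nat set" assume J: "finite J" "J ~= {}"
  let ?TJ = "{N. N \<in> T & J \<subseteq> N}"
  show "2 ^ max (card J - 1) 2 * sum \<tau> ?TJ \<in> \<int>"
  proof (cases "J \<subseteq> V")
   case True
   have "?TJ = colt ` ?X J" using J(2) True by (auto simp: T_def colt_def)
   moreover have "\<tau> N = sum t {u \<in> ?X J. colt u = N}" if "N \<in> colt ` ?X J" for N
   proof -
    have "{u \<in> V. colt u = N} = {u \<in> ?X J. colt u = N}"
     using that True by (auto simp: colt_def set_eq_iff)
    thus ?thesis by (simp add: \<tau>_def)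
   qed
   ultimately have "sum \<tau> ?TJ = sum t (?X J)"
    using sum.image_gen[of "?X J" t colt] fin by simp
   thus ?thesis using cJ[OF True J(2)] by simp
  next
   case False
   have E: "?TJ = {}" using False by (auto simp: T_def colt_def)
   show ?thesis unfolding E by simp
  qed
 qed
 have "\<forall>N\<in>T. \<exists>u. u \<in> V & colt u = N" by (auto simp: T_def)
 then obtain rep where rep: "!!N. N \<in> T ==> rep N \<in> V & colt (rep N) = N" by metis
 \<comment> \<open>A whole class sum is placed on one representative, and the other vertices of the
   class get angle 0. Vertices in no \<open>a j\<close> get 0 as well: they occur in no equation,
   \<open>J\<close> being nonempty.\<close>
 define s where "s u = (if colt u \<in> T & u = rep (colt u) then \<lfloor>2 ^ r * \<tau> (colt u)\<rfloor> else 0)" for u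
 have sum_s: "real_of_int (sum s X) = 2 ^ r * sum t X"
  if X: "X \<subseteq> V" "!!u u'. u \<in> X ==> u' \<in> V ==> colt u = colt u' ==> u' \<in> X" "!!u. u \<in> X ==> colt u ~= {}" for X
 proof -
  have finX: "finite X" using X(1) fin finite_subset by blast
  have "real_of_int (sum s {u \<in> X. colt u = N}) = 2 ^ r * sum t {u \<in> X. colt u = N}" if N: "N \<in> colt ` X" for N
  proof -
   have NT: "N \<in> T" using N X unfolding T_def by blast
   have eq: "{u \<in> X. colt u = N} = {u \<in> V. colt u = N}" using X(1,2) N by blast
   have "rep N \<in> {u \<in> V. colt u = N}" using rep[OF NT] by simp
   hence "sum s {u \<in> V. colt u = N} = s (rep N) + sum s ({u \<in> V. colt u = N} - {rep N})"
    by (intro sum.remove) (use fin in auto)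
   also have "sum s ({u \<in> V. colt u = N} - {rep N}) = 0" by (rule sum.neutral) (auto simp: s_def)
   also have "s (rep N) = \<lfloor>2 ^ r * \<tau> N\<rfloor>" using rep[OF NT] NT by (simp add: s_def)
   finally show ?thesis unfolding eq using \<tau>_int[OF NT] by (auto simp: \<tau>_def elim: Ints_cases)
  qed
  thus ?thesis
   using sum.image_gen[OF finX, of s colt] sum.image_gen[OF finX, of t colt] by (simp add: sum_distrib_left)
 qed
 \<comment> \<open>Elements of the span are unions of classes, and hence so are the index sets of
   the equations, including the sets \<open>b k\<close>.\<close>
 have mem_typ: "u \<in> e \<longleftrightarrow> u' \<in> e" if "e \<in> ?S" "colt u = colt u'" for e u u'
  using that(1)
 proof (induction e rule: spn.induct)
  case (step e j)
  have "u \<in> a j \<longleftrightarrow> u' \<in> a j" using that(2) step.hyps(2) by (auto simp: colt_def set_eq_iff)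
  thus ?case using step.IH by blast
 qed simp
 have "lin_ok V (2 ^ r) a c b d s"
  unfolding lin_ok_def
 proof (intro ballI allI impI)
  fix k J assume k: "k \<in> V" and J: "J \<subseteq> V" "J ~= {}"
  obtain j where j: "j \<in> J" using J(2) by blast
  hence jV: "j \<in> V" using J(1) by blast
  let ?Y = "{u \<in> b k. \<forall>j\<in>J. u \<in> a j}"
  let ?rhs = "if \<exists>j. J = {j} & ?par j k then (2::int) ^ r div 2 else 0"
  have bS: "b k \<in> ?S" using spn_gen[OF k, of b] spn by simp
  have "real_of_int (sum s ?Y) = 2 ^ r * sum t ?Y"
  proof (rule sum_s)
   show "?Y \<subseteq> V" using bV[OF k] by blast
  next
   fix u u' assume u: "u \<in> ?Y" "u' \<in> V" "colt u = colt u'"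
   have "u' \<in> b k" using mem_typ[OF bS u(3)] u(1) by simp
   moreover have "u' \<in> a j" if "j \<in> J" for j
    using mem_typ[OF spn_gen u(3), of j] that J(1) u(1) by blast
   ultimately show "u' \<in> ?Y" by simp
  next
   fix u assume "u \<in> ?Y"
   thus "colt u ~= {}" using j jV by (auto simp: colt_def)
  qed
  note sY = this
  have eq: "real_of_int (2 ^ card J * sum s ?Y - ?rhs) = 2 ^ r * (2 ^ card J * sum t ?Y) - real_of_int ?rhs"
   by (simp only: of_int_diff of_int_mult of_int_power of_int_numeral sY mult.left_commute)
  have "\<exists>z. 2 ^ card J * sum s ?Y - ?rhs = 2 ^ r * z"
  proof (cases "J = {j}")
   case True
   have Y: "?Y = a j \<inter> b k" using True by blast
   obtain z where z: "2 * sum t (a j \<inter> b k) + ?h j k = real_of_int z" using two[OF jV k] by (elim Ints_cases)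
   have "\<exists>w. 2 * sum t (a j \<inter> b k) = real_of_int w + ?h j k"
   proof (cases "?par j k")
    case par: True
    hence "2 * sum t (a j \<inter> b k) = real_of_int (z - 1) + ?h j k" using z by simp
    thus ?thesis by blast
   next
    case False
    hence "2 * sum t (a j \<inter> b k) = real_of_int z + ?h j k" using z by simp
    thus ?thesis by blast
   qed
   then obtain w where w: "2 * sum t (a j \<inter> b k) = real_of_int w + ?h j k" by blast
   have rhs: "real_of_int ?rhs = 2 ^ r * ?h j k"
   proof -
    have "real_of_int (2 ^ r div 2) = 2 ^ r / 2" using r(2) by (cases r) auto
    thus ?thesis using True by auto
   qed
   have "real_of_int (2 ^ card J * sum s ?Y - ?rhs) = 2 ^ r * (2 * sum t (a j \<inter> b k)) - real_of_int ?rhs"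
   proof -
    have "card J = 1" using True by simp
    thus ?thesis unfolding eq by (simp only: Y power_one_right)
   qed
   also have "... = real_of_int (2 ^ r * w)" by (simp only: w rhs of_int_mult of_int_power of_int_numeral distrib_left add_diff_cancel_right')
   finally have "2 ^ card J * sum s ?Y - ?rhs = 2 ^ r * w" by (simp only: of_int_eq_iff)
   thus ?thesis by (rule exI)
  next
   case False
   then obtain i where i: "i \<in> J" "i ~= j" using j by blast
   hence iV: "i \<in> V" using J(1) by blast
   let ?J = "J - {j, i}"
   have finJ: "finite J" using J(1) fin finite_subset by blast
   have cardJ: "card J = 2 + card ?J"
   proof -
    have "card {j, i} = 2" "{j, i} \<subseteq> J" using i j by auto
    thus ?thesis using card_Diff_subset[of "{j, i}" J] card_mono[OF finJ, of "{j, i}"] by simp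
   qed
   have "Dyn (a j \<inter> b k \<inter> {u. \<forall>j\<in>?J. u \<in> a j}) (2 + card ?J)"
    using base[OF jV k] fina[OF jV] J(1) by (intro Dyn_INT) auto
   hence "2 ^ (2 + card ?J) * sum t (a j \<inter> b k \<inter> {u. \<forall>j\<in>?J. u \<in> a j} \<inter> a i) \<in> \<int>"
    using spn_gen[OF iV, of a] unfolding Dyn_def by blast
   moreover have "a j \<inter> b k \<inter> {u. \<forall>j\<in>?J. u \<in> a j} \<inter> a i = ?Y" using j i(1) by blast
   ultimately have "2 ^ card J * sum t ?Y \<in> \<int>" using cardJ by simp
   then obtain z where z: "2 ^ card J * sum t ?Y = real_of_int z" by (elim Ints_cases)
   have "\<not> (\<exists>j. J = {j} & ?par j k)" using False j by auto
   hence "real_of_int ?rhs = 0" by (simp only: if_False of_int_0)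
   hence "real_of_int (2 ^ card J * sum s ?Y - ?rhs) = real_of_int (2 ^ r * z)"
    unfolding eq z by (simp only: diff_0_right of_int_mult of_int_power of_int_numeral)
   hence "2 ^ card J * sum s ?Y - ?rhs = 2 ^ r * z" by (simp only: of_int_eq_iff)
   thus ?thesis by (rule exI)
  qed
  thus "2 ^ r dvd 2 ^ card J * sum s ?Y - ?rhs" by (elim exE) (simp only: dvd_triv_left)
 qed
 thus ?thesis by blast
qed

text \<open>The equations for single generators give the constant part of a second difference, and
  those for larger \<open>J\<close> let the induction over \<open>e\<close> run: adding a generator
  to \<open>e\<close> trades an intersection for a larger \<open>J\<close>. The exponent
  \<open>card J + 1\<close> leaves room for the half-integral right-hand sides.\<close>

lemma lin_ok_real:
 fixes a c b d :: "nat => nat set" and r :: nat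
 assumes fin: "finite V" and aV: "!!j. j \<in> V ==> a j \<subseteq> V" and bV: "!!k. k \<in> V ==> b k \<subseteq> V"
  and ok: "lin_ok V (2 ^ r) a c b d s" and r: "r \<ge> 1" and jk: "j \<in> V" "k \<in> V"
 defines "t \<equiv> %u. real_of_int (s u) / 2 ^ r"
 shows "2 * sum t (a j \<inter> b k) - (if odd (card (a j \<inter> d k) + card (c j \<inter> b k)) then 1 / 2 else 0) \<in> \<int>" (is ?one)
  and "e \<in> spn V a ==> 4 * sum t (a j \<inter> b k \<inter> e) \<in> \<int>"
proof -
 have sum_t: "sum t X = real_of_int (sum s X) / 2 ^ r" for X by (simp add: t_def sum_divide_distrib)
 let ?X = "%J. {u \<in> b k. \<forall>j\<in>J. u \<in> a j}"
 let ?rhs = "%J. if \<exists>j. J = {j} & odd (card (a j \<inter> d k) + card (c j \<inter> b k)) then (2::int) ^ r div 2 else 0"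
 have half: "real_of_int (2 ^ r div 2) = 2 ^ r / 2" using r by (cases r) auto
 have main: "2 ^ card J * sum t (?X J) - real_of_int (?rhs J) / 2 ^ r \<in> \<int>" if "J \<subseteq> V" "J ~= {}" for J
 proof -
  from ok that jk(2) have "2 ^ r dvd 2 ^ card J * sum s (?X J) - ?rhs J" unfolding lin_ok_def by blast
  then obtain z where z: "2 ^ card J * sum s (?X J) - ?rhs J = 2 ^ r * z" by (elim dvdE)
  have "2 ^ card J * sum t (?X J) - real_of_int (?rhs J) / 2 ^ r
    = real_of_int (2 ^ card J * sum s (?X J) - ?rhs J) / 2 ^ r"
   unfolding sum_t by (simp add: diff_divide_distrib)
  also have "... = real_of_int z" unfolding z by simp
  finally show ?thesis by simp
 qed
 have "?X {j} = a j \<inter> b k" by blast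
 moreover have "real_of_int (?rhs {j}) / 2 ^ r = (if odd (card (a j \<inter> d k) + card (c j \<inter> b k)) then 1 / 2 else 0)"
 proof -
  have "real_of_int (2 ^ r div 2) / 2 ^ r = 1 / 2" unfolding half by simp
  moreover have "(\<exists>j'. {j} = {j'} & P j') = P j" for P by auto
  ultimately show ?thesis by (simp only:) (simp only: if_distrib[of real_of_int] if_distrib[of "%x. x / _"] of_int_0 div_0)
 qed
 ultimately show ?one using main[of "{j}"] jk(1) by (simp only: card.insert) simp
 have twice: "2 ^ (card J + 1) * sum t (?X J) \<in> \<int>" if J: "J \<subseteq> V" "J ~= {}" for J
 proof -
  have "real_of_int (2 ^ r div 2) / 2 ^ r = 1 / 2" unfolding half by simp
  hence "real_of_int (?rhs J) / 2 ^ r \<in> {0, 1 / 2}"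
   by (cases "\<exists>j. J = {j} & odd (card (a j \<inter> d k) + card (c j \<inter> b k))")
     (simp_all only: if_True if_False of_int_0 div_0 insert_iff simp_thms)
  moreover have "2 * x \<in> \<int>" if "x \<in> {0, 1 / 2}" for x :: real
   using that by (elim insertE emptyE; hypsubst) simp_all
  ultimately have "2 * (real_of_int (?rhs J) / 2 ^ r) \<in> \<int>" by blast
  moreover have "2 * (2 ^ card J * sum t (?X J) - real_of_int (?rhs J) / 2 ^ r) \<in> \<int>"
   using main[OF J] by (intro Ints_mult) auto
  ultimately have "2 * (2 ^ card J * sum t (?X J) - real_of_int (?rhs J) / 2 ^ r) + 2 * (real_of_int (?rhs J) / 2 ^ r) \<in> \<int>"
   by (rule Ints_add[rotated])
  thus ?thesis by (simp add: algebra_simps)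
 qed
 have many: "2 ^ card J * sum t (?X J) \<in> \<int>" if J: "J \<subseteq> V" "card J \<ge> 2" for J
 proof -
  have "J ~= {}" "\<not> (\<exists>j. J = {j} & odd (card (a j \<inter> d k) + card (c j \<inter> b k)))" using J(2) by auto
  thus ?thesis using main[OF J(1)] by (simp only: if_False of_int_0 div_0 diff_0_right not_False_eq_True simp_thms)
 qed
 have "2 ^ (card J + 1) * sum t (?X J \<inter> e) \<in> \<int>" if "e \<in> spn V a" "J \<subseteq> V" "J ~= {}" for J e
  using that
 proof (induction e arbitrary: J rule: spn.induct)
  case (step e i)
  have finJ: "finite J" using step.prems(1) fin finite_subset by blast
  have finX: "finite (?X J)" using bV[OF jk(2)] fin by (auto intro: finite_subset)
  have J': "insert i J \<subseteq> V" "insert i J ~= {}" using step by auto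
  have X': "?X (insert i J) = ?X J \<inter> a i" by blast
  have A: "2 ^ (card J + 1) * sum t (?X J \<inter> e) \<in> \<int>" by (rule step.IH[OF step.prems])
  have B: "2 ^ (card J + 1) * sum t (?X J \<inter> a i) \<in> \<int>"
  proof (cases "i \<in> J")
   case True
   hence "insert i J = J" by blast
   thus ?thesis using twice[OF step.prems] X' by simp
  next
   case False
   hence "card (insert i J) = card J + 1" using finJ by simp
   moreover have "card J ~= 0" using step.prems(2) finJ by simp
   ultimately show ?thesis using many[OF J'(1)] unfolding X' by simp
  qed
  have "2 ^ (card (insert i J) + 1) * sum t (?X (insert i J) \<inter> e) \<in> \<int>" by (rule step.IH[OF J'])
  moreover have "?X (insert i J) \<inter> e = ?X J \<inter> e \<inter> a i" by blast
  ultimately have C0: "2 ^ (card (insert i J) + 1) * sum t (?X J \<inter> e \<inter> a i) \<in> \<int>" by simp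
  have "card (insert i J) + 1 <= card J + 2" using finJ by (simp add: card_insert_if)
  hence C: "2 ^ (card J + 2) * sum t (?X J \<inter> e \<inter> a i) \<in> \<int>"
   by (rule Ints_power2_mono[OF C0])
  have "2 ^ (card J + 1) * sum t (?X J \<inter> sym_diff e (a i)) =
   2 ^ (card J + 1) * sum t (?X J \<inter> e) + 2 ^ (card J + 1) * sum t (?X J \<inter> a i) - 2 ^ (card J + 2) * sum t (?X J \<inter> e \<inter> a i)"
   unfolding sum_Int_sym_diff[OF finX] by (simp add: algebra_simps)
  also have "... \<in> \<int>" using A B C by (intro Ints_diff Ints_add)
  finally show ?case .
 qed simp
 note all = this
 show "4 * sum t (a j \<inter> b k \<inter> e) \<in> \<int>" if "e \<in> spn V a"
 proof -
  have "2 ^ (card {j} + 1) * sum t (?X {j} \<inter> e) \<in> \<int>" using all[OF that, of "{j}"] jk(1) by blast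
  moreover have "?X {j} \<inter> e = a j \<inter> b k \<inter> e" by blast
  ultimately show ?thesis by simp
 qed
qed

section \<open>Local frames\<close>

text \<open>An axis is coded by a number: 1 for \<open>X\<close>, 3 for \<open>Y\<close>, and 2 (or any other number) for \<open>Z\<close>. The Clifford
  operator \<open>fr p\<close> turns the axis \<open>p\<close> into the \<open>Z\<close> axis; \<open>fa p\<close> and \<open>fc p\<close> are the \<open>X\<close> and \<open>Z\<close> components of a
  Pauli operator after conjugation by \<open>fr p\<close>, and \<open>kap p\<close> is the resulting phase.\<close>

definition axp :: "nat => bool \<times> bool" where
 "axp p = (if p = 1 then (True, False) else if p = 3 then (True, True) else (False, True))"

definition fa :: "nat => bool \<times> bool => bool" where
 "fa p q = (if p = 1 then snd q else if p = 3 then fst q ~= snd q else fst q)"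

definition fc :: "nat => bool \<times> bool => bool" where
 "fc p q = (if p = 1 \<or> p = 3 then fst q else snd q)"

definition rt2 :: complex where "rt2 = complex_of_real (1 / sqrt 2)"

definition fr :: "nat => bool => bool => complex" where
 "fr p i j = (if p = 1 then (if i & j then - rt2 else rt2)
  else if p = 3 then (if j then (if i then \<i> * rt2 else - \<i> * rt2) else rt2)
  else of_bool (i = j))"

definition kap :: "nat => bool \<times> bool => complex" where
 "kap p q = (if p = 1 then (if q = (True, True) then - 1 else 1)
  else if p = 3 then (if q = (True, False) then \<i> else if q = (True, True) then - \<i> else 1) else 1)"

lemma rt2: "rt2 * rt2 = 1 / 2" "cnj rt2 = rt2"
proof -
 have "rt2 * rt2 = complex_of_real (1 / sqrt 2 * (1 / sqrt 2))" by (simp only: rt2_def of_real_mult)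
 also have "1 / sqrt 2 * (1 / sqrt 2) = 1 / (2::real)" by simp
 finally show "rt2 * rt2 = 1 / 2" by simp
qed (simp add: rt2_def)

lemma uni_fr: "uni (fr p)"
proof -
 have r: "rt2 * rt2 + rt2 * rt2 = 1" "rt2 * (rt2 * 2) = 1"
  using rt2(1) by (simp_all add: field_simps)
 show ?thesis unfolding uni_def
  by (cases "p = 1"; cases "p = 3")
    (auto intro!: ext simp: mmul_def madj_def fr_def mone_def rt2 r algebra_simps)
qed

lemma fr_tau: "mmul (fr p) (tau q) = (%i j. kap p q * mmul (tau (fa p q, fc p q)) (fr p) i j)"
 by (cases q; cases "p = 1"; cases "p = 3"; cases "fst q"; cases "snd q")
   (auto intro!: ext simp: mmul_def fr_def kap_def tau_def fa_def fc_def mone_def algebra_simps)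

lemma kap_ne_0: "kap p q ~= 0"
 by (simp add: kap_def)

lemma fa_axp: "fa p (axp p) = False" "fc p (axp p) = True"
 by (auto simp: fa_def fc_def axp_def)

definition chi :: "nat set => nat set => complex" where
 "chi c y = (- 1) ^ card (c \<inter> y)"

lemma chi_sq [simp]: "chi c y * chi c y = 1"
 by (simp add: chi_def flip: power_mult_distrib)

lemma chi_ne_0 [simp]: "chi c y ~= 0"
 by (simp add: chi_def)

lemma chi_sym_diff: "finite x ==> finite y ==> chi c (sym_diff x y) = chi c x * chi c y"
 using odd_card_Int_sym_diff[of x y c] by (simp add: chi_def minus_one_power_iff)

lemma prod_chi:
 assumes "finite V" "y \<subseteq> V"
 shows "(\<Prod>u\<in>V. if u \<in> c & u \<in> y then - 1 else 1) = chi c y"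
proof -
 have "V \<inter> {u. u \<in> c & u \<in> y} = c \<inter> y" using assms(2) by blast
 thus ?thesis using assms(1) by (simp add: prod.If_cases chi_def)
qed

lemma lap_tau_sets:
 assumes "finite V" "y \<subseteq> V" "a \<subseteq> V"
 shows "lap V (%u. tau (u \<in> a, u \<in> c)) \<psi> (sym_diff y a) = chi c y * \<psi> y"
proof -
 have "lap V (%u. tau (u \<in> a, u \<in> c)) \<psi> (sym_diff y a)
   = (\<Prod>u\<in>V. if u \<in> c & u \<in> y then - 1 else 1) * \<psi> y"
  by (rule lap_monomial[OF assms]) (auto simp: tau_def)
 thus ?thesis using prod_chi[OF assms(1,2)] by simp
qed

text \<open>\<open>\<psi>\<close> is an eigenvector of \<open>X\<^sup>a Z\<^sup>c\<close>.\<close>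

definition st :: "nat set => (nat set => complex) => nat set => nat set => complex => bool" where
 "st V \<psi> a c K \<longleftrightarrow> (\<forall>y\<subseteq>V. \<psi> (sym_diff y a) = K * chi c y * \<psi> y)"

lemma stD: "st V \<psi> a c K ==> y \<subseteq> V ==> \<psi> (sym_diff y a) = K * chi c y * \<psi> y"
 by (simp add: st_def)

text \<open>With \<open>genc\<close>, the X and Z supports of the stabilizer generator at
  \<open>j\<close> after each vertex has been turned to the frame \<open>p\<close>;
  \<open>Kc\<close> collects the phases, and \<open>frs\<close> is the graph state in this
  frame.\<close>

definition gena :: "(nat => nat) => nat set set => nat set => nat => nat set" where
 "gena p E V j = {u \<in> V. fa (p u) (u = j, u \<in> nbr E j)}"

definition genc :: "(nat => nat) => nat set set => nat set => nat => nat set" where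
 "genc p E V j = {u \<in> V. fc (p u) (u = j, u \<in> nbr E j)}"

definition frs :: "nat set => nat set set => (nat => nat) => nat set => complex" where
 "frs V E p = lap V (%u. fr (p u)) (sgn_st E)"

definition Kc :: "nat set => nat set set => (nat => nat) => nat => complex" where
 "Kc V E p j = (\<Prod>u\<in>V. kap (p u) (u = j, u \<in> nbr E j))"

lemma gena_subset: "gena p E V j \<subseteq> V" by (auto simp: gena_def)
lemma lap_scaled: "lap V (%u i j. k u * a u i j) \<psi> y = (\<Prod>u\<in>V. k u) * lap V a \<psi> y"
 by (simp add: lap_def prod.distrib sum_distrib_left mult.assoc)

lemma sym_diff_sub: "x \<subseteq> V ==> y \<subseteq> V ==> sym_diff x y \<subseteq> V"
 by blast

section \<open>The framed graph state as a joint eigenvector\<close>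

locale graph_on =
 fixes V :: "nat set" and E :: "nat set set"
 assumes G: "simple_graph V E"
begin

lemma fin: "finite V"
 using G by (simp add: simple_graph_def)

lemma fin_sub: "y \<subseteq> V ==> finite y"
 using fin finite_subset by blast

lemma Kc_ne_0: "Kc V E p j ~= 0"
 using fin kap_ne_0 by (simp add: Kc_def)

lemma lap_fr_gen:
 assumes "y \<subseteq> V"
 shows "lap V (%u. fr (p u)) (lap V (%u. tau (u \<in> {j}, u \<in> nbr E j)) \<phi>) (sym_diff y (gena p E V j))
   = Kc V E p j * chi (genc p E V j) y * lap V (%u. fr (p u)) \<phi> y"
proof -
 have "lap V (%u. fr (p u)) (lap V (%u. tau (u \<in> {j}, u \<in> nbr E j)) \<phi>) (sym_diff y (gena p E V j))
   = lap V (%u i i'. kap (p u) (u = j, u \<in> nbr E j) *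
     mmul (tau (u \<in> gena p E V j, u \<in> genc p E V j)) (fr (p u)) i i') \<phi> (sym_diff y (gena p E V j))"
  unfolding lap_lap[OF fin] by (rule lap_cong) (simp_all add: fr_tau gena_def genc_def)
 also have "... = Kc V E p j * lap V (%u. tau (u \<in> gena p E V j, u \<in> genc p E V j))
   (lap V (%u. fr (p u)) \<phi>) (sym_diff y (gena p E V j))"
  unfolding lap_scaled lap_lap[OF fin] Kc_def ..
 finally show ?thesis
  by (simp only: lap_tau_sets[OF fin assms gena_subset] mult.assoc)
qed

lemma sgn_st_stab:
 assumes "j \<in> V" "y \<subseteq> V"
 shows "lap V (%u. tau (u \<in> {j}, u \<in> nbr E j)) (sgn_st E) y = sgn_st E y"
proof -
 have s: "sym_diff y {j} \<subseteq> V" using assms by blast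
 have "lap V (%u. tau (u \<in> {j}, u \<in> nbr E j)) (sgn_st E) (sym_diff (sym_diff y {j}) {j})
   = chi (nbr E j) (sym_diff y {j}) * sgn_st E (sym_diff y {j})"
  by (rule lap_tau_sets[OF fin s]) (use assms in simp)
 also have "... = sgn_st E (sym_diff (sym_diff y {j}) {j})"
  using sgn_st_flip[OF G assms(1) s] by (simp add: chi_def)
 finally show ?thesis by simp
qed

lemma frs_st:
 assumes "j \<in> V"
 shows "st V (frs V E p) (gena p E V j) (genc p E V j) (Kc V E p j)"
 unfolding st_def
proof (intro allI impI)
 fix y assume y: "y \<subseteq> V"
 have "frs V E p (sym_diff y (gena p E V j)) =
   lap V (%u. fr (p u)) (lap V (%u. tau (u \<in> {j}, u \<in> nbr E j)) (sgn_st E)) (sym_diff y (gena p E V j))"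
  unfolding frs_def by (rule lap_cong[OF refl]) (rule sgn_st_stab[OF assms, symmetric])
 thus "frs V E p (sym_diff y (gena p E V j)) = Kc V E p j * chi (genc p E V j) y * frs V E p y"
  unfolding lap_fr_gen[OF y] frs_def .
qed

text \<open>Undoing the frame turns an eigenvector of the framed generator into one of the original
  generator; its eigenvalue is measured relative to the phase \<open>Kc V E p j\<close>, which
  belongs to the graph state itself.\<close>

lemma st_back:
 assumes j: "j \<in> V" and st: "st V \<phi> (gena p E V j) (genc p E V j) L" and L: "L ~= 0" and y: "y \<subseteq> V"
 defines "\<phi>' \<equiv> lap V (%u. madj (fr (p u))) \<phi>"
 shows "chi (nbr E j) y * \<phi>' y = (Kc V E p j / L) * \<phi>' (sym_diff y {j})"
proof -
 let ?T = "%u. tau (u \<in> {j}, u \<in> nbr E j)" and ?F = "%u. fr (p u)"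
 let ?a = "gena p E V j" and ?k = "Kc V E p j / L"
 have FF: "lap V ?F \<phi>' w = \<phi> w" if "w \<subseteq> V" for w
  unfolding \<phi>'_def by (rule lap_uni_inverse(1)[OF fin _ that]) (simp add: uni_fr)
 have "lap V ?F (lap V ?T \<phi>') w = ?k * \<phi> w" if w: "w \<subseteq> V" for w
 proof -
  have s: "sym_diff w ?a \<subseteq> V" using w gena_subset by (rule sym_diff_sub)
  have "lap V ?F (lap V ?T \<phi>') (sym_diff (sym_diff w ?a) ?a)
    = Kc V E p j * chi (genc p E V j) (sym_diff w ?a) * \<phi> (sym_diff w ?a)"
   unfolding lap_fr_gen[OF s] FF[OF s] ..
  also have "... = ?k * \<phi> (sym_diff (sym_diff w ?a) ?a)"
   unfolding stD[OF st s] using L by (simp add: field_simps)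
  finally show ?thesis by simp
 qed
 hence T: "lap V ?T \<phi>' w = ?k * \<phi>' w" if "w \<subseteq> V" for w
 proof -
  have "lap V ?T \<phi>' w = lap V (%u. madj (fr (p u))) (lap V ?F (lap V ?T \<phi>')) w"
   by (rule lap_uni_inverse(2)[OF fin _ that, symmetric]) (simp add: uni_fr)
  also have "... = lap V (%u. madj (fr (p u))) (%w. ?k * \<phi> w) w"
   by (rule lap_cong[OF refl]) fact
  finally show ?thesis by (simp only: lap_scale \<phi>'_def)
 qed
 have "sym_diff y {j} \<subseteq> V" using y j by blast
 from T[OF this] show ?thesis using lap_tau_sets[OF fin y, of "{j}" "nbr E j" \<phi>'] j by simp
qed

text \<open>Adding vertices one by one expresses every amplitude through the one at the empty set.
  The signs \<open>e j\<close> of the eigenvalues amount to operators \<open>Z\<close> applied to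
  the graph state.\<close>

lemma graph_eigenvector:
 assumes eps: "!!j. j \<in> V ==> e j * e j = 1"
  and eig: "!!j y. j \<in> V ==> y \<subseteq> V ==> chi (nbr E j) y * \<phi> y = e j * \<phi> (sym_diff y {j})"
  and y: "y \<subseteq> V"
 shows "\<phi> y = \<phi> {} * (\<Prod>j\<in>V. if j \<in> y then e j else 1) * sgn_st E y"
 using fin_sub[OF y] y
proof (induction y rule: finite_induct)
 case empty
 thus ?case using sgn_st_empty[OF simple_graph_no_empty[OF G]] by simp
next
 case (insert j y)
 hence jy: "j \<in> V" "y \<subseteq> V" by auto
 have s: "sym_diff y {j} = insert j y" using insert.hyps by auto
 have "\<phi> (insert j y) = e j * (e j * \<phi> (sym_diff y {j}))"
  using eps[OF jy(1)] unfolding s by (simp flip: mult.assoc)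
 also have "... = e j * (chi (nbr E j) y * \<phi> y)" using eig[OF jy] by simp
 also have "\<phi> y = \<phi> {} * (\<Prod>j\<in>V. if j \<in> y then e j else 1) * sgn_st E y" by (rule insert.IH[OF jy(2)])
 also have "e j * (chi (nbr E j) y * (\<phi> {} * (\<Prod>j\<in>V. if j \<in> y then e j else 1) * sgn_st E y))
   = \<phi> {} * (e j * (\<Prod>j\<in>V. if j \<in> y then e j else 1)) * sgn_st E (insert j y)"
  using sgn_st_insert[OF G insert.hyps(2) jy(2)] by (simp add: chi_def mult_ac)
 also have "e j * (\<Prod>i\<in>V. if i \<in> y then e i else 1) = (\<Prod>i\<in>V. if i \<in> insert j y then e i else 1)"
 proof -
  have "(\<Prod>i\<in>V. if i \<in> insert j y then e i else 1) = e j * (\<Prod>i\<in>V - {j}. if i \<in> insert j y then e i else 1)"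
   using prod.remove[OF fin jy(1), of "%i. if i \<in> insert j y then e i else 1"] by simp
  also have "(\<Prod>i\<in>V - {j}. if i \<in> insert j y then e i else 1) = (\<Prod>i\<in>V - {j}. if i \<in> y then e i else 1)"
   by (rule prod.cong) auto
  also have "... = (\<Prod>i\<in>V. if i \<in> y then e i else 1)"
   using prod.remove[OF fin jy(1), of "%i. if i \<in> y then e i else 1"] insert.hyps by simp
  finally show ?thesis by simp
 qed
 finally show ?case .
qed

lemma frs_unique:
 assumes "!!j. j \<in> V ==> st V \<phi> (gena p E V j) (genc p E V j) (Kc V E p j)"
 shows "\<exists>k. \<forall>y\<subseteq>V. \<phi> y = k * frs V E p y"
proof -
 define \<phi>' where "\<phi>' = lap V (%u. madj (fr (p u))) \<phi>"
 have "chi (nbr E j) y * \<phi>' y = 1 * \<phi>' (sym_diff y {j})" if "j \<in> V" "y \<subseteq> V" for j y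
  using st_back[OF that(1) assms[OF that(1)] Kc_ne_0 that(2)] Kc_ne_0 unfolding \<phi>'_def by simp
 hence eq: "\<phi>' y = \<phi>' {} * sgn_st E y" if "y \<subseteq> V" for y
  using graph_eigenvector[of "%_. 1" \<phi>' y] that by simp
 have "\<phi> y = \<phi>' {} * frs V E p y" if y: "y \<subseteq> V" for y
 proof -
  have "\<phi> y = lap V (%u. fr (p u)) \<phi>' y"
   unfolding \<phi>'_def by (rule lap_uni_inverse(1)[OF fin _ y, symmetric]) (simp add: uni_fr)
  also have "... = lap V (%u. fr (p u)) (%y. \<phi>' {} * sgn_st E y) y"
   by (rule lap_cong[OF refl]) (rule eq)
  finally show ?thesis by (simp only: lap_scale frs_def)
 qed
 thus ?thesis by blast
qed

lemma frs_ex_ne_0: "\<exists>y\<subseteq>V. frs V E p y ~= 0"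
proof (rule ccontr)
 assume "\<not> ?thesis"
 hence z: "frs V E p y = 0" if "y \<subseteq> V" for y using that by auto
 have "sgn_st E {} = lap V (%u. madj (fr (p u))) (frs V E p) {}"
  unfolding frs_def by (rule lap_uni_inverse(2)[OF fin, symmetric]) (simp_all add: uni_fr)
 also have "... = lap V (%u. madj (fr (p u))) (%_. 0) {}" by (rule lap_cong[OF refl]) (rule z)
 also have "... = 0" by (simp add: lap_def)
 finally show False by simp
qed

lemma frs_support_closed:
 assumes "y \<subseteq> V" "frs V E p y ~= 0" "e \<in> spn V (gena p E V)"
 shows "frs V E p (sym_diff y e) ~= 0"
 using assms(3)
proof (induction e rule: spn.induct)
 case empty
 thus ?case using assms(2) by simp
next
 case (step e j)
 have "e \<subseteq> V" using spn_subset[of V "gena p E V" V e] gena_subset step.hyps(1) by blast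
 hence s: "sym_diff y e \<subseteq> V" using assms(1) by blast
 have "sym_diff y (sym_diff e (gena p E V j)) = sym_diff (sym_diff y e) (gena p E V j)" by blast
 thus ?case using stD[OF frs_st[OF step.hyps(2)] s] step.IH Kc_ne_0 by simp
qed

text \<open>Setting the state to 0 outside one coset of the span of the X supports keeps all
  eigenvalue equations, since every generator maps each coset to itself. By uniqueness of the joint
  eigenvector nothing has been cut off.\<close>

lemma frs_support_coset:
 assumes y: "y \<subseteq> V" "frs V E p y ~= 0" and w: "w \<subseteq> V" "frs V E p w ~= 0"
 shows "sym_diff w y \<in> spn V (gena p E V)"
proof -
 let ?S = "spn V (gena p E V)"
 define \<phi> where "\<phi> x = (if sym_diff x y \<in> ?S then frs V E p x else 0)" for x
 have mem: "sym_diff (sym_diff x (gena p E V j)) y \<in> ?S \<longleftrightarrow> sym_diff x y \<in> ?S" if "j \<in> V" for x j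
 proof -
  have 1: "sym_diff (sym_diff x (gena p E V j)) y = sym_diff (sym_diff x y) (gena p E V j)" by blast
  hence 2: "sym_diff x y = sym_diff (sym_diff (sym_diff x (gena p E V j)) y) (gena p E V j)" by simp
  show ?thesis using spn.step[OF _ that] 1 2 by metis
 qed
 have "st V \<phi> (gena p E V j) (genc p E V j) (Kc V E p j)" if "j \<in> V" for j
  unfolding st_def \<phi>_def mem[OF that] using stD[OF frs_st[OF that]] by simp
 then obtain k where k: "!!x. x \<subseteq> V ==> \<phi> x = k * frs V E p x" using frs_unique by blast
 have "\<phi> y = frs V E p y" by (simp add: \<phi>_def spn.empty)
 hence "k = 1" using k[OF y(1)] y(2) by simp
 hence "\<phi> w ~= 0" using k[OF w(1)] w(2) by simp
 thus ?thesis by (auto simp: \<phi>_def split: if_splits)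
qed

end

section \<open>Phases and second differences\<close>

definition Dp :: "nat set => (nat => complex) => nat set => complex" where
 "Dp V w y = (\<Prod>u\<in>V. if u \<in> y then w u else 1)"

lemma Dp_ne_0: "finite V ==> (!!u. u \<in> V ==> w u ~= 0) ==> Dp V w y ~= 0"
 by (auto simp: Dp_def)

lemma cis_half_iff: "x - (if P then 1 / 2 else 0) \<in> \<int> \<longleftrightarrow> cis (2 * pi * x) = (if P then - 1 else 1)"
proof -
 have *: "cis (2 * pi * x) = 1 \<longleftrightarrow> x \<in> \<int>" for x
 proof
  assume "cis (2 * pi * x) = 1"
  hence "cos (2 * pi * x) = 1" by (metis cis.simps(1) one_complex.simps(1))
  then obtain n :: int where "2 * pi * x = of_int n * 2 * pi" using cos_one_2pi_int by blast
  hence "x = of_int n" by simp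
  thus "x \<in> \<int>" by simp
 qed (rule cis_multiple_2pi)
 show ?thesis
 proof (cases P)
  case True
  have "2 * pi * (x - 1 / 2) = 2 * pi * x - pi" by (simp add: algebra_simps)
  hence "cis (2 * pi * (x - 1 / 2)) = - cis (2 * pi * x)"
   by (simp add: cis_divide[symmetric] complex_eq_iff)
  thus ?thesis using *[of "x - 1 / 2"] True by (metis minus_minus)
 qed (use *[of x] in simp)
qed

text \<open>A product of local phases has second differences concentrated on
  \<open>a \<inter> b\<close>. The angles are signed by a base point \<open>y1\<close>, so that the
  result depends on \<open>y\<close> only through \<open>sym_diff y y1\<close>, which lies in the
  span when both points are in the support.\<close>

lemma Dp_second_difference:
 fixes t :: "nat => real"
 assumes fin: "finite V" and ab: "a \<subseteq> V" "b \<subseteq> V"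
  and w: "!!u. u \<in> V ==> w u = cis (2 * pi * (t u * (if u \<in> y1 then - 1 else 1)))"
 shows "Dp V w (sym_diff (sym_diff y a) b) * Dp V w y = Dp V w (sym_diff y a) * Dp V w (sym_diff y b) *
   cis (2 * pi * (4 * sum t (a \<inter> b \<inter> sym_diff y y1) - 2 * sum t (a \<inter> b)))"
proof -
 let ?x = "%u. if u \<in> a \<inter> b then t u * (if u \<in> sym_diff y y1 then 2 else - 2) else 0"
 have w0: "w u ~= 0" if "u \<in> V" for u using w[OF that] by simp
 have "Dp V w (sym_diff (sym_diff y a) b) * Dp V w y =
   (\<Prod>u\<in>V. (if u \<in> sym_diff y a then w u else 1) * (if u \<in> sym_diff y b then w u else 1) * cis (2 * pi * ?x u))"
  unfolding Dp_def prod.distrib[symmetric]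
 proof (rule prod.cong[OF refl])
  fix u assume u: "u \<in> V"
  show "(if u \<in> sym_diff (sym_diff y a) b then w u else 1) * (if u \<in> y then w u else 1) =
   (if u \<in> sym_diff y a then w u else 1) * (if u \<in> sym_diff y b then w u else 1) * cis (2 * pi * ?x u)"
   unfolding w[OF u]
   by (cases "u \<in> y"; cases "u \<in> y1"; cases "u \<in> a"; cases "u \<in> b")
     (simp_all add: cis_mult algebra_simps)
 qed
 also have "... = Dp V w (sym_diff y a) * Dp V w (sym_diff y b) * (\<Prod>u\<in>V. cis (2 * pi * ?x u))"
  by (simp add: Dp_def prod.distrib)
 also have "(\<Prod>u\<in>V. cis (2 * pi * ?x u)) = cis (\<Sum>u\<in>V. 2 * pi * ?x u)"
  using fin by (induction V rule: finite_induct) (auto simp: cis_mult)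
 also have "(\<Sum>u\<in>V. 2 * pi * ?x u) = 2 * pi * (\<Sum>u\<in>V. ?x u)" by (simp only: sum_distrib_left)
 also have "(\<Sum>u\<in>V. ?x u) = (\<Sum>u\<in>a \<inter> b. t u * (if u \<in> sym_diff y y1 then 2 else - 2))"
 proof -
  have "V \<inter> (a \<inter> b) = a \<inter> b" using ab by blast
  thus ?thesis using sum.inter_restrict[OF fin, of "%u. t u * (if u \<in> sym_diff y y1 then 2 else - 2)" "a \<inter> b"] by simp
 qed
 also have "... = (\<Sum>u\<in>a \<inter> b. 4 * (if u \<in> sym_diff y y1 then t u else 0) - 2 * t u)"
  by (rule sum.cong) auto
 also have "... = 4 * sum t (a \<inter> b \<inter> sym_diff y y1) - 2 * sum t (a \<inter> b)"
 proof -
  have "finite (a \<inter> b)" using ab fin finite_subset by blast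
  from sum.inter_restrict[OF this, of t "sym_diff y y1"]
  show ?thesis by (simp only: sum_subtractf sum_distrib_left)
 qed
 finally show ?thesis .
qed

section \<open>From the linear system to local unitaries\<close>

definition dmat :: "complex => bool => bool => complex" where
 "dmat w i j = (if i = j then (if i then w else 1) else 0)"

lemma uni_dmat: "cmod w = 1 ==> uni (dmat w)"
proof -
 assume "cmod w = 1"
 hence "cnj w * w = 1" "w * cnj w = 1"
  by (metis complex_norm_square mult.commute of_real_1 power_one)+
 thus ?thesis unfolding uni_def by (auto intro!: ext simp: mmul_def madj_def dmat_def mone_def)
qed

lemma lap_dmat: "finite V ==> y \<subseteq> V ==> lap V (%u. dmat (w u)) \<psi> y = Dp V w y * \<psi> y"
 using lap_monomial[of V y "{}" "%u. dmat (w u)" "%u c. if c then w u else 1" \<psi>]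
 by (simp add: dmat_def Dp_def)

lemma Ints_diff_swap: "x - p - z \<in> \<int> ==> x - z - p \<in> (\<int> :: real set)"
proof -
 have "x - p - z = x - z - p" by simp
 thus "x - p - z \<in> \<int> ==> x - z - p \<in> \<int>" by (simp only:)
qed

text \<open>Let \<open>D\<close> be diagonal with the angles \<open>s u / 2 ^ r\<close>, signed by a
  point \<open>y1\<close> of the support. By the second-difference equations the generators of
  \<open>E2\<close>, conjugated by \<open>D\<close>, map the framed state of \<open>E1\<close> to
  joint eigenvectors of the generators of \<open>E1\<close>. That eigenspace is one-dimensional, so
  \<open>D\<close> times the framed state is a joint eigenvector for \<open>E2\<close>, and a final
  layer of operators \<open>Z\<close> corrects its eigenvalues.\<close>

theorem lin_ok_imp_LUc:
 assumes G1: "simple_graph V E1" and G2: "simple_graph V E2" and r: "r \<ge> 1"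
  and ok: "lin_ok V (2 ^ r) (gena p1 E1 V) (genc p1 E1 V) (gena p2 E2 V) (genc p2 E2 V) s"
 shows "LUc V E1 E2"
proof -
 interpret g1: graph_on V E1 by unfold_locales (rule G1)
 interpret g2: graph_on V E2 by unfold_locales (rule G2)
 note fin = g1.fin
 let ?a = "gena p1 E1 V" and ?c = "genc p1 E1 V" and ?b = "gena p2 E2 V" and ?d = "genc p2 E2 V"
 let ?\<psi> = "frs V E1 p1" and ?K = "Kc V E1 p1"
 define t where "t u = real_of_int (s u) / 2 ^ r" for u
 have one: "2 * sum t (?a j \<inter> ?b k) - (if odd (card (?a j \<inter> ?d k) + card (?c j \<inter> ?b k)) then 1 / 2 else 0) \<in> \<int>"
  and four: "e \<in> spn V ?a ==> 4 * sum t (?a j \<inter> ?b k \<inter> e) \<in> \<int>"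
  if "j \<in> V" "k \<in> V" for j k e
  using lin_ok_real[OF fin gena_subset gena_subset ok r that] unfolding t_def by blast+
 obtain y1 where y1: "y1 \<subseteq> V" "?\<psi> y1 ~= 0" using g1.frs_ex_ne_0 by blast
 define w where "w u = cis (2 * pi * (t u * (if u \<in> y1 then - 1 else 1)))" for u
 have w0: "w u ~= 0" for u by (simp add: w_def)
 let ?D = "Dp V w"
 have D0: "?D y ~= 0" for y by (rule Dp_ne_0[OF fin w0])
 define \<chi> where "\<chi> y = ?D y * ?\<psi> y" for y
 have st\<chi>: "\<exists>L. L ~= 0 & st V \<chi> (?b k) (?d k) L" if k: "k \<in> V" for k
 proof -
  \<comment> \<open>Up to a scalar, the framed state under generator \<open>k\<close> of
    \<open>E2\<close> conjugated by the phases.\<close>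
  define \<xi> where "\<xi> y = chi (?d k) y * (?D (sym_diff y (?b k)) / ?D y) * ?\<psi> (sym_diff y (?b k))" for y
  have "st V \<xi> (?a j) (?c j) (?K j)" if j: "j \<in> V" for j
   unfolding st_def
  proof (intro allI impI)
   fix y assume y: "y \<subseteq> V"
   let ?aj = "?a j" and ?bk = "?b k" and ?cj = "?c j" and ?dk = "?d k"
   have sub: "?aj \<subseteq> V" "?bk \<subseteq> V" by (rule gena_subset)+
   have yb: "sym_diff y ?bk \<subseteq> V" using y sub by blast
   have comm: "sym_diff (sym_diff y ?aj) ?bk = sym_diff (sym_diff y ?bk) ?aj" by blast
   have psi: "?\<psi> (sym_diff (sym_diff y ?bk) ?aj) = ?K j * chi ?cj (sym_diff y ?bk) * ?\<psi> (sym_diff y ?bk)"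
    by (rule stD[OF g1.frs_st[OF j] yb])
   have fins: "finite y" "finite ?aj" "finite ?bk" using y sub g1.fin_sub by auto
   \<comment> \<open>Off the support both sides vanish, so the phase equation has to hold only where
     \<open>?e\<close> lies in the span.\<close>
   show "\<xi> (sym_diff y ?aj) = ?K j * chi ?cj y * \<xi> y"
   proof (cases "?\<psi> (sym_diff y ?bk) = 0")
    case True
    thus ?thesis unfolding \<xi>_def comm psi by simp
   next
    case False
    have e: "sym_diff (sym_diff y ?bk) y1 \<in> spn V ?a" (is "?e \<in> _")
     by (rule g1.frs_support_coset[OF y1 yb False])
    have fab: "finite (?aj \<inter> ?bk)" using fins by simp
    have "sum t (?aj \<inter> ?bk \<inter> sym_diff y y1) + sum t (?aj \<inter> ?bk \<inter> ?e) = sum t (?aj \<inter> ?bk)"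
    proof -
     \<comment> \<open>\<open>?e\<close> is \<open>sym_diff y y1\<close> with the elements of
       \<open>?bk\<close> toggled, so inside \<open>?bk\<close> the two are complementary.\<close>
     have 1: "?aj \<inter> ?bk \<inter> sym_diff y y1 = (?aj \<inter> ?bk) - ?e" by blast
     show ?thesis unfolding 1 using sum.Int_Diff[OF fab, of t ?e] by simp
    qed
    hence sum: "4 * sum t (?aj \<inter> ?bk \<inter> sym_diff y y1) - 2 * sum t (?aj \<inter> ?bk)
      = 2 * sum t (?aj \<inter> ?bk) - 4 * sum t (?aj \<inter> ?bk \<inter> ?e)" by linarith
    let ?par = "odd (card (?aj \<inter> ?dk) + card (?cj \<inter> ?bk))"
    have "2 * sum t (?aj \<inter> ?bk) - (if ?par then 1 / 2 else 0) - 4 * sum t (?aj \<inter> ?bk \<inter> ?e) \<in> \<int>"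
     by (rule Ints_diff[OF one[OF j k] four[OF j k e]])
    hence "2 * sum t (?aj \<inter> ?bk) - 4 * sum t (?aj \<inter> ?bk \<inter> ?e) - (if ?par then 1 / 2 else 0) \<in> \<int>"
     by (rule Ints_diff_swap)
    hence "cis (2 * pi * (4 * sum t (?aj \<inter> ?bk \<inter> sym_diff y y1) - 2 * sum t (?aj \<inter> ?bk))) = (if ?par then - 1 else 1)"
     unfolding sum cis_half_iff .
    also have "... = chi ?dk ?aj * chi ?cj ?bk"
     by (simp add: chi_def minus_one_power_iff Int_commute)
    finally have D2: "?D (sym_diff (sym_diff y ?aj) ?bk) * ?D y =
      ?D (sym_diff y ?aj) * ?D (sym_diff y ?bk) * (chi ?dk ?aj * chi ?cj ?bk)"
     using Dp_second_difference[OF fin sub, of w t y1 y] w_def by simp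
    have q: "?D (sym_diff (sym_diff y ?aj) ?bk) / ?D (sym_diff y ?aj) =
      ?D (sym_diff y ?bk) / ?D y * (chi ?dk ?aj * chi ?cj ?bk)"
     using D2 D0[of y] D0[of "sym_diff y ?aj"] by (simp add: field_simps)
    have "\<xi> (sym_diff y ?aj) = chi ?dk y * chi ?dk ?aj * (?D (sym_diff y ?bk) / ?D y * (chi ?dk ?aj * chi ?cj ?bk))
      * (?K j * (chi ?cj y * chi ?cj ?bk) * ?\<psi> (sym_diff y ?bk))"
     unfolding \<xi>_def q unfolding comm psi chi_sym_diff[OF fins(1,2)] chi_sym_diff[OF fins(1,3)] ..
    also have "... = (chi ?dk ?aj * chi ?dk ?aj) * (chi ?cj ?bk * chi ?cj ?bk) * (?K j * chi ?cj y * \<xi> y)"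
     unfolding \<xi>_def by (simp only: mult_ac)
    finally show ?thesis by simp
   qed
  qed
  then obtain L where L: "!!y. y \<subseteq> V ==> \<xi> y = L * ?\<psi> y" using g1.frs_unique by blast
  have bk: "?b k \<subseteq> V" by (rule gena_subset)
  have st: "st V \<chi> (?b k) (?d k) L" unfolding st_def
  proof (intro allI impI)
   fix y assume y: "y \<subseteq> V"
   have "\<chi> (sym_diff y (?b k)) = chi (?d k) y * chi (?d k) y * \<chi> (sym_diff y (?b k))" by simp
   also have "... = chi (?d k) y * (?D y * \<xi> y)" using D0[of y] by (simp add: \<xi>_def \<chi>_def)
   also have "... = L * chi (?d k) y * \<chi> y" unfolding L[OF y] \<chi>_def by (simp only: mult_ac)
   finally show "\<chi> (sym_diff y (?b k)) = L * chi (?d k) y * \<chi> y" .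
  qed
  have "L ~= 0"
  proof
   assume "L = 0"
   have "sym_diff y1 (?b k) \<subseteq> V" using y1(1) bk by blast
   from stD[OF st this] have "\<chi> y1 = 0" unfolding \<open>L = 0\<close> by simp
   thus False using y1(2) D0 by (simp add: \<chi>_def)
  qed
  with st show ?thesis by blast
 qed
 hence "\<forall>k\<in>V. \<exists>L. L ~= 0 & st V \<chi> (?b k) (?d k) L" by blast
 from bchoice[OF this] obtain L where L: "!!k. k \<in> V ==> L k ~= 0" "!!k. k \<in> V ==> st V \<chi> (?b k) (?d k) (L k)"
  by blast
 define \<phi> where "\<phi> = lap V (%u. madj (fr (p2 u))) \<chi>"
 define e where "e k = Kc V E2 p2 k / L k" for k
 have eig: "chi (nbr E2 k) y * \<phi> y = e k * \<phi> (sym_diff y {k})" if "k \<in> V" "y \<subseteq> V" for k y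
  unfolding \<phi>_def e_def by (rule g2.st_back[OF that(1) L(2)[OF that(1)] L(1)[OF that(1)] that(2)])
 have "\<exists>y0\<subseteq>V. \<phi> y0 ~= 0"
 proof (rule ccontr)
  assume "\<not> ?thesis"
  hence z: "\<phi> y = 0" if "y \<subseteq> V" for y using that by blast
  have "\<chi> y1 = lap V (%u. fr (p2 u)) \<phi> y1"
   unfolding \<phi>_def by (rule lap_uni_inverse(1)[OF fin _ y1(1), symmetric]) (simp add: uni_fr)
  also have "... = lap V (%u. fr (p2 u)) (%_. 0) y1" by (rule lap_cong[OF refl]) (rule z)
  also have "... = 0" by (simp add: lap_def)
  finally show False using y1(2) D0 by (simp add: \<chi>_def)
 qed
 then obtain y0 where y0: "y0 \<subseteq> V" "\<phi> y0 ~= 0" by blast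
 \<comment> \<open>Applying the eigenvalue equation twice at a point of nonzero amplitude squares
   the eigenvalue to 1.\<close>
 have ee: "e k * e k = 1" if k: "k \<in> V" for k
 proof -
  let ?y = "sym_diff y0 {k}"
  have s: "?y \<subseteq> V" using y0(1) k by blast
  have A: "chi (nbr E2 k) y0 * \<phi> y0 = e k * \<phi> ?y" by (rule eig[OF k y0(1)])
  have B: "chi (nbr E2 k) ?y * \<phi> ?y = e k * \<phi> y0" using eig[OF k s] by simp
  have "nbr E2 k \<inter> ?y = nbr E2 k \<inter> y0" using nbr_irrefl[OF G2, of k] by blast
  hence c: "chi (nbr E2 k) ?y = chi (nbr E2 k) y0" by (simp add: chi_def)
  have "e k * e k * \<phi> y0 = e k * (chi (nbr E2 k) y0 * \<phi> ?y)" using B c by simp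
  also have "... = chi (nbr E2 k) y0 * (e k * \<phi> ?y)" by simp
  also have "... = chi (nbr E2 k) y0 * chi (nbr E2 k) y0 * \<phi> y0" unfolding A[symmetric] by simp
  finally show ?thesis using y0(2) by simp
 qed
 have cmode: "cmod (e k) = 1" if "k \<in> V" for k
 proof -
  have "cmod (e k) * cmod (e k) = 1" using ee[OF that] by (metis norm_mult norm_one)
  thus ?thesis by (metis norm_ge_zero real_sqrt_abs2 real_sqrt_one abs_of_nonneg)
 qed
 have \<phi>: "\<phi> y = \<phi> {} * Dp V e y * sgn_st E2 y" if "y \<subseteq> V" for y
  unfolding Dp_def by (rule g2.graph_eigenvector[OF ee eig that])
 have \<phi>0: "\<phi> {} ~= 0" using \<phi>[OF y0(1)] y0(2) by auto
 let ?m = "%u. mmul (dmat (e u)) (mmul (madj (fr (p2 u))) (mmul (dmat (w u)) (fr (p1 u))))"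
 have "lap V ?m (sgn_st E1) y = \<phi> {} * sgn_st E2 y" if y: "y \<in> Pow V" for y
 proof -
  have yV: "y \<subseteq> V" using y by simp
  have "lap V ?m (sgn_st E1) y =
    lap V (%u. dmat (e u)) (lap V (%u. madj (fr (p2 u))) (lap V (%u. dmat (w u)) ?\<psi>)) y"
   by (simp add: frs_def lap_lap_fun[OF fin])
  also have "... = Dp V e y * lap V (%u. madj (fr (p2 u))) (lap V (%u. dmat (w u)) ?\<psi>) y"
   by (rule lap_dmat[OF fin yV])
  also have "lap V (%u. madj (fr (p2 u))) (lap V (%u. dmat (w u)) ?\<psi>) y = \<phi> y"
   unfolding \<phi>_def by (rule lap_cong[OF refl]) (simp add: lap_dmat[OF fin] \<chi>_def)
  also have "Dp V e y * \<phi> y = \<phi> {} * (Dp V e y * Dp V e y) * sgn_st E2 y"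
   unfolding \<phi>[OF yV] by (simp only: mult_ac)
  also have "Dp V e y * Dp V e y = 1"
   unfolding Dp_def prod.distrib[symmetric] by (rule prod.neutral) (simp add: ee)
  finally show ?thesis by simp
 qed
 moreover have "uni (?m u)" if "u \<in> V" for u
  using cmode[OF that] by (intro uni_mmul uni_madj uni_fr uni_dmat) (simp_all add: w_def)
 ultimately have "\<phi> {} ~= 0 & (\<forall>u\<in>V. uni (?m u)) & (\<forall>y\<in>Pow V. lap V ?m (sgn_st E1) y = \<phi> {} * sgn_st E2 y)"
  using \<phi>0 by simp
 thus ?thesis unfolding LUc_def by (intro exI)
qed

section \<open>From local unitaries to the linear system\<close>

lemma uni_column_norm: "uni W ==> (cmod (W True j))\<^sup>2 + (cmod (W False j))\<^sup>2 = 1"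
proof -
 assume "uni W"
 hence "mmul (madj W) W j j = mone j j" by (simp add: uni_def)
 hence "cnj (W True j) * W True j + cnj (W False j) * W False j = 1" by (simp add: mmul_def madj_def mone_def)
 hence "complex_of_real ((cmod (W True j))\<^sup>2 + (cmod (W False j))\<^sup>2) = 1"
  by (simp only: of_real_add complex_norm_square mult.commute)
 thus ?thesis by (metis of_real_eq_1_iff)
qed

text \<open>In the frames \<open>m\<close> intertwines \<open>Z\<close> with a multiple of
  \<open>Z\<close>. Comparing entries, the multiple is 1 or \<open>- 1\<close>: in the first case
  \<open>W\<close> is diagonal, in the second antidiagonal, which \<open>f\<close> records as a bit
  flip.\<close>

lemma axis_monomial:
 assumes "uni m" and ax: "cmod (pt m (axp p2) (axp p1)) = 1"
 defines "W \<equiv> mmul (fr p2) (mmul m (madj (fr p1)))"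
 shows "\<exists>f v. (\<forall>j. cmod (v j) = 1) & (\<forall>i j. W i j = (if i = (j ~= f) then v j else 0))"
proof -
 let ?Z = "tau (False, True)"
 define l where "l = pt m (axp p2) (axp p1)"
 have "mmul (madj m) (mmul (tau (axp p2)) m) i j = l * tau (axp p1) i j" for i j
 proof -
  have "mmul (madj m) (mmul (tau (axp p2)) m) i j = (\<Sum>p\<in>UNIV. pt m (axp p2) p * tau p i j)"
   unfolding pt_def by (rule pauli_expansion)
  also have "... = (\<Sum>p\<in>{axp p1}. pt m (axp p2) p * tau p i j)"
   by (rule sum.mono_neutral_right) (use pt_axis_row[OF assms(1) ax] in auto)
  finally show ?thesis by (simp add: l_def)
 qed
 hence 1: "mmul (madj m) (mmul (tau (axp p2)) m) = (%i j. l * tau (axp p1) i j)" by (intro ext)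
 have scale: "mmul a (%i j. x * b i j) = (%i j. x * mmul a b i j)"
  "mmul (%i j. x * a i j) b = (%i j. x * mmul a b i j)" for a b x
  by (intro ext; simp add: mmul_def algebra_simps)+
 have um: "mmul m (madj m) = mone" "mmul (madj m) m = mone" using assms(1) by (simp_all add: uni_def)
 have uf: "mmul (fr p) (madj (fr p)) = mone" "mmul (madj (fr p)) (fr p) = mone" for p
  using uni_fr[of p] by (simp_all add: uni_def)
 have 2: "mmul (tau (axp p2)) m = (%i j. l * mmul m (tau (axp p1)) i j)"
 proof -
  have "mmul (tau (axp p2)) m = mmul (mmul m (madj m)) (mmul (tau (axp p2)) m)" by (simp add: um)
  also have "... = mmul m (%i j. l * tau (axp p1) i j)" by (simp only: mmul_assoc 1)
  finally show ?thesis by (simp only: scale)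
 qed
 have Zfr: "mmul (fr p) (tau (axp p)) = (%i j. kap p (axp p) * mmul ?Z (fr p) i j)" for p
  using fr_tau[of p "axp p"] by (simp add: fa_axp)
 define k1 where "k1 = kap p1 (axp p1)"
 define k2 where "k2 = kap p2 (axp p2)"
 have k0: "k1 ~= 0" "k2 ~= 0" by (simp_all add: k1_def k2_def kap_ne_0)
 have "(%i j. k2 * mmul ?Z W i j) = mmul (%i j. k2 * mmul ?Z (fr p2) i j) (mmul m (madj (fr p1)))"
  by (simp only: W_def scale mmul_assoc)
 also have "... = mmul (fr p2) (mmul (mmul (tau (axp p2)) m) (madj (fr p1)))"
  by (simp only: Zfr[of p2, folded k2_def, symmetric] mmul_assoc)
 also have "... = (%i j. l * mmul (fr p2) (mmul m (mmul (tau (axp p1)) (madj (fr p1)))) i j)"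
  by (simp only: 2 scale mmul_assoc)
 also have "mmul (tau (axp p1)) (madj (fr p1)) = (%i j. k1 * mmul (madj (fr p1)) ?Z i j)"
 proof -
  have "mmul (tau (axp p1)) (madj (fr p1)) = mmul (madj (fr p1)) (mmul (mmul (fr p1) (tau (axp p1))) (madj (fr p1)))"
   by (metis mmul_assoc mmul_one(1) uf(2))
  also have "... = (%i j. k1 * mmul (madj (fr p1)) (mmul ?Z (mmul (fr p1) (madj (fr p1)))) i j)"
   by (simp only: Zfr k1_def scale mmul_assoc)
  finally show ?thesis by (simp add: uf)
 qed
 also have "(%i j. l * mmul (fr p2) (mmul m (%i j. k1 * mmul (madj (fr p1)) ?Z i j)) i j) = (%i j. (l * k1) * mmul W ?Z i j)"
  by (simp only: scale W_def mmul_assoc mult.assoc)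
 finally have eq: "k2 * mmul ?Z W i j = (l * k1) * mmul W ?Z i j" for i j by metis
 define \<mu> where "\<mu> = l * k1 / k2"
 have ent: "(if i then - 1 else 1) * W i j = \<mu> * (W i j * (if j then - 1 else 1))" for i j
 proof -
  have "mmul ?Z W i j = (if i then - 1 else 1) * W i j" "mmul W ?Z i j = W i j * (if j then - 1 else 1)"
   by (cases i; cases j; simp add: mmul_def tau_def)+
  thus ?thesis using eq[of i j] k0(2) by (simp add: \<mu>_def field_simps)
 qed
 have uW: "uni W" unfolding W_def by (intro uni_mmul uni_madj uni_fr assms(1))
 show ?thesis
 proof (cases "W False False = 0")
  case False
  hence "\<mu> = 1" using ent[of False False] by simp
  hence z: "W True False = 0" "W False True = 0" using ent[of True False] ent[of False True] by simp_all
  have "cmod (W True True) = 1" "cmod (W False False) = 1"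
   using uni_column_norm[OF uW, of True] uni_column_norm[OF uW, of False] z
   by (simp_all add: power2_eq_1_iff) (smt (verit) norm_ge_zero)+
  thus ?thesis using z
   by (intro exI[of _ False] exI[of _ "%j. W j j"]) (auto split: if_splits, (metis (full_types))+)
 next
  case True
  hence n: "cmod (W True False) = 1" using uni_column_norm[OF uW, of False]
   by (simp add: power2_eq_1_iff) (smt (verit) norm_ge_zero)
  hence "W True False ~= 0" by auto
  moreover have "(\<mu> + 1) * W True False = 0"
   using ent[of True False] by (simp add: distrib_right) (metis add.left_inverse)
  ultimately have "\<mu> = - 1" by (simp add: eq_neg_iff_add_eq_0)
  hence z: "W True True = 0" using ent[of True True] by simp
  hence "cmod (W False True) = 1" using uni_column_norm[OF uW, of True]
   by (simp add: power2_eq_1_iff) (smt (verit) norm_ge_zero)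
  thus ?thesis using z True n
   by (intro exI[of _ True] exI[of _ "%j. W (\<not> j) j"]) (auto split: if_splits, (metis (full_types))+)
 qed
qed

context lu_pair
begin

text \<open>In the frames the unitary is a product of phases followed by a flip of the bits in
  \<open>f\<close>, so the supports of the two framed states are translates of each other and their
  direction spaces, the spans of \<open>gena\<close>, agree. Computing the amplitude at
  \<open>sym_diff (sym_diff y a) b\<close> with either generator first compares the phases around a
  square, which gives the second-difference equations.\<close>

theorem axes_imp_lin_ok:
 assumes ax: "!!u. u \<in> V ==> axis_map u (axp (p1 u)) (axp (p2 u))" and c0: "c ~= 0"
  and r: "card V < 2 ^ r" "r \<ge> 2"
 shows "\<exists>s. lin_ok V (2 ^ r) (gena p1 E1 V) (genc p1 E1 V) (gena p2 E2 V) (genc p2 E2 V) s"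
proof -
 interpret g1: graph_on V E1 by unfold_locales (rule G1)
 interpret g2: graph_on V E2 by unfold_locales (rule G2)
 let ?a = "gena p1 E1 V" and ?c = "genc p1 E1 V" and ?b = "gena p2 E2 V" and ?d = "genc p2 E2 V"
 let ?\<psi> = "frs V E1 p1" and ?\<psi>' = "frs V E2 p2"
 let ?W = "%u. mmul (fr (p2 u)) (mmul (m u) (madj (fr (p1 u))))"
 have "\<forall>u\<in>V. \<exists>fv. (\<forall>j. cmod (snd fv j) = 1) & (\<forall>i j. ?W u i j = (if i = (j ~= fst fv) then snd fv j else 0))"
 proof
  fix u assume "u \<in> V"
  from axis_monomial[OF uni[OF this], of "p2 u" "p1 u"] ax[OF this]
  obtain f v where "(\<forall>j. cmod (v j) = 1) & (\<forall>i j. ?W u i j = (if i = (j ~= f) then v j else 0))"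
   unfolding axis_map_def by blast
  thus "\<exists>fv. (\<forall>j. cmod (snd fv j) = 1) & (\<forall>i j. ?W u i j = (if i = (j ~= fst fv) then snd fv j else 0))"
   by (intro exI[of _ "(f, v)"]) (simp only: fst_conv snd_conv simp_thms)
 qed
 from bchoice[OF this] obtain fv where fv: "\<forall>u\<in>V. (\<forall>j. cmod (snd (fv u) j) = 1) \<and>
   (\<forall>i j. ?W u i j = (if i = (j ~= fst (fv u)) then snd (fv u) j else 0))" by blast
 define v where "v u = snd (fv u)" for u
 define f where "f = {u \<in> V. fst (fv u)}"
 have fV: "f \<subseteq> V" by (auto simp: f_def)
 have v1: "cmod (v u j) = 1" if "u \<in> V" for u j using fv that by (simp add: v_def)
 have v0: "v u j ~= 0" if "u \<in> V" for u j using v1[OF that, of j] by auto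
 have W: "?W u i j = (if i = (j ~= (u \<in> f)) then v u j else 0)" if "u \<in> V" for u i j
 proof -
  have "u \<in> f \<longleftrightarrow> fst (fv u)" using that by (simp add: f_def)
  thus ?thesis using fv that unfolding v_def by metis
 qed
 define w where "w u = v u True / v u False" for u
 let ?D = "Dp V w"
 have w1: "cmod (w u) = 1" if "u \<in> V" for u using v1[OF that] by (simp add: w_def norm_divide)
 have w0: "w u ~= 0" if "u \<in> V" for u using w1[OF that] by auto
 have D0: "?D y ~= 0" for y by (rule Dp_ne_0[OF fin w0])
 define C where "C = (\<Prod>u\<in>V. v u False)"
 have C0: "C ~= 0" using v0 fin by (simp add: C_def)
 have vD: "(\<Prod>u\<in>V. v u (u \<in> y)) = C * ?D y" for y
  unfolding C_def Dp_def prod.distrib[symmetric] by (rule prod.cong) (use v0 in "auto simp: w_def")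
 have main: "c * ?\<psi>' (sym_diff y f) = C * ?D y * ?\<psi> y" if y: "y \<subseteq> V" for y
 proof -
  have "c * ?\<psi>' (sym_diff y f) = lap V (%u. fr (p2 u)) (%x. c * sgn_st E2 x) (sym_diff y f)"
   by (simp only: frs_def lap_scale)
  also have "... = lap V (%u. fr (p2 u)) (lap V m (sgn_st E1)) (sym_diff y f)"
   by (rule lap_cong[OF refl]) (simp add: eq)
  also have "... = lap V (%u. mmul (?W u) (fr (p1 u))) (sgn_st E1) (sym_diff y f)"
   unfolding lap_lap[OF fin]
  proof (rule lap_cong)
   fix u
   have "mmul (madj (fr (p1 u))) (fr (p1 u)) = mone" using uni_fr by (simp add: uni_def)
   thus "mmul (fr (p2 u)) (m u) = mmul (?W u) (fr (p1 u))" by (simp add: mmul_assoc)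
  qed simp
  also have "... = lap V ?W ?\<psi> (sym_diff y f)" by (simp only: lap_lap[OF fin] frs_def)
  also have "... = (\<Prod>u\<in>V. v u (u \<in> y)) * ?\<psi> y"
   by (rule lap_monomial[OF fin y fV]) (rule W)
  finally show ?thesis by (simp add: vD)
 qed
 obtain y1 where y1: "y1 \<subseteq> V" "?\<psi> y1 ~= 0" using g1.frs_ex_ne_0 by blast
 \<comment> \<open>Angles in full turns, signed by the base point as
   \<open>Dp_second_difference\<close> expects.\<close>
 define t where "t u = Arg (w u) / (2 * pi) * (if u \<in> y1 then - 1 else 1)" for u
 have w_cis: "w u = cis (2 * pi * (t u * (if u \<in> y1 then - 1 else 1)))" if "u \<in> V" for u
 proof -
  have "2 * pi * (t u * (if u \<in> y1 then - 1 else 1)) = Arg (w u)" by (simp add: t_def)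
  thus ?thesis using cis_Arg[OF w0[OF that]] w1[OF that] by (simp add: sgn_eq)
 qed
 define \<chi> where "\<chi> y = ?D y * ?\<psi> y" for y
 have \<chi>': "\<chi> y = (c / C) * ?\<psi>' (sym_diff y f)" if "y \<subseteq> V" for y
  using main[OF that] C0 by (simp add: \<chi>_def field_simps)
 have st\<chi>: "\<chi> (sym_diff y (?b k)) = Kc V E2 p2 k * chi (?d k) f * chi (?d k) y * \<chi> y" if k: "k \<in> V" and y: "y \<subseteq> V" for k y
 proof -
  have sub: "sym_diff y f \<subseteq> V" "sym_diff y (?b k) \<subseteq> V" using y fV gena_subset[of p2 E2 V k] by blast+
  have "sym_diff (sym_diff y (?b k)) f = sym_diff (sym_diff y f) (?b k)" by blast
  hence "\<chi> (sym_diff y (?b k)) = (c / C) * ?\<psi>' (sym_diff (sym_diff y f) (?b k))" using \<chi>'[OF sub(2)] by simp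
  also have "... = (c / C) * (Kc V E2 p2 k * chi (?d k) (sym_diff y f) * ?\<psi>' (sym_diff y f))"
   by (simp only: stD[OF g2.frs_st[OF k] sub(1)])
  also have "chi (?d k) (sym_diff y f) = chi (?d k) y * chi (?d k) f"
   by (rule chi_sym_diff) (use y fV g1.fin_sub in auto)
  finally show ?thesis unfolding \<chi>'[OF y] by (simp only: mult_ac)
 qed
 show ?thesis
 proof (rule dyadic_system_solution[OF fin gena_subset gena_subset _ _ r])
  have Y2: "y \<subseteq> V ==> ?\<psi>' (sym_diff y f) ~= 0 \<longleftrightarrow> ?\<psi> y ~= 0" for y
   using main[of y] c0 C0 D0[of y] by (metis mult_eq_0_iff)
  have y1f: "sym_diff y1 f \<subseteq> V" "?\<psi>' (sym_diff y1 f) ~= 0" using y1 fV Y2[of y1] by blast+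
  have one: "?a j \<in> spn V ?b" if j: "j \<in> V" for j
  proof -
   have s: "sym_diff y1 (?a j) \<subseteq> V" "sym_diff (sym_diff y1 (?a j)) f \<subseteq> V"
    using y1(1) fV gena_subset[of p1 E1 V j] by blast+
   have "?\<psi> (sym_diff y1 (?a j)) ~= 0" by (rule g1.frs_support_closed[OF y1 spn_gen[OF j]])
   hence "?\<psi>' (sym_diff (sym_diff y1 (?a j)) f) ~= 0" using Y2[OF s(1)] by simp
   from g2.frs_support_coset[OF y1f s(2) this]
   have "sym_diff (sym_diff (sym_diff y1 (?a j)) f) (sym_diff y1 f) \<in> spn V ?b" .
   moreover have "sym_diff (sym_diff (sym_diff y1 (?a j)) f) (sym_diff y1 f) = ?a j" by blast
   ultimately show ?thesis by simp
  qed
  have two: "?b k \<in> spn V ?a" if k: "k \<in> V" for k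
  proof -
   have s: "sym_diff y1 (?b k) \<subseteq> V" "sym_diff (sym_diff y1 f) (?b k) \<subseteq> V"
    using y1(1) fV gena_subset[of p2 E2 V k] by blast+
   have "?\<psi>' (sym_diff (sym_diff y1 f) (?b k)) ~= 0" by (rule g2.frs_support_closed[OF y1f spn_gen[OF k]])
   moreover have "sym_diff (sym_diff y1 f) (?b k) = sym_diff (sym_diff y1 (?b k)) f" by blast
   ultimately have "?\<psi> (sym_diff y1 (?b k)) ~= 0" using Y2[OF s(1)] by simp
   from g1.frs_support_coset[OF y1 s(1) this]
   have "sym_diff (sym_diff y1 (?b k)) y1 \<in> spn V ?a" .
   moreover have "sym_diff (sym_diff y1 (?b k)) y1 = ?b k" by blast
   ultimately show ?thesis by simp
  qed
  have "spn V x \<subseteq> spn V y" if "!!j. j \<in> V ==> x j \<in> spn V y" for x y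
  proof
   fix e assume "e \<in> spn V x"
   thus "e \<in> spn V y" by induction (auto intro: spn.empty spn_sym_diff that)
  qed
  thus "spn V ?a = spn V ?b" using one two by (metis subset_antisym)
 next
  fix j k e assume j: "j \<in> V" and k: "k \<in> V" and e: "e \<in> spn V ?a"
  let ?aj = "?a j" and ?bk = "?b k" and ?cj = "?c j" and ?dk = "?d k"
  have eV: "e \<subseteq> V" using spn_subset[OF gena_subset e] .
  define y where "y = sym_diff y1 e"
  have y: "y \<subseteq> V" using y1(1) eV by (auto simp: y_def)
  have \<psi>y: "?\<psi> y ~= 0" unfolding y_def by (rule g1.frs_support_closed[OF y1 e])
  have ye: "sym_diff y y1 = e" by (auto simp: y_def)
  have sub: "?aj \<subseteq> V" "?bk \<subseteq> V" by (rule gena_subset)+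
  have ya: "sym_diff y ?aj \<subseteq> V" and yb: "sym_diff y ?bk \<subseteq> V" using y sub by blast+
  have fins: "finite y" "finite ?aj" "finite ?bk" using y sub g1.fin_sub by auto
  have comm: "sym_diff (sym_diff y ?aj) ?bk = sym_diff (sym_diff y ?bk) ?aj" by blast
  let ?K = "Kc V E1 p1 j" and ?L = "Kc V E2 p2 k * chi ?dk f"
  have K0: "?K ~= 0" "?L ~= 0" using g1.Kc_ne_0 g2.Kc_ne_0 by simp_all
  let ?x = "cis (2 * pi * (4 * sum t (?aj \<inter> ?bk \<inter> e) - 2 * sum t (?aj \<inter> ?bk)))"
  have pa: "?\<psi> (sym_diff y ?aj) = ?K * chi ?cj y * ?\<psi> y" by (rule stD[OF g1.frs_st[OF j] y])
  have pba: "?\<psi> (sym_diff (sym_diff y ?aj) ?bk) = ?K * (chi ?cj y * chi ?cj ?bk) * ?\<psi> (sym_diff y ?bk)"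
   unfolding comm chi_sym_diff[OF fins(1,3), symmetric] by (rule stD[OF g1.frs_st[OF j] yb])
  have B: "?D (sym_diff y ?bk) * ?\<psi> (sym_diff y ?bk) = ?L * chi ?dk y * (?D y * ?\<psi> y)"
   using st\<chi>[OF k y] by (simp only: \<chi>_def)
  have AB: "?D (sym_diff (sym_diff y ?aj) ?bk) * ?\<psi> (sym_diff (sym_diff y ?aj) ?bk) =
    ?L * (chi ?dk y * chi ?dk ?aj) * (?D (sym_diff y ?aj) * ?\<psi> (sym_diff y ?aj))"
   using st\<chi>[OF k ya] unfolding chi_sym_diff[OF fins(1,2)] by (simp only: \<chi>_def)
  have D2: "?D (sym_diff (sym_diff y ?aj) ?bk) * ?D y = ?D (sym_diff y ?aj) * ?D (sym_diff y ?bk) * ?x"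
   using Dp_second_difference[OF fin sub w_cis, of y] unfolding ye by simp
  \<comment> \<open>The same amplitude is reached along both orders of the two generators; the
    common factors are nonzero on the support and cancel.\<close>
  have "(?D (sym_diff (sym_diff y ?aj) ?bk) * ?D y) * (?K * (chi ?cj y * chi ?cj ?bk)) * ?\<psi> (sym_diff y ?bk)
    = ?D y * (?D (sym_diff (sym_diff y ?aj) ?bk) * ?\<psi> (sym_diff (sym_diff y ?aj) ?bk))"
   unfolding pba by (simp only: mult_ac)
  also have "... = (?L * chi ?dk y * (?D y * ?\<psi> y)) * (chi ?dk ?aj * ?D (sym_diff y ?aj) * ?K * chi ?cj y)"
   unfolding AB pa by (simp only: mult_ac)
  also have "... = ?D (sym_diff y ?bk) * ?\<psi> (sym_diff y ?bk) * (chi ?dk ?aj * ?D (sym_diff y ?aj) * ?K * chi ?cj y)"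
   unfolding B ..
  finally have "(?D (sym_diff y ?aj) * ?D (sym_diff y ?bk) * ?\<psi> (sym_diff y ?bk) * ?K * chi ?cj y) * (?x * chi ?cj ?bk)
    = (?D (sym_diff y ?aj) * ?D (sym_diff y ?bk) * ?\<psi> (sym_diff y ?bk) * ?K * chi ?cj y) * chi ?dk ?aj"
   unfolding D2 by (simp only: mult_ac)
  moreover have "?\<psi> (sym_diff y ?bk) ~= 0"
  proof
   assume "?\<psi> (sym_diff y ?bk) = 0"
   hence "?L * chi ?dk y * (?D y * ?\<psi> y) = 0" using B by simp
   thus False using K0(2) D0[of y] \<psi>y by simp
  qed
  ultimately have "?x * chi ?cj ?bk = chi ?dk ?aj" using D0 K0(1) by simp
  hence "?x * (chi ?cj ?bk * chi ?cj ?bk) = chi ?dk ?aj * chi ?cj ?bk" by (simp only: mult.assoc[symmetric])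
  hence "?x = chi ?dk ?aj * chi ?cj ?bk" by simp
  also have "... = (if odd (card (?aj \<inter> ?dk) + card (?cj \<inter> ?bk)) then - 1 else 1)"
   by (simp add: chi_def minus_one_power_iff Int_commute)
  finally show "4 * sum t (?aj \<inter> ?bk \<inter> e) - 2 * sum t (?aj \<inter> ?bk)
    - (if odd (card (?aj \<inter> ?dk) + card (?cj \<inter> ?bk)) then 1 / 2 else 0) \<in> \<int>"
   unfolding cis_half_iff .
 qed
qed

end

section \<open>Connected components\<close>

definition closed_in :: "nat set set => nat set => bool" where
 "closed_in E C \<longleftrightarrow> (\<forall>u\<in>C. nbr E u \<subseteq> C)"

lemma simple_graph_induced: "simple_graph V E ==> simple_graph V (induced_edges E C)"
 by (auto simp: simple_graph_def induced_edges_def)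

lemma induced_induced: "induced_edges (induced_edges E C) D = induced_edges E (C \<inter> D)"
 by (auto simp: induced_edges_def)

lemma nbr_induced: "nbr (induced_edges E C) u = (if u \<in> C then nbr E u \<inter> C else {})"
 by (auto simp: nbr_def induced_edges_def)

lemma closed_edge:
 assumes "simple_graph V E" "closed_in E C" "e \<in> E"
 shows "e \<subseteq> C \<or> e \<inter> C = {}"
proof (rule ccontr)
 assume "\<not> ?thesis"
 then obtain j where j: "j \<in> e" "j \<in> C" "\<not> e \<subseteq> C" by blast
 from simple_graph_edge[OF assms(1,3) j(1)] obtain v where "e = {j, v}" "v \<in> nbr E j" by metis
 thus False using assms(2) j by (auto simp: closed_in_def)
qed

lemma closed_complement:
 assumes "simple_graph V E" "closed_in E C" shows "closed_in E (V - C)"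
 using assms nbr_subset[OF assms(1)] nbr_sym unfolding closed_in_def by blast

lemma closed_Int: "closed_in E C ==> closed_in E D ==> closed_in E (C \<inter> D)"
 unfolding closed_in_def by blast

lemma sgn_st_induced: "sgn_st (induced_edges E C) y = sgn_st E (y \<inter> C)"
 by (simp add: sgn_st_def induced_induced Int_commute)

lemma finite_edges: "simple_graph V E ==> finite E"
 by (rule finite_subset[of _ "Pow V"]) (auto simp: simple_graph_def)

lemma sgn_st_split:
 assumes "simple_graph V E" "closed_in E C" "y \<subseteq> V"
 shows "sgn_st E y = sgn_st E (y \<inter> C) * sgn_st E (y - C)"
proof -
 have ne: "e ~= {}" if "e \<in> E" for e using that simple_graph_no_empty[OF assms(1)] by blast
 have "induced_edges E y = induced_edges E (y \<inter> C) \<union> induced_edges E (y - C)"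
  using closed_edge[OF assms(1,2)] by (auto simp: induced_edges_def)
 moreover have "induced_edges E (y \<inter> C) \<inter> induced_edges E (y - C) = {}"
  using ne by (auto simp: induced_edges_def)
 moreover have "finite (induced_edges E z)" for z
  using finite_edges[OF assms(1)] by (simp add: induced_edges_def)
 ultimately have "card (induced_edges E y) = card (induced_edges E (y \<inter> C)) + card (induced_edges E (y - C))"
  by (metis card_Un_disjoint)
 thus ?thesis by (simp add: sgn_st_def power_add)
qed

lemma lap_split:
 assumes "finite V" "C \<subseteq> V"
 shows "lap V m (%x. f (x \<inter> C) * g (x - C)) y = lap C m f (y \<inter> C) * lap (V - C) m g (y - C)"
proof -
 let ?h = "%p :: nat set \<times> nat set. fst p \<union> snd p"
 have bij: "bij_betw ?h (Pow C \<times> Pow (V - C)) (Pow V)"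
  by (rule bij_betw_byWitness[where f' = "%x. (x \<inter> C, x - C)"]) (use assms(2) in auto)
 have pr: "(\<Prod>u\<in>V. m u (u \<in> y) (u \<in> a \<union> b)) =
   (\<Prod>u\<in>C. m u (u \<in> y \<inter> C) (u \<in> a)) * (\<Prod>u\<in>V - C. m u (u \<in> y - C) (u \<in> b))"
  if "a \<in> Pow C" "b \<in> Pow (V - C)" for a b
 proof -
  have "(\<Prod>u\<in>V. m u (u \<in> y) (u \<in> a \<union> b)) =
   (\<Prod>u\<in>V - C. m u (u \<in> y) (u \<in> a \<union> b)) * (\<Prod>u\<in>C. m u (u \<in> y) (u \<in> a \<union> b))"
   by (rule prod.subset_diff[OF assms(2,1)])
  also have "(\<Prod>u\<in>V - C. m u (u \<in> y) (u \<in> a \<union> b)) = (\<Prod>u\<in>V - C. m u (u \<in> y - C) (u \<in> b))"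
  proof (rule prod.cong[OF refl])
   fix u assume "u \<in> V - C"
   hence "(u \<in> a \<union> b) = (u \<in> b)" "(u \<in> y) = (u \<in> y - C)" using that by blast+
   thus "m u (u \<in> y) (u \<in> a \<union> b) = m u (u \<in> y - C) (u \<in> b)" by (simp only:)
  qed
  also have "(\<Prod>u\<in>C. m u (u \<in> y) (u \<in> a \<union> b)) = (\<Prod>u\<in>C. m u (u \<in> y \<inter> C) (u \<in> a))"
  proof (rule prod.cong[OF refl])
   fix u assume "u \<in> C"
   hence "(u \<in> a \<union> b) = (u \<in> a)" "(u \<in> y) = (u \<in> y \<inter> C)" using that by blast+
   thus "m u (u \<in> y) (u \<in> a \<union> b) = m u (u \<in> y \<inter> C) (u \<in> a)" by (simp only:)
  qed
  finally show ?thesis by (simp only: mult.commute)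
 qed
 have "lap V m (%x. f (x \<inter> C) * g (x - C)) y =
   (\<Sum>p\<in>Pow C \<times> Pow (V - C). (\<Prod>u\<in>V. m u (u \<in> y) (u \<in> ?h p)) * (f (?h p \<inter> C) * g (?h p - C)))"
  unfolding lap_def by (rule sum.reindex_bij_betw[OF bij, symmetric])
 also have "... = (\<Sum>(a, b)\<in>Pow C \<times> Pow (V - C).
   ((\<Prod>u\<in>C. m u (u \<in> y \<inter> C) (u \<in> a)) * f a) * ((\<Prod>u\<in>V - C. m u (u \<in> y - C) (u \<in> b)) * g b))"
 proof (rule sum.cong[OF refl])
  fix p assume p: "p \<in> Pow C \<times> Pow (V - C)"
  then obtain a b where ab: "p = (a, b)" "a \<in> Pow C" "b \<in> Pow (V - C)" by blast
  have "(a \<union> b) \<inter> C = a" "(a \<union> b) - C = b" using ab by auto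
  thus "(\<Prod>u\<in>V. m u (u \<in> y) (u \<in> ?h p)) * (f (?h p \<inter> C) * g (?h p - C)) =
   (case p of (a, b) => ((\<Prod>u\<in>C. m u (u \<in> y \<inter> C) (u \<in> a)) * f a) * ((\<Prod>u\<in>V - C. m u (u \<in> y - C) (u \<in> b)) * g b))"
   using pr[OF ab(2,3)] by (simp only: ab(1) fst_conv snd_conv prod.case mult_ac)
 qed
 also have "... = lap C m f (y \<inter> C) * lap (V - C) m g (y - C)"
  unfolding lap_def by (simp add: sum_product sum.cartesian_product)
 finally show ?thesis .
qed

text \<open>A local operator maps products over \<open>C\<close> and its complement to products. An
  edge of \<open>E2\<close> from \<open>u\<close> in \<open>C\<close> to \<open>v\<close> outside
  would make the sign at \<open>{u, v}\<close> differ from the product of those at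
  \<open>{u}\<close> and \<open>{v}\<close>, which a product function with sign 1 at
  \<open>{}\<close> excludes. Freezing the outer part at \<open>{}\<close> leaves a unitary on
  \<open>C\<close> alone.\<close>

lemma LUc_restrict:
 assumes G1: "simple_graph V E1" and G2: "simple_graph V E2" and C: "C \<subseteq> V" "closed_in E1 C"
  and LU: "LUc V E1 E2"
 shows "closed_in E2 C & LUc V (induced_edges E1 C) (induced_edges E2 C)"
proof -
 have fin: "finite V" using G1 by (simp add: simple_graph_def)
 obtain m c where c: "c ~= 0" and m: "!!u. u \<in> V ==> uni (m u)"
  and eq: "!!y. y \<in> Pow V ==> lap V m (sgn_st E1) y = c * sgn_st E2 y"
  using LU unfolding LUc_def by blast
 let ?A = "lap C m (sgn_st E1)" and ?B = "lap (V - C) m (sgn_st E1)"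
 have AB: "c * sgn_st E2 y = ?A (y \<inter> C) * ?B (y - C)" if "y \<subseteq> V" for y
 proof -
  have "lap V m (sgn_st E1) y = lap V m (%x. sgn_st E1 (x \<inter> C) * sgn_st E1 (x - C)) y"
   by (rule lap_cong[OF refl]) (rule sgn_st_split[OF G1 C(2)])
  thus ?thesis using eq[of y] that lap_split[OF fin C(1), of m "sgn_st E1" "sgn_st E1" y] by simp
 qed
 have B0: "?B {} ~= 0" using AB[of "{}"] c by auto
 have "closed_in E2 C"
  unfolding closed_in_def
 proof (intro ballI subsetI)
  fix u v assume u: "u \<in> C" and v: "v \<in> nbr E2 u"
  show "v \<in> C"
  proof (rule ccontr)
   assume vC: "v \<notin> C"
   have uV: "u \<in> V" using u C(1) by blast
   have vV: "v \<in> V" using v nbr_subset[OF G2] by blast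
   have e1: "c * sgn_st E2 {u, v} = ?A {u} * ?B {v}"
   proof -
    have "{u, v} \<inter> C = {u}" "{u, v} - C = {v}" using u vC by auto
    thus ?thesis using AB[of "{u, v}"] uV vV by simp
   qed
   have e2: "c * sgn_st E2 {u} = ?A {u} * ?B {}"
   proof -
    have "{u} \<inter> C = {u}" "{u} - C = {}" using u by auto
    thus ?thesis using AB[of "{u}"] uV by simp
   qed
   have e3: "c * sgn_st E2 {v} = ?A {} * ?B {v}"
   proof -
    have "{v} \<inter> C = {}" "{v} - C = {v}" using vC by auto
    thus ?thesis using AB[of "{v}"] vV by simp
   qed
   have e4: "c * sgn_st E2 {} = ?A {} * ?B {}" using AB[of "{}"] by simp
   have s1: "sgn_st E2 {} = 1" using sgn_st_empty simple_graph_no_empty[OF G2] by simp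
   have single: "sgn_st E2 {w} = 1" for w
    using sgn_st_insert[OF G2, of w "{}"] s1 by simp
   have "sgn_st E2 {u, v} = - 1"
   proof -
    have "nbr E2 u \<inter> {v} = {v}" using v by auto
    moreover have "u ~= v" using u vC by auto
    ultimately show ?thesis using sgn_st_insert[OF G2, of u "{v}"] single vV by simp
   qed
   moreover have "(c * sgn_st E2 {u, v}) * (c * sgn_st E2 {}) = (c * sgn_st E2 {u}) * (c * sgn_st E2 {v})"
    unfolding e1 e2 e3 e4 by (simp only: mult_ac)
   ultimately show False using s1 single c by simp
  qed
 qed
 moreover have "LUc V (induced_edges E1 C) (induced_edges E2 C)"
 proof -
  define m' where "m' u = (if u \<in> C then m u else mone)" for u
  have "lap V m' (sgn_st (induced_edges E1 C)) y = (c / ?B {}) * sgn_st (induced_edges E2 C) y" if y: "y \<in> Pow V" for y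
  proof -
   have "lap V m' (sgn_st (induced_edges E1 C)) y = lap V m' (%x. sgn_st E1 (x \<inter> C) * (%_. 1) (x - C)) y"
    by (rule lap_cong) (simp_all add: sgn_st_induced)
   also have "... = lap C m' (sgn_st E1) (y \<inter> C) * lap (V - C) m' (%_. 1) (y - C)"
    by (rule lap_split[OF fin C(1)])
   also have "lap C m' (sgn_st E1) (y \<inter> C) = ?A (y \<inter> C)"
    by (rule lap_cong) (simp_all add: m'_def)
   also have "lap (V - C) m' (%_. 1) (y - C) = lap (V - C) (%_. mone) (%_. 1) (y - C)"
    by (rule lap_cong) (simp_all add: m'_def)
   also have "... = 1" by (rule lap_mone) (use fin y in auto)
   also have "?A (y \<inter> C) * 1 = (c / ?B {}) * sgn_st E2 (y \<inter> C)"
   proof -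
    have s: "y \<inter> C \<subseteq> V" "(y \<inter> C) \<inter> C = y \<inter> C" "(y \<inter> C) - C = {}" using C(1) by auto
    have "c * sgn_st E2 (y \<inter> C) = ?A (y \<inter> C) * ?B {}" using AB[OF s(1)] unfolding s(2,3) .
    thus ?thesis using B0 by (simp add: field_simps)
   qed
   finally show ?thesis unfolding sgn_st_induced[of E2 C y] .
  qed
  moreover have "uni (m' u)" if "u \<in> V" for u using m[OF that] by (simp add: m'_def)
  moreover have "c / ?B {} ~= 0" using c B0 by simp
  ultimately have "c / ?B {} ~= 0 & (\<forall>u\<in>V. uni (m' u)) \<and>
   (\<forall>y\<in>Pow V. lap V m' (sgn_st (induced_edges E1 C)) y = (c / ?B {}) * sgn_st (induced_edges E2 C) y)" by simp
  thus ?thesis unfolding LUc_def by (intro exI)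
 qed
 ultimately show ?thesis by blast
qed

text \<open>The given unitary is kept on \<open>C\<close> and replaced by the identity elsewhere,
  where the graphs agree.\<close>

lemma LUc_glue:
 assumes G1: "simple_graph V E1" and G2: "simple_graph V E2" and C: "C \<subseteq> V" "closed_in E1 C" "closed_in E2 C"
  and same: "induced_edges E1 (V - C) = induced_edges E2 (V - C)"
  and LU: "LUc V (induced_edges E1 C) (induced_edges E2 C)"
 shows "LUc V E1 E2"
proof -
 have fin: "finite V" using G1 by (simp add: simple_graph_def)
 obtain m c where c: "c ~= 0" and m: "!!u. u \<in> V ==> uni (m u)"
  and eq: "!!y. y \<in> Pow V ==> lap V m (sgn_st (induced_edges E1 C)) y = c * sgn_st (induced_edges E2 C) y"
  using LU unfolding LUc_def by blast
 let ?A = "lap C m (sgn_st E1)" and ?B = "lap (V - C) m (%_. 1)"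
 have AB: "c * sgn_st E2 (y \<inter> C) = ?A (y \<inter> C) * ?B (y - C)" if "y \<subseteq> V" for y
 proof -
  have "lap V m (sgn_st (induced_edges E1 C)) y = lap V m (%x. sgn_st E1 (x \<inter> C) * (%_. 1) (x - C)) y"
   by (rule lap_cong) (simp_all add: sgn_st_induced)
  thus ?thesis using eq[of y] that lap_split[OF fin C(1), of m "sgn_st E1" "%_. 1" y]
   by (simp add: sgn_st_induced)
 qed
 have B0: "?B {} ~= 0" using AB[of "{}"] c by auto
 define m' where "m' u = (if u \<in> C then m u else mone)" for u
 have "lap V m' (sgn_st E1) y = (c / ?B {}) * sgn_st E2 y" if y: "y \<in> Pow V" for y
 proof -
  have yV: "y \<subseteq> V" using y by simp
  have "lap V m' (sgn_st E1) y = lap V m' (%x. sgn_st E1 (x \<inter> C) * sgn_st E1 (x - C)) y"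
   by (rule lap_cong[OF refl]) (rule sgn_st_split[OF G1 C(2)])
  also have "... = lap C m' (sgn_st E1) (y \<inter> C) * lap (V - C) m' (sgn_st E1) (y - C)"
   by (rule lap_split[OF fin C(1)])
  also have "lap C m' (sgn_st E1) (y \<inter> C) = ?A (y \<inter> C)"
   by (rule lap_cong) (simp_all add: m'_def)
  also have "lap (V - C) m' (sgn_st E1) (y - C) = lap (V - C) (%_. mone) (sgn_st E1) (y - C)"
   by (rule lap_cong) (simp_all add: m'_def)
  also have "... = sgn_st E1 (y - C)" by (rule lap_mone) (use fin y in auto)
  also have "... = sgn_st E2 (y - C)"
  proof -
   have "y \<inter> (V - C) = y - C" using yV by blast
   thus ?thesis using sgn_st_induced[of E1 "V - C" y] sgn_st_induced[of E2 "V - C" y] same by simp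
  qed
  also have "?A (y \<inter> C) = (c / ?B {}) * sgn_st E2 (y \<inter> C)"
  proof -
   have s: "y \<inter> C \<subseteq> V" "(y \<inter> C) \<inter> C = y \<inter> C" "(y \<inter> C) - C = {}" using C(1) by auto
   have "c * sgn_st E2 (y \<inter> C) = ?A (y \<inter> C) * ?B {}" using AB[OF s(1)] unfolding s(2,3) .
   thus ?thesis using B0 by (simp add: field_simps)
  qed
  finally show ?thesis using sgn_st_split[OF G2 C(3) yV] by (simp only: mult.assoc)
 qed
 moreover have "uni (m' u)" if "u \<in> V" for u using m[OF that] by (simp add: m'_def)
 moreover have "c / ?B {} ~= 0" using c B0 by simp
 ultimately have "c / ?B {} ~= 0 & (\<forall>u\<in>V. uni (m' u)) \<and>
   (\<forall>y\<in>Pow V. lap V m' (sgn_st E1) y = (c / ?B {}) * sgn_st E2 y)" by simp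
 thus ?thesis unfolding LUc_def by (intro exI)
qed

text \<open>Hybrid graphs, equal to \<open>E2\<close> on \<open>D\<close> and to \<open>E1\<close>
  off \<open>D\<close>, change one graph into the other one root at a time. Only the part of
  \<open>C r\<close> outside \<open>D\<close> is exchanged in a step; it is closed in both graphs,
  so the sets \<open>C r\<close> may overlap.\<close>

lemma LUc_components:
 assumes G1: "simple_graph V E1" and G2: "simple_graph V E2"
  and C: "!!r. r \<in> V ==> r \<in> C r & C r \<subseteq> V & closed_in E1 (C r)"
 shows "LUc V E1 E2 \<longleftrightarrow>
  (\<forall>r\<in>V. closed_in E2 (C r) & LUc V (induced_edges E1 (C r)) (induced_edges E2 (C r)))"
proof
 assume "LUc V E1 E2"
 thus "\<forall>r\<in>V. closed_in E2 (C r) & LUc V (induced_edges E1 (C r)) (induced_edges E2 (C r))"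
  using LUc_restrict[OF G1 G2] C by blast
next
 assume H: "\<forall>r\<in>V. closed_in E2 (C r) & LUc V (induced_edges E1 (C r)) (induced_edges E2 (C r))"
 have fin: "finite V" using G1 by (simp add: simple_graph_def)
 define hyb where "hyb D = induced_edges E2 D \<union> induced_edges E1 (V - D)" for D
 have Gh: "simple_graph V (hyb D)" for D
  using G1 G2 by (auto simp: hyb_def simple_graph_def induced_edges_def)
 have edgeV: "e \<subseteq> V" "e ~= {}" if "e \<in> E1 \<or> e \<in> E2" for e
  using that G1 G2 simple_graph_no_empty[OF G1] simple_graph_no_empty[OF G2] by (auto simp: simple_graph_def)
 have ind: "LUc V E1 (hyb (\<Union>(C ` R))) & closed_in E1 (\<Union>(C ` R)) & closed_in E2 (\<Union>(C ` R))"
  if "finite R" "R \<subseteq> V" for R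
  using that
 proof (induction R rule: finite_induct)
  case empty
  have "hyb {} = E1" using edgeV by (auto simp: hyb_def induced_edges_def)
  thus ?case using LUc_refl[OF fin] by (simp add: closed_in_def)
 next
  case (insert r R)
  let ?D = "\<Union>(C ` R)" and ?C = "C r - \<Union>(C ` R)"
  have r: "r \<in> V" "R \<subseteq> V" using insert.prems by auto
  have D1: "closed_in E1 ?D" and D2: "closed_in E2 ?D" and LUD: "LUc V E1 (hyb ?D)" using insert.IH r by auto
  have C1: "closed_in E1 (C r)" and C2: "closed_in E2 (C r)" and CV: "C r \<subseteq> V" using C[OF r(1)] H r(1) by auto
  have eqC: "?C = C r \<inter> (V - ?D)" using CV by blast
  have c1: "closed_in E1 ?C" and c2: "closed_in E2 ?C"
   unfolding eqC by (intro closed_Int C1 C2 closed_complement[OF G1 D1] closed_complement[OF G2 D2])+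
  have cV: "?C \<subseteq> V" using CV by blast
  have clI: "closed_in (induced_edges E1 (C r)) ?C" using c1 by (auto simp: closed_in_def nbr_induced)
  have "LUc V (induced_edges (induced_edges E1 (C r)) ?C) (induced_edges (induced_edges E2 (C r)) ?C)"
   using LUc_restrict[OF simple_graph_induced[OF G1] simple_graph_induced[OF G2] cV clI] H r(1) by blast
  moreover have "C r \<inter> ?C = ?C" by blast
  ultimately have LUC: "LUc V (induced_edges E1 ?C) (induced_edges E2 ?C)" by (simp only: induced_induced)
  have un: "\<Union>(C ` insert r R) = ?D \<union> ?C" by blast
  have step: "LUc V (hyb D) (hyb (D \<union> B))"
   if B: "B \<subseteq> V" "B \<inter> D = {}" "closed_in E1 B" "closed_in E2 B" "LUc V (induced_edges E1 B) (induced_edges E2 B)" for D B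
  proof (rule LUc_glue[OF Gh Gh B(1)])
   have n: "nbr (hyb X) u \<subseteq> nbr E1 u \<union> nbr E2 u" for X u
    by (auto simp: hyb_def nbr_def induced_edges_def)
   show "closed_in (hyb D) B" "closed_in (hyb (D \<union> B)) B"
    using B(3,4) n unfolding closed_in_def by (meson Un_least subset_trans)+
   show "induced_edges (hyb D) (V - B) = induced_edges (hyb (D \<union> B)) (V - B)"
    unfolding hyb_def induced_edges_def by blast
   have "induced_edges (hyb D) B = induced_edges E1 B"
    using edgeV B(1,2) unfolding hyb_def induced_edges_def by blast
   moreover have "induced_edges (hyb (D \<union> B)) B = induced_edges E2 B"
    using edgeV unfolding hyb_def induced_edges_def by blast
   ultimately show "LUc V (induced_edges (hyb D) B) (induced_edges (hyb (D \<union> B)) B)"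
    using B(5) by simp
  qed
  have "?C \<inter> ?D = {}" by blast
  from step[OF cV this c1 c2 LUC] have "LUc V (hyb ?D) (hyb (?D \<union> ?C))" .
  hence "LUc V E1 (hyb (?D \<union> ?C))" using LUc_trans[OF fin LUD] by blast
  moreover have cU: "closed_in E (X \<union> Y)" if "closed_in E X" "closed_in E Y" for E X Y
   using that unfolding closed_in_def by blast
  ultimately show ?case unfolding un using cU[OF D1 c1] cU[OF D2 c2] by (simp only: simp_thms)
 qed
 have "\<Union>(C ` V) = V" using C by blast
 moreover have "hyb V = E2" using edgeV by (auto simp: hyb_def induced_edges_def)
 ultimately show "LUc V E1 E2" using ind[OF fin order_refl] by simp
qed

section \<open>Propagation of axes\<close>

text \<open>Inverse to \<open>axp\<close> on the three axes. The code 0 of the identity serves below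
  as the sign that no axis has been found.\<close>

definition pcode :: "bool \<times> bool => nat" where
 "pcode p = of_bool (fst p) + 2 * of_bool (snd p)"

lemma axp_pcode: "p ~= pI ==> axp (pcode p) = p"
 by (cases p) (auto simp: axp_def pcode_def)

lemma pcode_range: "p ~= pI ==> pcode p \<in> {1, 2, 3}"
 by (cases p) (auto simp: pcode_def)

lemma axp_ne_pI: "axp p ~= pI"
 by (simp add: axp_def)

text \<open>The chain of constraints: the vertices outside \<open>R\<close> below \<open>i\<close> are free, and the vertices of \<open>R\<close>, whose axes
  are known, are released one after the other, in two steps of one dimension each, as \<open>j\<close> grows.\<close>

definition kst :: "nat set => nat => nat => nat => nat" where
 "kst R i j v = (if v \<in> R then (if j <= 2 * v then 0 else if j = 2 * v + 1 then 1 else 2)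
   else if v < i then 2 else 0)"

definition Wst :: "nat set => (nat => nat) => nat => nat => nat => (bool \<times> bool) set" where
 "Wst R al i j = kset (kst R i j) (%u. axp (al u))"

definition cimg :: "nat => nat set set => (nat => (bool \<times> bool) set) => nat => nat" where
 "cimg n E W u = (if \<exists>p. p ~= pI & img {..<n} E W u = {pI, p}
   then pcode (THE p. p ~= pI & img {..<n} E W u = {pI, p}) else 0)"

lemma cimg_eq: "p ~= pI ==> img {..<n} E W u = {pI, p} ==> cimg n E W u = pcode p"
proof -
 assume p: "p ~= pI" "img {..<n} E W u = {pI, p}"
 have "(THE p. p ~= pI & img {..<n} E W u = {pI, p}) = p"
 proof (rule the_equality)
  fix q assume "q ~= pI & img {..<n} E W u = {pI, q}"
  hence "q \<in> {pI, p}" "q ~= pI" using p(2) by (metis insertCI)+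
  thus "q = p" by simp
 qed (use p in simp)
 thus ?thesis using p unfolding cimg_def by (metis (no_types, lifting))
qed

lemma cimg_ne_0: "cimg n E W u ~= 0 \<longleftrightarrow> (\<exists>p. p ~= pI & img {..<n} E W u = {pI, p})"
proof
 assume "\<exists>p. p ~= pI & img {..<n} E W u = {pI, p}"
 then obtain p where p: "p ~= pI" "img {..<n} E W u = {pI, p}" by (elim exE conjE)
 show "cimg n E W u ~= 0" using cimg_eq[OF p] pcode_range[OF p(1)] by auto
next
 assume "cimg n E W u ~= 0"
 thus "\<exists>p. p ~= pI & img {..<n} E W u = {pI, p}" unfolding cimg_def by (metis (no_types, lifting))
qed

text \<open>The resolved vertices and the codes of their axes in the first and in the second
  graph.\<close>

type_synonym axes = "nat set \<times> (nat => nat) \<times> (nat => nat)"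

text \<open>The first graph alone decides which vertices become resolved; by
  \<open>axis_transfer\<close> the image in the second graph is then a single axis too.\<close>

definition newly :: "nat => nat set set => nat => nat => axes => nat set" where
 "newly n E1 i j s = (case s of (R, al, be) => {u. u < i & u \<notin> R & cimg n E1 (Wst R al i j) u ~= 0})"

definition astep :: "nat => nat set set => nat set set => nat => nat => axes => axes" where
 "astep n E1 E2 i j s = (case s of (R, al, be) => let N = newly n E1 i j s in
   (R \<union> N, (%u. if u \<in> N then cimg n E1 (Wst R al i j) u else al u),
   (%u. if u \<in> N then cimg n E2 (Wst R be i j) u else be u)))"

definition jloop :: "nat => nat set set => nat set set => nat => nat => axes => axes" where
 "jloop n E1 E2 i m = fold (astep n E1 E2 i) [0..<m]"

text \<open>Prefixes have length 1 to \<open>n\<close>, and the stages run up to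
  \<open>2 * n\<close>, where all of \<open>R\<close> is free.\<close>

definition iloop :: "nat => nat set set => nat set set => nat => axes => axes" where
 "iloop n E1 E2 m = fold (%i. jloop n E1 E2 (Suc i) (2 * n + 1)) [0..<m]"

definition ploop :: "nat => nat set set => nat set set => nat => axes => axes" where
 "ploop n E1 E2 m = fold (%_. iloop n E1 E2 n) [0..<m]"

lemma loop_0: "jloop n E1 E2 i 0 s = s" "iloop n E1 E2 0 s = s" "ploop n E1 E2 0 s = s"
 by (simp_all add: jloop_def iloop_def ploop_def)

lemma loop_Suc:
 "jloop n E1 E2 i (Suc m) s = astep n E1 E2 i m (jloop n E1 E2 i m s)"
 "iloop n E1 E2 (Suc m) s = jloop n E1 E2 (Suc m) (2 * n + 1) (iloop n E1 E2 m s)"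
 "ploop n E1 E2 (Suc m) s = iloop n E1 E2 n (ploop n E1 E2 m s)"
 by (simp_all add: jloop_def iloop_def ploop_def)

lemma fst_astep: "fst (astep n E1 E2 i j s) = fst s \<union> newly n E1 i j s"
 by (cases s) (simp add: astep_def Let_def)

lemma astep_noop: "newly n E1 i j s = {} ==> astep n E1 E2 i j s = s"
 by (cases s) (simp add: astep_def Let_def)

lemma newly_disjoint: "newly n E1 i j s \<inter> fst s = {}"
 by (cases s) (auto simp: newly_def)

lemma newly_subset: "newly n E1 i j s \<subseteq> {..<i}"
 by (cases s) (auto simp: newly_def)

definition stuck :: "nat => nat set set => axes => bool" where
 "stuck n E1 s \<longleftrightarrow> (\<forall>i\<in>{1..n}. \<forall>j\<le>2 * n. newly n E1 i j s = {})"

lemma jloop_mono: "fst s \<subseteq> fst (jloop n E1 E2 i m s)"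
 by (induction m) (auto simp: loop_0 loop_Suc fst_astep)

lemma jloop_noop: "fst (jloop n E1 E2 i m s) = fst s ==> jloop n E1 E2 i m s = s & (\<forall>j<m. newly n E1 i j s = {})"
proof (induction m)
 case (Suc m)
 have "fst s \<subseteq> fst (jloop n E1 E2 i m s)" by (rule jloop_mono)
 moreover have "fst (jloop n E1 E2 i m s) \<subseteq> fst (jloop n E1 E2 i (Suc m) s)" by (auto simp: loop_Suc fst_astep)
 ultimately have eq: "fst (jloop n E1 E2 i m s) = fst s" using Suc.prems by blast
 from Suc.IH[OF this] have j: "jloop n E1 E2 i m s = s" and all: "\<forall>j<m. newly n E1 i j s = {}" by auto
 have "fst s \<union> newly n E1 i m s = fst s" using Suc.prems by (simp add: loop_Suc fst_astep j)
 hence e: "newly n E1 i m s = {}" using newly_disjoint[of n E1 i m s] by blast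
 show ?case using j all e astep_noop[OF e] by (auto simp: loop_Suc less_Suc_eq)
qed (simp add: loop_0)

lemma iloop_mono: "fst s \<subseteq> fst (iloop n E1 E2 m s)"
proof (induction m)
 case (Suc m)
 thus ?case using jloop_mono[of "iloop n E1 E2 m s" n E1 E2 "Suc m" "2 * n + 1"] by (auto simp: loop_Suc)
qed (simp add: loop_0)

lemma iloop_noop: "fst (iloop n E1 E2 m s) = fst s ==>
 iloop n E1 E2 m s = s & (\<forall>i\<in>{1..m}. \<forall>j\<le>2 * n. newly n E1 i j s = {})"
proof (induction m)
 case (Suc m)
 have "fst s \<subseteq> fst (iloop n E1 E2 m s)" by (rule iloop_mono)
 moreover have "fst (iloop n E1 E2 m s) \<subseteq> fst (iloop n E1 E2 (Suc m) s)" by (simp only: loop_Suc jloop_mono)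
 ultimately have eq: "fst (iloop n E1 E2 m s) = fst s" using Suc.prems by blast
 from Suc.IH[OF this] have j: "iloop n E1 E2 m s = s"
  and all: "\<forall>i\<in>{1..m}. \<forall>j\<le>2 * n. newly n E1 i j s = {}" by auto
 have "fst (jloop n E1 E2 (Suc m) (2 * n + 1) s) = fst s" using Suc.prems by (simp only: loop_Suc j)
 from jloop_noop[OF this] show ?case using j all
  by (simp add: loop_Suc) (metis atLeastAtMost_iff le_SucE le_imp_less_Suc)
qed (simp add: loop_0)

text \<open>A sweep that resolves nothing has found every step idle, hence its state is stuck; any
  other sweep enlarges \<open>R\<close>.\<close>

lemma ploop_stuck_or_grows: "stuck n E1 (ploop n E1 E2 m s) \<or> card (fst s) + m <= card (fst (ploop n E1 E2 m s))"
 if "fst s \<subseteq> {..<n}" "!!m. fst (ploop n E1 E2 m s) \<subseteq> {..<n}"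
proof (induction m)
 case (Suc m)
 let ?t = "ploop n E1 E2 m s"
 show ?case
 proof (cases "fst (iloop n E1 E2 n ?t) = fst ?t")
  case True
  from iloop_noop[OF this] show ?thesis by (auto simp: loop_Suc stuck_def)
 next
  case False
  hence "fst ?t \<subset> fst (iloop n E1 E2 n ?t)" using iloop_mono by blast
  moreover have "finite (fst (iloop n E1 E2 n ?t))"
   using that(2)[of "Suc m"] finite_subset by (auto simp: loop_Suc)
  ultimately have lt: "card (fst ?t) < card (fst (iloop n E1 E2 n ?t))" by (rule psubset_card_mono[rotated])
  show ?thesis
  proof (cases "stuck n E1 ?t")
   case True
   have no: "iloop n E1 E2 k ?t = ?t" if "k <= n" for k
    using that
   proof (induction k)
    case (Suc k)
    have jl: "jloop n E1 E2 (Suc k) l ?t = ?t" if "l <= 2 * n + 1" for l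
     using that
    proof (induction l)
     case (Suc l)
     have "newly n E1 (Suc k) l ?t = {}" using True Suc.prems \<open>Suc k <= n\<close> by (simp add: stuck_def)
     thus ?case using Suc by (simp add: loop_Suc astep_noop)
    qed (simp add: loop_0)
    have ik: "iloop n E1 E2 k ?t = ?t" using Suc by simp
    show ?case unfolding loop_Suc(2) ik by (rule jl) simp
   qed (simp add: loop_0)
   thus ?thesis using False by simp
  next
   case notst: False
   hence "card (fst s) + m <= card (fst ?t)" using Suc.IH by blast
   thus ?thesis using lt by (simp add: loop_Suc)
  qed
 qed
qed (simp add: loop_0)

lemma fst_loops_subset:
 assumes "fst s \<subseteq> {..<n}"
 shows "fst (ploop n E1 E2 m s) \<subseteq> {..<n}"
proof -
 have j: "fst (jloop n E1 E2 i m s) \<subseteq> {..<n}" if "fst s \<subseteq> {..<n}" "i <= n" for i m s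
 proof (induction m)
  case (Suc m)
  have "newly n E1 i m (jloop n E1 E2 i m s) \<subseteq> {..<n}" using newly_subset that(2) by fastforce
  thus ?case using Suc by (simp add: loop_Suc fst_astep)
 qed (use that in "simp add: loop_0")
 have i: "fst (iloop n E1 E2 m s) \<subseteq> {..<n}" if "fst s \<subseteq> {..<n}" "m <= n" for m s
  using that(2)
 proof (induction m)
  case (Suc m)
  thus ?case by (simp only: loop_Suc) (rule j, simp_all)
 qed (use that in "simp add: loop_0")
 show ?thesis
 proof (induction m)
  case (Suc m)
  thus ?case by (simp only: loop_Suc) (rule i, simp_all)
 qed (use assms in "simp add: loop_0")
qed

text \<open>If no vertex outside \<open>R\<close> is resolved, then the stabilizer group is the product of the parts supported
  on \<open>R\<close> and outside \<open>R\<close>, hence there are no edges between \<open>R\<close> and its complement.\<close>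

lemma stuck_imp_all:
 assumes G: "simple_graph {..<n} E1" and R: "R \<subseteq> {..<n}" "r \<in> R" and st: "stuck n E1 (R, al, be)"
  and conn: "!!T. T \<subseteq> {..<n} ==> r \<in> T ==> closed_in E1 T ==> (\<forall>u\<in>{..<n} - T. nbr E1 u = {})"
 shows "R = {..<n}"
proof (rule ccontr)
 assume neq: "R ~= {..<n}"
 let ?V = "{..<n}" and ?ax = "%u. axp (al u)"
 have fin: "finite ?V" by simp
 define S where "S i j = SW ?V E1 (kset (kst R i j) ?ax)" for i j
 have finS: "finite (S i j)" for i j unfolding S_def by (rule finite_SW[OF fin])
 have img2: "img ?V E1 (kset (kst R i j) ?ax) u ~= {pI, p}"
  if "i \<in> {1..n}" "j <= 2 * n" "u < i" "u \<notin> R" "p ~= pI" for i j u p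
 proof
  assume "img ?V E1 (kset (kst R i j) ?ax) u = {pI, p}"
  hence "cimg n E1 (Wst R al i j) u ~= 0" unfolding cimg_ne_0 Wst_def using that(5) by (intro exI conjI)
  hence "u \<in> newly n E1 i j (R, al, be)" using that by (simp add: newly_def)
  moreover have "newly n E1 i j (R, al, be) = {}" using st that(1,2) by (simp add: stuck_def)
  ultimately show False by simp
 qed
 have img_cases: "img ?V E1 (kset (kst R i j) ?ax) u = {pI} \<or> img ?V E1 (kset (kst R i j) ?ax) u = UNIV"
  if "i \<in> {1..n}" "j <= 2 * n" "u < i" "u \<notin> R" for i j u
 proof (rule img_kset_cases[OF fin, of E1 "kst R i j" ?ax u])
  fix P assume "P ~= pI" "img ?V E1 (kset (kst R i j) ?ax) u = {pI, P}"
  thus ?thesis using img2[OF that] by metis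
 qed (simp_all only: simp_thms)
 \<comment> \<open>Each stage releases one dimension at the single vertex
   \<open>v = j div 2\<close>. If the image at \<open>u\<close> jumped from trivial to everything,
   elements \<open>x\<close>, \<open>y\<close> and their sum would all violate the old constraint at
   \<open>v\<close>; but the violators form one coset, so the sum of two of them is not a
   violator.\<close>
 have img_step: "img ?V E1 (kset (kst R i j) ?ax) u = img ?V E1 (kset (kst R i (Suc j)) ?ax) u"
  if i: "i \<in> {1..n}" and j: "Suc j <= 2 * n" and u: "u < i" "u \<notin> R" for i j u
 proof (rule ccontr)
  let ?I = "img ?V E1 (kset (kst R i j) ?ax) u" and ?I' = "img ?V E1 (kset (kst R i (Suc j)) ?ax) u"
  assume ne: "?I ~= ?I'"
  have sub: "kset (kst R i j) ?ax v \<subseteq> kset (kst R i (Suc j)) ?ax v" for v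
   by (auto simp: kset_def kst_def)
  have "S i j \<subseteq> S i (Suc j)" unfolding S_def SW_def using sub by blast
  hence "?I \<subseteq> ?I'" unfolding img_def S_def by (rule image_mono)
  moreover have "pI \<in> ?I" unfolding img_def by (rule image_eqI[of _ _ "{}"]) simp_all
  ultimately have I: "?I = {pI}" and I': "?I' = UNIV"
   using ne img_cases[OF i _ u, of j] img_cases[OF i j u] j by (metis Suc_leD top.extremum_unique)+
  have notin: "x \<notin> S i j" if "cmp E1 x u ~= pI" for x
  proof
   assume "x \<in> S i j"
   hence "cmp E1 x u \<in> ?I" unfolding img_def S_def by (rule imageI)
   thus False using that I by simp
  qed
  have ex: "\<exists>x. x \<in> S i (Suc j) & cmp E1 x u = p" for p
  proof -
   have "p \<in> ?I'" unfolding I' by (rule UNIV_I)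
   thus ?thesis unfolding img_def S_def by (elim imageE) (intro exI conjI, simp_all)
  qed
  obtain x where x: "x \<in> S i (Suc j)" "cmp E1 x u = (True, False)" using ex by metis
  obtain y where y: "y \<in> S i (Suc j)" "cmp E1 y u = (False, True)" using ex by metis
  have xV: "x \<subseteq> ?V" "y \<subseteq> ?V" using x y by (auto simp: S_def SW_def)
  have z: "sym_diff x y \<in> S i (Suc j)" using x(1) y(1) unfolding S_def by (rule SW_kset_sym_diff[OF fin])
  have zu: "cmp E1 (sym_diff x y) u ~= pI" using cmp_sym_diff[OF fin xV, of E1 u] x(2) y(2) by simp
  define v where "v = j div 2"
  have same: "kst R i j w = kst R i (Suc j) w" if "w ~= v \<or> w \<notin> R" for w
   using that by (auto simp: kst_def v_def)
  have viol: "v \<in> R & cmp E1 q v \<notin> kset (kst R i j) ?ax v" if q: "q \<in> S i (Suc j)" "q \<notin> S i j" for q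
  proof (rule ccontr)
   assume a: "\<not> ?thesis"
   have "cmp E1 q w \<in> kset (kst R i j) ?ax w" if w: "w \<in> ?V" for w
   proof (cases "w = v & w \<in> R")
    case True
    show ?thesis using a True by (elim conjE) (simp only: simp_thms de_Morgan_conj not_not)
   next
    case False
    hence "kset (kst R i j) ?ax w = kset (kst R i (Suc j)) ?ax w" using same[of w] by (simp add: kset_def)
    thus ?thesis using q(1) w by (auto simp: S_def SW_def)
   qed
   hence "q \<in> S i j" using q(1) by (simp add: S_def SW_def)
   thus False using q(2) by simp
  qed
  have vR: "v \<in> R" using viol[OF x(1)] notin[of x] x(2) by simp
  hence vV: "v \<in> ?V" using R(1) by blast
  have inW: "cmp E1 q v \<in> kset (kst R i (Suc j)) ?ax v" if "q \<in> S i (Suc j)" for q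
   using that vV by (simp add: S_def SW_def)
  have viol3: "cmp E1 x v \<notin> kset (kst R i j) ?ax v" "cmp E1 y v \<notin> kset (kst R i j) ?ax v"
   "cmp E1 (sym_diff x y) v \<notin> kset (kst R i j) ?ax v"
   using viol[OF x(1)] viol[OF y(1)] viol[OF z] notin[of x] notin[of y] notin[OF zu] x(2) y(2) by simp_all
  have sd: "cmp E1 (sym_diff x y) v = padd (cmp E1 x v) (cmp E1 y v)" by (rule cmp_sym_diff[OF fin xV])
  show False
  proof (cases "even j")
   case True
   hence k: "kst R i j v = 0" "kst R i (Suc j) v = 1" using vR by (auto simp: kst_def v_def)
   thus False using viol3 inW[OF x(1)] inW[OF y(1)] inW[OF z] sd by (auto simp: kset_def)
  next
   case False
   hence "j = 2 * v + 1" by (simp add: v_def)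
   hence k: "kst R i j v = 1" using vR by (simp add: kst_def)
   obtain p where p: "p = ?ax v" by simp
   have "p ~= pI" unfolding p by (rule axp_ne_pI)
   thus False using viol3 k sd unfolding kset_def p[symmetric]
    by (cases p; cases "cmp E1 x v"; cases "cmp E1 y v") (auto simp: padd_def)
  qed
 qed
 have img_const: "img ?V E1 (kset (kst R i j) ?ax) u = img ?V E1 (kset (kst R i 0) ?ax) u"
  if "i \<in> {1..n}" "j <= 2 * n" "u < i" "u \<notin> R" for i j u
  using that(2)
 proof (induction j)
  case (Suc j)
  thus ?case using img_step[OF that(1) Suc.prems that(3,4)] by simp
 qed simp
 \<comment> \<open>Freeing one more vertex outside \<open>R\<close> multiplies the cardinality by
   the size of the image there, which is the same at stages 0 and \<open>2 * n\<close>. So the whole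
   stabilizer group has the size of the product of its parts off and on \<open>R\<close>.\<close>
 have prod: "card (S i (2 * n)) = card (S i 0) * card (S 0 (2 * n))" if "i <= n" for i
  using that
 proof (induction i)
  case 0
  have "S 0 0 = {{}}"
  proof -
   have k0: "kset (kst R 0 0) ?ax u = {pI}" for u by (simp add: kset_def kst_def)
   have "x = {}" if "x \<in> S 0 0" for x
   proof -
    have x: "x \<subseteq> ?V" "!!u. u \<in> ?V ==> cmp E1 x u = pI" using that by (auto simp: S_def SW_def k0)
    have "u \<notin> x" if "u \<in> ?V" for u using x(2)[OF that] by (simp add: cmp_def)
    thus ?thesis using x(1) by blast
   qed
   thus ?thesis by (auto simp: S_def)
  qed
  thus ?case by simp
 next
  case (Suc i)
  show ?case
  proof (cases "i \<in> R")
   case True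
   hence "kst R (Suc i) j = kst R i j" for j
    by (auto simp: kst_def less_Suc_eq)
   thus ?thesis using Suc by (simp add: S_def)
  next
   case False
   have iV: "i \<in> ?V" "Suc i \<in> {1..n}" using Suc.prems by auto
   have fib: "{x \<in> S (Suc i) j. cmp E1 x i = pI} = S i j" for j
   proof -
    have k: "kset (kst R (Suc i) j) ?ax v = (if v = i then UNIV else kset (kst R i j) ?ax v)"
     "kset (kst R i j) ?ax i = {pI}" for v
     using False by (auto simp: kset_def kst_def)
    show ?thesis unfolding S_def SW_def using iV(1) k(2) by (auto simp: k(1) split: if_splits)
   qed
   have "card (S (Suc i) j) = card (img ?V E1 (kset (kst R (Suc i) j) ?ax) i) * card (S i j)" for j
    using SW_kset_card[OF fin, of E1 "kst R (Suc i) j" ?ax i] fib[of j] by (simp add: S_def)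
   thus ?thesis using Suc img_const[OF iV(2), of "2 * n" i] False by simp
  qed
 qed
 have "S n (2 * n) = Pow ?V"
 proof -
  have "kst R n (2 * n) v = 2" if "v \<in> ?V" for v using that by (auto simp: kst_def)
  hence "kset (kst R n (2 * n)) ?ax v = UNIV" if "v \<in> ?V" for v using that by (simp add: kset_def)
  thus ?thesis by (auto simp: S_def SW_def)
 qed
 hence total: "card (Pow ?V) = card (S n 0) * card (S 0 (2 * n))" using prod[of n] by simp
 let ?A = "S n 0" and ?B = "S 0 (2 * n)"
 have A: "x \<in> ?A \<longleftrightarrow> x \<subseteq> ?V & (\<forall>u\<in>R. cmp E1 x u = pI)" for x
  using R(1) by (auto simp: S_def SW_def kset_def kst_def)
 have B: "x \<in> ?B \<longleftrightarrow> x \<subseteq> ?V & (\<forall>u\<in>?V - R. cmp E1 x u = pI)" for x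
  using R(1) by (auto simp: S_def SW_def kset_def kst_def)
 let ?f = "%p :: nat set \<times> nat set. sym_diff (fst p) (snd p)"
 have AR: "x \<inter> R = {}" if "x \<in> ?A" for x using that unfolding A by (auto simp: cmp_def)
 have BR: "x \<subseteq> R" if "x \<in> ?B" for x using that unfolding B by (auto simp: cmp_def)
 have inj: "inj_on ?f (?A \<times> ?B)"
 proof (rule inj_on_inverseI[where g = "%z. (z - R, z \<inter> R)"])
  fix p assume "p \<in> ?A \<times> ?B"
  hence "fst p \<inter> R = {}" "snd p \<subseteq> R" using AR[of "fst p"] BR[of "snd p"] by (simp_all add: mem_Times_iff)
  hence "?f p - R = fst p" "?f p \<inter> R = snd p" by blast+
  thus "(?f p - R, ?f p \<inter> R) = p" by simp
 qed
 have "?f ` (?A \<times> ?B) \<subseteq> Pow ?V" using A B by auto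
 moreover have "card (?f ` (?A \<times> ?B)) = card (Pow ?V)"
  using card_image[OF inj] total by (simp add: card_cartesian_product)
 ultimately have surj: "?f ` (?A \<times> ?B) = Pow ?V" by (intro card_subset_eq) auto
 have no_edge: "nbr E1 j \<inter> R = {}" if j: "j \<in> ?V - R" for j
 proof -
  have "{j} \<in> ?f ` (?A \<times> ?B)" unfolding surj using j by simp
  then obtain p where p: "p \<in> ?A \<times> ?B" "{j} = ?f p" by (elim imageE) (metis)
  have "fst p \<inter> R = {}" "snd p \<subseteq> R" using p(1) AR[of "fst p"] BR[of "snd p"] by (simp_all add: mem_Times_iff)
  hence "fst p = {j}" using p(2) j by blast
  hence jA: "{j} \<in> ?A" using p(1) by (metis mem_Sigma_iff prod.collapse)
  have "u \<notin> nbr E1 j" if u: "u \<in> R" for u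
  proof
   assume "u \<in> nbr E1 j"
   hence "nbr E1 u \<inter> {j} = {j}" using nbr_sym by blast
   hence "cmp E1 {j} u ~= pI" by (simp add: cmp_def)
   thus False using jA u unfolding A by blast
  qed
  thus ?thesis by blast
 qed
 have "closed_in E1 R"
  unfolding closed_in_def
 proof (intro ballI subsetI)
  fix u w assume u: "u \<in> R" "w \<in> nbr E1 u"
  show "w \<in> R"
  proof (rule ccontr)
   assume "w \<notin> R"
   moreover have "w \<in> ?V" using u(2) nbr_subset[OF G] by blast
   ultimately have "nbr E1 w \<inter> R = {}" using no_edge by simp
   thus False using u nbr_sym by blast
  qed
 qed
 from conn[OF R this] have iso: "!!u. u \<in> ?V - R ==> nbr E1 u = {}" by blast
 obtain u where u: "u \<in> ?V - R" using neq R(1) by blast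
 \<comment> \<open>An isolated vertex is stabilized by \<open>X\<close> alone, so it would have been
   resolved with that axis.\<close>
 have "img ?V E1 (kset (kst R (Suc u) 0) ?ax) u = {pI, (True, False)}"
 proof
  show "img ?V E1 (kset (kst R (Suc u) 0) ?ax) u \<subseteq> {pI, (True, False)}"
   unfolding img_def using iso[OF u] by (auto simp: cmp_def)
  have "{u} \<in> SW ?V E1 (kset (kst R (Suc u) 0) ?ax)"
  proof -
   have "cmp E1 {u} w \<in> kset (kst R (Suc u) 0) ?ax w" if "w \<in> ?V" for w
   proof (cases "w = u")
    case True
    thus ?thesis using u by (simp add: kset_def kst_def)
   next
    case False
    have "nbr E1 w \<inter> {u} = {}" using iso[OF u] nbr_sym by blast
    hence "cmp E1 {u} w = pI" using False by (simp add: cmp_def)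
    thus ?thesis by simp
   qed
   thus ?thesis using u by (simp add: SW_def)
  qed
  hence "cmp E1 {u} u \<in> img ?V E1 (kset (kst R (Suc u) 0) ?ax) u" unfolding img_def by (rule imageI)
  moreover have "cmp E1 {u} u = (True, False)" using iso[OF u] by (simp add: cmp_def)
  moreover have "pI \<in> img ?V E1 (kset (kst R (Suc u) 0) ?ax) u"
   unfolding img_def by (rule image_eqI[of _ _ "{}"]) simp_all
  ultimately show "{pI, (True, False)} \<subseteq> img ?V E1 (kset (kst R (Suc u) 0) ?ax) u" by simp
 qed
 thus False using img2[of "Suc u" 0 u "(True, False)"] u by auto
qed

text \<open>The root is resolved at the start, so at most \<open>n - 1\<close> sweeps can enlarge
  \<open>R\<close>, and after \<open>n\<close> sweeps the state is stuck.\<close>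

lemma ploop_complete:
 assumes G: "simple_graph {..<n} E1" and R: "fst s \<subseteq> {..<n}" "r \<in> fst s"
  and conn: "!!T. T \<subseteq> {..<n} ==> r \<in> T ==> closed_in E1 T ==> (\<forall>u\<in>{..<n} - T. nbr E1 u = {})"
 shows "fst (ploop n E1 E2 n s) = {..<n}"
proof -
 let ?t = "ploop n E1 E2 n s"
 have sub: "fst (ploop n E1 E2 m s) \<subseteq> {..<n}" for m by (rule fst_loops_subset[OF R(1)])
 have mono: "fst s \<subseteq> fst (ploop n E1 E2 m s)" for m
 proof (induction m)
  case (Suc m)
  thus ?case using iloop_mono[of "ploop n E1 E2 m s" n E1 E2 n] by (auto simp: loop_Suc)
 qed (simp add: loop_0)
 from ploop_stuck_or_grows[OF R(1) sub, of n] show ?thesis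
 proof
  assume "stuck n E1 ?t"
  hence "stuck n E1 (fst ?t, fst (snd ?t), snd (snd ?t))" by simp
  from stuck_imp_all[OF G sub _ this conn] show ?thesis using mono R(2) by blast
 next
  assume le: "card (fst s) + n <= card (fst ?t)"
  have "card (fst s) > 0" using R finite_subset by (auto simp: card_gt_0_iff)
  hence "card (fst ?t) > n" using le by simp
  moreover have "card (fst ?t) <= n" using card_mono[OF _ sub[of n]] by simp
  ultimately show ?thesis by simp
 qed
qed

definition axes_ok :: "(nat => bool \<times> bool => bool \<times> bool => bool) => axes => bool" where
 "axes_ok P s \<longleftrightarrow> (\<forall>u\<in>fst s. P u (axp (fst (snd s) u)) (axp (snd (snd s) u)))"

lemma ploop_axes_ok:
 assumes lu: "lu_pair {..<n} E1 E2 m c" and R: "fst s \<subseteq> {..<n}"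
  and ok: "axes_ok (lu_pair.axis_map m) s"
 shows "axes_ok (lu_pair.axis_map m) (ploop n E1 E2 k s)"
proof -
 interpret lu_pair "{..<n}" E1 E2 m c by (rule lu)
 have step: "axes_ok axis_map (astep n E1 E2 i j s)"
  if ok: "axes_ok axis_map s" and i: "i <= n" for i j s
 proof -
  obtain R al be where s: "s = (R, al, be)" by (cases s)
  let ?N = "newly n E1 i j s"
  have N: "axis_map u (axp (cimg n E1 (Wst R al i j) u)) (axp (cimg n E2 (Wst R be i j) u))" if u: "u \<in> ?N" for u
  proof -
   have u': "u < i" "u \<notin> R" "cimg n E1 (Wst R al i j) u ~= 0" using u by (simp_all add: newly_def s)
   then obtain P where P: "P ~= pI" "img {..<n} E1 (Wst R al i j) u = {pI, P}"
    unfolding cimg_ne_0 by (elim exE conjE)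
   have k2: "kst R i j u = 2" using u' by (simp add: kst_def)
   have uV: "u \<in> {..<n}" using u' i by simp
   have ax: "axis_map w (axp (al w)) (axp (be w))" if "w \<in> {..<n}" "kst R i j w = 1" for w
    using ok that by (auto simp: axes_ok_def s kst_def split: if_splits)
   obtain Q where Q: "Q ~= pI" "img {..<n} E2 (kset (kst R i j) (%u. axp (be u))) u = {pI, Q}" "axis_map u P Q"
    using axis_transfer[of "kst R i j" "%u. axp (al u)" "%u. axp (be u)" u P, OF ax uV k2 P(1) P(2)[unfolded Wst_def]] .
   show ?thesis
    using cimg_eq[OF P] cimg_eq[OF Q(1) Q(2)[folded Wst_def]] Q(3) axp_pcode[OF P(1)] axp_pcode[OF Q(1)]
    by simp
  qed
  have "axis_map u (axp (if u \<in> ?N then cimg n E1 (Wst R al i j) u else al u))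
    (axp (if u \<in> ?N then cimg n E2 (Wst R be i j) u else be u))" if "u \<in> R \<union> ?N" for u
  proof (cases "u \<in> ?N")
   case True
   thus ?thesis using N by simp
  next
   case False
   thus ?thesis using ok that by (simp add: axes_ok_def s)
  qed
  thus ?thesis by (simp add: axes_ok_def astep_def Let_def s)
 qed
 have j: "axes_ok axis_map (jloop n E1 E2 i l s)" if "axes_ok axis_map s" "i <= n" for i l s
  by (induction l) (use that step in "auto simp: loop_0 loop_Suc")
 have i: "axes_ok axis_map (iloop n E1 E2 l s)" if "axes_ok axis_map s" "l <= n" for l s
  using that(2)
 proof (induction l)
  case (Suc l)
  thus ?case unfolding loop_Suc(2) by (intro j) simp_all
 qed (use that(1) in "simp add: loop_0")
 show ?thesis
  by (induction k) (use ok i in "auto simp: loop_0 loop_Suc")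
qed

definition seed_axes :: "nat => nat => nat => axes" where
 "seed_axes r p q = ({r}, (%u. if u = r then p else 0), (%u. if u = r then q else 0))"

definition solvable :: "nat => int => nat set set => nat set set => (nat => nat) => (nat => nat) => bool" where
 "solvable n M E1 E2 al be \<longleftrightarrow> (\<exists>s. lin_ok {..<n} M (gena al E1 {..<n}) (genc al E1 {..<n})
   (gena be E2 {..<n}) (genc be E2 {..<n}) s)"

definition root_test :: "nat => int => nat set set => nat set set => nat => nat => nat => bool" where
 "root_test n M E1 E2 r p q \<longleftrightarrow> (case ploop n E1 E2 n (seed_axes r p q) of (R, al, be) => solvable n M E1 E2 al be)"

lemma pt_mone: "pt mone q p = (if p = q then 1 else 0)"
proof -
 have "madj mone = mone" by (intro ext) (auto simp: madj_def mone_def)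
 thus ?thesis using mtr_tau[of p q] by (simp add: pt_def pco_mtr)
qed

text \<open>Wrong guesses do no harm, since any solution of the system yields a local unitary
  whatever the axes. Conversely the axes at \<open>r\<close> of a suitable unitary are among the
  nine guesses and propagate correctly. Vertices outside the component of \<open>r\<close> are kept
  as isolated ones, so that all components are handled on the same vertex set; \<open>conn\<close>
  expresses this.\<close>

theorem connected_LUc_iff:
 assumes G1: "simple_graph {..<n} E1" and G2: "simple_graph {..<n} E2" and r: "r < n"
  and conn: "!!T. T \<subseteq> {..<n} ==> r \<in> T ==> closed_in E1 T ==> (\<forall>u\<in>{..<n} - T. nbr E1 u = {} & nbr E2 u = {})"
  and k: "n < 2 ^ k" "k \<ge> 2"
 shows "LUc {..<n} E1 E2 \<longleftrightarrow> (\<exists>p\<in>{1, 2, 3}. \<exists>q\<in>{1, 2, 3}. root_test n (2 ^ k) E1 E2 r p q)"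
proof
 assume "\<exists>p\<in>{1, 2, 3}. \<exists>q\<in>{1, 2, 3}. root_test n (2 ^ k) E1 E2 r p q"
 then obtain p q where "root_test n (2 ^ k) E1 E2 r p q" by blast
 moreover obtain R al be where "ploop n E1 E2 n (seed_axes r p q) = (R, al, be)"
  by (cases "ploop n E1 E2 n (seed_axes r p q)")
 ultimately obtain s where "lin_ok {..<n} (2 ^ k) (gena al E1 {..<n}) (genc al E1 {..<n})
   (gena be E2 {..<n}) (genc be E2 {..<n}) s" unfolding root_test_def solvable_def by auto
 from lin_ok_imp_LUc[OF G1 G2 _ this] k(2) show "LUc {..<n} E1 E2" by simp
next
 assume LU: "LUc {..<n} E1 E2"
 have rV: "r \<in> {..<n}" using r by simp
 have "\<exists>m c P Q. c ~= 0 & lu_pair {..<n} E1 E2 m c & lu_pair.axis_map m r P Q"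
 proof -
  obtain m c where c: "c ~= 0" and m: "!!u. u \<in> {..<n} ==> uni (m u)"
   and eq: "!!y. y \<in> Pow {..<n} ==> lap {..<n} m (sgn_st E1) y = c * sgn_st E2 y"
   using LU unfolding LUc_def by blast
  have lu: "lu_pair {..<n} E1 E2 m c" by (rule lu_pair.intro[OF G1 G2 m eq])
  from lu_pair.seed[OF lu rV] show ?thesis
  proof
   assume "\<exists>P Q. lu_pair.axis_map m r P Q"
   thus ?thesis using lu c by blast
  next
   \<comment> \<open>On an isolated edge the given unitary may preserve no axis. Both graphs are
     then equal, and the identity, which preserves the axis \<open>X\<close>, takes its
     place.\<close>
   assume "\<exists>v\<in>{..<n}. nbr E1 r = {v} & nbr E1 v = {r} & nbr E2 r = {v} & nbr E2 v = {r}"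
   then obtain v where v: "v \<in> {..<n}" "nbr E1 r = {v}" "nbr E1 v = {r}" "nbr E2 r = {v}" "nbr E2 v = {r}" by blast
   have "closed_in E1 {r, v}" using v(2,3) by (auto simp: closed_in_def)
   from conn[OF _ _ this] rV v(1) have iso: "!!u. u \<in> {..<n} - {r, v} ==> nbr E1 u = {} & nbr E2 u = {}" by simp
   have nbrs: "nbr E1 u = nbr E2 u" for u
   proof (cases "u \<in> {..<n}")
    case True
    thus ?thesis using iso[of u] v(2-5) by (cases "u = r \<or> u = v") auto
   next
    case False
    have "w \<notin> nbr E u" if "simple_graph {..<n} E" for E w
     using False nbr_subset[OF that, of w] nbr_sym[of w E u] by blast
    thus ?thesis using G1 G2 by blast
   qed
   have sub: "Ea \<subseteq> Eb" if G: "simple_graph {..<n} Ea" and nb: "!!u. nbr Ea u = nbr Eb u" for Ea Eb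
   proof
    fix e assume e: "e \<in> Ea"
    hence "e ~= {}" using simple_graph_no_empty[OF G] by auto
    then obtain j where j: "j \<in> e" by blast
    from simple_graph_edge[OF G e j] obtain w where w: "e = {j, w}" "w \<in> nbr Ea j" by metis
    from w(2) have "w \<in> nbr Eb j" unfolding nb .
    thus "e \<in> Eb" unfolding w(1) nbr_def by simp
   qed
   have eqE: "E1 = E2" using sub[OF G1, of E2] sub[OF G2, of E1] nbrs by auto
   have "lap {..<n} (%_. mone) (sgn_st E1) y = 1 * sgn_st E2 y" if "y \<in> Pow {..<n}" for y
    using lap_mone[of "{..<n}" y] that eqE by simp
   hence lu1: "lu_pair {..<n} E1 E2 (%_. mone) 1"
    by (intro lu_pair.intro[OF G1 G2]) simp_all
   have "lu_pair.axis_map (%_. mone) r (True, False) (True, False)"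
    unfolding lu_pair.axis_map_def[OF lu1] by (simp add: pt_mone)
   thus ?thesis using lu1 by (intro exI[of _ "%_. mone"] exI[of _ 1] exI[of _ "(True, False)"]) simp
  qed
 qed
 then obtain m c P Q where c: "c ~= 0" and lu: "lu_pair {..<n} E1 E2 m c" and PQ: "lu_pair.axis_map m r P Q" by blast
 interpret lu_pair "{..<n}" E1 E2 m c by (rule lu)
 have ne: "P ~= pI" "Q ~= pI" using PQ by (simp_all add: axis_map_def)
 let ?s = "seed_axes r (pcode P) (pcode Q)"
 have fs: "fst ?s = {r}" by (simp add: seed_axes_def)
 have ok: "axes_ok axis_map ?s" using PQ by (simp add: axes_ok_def seed_axes_def axp_pcode ne)
 obtain R al be where t: "ploop n E1 E2 n ?s = (R, al, be)" by (cases "ploop n E1 E2 n ?s")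
 have "fst (ploop n E1 E2 n ?s) = {..<n}"
  by (rule ploop_complete[OF G1, of _ r]) (use fs r conn in auto)
 moreover have "axes_ok axis_map (ploop n E1 E2 n ?s)"
  by (rule ploop_axes_ok[OF lu _ ok]) (use fs r in auto)
 ultimately have "axis_map u (axp (al u)) (axp (be u))" if "u \<in> {..<n}" for u
  using that by (simp add: t axes_ok_def)
 from axes_imp_lin_ok[OF this c] k have "root_test n (2 ^ k) E1 E2 r (pcode P) (pcode Q)"
  by (simp add: root_test_def solvable_def t)
 thus "\<exists>p\<in>{1, 2, 3}. \<exists>q\<in>{1, 2, 3}. root_test n (2 ^ k) E1 E2 r p q"
  using pcode_range[OF ne(1)] pcode_range[OF ne(2)] by blast
qed

section \<open>A language with bounded loops\<close>

datatype expr = Num nat | Var nat | Plus expr expr | Minus expr expr | IfE expr expr expr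
 | Arr nat expr expr | Inp expr

datatype cmd = Assign nat expr | Put nat expr expr expr | Then cmd cmd (infixr ";;" 55)
 | Cond expr cmd cmd | For nat expr cmd | RepQ cmd | Nop

type_synonym store = "(nat => nat) \<times> (nat => nat => nat => nat)"

text \<open>All values are bounded by \<open>B\<close>: sums are truncated. The bounds \<open>16\<close> for constants and \<open>32\<close> for the number of
  arrays suffice for the program below and spare side conditions.\<close>

primrec eval :: "nat => (nat => nat) => store => expr => nat" where
 "eval B f s (Num k) = min k 16"
| "eval B f s (Var x) = fst s x"
| "eval B f s (Plus a b) = min (eval B f s a + eval B f s b) B"
| "eval B f s (Minus a b) = eval B f s a - eval B f s b"
| "eval B f s (IfE c a b) = (if eval B f s c ~= 0 then eval B f s a else eval B f s b)"
| "eval B f s (Arr a i j) = snd s (a mod 32) (eval B f s i) (eval B f s j)"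
| "eval B f s (Inp e) = f (eval B f s e)"

definition setv :: "nat => nat => store => store" where
 "setv x k s = ((fst s)(x := k), snd s)"

definition seta :: "nat => nat => nat => nat => store => store" where
 "seta a i j k s = (fst s, (%a' i' j'. if a' = a & i' = i & j' = j then k else snd s a' i' j'))"

primrec run :: "nat => nat => (nat => nat) => cmd => store => store" where
 "run B Q f (Assign x e) s = setv x (eval B f s e) s"
| "run B Q f (Put a i j e) s = seta (a mod 32) (eval B f s i) (eval B f s j) (eval B f s e) s"
| "run B Q f (p ;; q) s = run B Q f q (run B Q f p s)"
| "run B Q f (Cond e p q) s = (if eval B f s e ~= 0 then run B Q f p s else run B Q f q s)"
| "run B Q f (For x e p) s = fold (%i s. run B Q f p (setv x i s)) [0..<eval B f s e] s"
| "run B Q f (RepQ p) s = (run B Q f p ^^ Q) s"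
| "run B Q f Nop s = s"

section \<open>Compilation\<close>

type_synonym assn = "(nat => nat) => (nat => nat) => bool"

text \<open>Total correctness with a cost: \<open>k\<close> bounds the number of operations, all on numbers up to \<open>X\<close>.\<close>

definition ht :: "nat => assn => ram => nat => assn => bool" where
 "ht X P p k Q \<longleftrightarrow> (\<forall>R M. P R M -->
   (\<exists>t R' M'. exec p (R, M) t (R', M') & t <= k * (1 + 2 * bit_length X) & Q R' M'))"

lemma bit_length_mono: "a <= X ==> bit_length a <= bit_length X"
 by (rule floorlog_mono)

lemma htD: "ht X P p k Q ==> P R M ==> \<exists>t R' M'. exec p (R, M) t (R', M') & t <= k * (1 + 2 * bit_length X) & Q R' M'"
 unfolding ht_def by blast

lemma ht_mono:
 assumes "ht X P p k Q" "!!R M. P' R M ==> P R M" "k <= l" "!!R M. Q R M ==> Q' R M"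
 shows "ht X P' p l Q'"
 unfolding ht_def using htD[OF assms(1), OF assms(2)] mult_le_mono1[OF assms(3)] assms(4) by (meson le_trans)

lemma ht_pre: "ht X P p k Q ==> (!!R M. P' R M ==> P R M) ==> k <= l ==> ht X P' p l Q"
 by (rule ht_mono)

lemma ht_assm: "(!!R M. P R M ==> ht X P p k Q) ==> ht X P p k Q"
 unfolding ht_def by blast

text \<open>A basic instruction handles at most two numbers; a missing one is entered as 0, whose
  bit length is 0.\<close>

lemma ht_op:
 assumes "!!R M. P R M ==> \<exists>x y R' M'. x <= X & y <= X & exec p (R, M) (1 + bit_length x + bit_length y) (R', M') & Q R' M'"
 shows "ht X P p 1 Q"
 unfolding ht_def
proof (intro allI impI)
 fix R M assume "P R M"
 then obtain x y R' M' where *: "x <= X" "y <= X" "exec p (R, M) (1 + bit_length x + bit_length y) (R', M')" "Q R' M'"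
  using assms by blast
 hence "1 + bit_length x + bit_length y <= 1 * (1 + 2 * bit_length X)"
  using bit_length_mono[of x X] bit_length_mono[of y X] by simp
 thus "\<exists>t R' M'. exec p (R, M) t (R', M') & t <= 1 * (1 + 2 * bit_length X) & Q R' M'" using * by blast
qed

lemma ht_Skip: "ht X P Skip 1 P"
 by (rule ht_op) (use exec.Skip in "force intro!: exI[of _ 0] simp: floorlog_def")

lemma ht_Const: "ht X (%R M. c <= X & Q (R(i := c)) M) (Const i c) 1 Q"
 by (rule ht_op, rule exI[of _ c], rule exI[of _ 0]) (use exec.Const[of i c] in "fastforce simp: floorlog_def")

lemma ht_Add: "ht X (%R M. R j <= X & R k <= X & Q (R(i := R j + R k)) M) (Add i j k) 1 Q"
 by (rule ht_op) (use exec.Add in blast)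

lemma ht_Sub: "ht X (%R M. R j <= X & R k <= X & Q (R(i := R j - R k)) M) (Sub i j k) 1 Q"
 by (rule ht_op) (use exec.Sub in blast)

lemma ht_Load: "ht X (%R M. R j <= X & M (R j) <= X & Q (R(i := M (R j))) M) (Load i j) 1 Q"
 by (rule ht_op) (use exec.Load in blast)

lemma ht_Store: "ht X (%R M. R i <= X & R j <= X & Q R (M(R i := R j))) (Store i j) 1 Q"
 by (rule ht_op) (use exec.Store in blast)

lemma ht_Seq:
 assumes "ht X P' q l Q" "ht X P p k P'"
 shows "ht X P (Seq p q) (k + l) Q"
 unfolding ht_def
proof (intro allI impI)
 fix R M assume "P R M"
 then obtain t R1 M1 where 1: "exec p (R, M) t (R1, M1)" "t <= k * (1 + 2 * bit_length X)" "P' R1 M1"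
  using htD[OF assms(2)] by blast
 obtain u R2 M2 where 2: "exec q (R1, M1) u (R2, M2)" "u <= l * (1 + 2 * bit_length X)" "Q R2 M2"
  using htD[OF assms(1), OF 1(3)] by blast
 have "t + u <= (k + l) * (1 + 2 * bit_length X)" unfolding add_mult_distrib by (rule add_mono[OF 1(2) 2(2)])
 thus "\<exists>t R' M'. exec (Seq p q) (R, M) t (R', M') & t <= (k + l) * (1 + 2 * bit_length X) & Q R' M'"
  using exec.Seq[OF 1(1) 2(1)] 2(3) by blast
qed

lemmas ht_intros = ht_Seq ht_Const ht_Add ht_Sub ht_Load ht_Store

lemma ht_If:
 assumes X: "!!R M. P R M ==> R i <= X"
  and p: "ht X (%R M. P R M & R i ~= 0) p k Q" and q: "ht X (%R M. P R M & R i = 0) q l Q"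
 shows "ht X P (IfNZ i p q) (1 + (k + l)) Q"
 unfolding ht_def
proof (intro allI impI)
 fix R M assume P: "P R M"
 have "\<exists>t R' M'. exec (IfNZ i p q) (R, M) (1 + bit_length (R i) + t) (R', M') & t <= (k + l) * (1 + 2 * bit_length X) & Q R' M'"
 proof (cases "R i = 0")
  case True
  thus ?thesis using htD[OF q, of R M] P exec.IfFalse[of R i q M _ _ p] by (fastforce simp: add_mult_distrib)
 next
  case False
  thus ?thesis using htD[OF p, of R M] P exec.IfTrue[of R i p M _ _ q] by (fastforce simp: add_mult_distrib)
 qed
 then obtain t R' M' where t: "exec (IfNZ i p q) (R, M) (1 + bit_length (R i) + t) (R', M')" "t <= (k + l) * (1 + 2 * bit_length X)" "Q R' M'"
  by blast
 have "1 + bit_length (R i) + t <= (1 + (k + l)) * (1 + 2 * bit_length X)"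
  using t(2) bit_length_mono[OF X[OF P]] by (simp add: add_mult_distrib)
 thus "\<exists>t R' M'. exec (IfNZ i p q) (R, M) t (R', M') & t <= (1 + (k + l)) * (1 + 2 * bit_length X) & Q R' M'"
  using t(1,3) by blast
qed

lemma ht_While:
 assumes i: "!!k R M. k <= m ==> I k R M ==> R i <= X & (R i = 0 \<longleftrightarrow> k = m)"
  and step: "!!k. k < m ==> ht X (I k) p c (I (Suc k))"
 shows "ht X (I 0) (WhileNZ i p) (m * (c + 1) + 1) (I m)"
proof -
 let ?b = "1 + 2 * bit_length X"
 have "ht X (I (m - d)) (WhileNZ i p) (d * (c + 1) + 1) (I m)" if "d <= m" for d using that
 proof (induction d)
  case 0
  show ?case
  proof (rule ht_mono[OF ht_op])
   fix R M assume "I (m - 0) R M"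
   thus "\<exists>x y R' M'. x <= X & y <= X & exec (WhileNZ i p) (R, M) (1 + bit_length x + bit_length y) (R', M') & I m R' M'"
    using exec.WhileFalse[of R i p M] i[of m R M] by (force intro!: exI[of _ 0] simp: floorlog_def)
  qed auto
 next
  case (Suc d)
  let ?k = "m - Suc d"
  have k: "?k < m" "Suc ?k = m - d" using Suc.prems by simp_all
  show ?case unfolding ht_def
  proof (intro allI impI)
   fix R M assume I: "I ?k R M"
   obtain t R1 M1 where 1: "exec p (R, M) t (R1, M1)" "t <= c * ?b" "I (m - d) R1 M1"
    using htD[OF step[OF k(1)], OF I] unfolding k(2) by blast
   obtain u R2 M2 where 2: "exec (WhileNZ i p) (R1, M1) u (R2, M2)" "u <= (d * (c + 1) + 1) * ?b" "I m R2 M2"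
    using htD[OF Suc.IH, OF _ 1(3)] Suc.prems by auto
   have Ri: "R i <= X" "R i ~= 0" using i[of ?k R M] k(1) I by simp_all
   have "1 + bit_length (R i) + t + u <= ?b + c * ?b + (d * (c + 1) + 1) * ?b"
    using 1(2) 2(2) bit_length_mono[OF Ri(1)] by (intro add_mono) simp_all
   also have "... = (Suc d * (c + 1) + 1) * ?b" by (simp add: add_mult_distrib)
   finally show "\<exists>t R' M'. exec (WhileNZ i p) (R, M) t (R', M') & t <= (Suc d * (c + 1) + 1) * ?b & I m R' M'"
    using exec.WhileTrue[of R i p M t "(R1, M1)" u "(R2, M2)", OF Ri(2) 1(1) 2(1)] 2(3) by blast
  qed
 qed
 from this[of m] show ?thesis by simp
qed

text \<open>The variables live in the even registers. Registers 1, 3, 5, 7, 9 hold \<open>B\<close>, \<open>0\<close>, \<open>Q\<close>, \<open>B + 1\<close> and \<open>1\<close>;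
  the other odd registers form an evaluation stack. The cells up to \<open>B\<close> keep the input.\<close>

abbreviation hid :: "nat => nat" where "hid d \<equiv> 2 * d + 11"

text \<open>The 32 arrays are interleaved, so an address arises from repeated addition of
  \<open>B + 1\<close>, five doublings and one addition. The offset \<open>B\<close> places them
  above the input cells.\<close>

definition addr :: "nat => nat => nat => nat => nat" where
 "addr B a i j = 32 * (B + j + i * (B + 1)) + a"

definition caddr :: "nat => nat => ram" where
 "caddr d a = Seq (Add (hid (d + 2)) 1 (hid (d + 1))) (Seq (WhileNZ (hid d) (Seq (Add (hid (d + 2)) (hid (d + 2)) 7)
   (Sub (hid d) (hid d) 9)))
  (Seq (Add (hid (d + 2)) (hid (d + 2)) (hid (d + 2))) (Seq (Add (hid (d + 2)) (hid (d + 2)) (hid (d + 2)))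
  (Seq (Add (hid (d + 2)) (hid (d + 2)) (hid (d + 2))) (Seq (Add (hid (d + 2)) (hid (d + 2)) (hid (d + 2)))
  (Seq (Add (hid (d + 2)) (hid (d + 2)) (hid (d + 2))) (Seq (Const (hid d) (a mod 32))
  (Add (hid d) (hid (d + 2)) (hid d)))))))))"

text \<open>The value is left in stack position \<open>d\<close>. A sum is truncated as
  \<open>x - (x - B)\<close>, which is \<open>min x B\<close> for natural numbers.\<close>

primrec cexp :: "nat => expr => ram" where
 "cexp d (Num k) = Const (hid d) (min k 16)"
| "cexp d (Var x) = Add (hid d) (2 * x) 3"
| "cexp d (Plus a b) = Seq (cexp d a) (Seq (cexp (d + 1) b) (Seq (Add (hid d) (hid d) (hid (d + 1)))
   (Seq (Sub (hid (d + 1)) (hid d) 1) (Sub (hid d) (hid d) (hid (d + 1))))))"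
| "cexp d (Minus a b) = Seq (cexp d a) (Seq (cexp (d + 1) b) (Sub (hid d) (hid d) (hid (d + 1))))"
| "cexp d (IfE c a b) = Seq (cexp d c) (IfNZ (hid d) (cexp d a) (cexp d b))"
| "cexp d (Arr a i j) = Seq (cexp d i) (Seq (cexp (d + 1) j) (Seq (caddr d a) (Load (hid d) (hid d))))"
| "cexp d (Inp e) = Seq (cexp d e) (Load (hid d) (hid d))"

primrec ecost :: "nat => expr => nat" where
 "ecost B (Num k) = 1"
| "ecost B (Var x) = 1"
| "ecost B (Plus a b) = ecost B a + (ecost B b + 3)"
| "ecost B (Minus a b) = ecost B a + (ecost B b + 1)"
| "ecost B (IfE c a b) = ecost B c + (1 + (ecost B a + ecost B b))"
| "ecost B (Arr a i j) = ecost B i + (ecost B j + (3 * B + 9 + 1))"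
| "ecost B (Inp e) = ecost B e + 1"

primrec ccmd :: "nat => cmd => ram" where
 "ccmd d (Assign x e) = Seq (cexp d e) (Add (2 * x) (hid d) 3)"
| "ccmd d (Put a i j e) = Seq (cexp d e) (Seq (cexp (d + 1) i) (Seq (cexp (d + 1 + 1) j) (Seq (caddr (d + 1) a)
   (Store (hid (d + 1)) (hid d)))))"
| "ccmd d (p ;; q) = Seq (ccmd d p) (ccmd d q)"
| "ccmd d (Cond e p q) = Seq (cexp d e) (IfNZ (hid d) (ccmd d p) (ccmd d q))"
| "ccmd d (For x e p) = Seq (cexp d e) (Seq (Const (hid (d + 1)) 0) (WhileNZ (hid d)
   (Seq (Add (2 * x) (hid (d + 1)) 3) (Seq (Add (hid (d + 1)) (hid (d + 1)) 9) (Seq (ccmd (d + 1 + 1) p)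
    (Sub (hid d) (hid d) 9))))))"
| "ccmd d (RepQ p) = Seq (Add (hid d) 5 3) (WhileNZ (hid d) (Seq (ccmd (d + 1) p) (Sub (hid d) (hid d) 9)))"
| "ccmd d Nop = Skip"

primrec ccost :: "nat => nat => cmd => nat" where
 "ccost B Q (Assign x e) = ecost B e + 1"
| "ccost B Q (Put a i j e) = ecost B e + (ecost B i + (ecost B j + (3 * B + 9 + 1)))"
| "ccost B Q (p ;; q) = ccost B Q p + ccost B Q q"
| "ccost B Q (Cond e p q) = ecost B e + (1 + (ccost B Q p + ccost B Q q))"
| "ccost B Q (For x e p) = ecost B e + (1 + (B * (ccost B Q p + 4) + 1))"
| "ccost B Q (RepQ p) = 1 + (Q * (ccost B Q p + 1 + 1) + 1)"
| "ccost B Q Nop = 1"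

section \<open>Correctness of the compiled code\<close>

locale ram_sim =
 fixes B Q X :: nat and f :: "nat => nat"
 assumes B: "16 <= B" and X: "32 * (2 * B + B * (B + 1)) + 32 <= X" and Q: "Q <= X"
  and f: "!!k. k <= B ==> f k <= B"
begin

definition st :: "store => nat => (nat => nat) => assn" where
 "st s d h R M \<longleftrightarrow> (\<forall>x. R (2 * x) = fst s x & fst s x <= B) & R 1 = B & R 3 = 0 & R 5 = Q & R 7 = B + 1 & R 9 = 1 \<and>
  (\<forall>k\<le>B. M k = f k) & (\<forall>a<32. \<forall>i\<le>B. \<forall>j\<le>B. M (addr B a i j) = snd s a i j & snd s a i j <= B) \<and>
  (\<forall>e<d. R (hid e) = h e)"

lemma X_ge: "B <= X" "2 * B <= X" "B + 1 <= X" "16 <= X"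
 using B X by auto

lemma stD:
 assumes "st s d h R M"
 shows "R (2 * x) = fst s x" "fst s x <= B" "R 1 = B" "R 3 = 0" "R 5 = Q" "R 7 = B + 1" "R 9 = 1" "k <= B ==> M k = f k"
  "a < 32 ==> i <= B ==> j <= B ==> M (addr B a i j) = snd s a i j"
  "a < 32 ==> i <= B ==> j <= B ==> snd s a i j <= B" "e < d ==> R (hid e) = h e"
 using assms unfolding st_def by blast+

lemma st_keep:
 assumes "st s d h R M" "!!y. even y \<or> y < 11 ==> R' y = R y" "!!e. e < d' ==> R' (hid e) = h' e"
 shows "st s d' h' R' M"
 using assms(1) assms(2)[of 1] assms(2)[of 3] assms(2)[of 5] assms(2)[of 7] assms(2)[of 9] assms(2)[of "2 * x" for x] assms(3)
 by (simp add: st_def)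

lemma eval_le: "st s d h R M ==> eval B f s e <= B"
proof (induction e)
 case (Num k)
 thus ?case using B by simp
next
 case (Arr a i j)
 thus ?case unfolding st_def by simp
next
 case (Minus a b)
 thus ?case using diff_le_self le_trans by (metis eval.simps(4))
qed (auto simp: st_def f)

lemma ht_caddr:
 assumes ij: "h d = i" "h (d + 1) = j" "i <= B" "j <= B"
 shows "ht X (st s (d + 1 + 1) h) (caddr d a) (3 * B + 9) (st s (d + 1) (h(d := addr B (a mod 32) i j)))"
proof -
 have bnd: "k * (B + 1) <= B * (B + 1)" if "k <= B" for k using that by (rule mult_le_mono1)
 let ?I = "%k R M. st s (d + 1) (h(d := i - k)) R M & R (hid (d + 2)) = B + j + k * (B + 1)"
 have loop: "ht X (?I 0) (WhileNZ (hid d) (Seq (Add (hid (d + 2)) (hid (d + 2)) 7) (Sub (hid d) (hid d) 9))) (i * (2 + 1) + 1) (?I i)"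
 proof (rule ht_While[where I = ?I])
  fix k R M assume k: "k <= i" and "?I k R M"
  hence "R (hid d) = i - k" using stD(11)[of s "d + 1" "h(d := i - k)" R M d] by simp
  thus "R (hid d) <= X & (R (hid d) = 0 \<longleftrightarrow> k = i)" using k ij(3) X_ge by auto
 next
  fix k assume k: "k < i"
  show "ht X (?I k) (Seq (Add (hid (d + 2)) (hid (d + 2)) 7) (Sub (hid d) (hid d) 9)) 2 (?I (Suc k))"
  proof (rule ht_pre, (rule ht_intros)+, goal_cases)
   case (1 R M)
   hence st: "st s (d + 1) (h(d := i - k)) R M" by simp
   have "R (hid d) = i - k" using stD(11)[OF st, of d] by simp
   thus ?case using 1 k ij stD(6,7)[OF st] stD(11)[OF st] bnd[of k] X X_ge
    by (auto intro!: st_keep[OF st] simp: less_Suc_eq)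
  qed simp
 qed
 have pre: "ht X (st s (d + 1 + 1) h) (Add (hid (d + 2)) 1 (hid (d + 1))) 1 (?I 0)"
 proof (rule ht_pre, rule ht_Add, goal_cases)
  case (1 R M)
  have "R (hid (d + 1)) = j" using stD(11)[OF 1, of "d + 1"] ij(2) by simp
  thus ?case using stD(11)[OF 1] ij X_ge by (auto intro!: st_keep[OF 1] simp: less_Suc_eq stD(3)[OF 1, simplified])
 qed simp
 define K where "K = B + j + i * (B + 1)"
 have K: "32 * K + 32 <= X" using X bnd[OF ij(3)] ij(4) by (simp add: K_def)
 let ?J = "%e R M. st s (d + 1) (h(d := 0)) R M & R (hid (d + 2)) = 2 ^ e * K"
 let ?dbl = "Add (hid (d + 2)) (hid (d + 2)) (hid (d + 2))"
 have dbl: "ht X (?J e) ?dbl 1 (?J (Suc e))" if "e <= 4" for e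
 proof (rule ht_pre, rule ht_Add, goal_cases)
  case (1 R M)
  have "2 ^ e * K <= 16 * K" by (rule mult_le_mono1) (use power_increasing[OF that, of "2 :: nat"] in simp)
  hence "2 ^ e * K <= X" using K by linarith
  thus ?case using 1 K stD(11)[OF conjunct1[OF 1]] by (auto intro!: st_keep[OF conjunct1[OF 1]])
 qed simp
 have fin: "ht X (?J (Suc (Suc (Suc (Suc (Suc 0)))))) (Seq (Const (hid d) (a mod 32)) (Add (hid d) (hid (d + 2)) (hid d))) 2
  (st s (d + 1) (h(d := addr B (a mod 32) i j)))"
 proof (rule ht_pre, (rule ht_intros)+, goal_cases)
  case (1 R M)
  thus ?case using K mod_less_divisor[of 32 a] stD(11)[OF conjunct1[OF 1]]
   by (auto intro!: st_keep[OF conjunct1[OF 1]] simp: less_Suc_eq addr_def K_def)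
 qed simp
 have "ht X (?J 0) (Seq ?dbl (Seq ?dbl (Seq ?dbl (Seq ?dbl (Seq ?dbl (Seq (Const (hid d) (a mod 32))
  (Add (hid d) (hid (d + 2)) (hid d)))))))) (1 + (1 + (1 + (1 + (1 + 2))))) (st s (d + 1) (h(d := addr B (a mod 32) i j)))"
  by (rule ht_Seq, (rule ht_Seq)+, rule fin, (rule dbl, simp)+)
 hence "ht X (?I i) (Seq ?dbl (Seq ?dbl (Seq ?dbl (Seq ?dbl (Seq ?dbl (Seq (Const (hid d) (a mod 32))
  (Add (hid d) (hid (d + 2)) (hid d)))))))) 7 (st s (d + 1) (h(d := addr B (a mod 32) i j)))"
  by (rule ht_mono) (simp_all add: K_def)
 note ht_Seq[OF ht_Seq[OF this loop] pre]
 thus ?thesis unfolding caddr_def by (rule ht_mono) (use ij in simp_all)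
qed

lemma addr_le: "i <= B ==> j <= B ==> addr B (a mod 32) i j <= X"
proof -
 assume "i <= B" "j <= B"
 hence "i * (B + 1) <= B * (B + 1)" "j <= B" "a mod 32 < 32" by (simp_all only: mult_le_mono1 mod_less_divisor zero_less_numeral)
 moreover have "32 * (B + j + y) + c <= X" if "y <= B * (B + 1)" "j <= B" "c < 32" for y c
  using that X by simp
 ultimately show ?thesis unfolding addr_def by blast
qed

lemma ht_branch:
 fixes s c
 defines "e \<equiv> eval B f s c"
 assumes p: "e ~= 0 ==> ht X (st s d h) p k T" and q: "e = 0 ==> ht X (st s d h) q l T"
 shows "ht X (st s (d + 1) (h(d := e))) (IfNZ (hid d) p q) (1 + (k + l)) T"
proof (rule ht_If)
 have e: "R (hid d) = e" "e <= X" "st s d h R M" if "st s (d + 1) (h(d := e)) R M" for R M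
  using stD(11)[OF that, of d] eval_le[OF that, of c] X_ge stD(11)[OF that] st_keep[OF that, of R d h]
  by (simp_all add: e_def less_Suc_eq)
 thus "R (hid d) <= X" if "st s (d + 1) (h(d := e)) R M" for R M using that by auto
 show "ht X (%R M. st s (d + 1) (h(d := e)) R M & R (hid d) ~= 0) p k T"
  by (rule ht_assm, rule ht_mono[OF p]) (use e in auto)
 show "ht X (%R M. st s (d + 1) (h(d := e)) R M & R (hid d) = 0) q l T"
  by (rule ht_assm, rule ht_mono[OF q]) (use e in auto)
qed

lemma cexp_correct: "ht X (st s d h) (cexp d e) (ecost B e) (st s (d + 1) (h(d := eval B f s e)))"
proof (induction e arbitrary: d h)
 case (Num k)
 show ?case unfolding cexp.simps ecost.simps eval.simps
 proof (rule ht_pre, rule ht_Const, goal_cases)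
  case (1 R M)
  thus ?case using X_ge stD(11)[OF 1] by (auto intro!: st_keep[OF 1] simp: less_Suc_eq)
 qed simp
next
 case (Var x)
 show ?case unfolding cexp.simps ecost.simps eval.simps
 proof (rule ht_pre, rule ht_Add, goal_cases)
  case (1 R M)
  thus ?case using X_ge stD(1,2)[OF 1, of x] stD(4,11)[OF 1] by (auto intro!: st_keep[OF 1] simp: less_Suc_eq)
 qed simp
next
 case (Plus a b)
 let ?a = "eval B f s a" and ?b = "eval B f s b"
 have "ht X (st s (d + 1 + 1) (h(d := ?a, d + 1 := ?b))) (Seq (Add (hid d) (hid d) (hid (d + 1)))
   (Seq (Sub (hid (d + 1)) (hid d) 1) (Sub (hid d) (hid d) (hid (d + 1))))) 3 (st s (d + 1) (h(d := min (?a + ?b) B)))"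
 proof (rule ht_pre, (rule ht_intros)+, goal_cases)
  case (1 R M)
  have R: "R (hid d) = ?a" "R (hid (d + 1)) = ?b" using stD(11)[OF 1, of d] stD(11)[OF 1, of "d + 1"] by simp_all
  show ?case using X_ge stD(11)[OF 1] eval_le[OF 1, of a] eval_le[OF 1, of b] R
   by (auto intro!: st_keep[OF 1] simp: less_Suc_eq stD(3)[OF 1, simplified])
 qed simp
 thus ?case unfolding cexp.simps ecost.simps eval.simps by (rule ht_Seq[OF ht_Seq]) (rule Plus)+
next
 case (Minus a b)
 let ?a = "eval B f s a" and ?b = "eval B f s b"
 have "ht X (st s (d + 1 + 1) (h(d := ?a, d + 1 := ?b))) (Sub (hid d) (hid d) (hid (d + 1))) 1 (st s (d + 1) (h(d := ?a - ?b)))"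
 proof (rule ht_pre, rule ht_Sub, goal_cases)
  case (1 R M)
  have R: "R (hid d) = ?a" "R (hid (d + 1)) = ?b" using stD(11)[OF 1, of d] stD(11)[OF 1, of "d + 1"] by simp_all
  show ?case using X_ge stD(11)[OF 1] eval_le[OF 1, of a] eval_le[OF 1, of b] R
   by (auto intro!: st_keep[OF 1] simp: less_Suc_eq)
 qed simp
 thus ?case unfolding cexp.simps ecost.simps eval.simps by (rule ht_Seq[OF ht_Seq]) (rule Minus)+
next
 case (IfE c a b)
 show ?case unfolding cexp.simps ecost.simps eval.simps
  by (rule ht_Seq, rule ht_branch[where s = s and c = c and h = h]) (use IfE[of d h] in "simp_all del: fun_upd_apply")
next
 case (Arr a i j)
 show ?case
 proof (rule ht_assm)
  fix R M assume "st s d h R M"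
  note le = eval_le[OF this]
  let ?i = "eval B f s i" and ?j = "eval B f s j"
  have "ht X (st s (d + 1) (h(d := ?i, d + 1 := ?j, d := addr B (a mod 32) ?i ?j))) (Load (hid d) (hid d)) 1
   (st s (d + 1) (h(d := snd s (a mod 32) ?i ?j)))"
  proof (rule ht_pre, rule ht_Load, goal_cases)
   case (1 R M)
   have R: "R (hid d) = addr B (a mod 32) ?i ?j" using stD(11)[OF 1, of d] by simp
   show ?case using X_ge stD(11)[OF 1] stD(9,10)[OF 1 _ le[of i] le[of j], of "a mod 32"] addr_le[OF le[of i] le[of j], of a] R
    by (auto intro!: st_keep[OF 1] simp: less_Suc_eq)
  qed simp
  moreover have "ht X (st s (d + 1 + 1) (h(d := ?i, d + 1 := ?j))) (caddr d a) (3 * B + 9)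
   (st s (d + 1) (h(d := ?i, d + 1 := ?j, d := addr B (a mod 32) ?i ?j)))"
   by (rule ht_caddr) (simp_all add: le)
  ultimately show ?thesis unfolding cexp.simps ecost.simps eval.simps
   by (rule ht_Seq[OF ht_Seq[OF ht_Seq]]) (rule Arr)+
 qed
next
 case (Inp e)
 have "ht X (st s (d + 1) (h(d := eval B f s e))) (Load (hid d) (hid d)) 1 (st s (d + 1) (h(d := f (eval B f s e))))"
 proof (rule ht_pre, rule ht_Load, goal_cases)
  case (1 R M)
  note le = eval_le[OF 1, of e]
  have "R (hid d) = eval B f s e" using stD(11)[OF 1, of d] by simp
  thus ?case using X_ge stD(11)[OF 1] stD(8)[OF 1 le] f[OF le] le by (auto intro!: st_keep[OF 1] simp: less_Suc_eq)
 qed simp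
 thus ?case unfolding cexp.simps ecost.simps eval.simps by (rule ht_Seq) (rule Inp)
qed

lemma addr_inj:
 assumes "a < 32" "a' < 32" "j <= B" "j' <= B" "addr B a i j = addr B a' i' j'"
 shows "a = a' & i = i' & j = j'"
proof -
 have "(32 * k + b) mod 32 = b" if "b < 32" for k b :: nat using that by simp
 hence "addr B a i j mod 32 = a" "addr B a' i' j' mod 32 = a'" using assms(1,2) unfolding addr_def by blast+
 hence "a = a'" using assms(5) by simp
 moreover from this have "j + i * (B + 1) = j' + i' * (B + 1)" using assms by (simp add: addr_def)
 hence "(j + i * (B + 1)) mod (B + 1) = (j' + i' * (B + 1)) mod (B + 1)"
  "(j + i * (B + 1)) div (B + 1) = (j' + i' * (B + 1)) div (B + 1)" by simp_all
 hence "i = i' & j = j'" using assms(3,4) by (simp only: mod_mult_self1 div_mult_self1) simp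
 ultimately show ?thesis using assms(5) by simp
qed

lemma st_setv:
 assumes st: "st s d h R M" and k: "k <= B" and d: "e <= d"
 shows "st (setv x k s) e h (R(2 * x := k)) M"
proof -
 have "odd y ==> (R(2 * x := k)) y = R y" for y by auto
 from this[of 1] this[of 3] this[of 5] this[of 7] this[of 9] this[of "hid c" for c] show ?thesis
  using st k d unfolding st_def setv_def by auto
qed

lemma st_seta:
 assumes st: "st s d h R M" and k: "a < 32" "i <= B" "j <= B" "k <= B" and d: "e <= d"
 shows "st (seta a i j k s) e h R (M(addr B a i j := k))"
proof -
 have "addr B a i j > B" using B by (simp add: addr_def)
 hence lo: "(M(addr B a i j := k)) l = f l" if "l <= B" for l using stD(8)[OF st that] that by simp
 have hi: "(M(addr B a i j := k)) (addr B a' i' j') = snd (seta a i j k s) a' i' j' & snd (seta a i j k s) a' i' j' <= B"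
  if "a' < 32" "i' <= B" "j' <= B" for a' i' j'
  using stD(9,10)[OF st that] addr_inj[OF that(1) k(1) that(3) k(3), of i' i] k(4) unfolding seta_def by auto
 show ?thesis unfolding st_def using stD(1-7,11)[OF st] lo hi d by (simp add: seta_def)
qed

lemma ht_dec:
 assumes "e < d" "h e <= X" "h' = h(e := h e - 1)"
 shows "ht X (st s d h) (Sub (hid e) (hid e) 9) 1 (st s d h')"
proof (rule ht_pre, rule ht_Sub, goal_cases)
 case (1 R M)
 thus ?case using assms stD(7,11)[OF 1] X_ge by (auto intro!: st_keep[OF 1])
qed simp

lemma ccmd_correct: "ht X (st s d h) (ccmd d p) (ccost B Q p) (st (run B Q f p s) d h)"
proof (induction p arbitrary: d s h)
 case (Assign x e)
 have "ht X (st s (d + 1) (h(d := eval B f s e))) (Add (2 * x) (hid d) 3) 1 (st (setv x (eval B f s e) s) d h)"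
 proof (rule ht_pre, rule ht_Add, goal_cases)
  case (1 R M)
  have "R (hid d) = eval B f s e" using stD(11)[OF 1, of d] by simp
  moreover have "st s d h R M" by (rule st_keep[OF 1]) (use stD(11)[OF 1] in "auto simp: less_Suc_eq")
  ultimately show ?case using st_setv[OF _ eval_le[OF 1] le_refl] stD(4)[OF 1] eval_le[OF 1, of e] X_ge by simp
 qed simp
 thus ?case unfolding ccmd.simps ccost.simps run.simps by (rule ht_Seq) (rule cexp_correct)
next
 case (Put a i j e)
 show ?case
 proof (rule ht_assm)
  fix R M assume "st s d h R M"
  note le = eval_le[OF this]
  let ?e = "eval B f s e" and ?i = "eval B f s i" and ?j = "eval B f s j"
  let ?h = "h(d := ?e, d + 1 := ?i, d + 1 + 1 := ?j)" and ?a = "addr B (a mod 32) ?i ?j"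
  have "ht X (st s (d + 1 + 1) (?h(d + 1 := ?a))) (Store (hid (d + 1)) (hid d)) 1 (st (seta (a mod 32) ?i ?j ?e s) d h)"
  proof (rule ht_pre, rule ht_Store, goal_cases)
   case (1 R M)
   have "R (hid d) = ?e" "R (hid (d + 1)) = ?a" using stD(11)[OF 1, of d] stD(11)[OF 1, of "d + 1"] by simp_all
   moreover have "st s d h R M" by (rule st_keep[OF 1]) (use stD(11)[OF 1] in "auto simp: less_Suc_eq")
   ultimately show ?case using st_seta[of s d h R M "a mod 32" ?i ?j ?e d] le[of i] le[of j] addr_le[OF le[of i] le[of j], of a] le[of e] X_ge by simp
  qed simp
  moreover have "ht X (st s (d + 1 + 1 + 1) ?h) (caddr (d + 1) a) (3 * B + 9) (st s (d + 1 + 1) (?h(d + 1 := ?a)))"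
   by (rule ht_caddr) (simp_all add: le)
  ultimately show ?thesis unfolding ccmd.simps ccost.simps run.simps
   by (rule ht_Seq[OF ht_Seq[OF ht_Seq[OF ht_Seq]]]) (rule cexp_correct)+
 qed
next
 case (Then p q)
 show ?case unfolding ccmd.simps ccost.simps run.simps by (rule ht_Seq) (rule Then)+
next
 case (Cond e p q)
 show ?case unfolding ccmd.simps ccost.simps
  by (rule ht_Seq, rule ht_branch[where s = s and c = e and h = h]) (use Cond[of s d h] cexp_correct[of s d h e] in "simp_all del: fun_upd_apply")
next
 case (For x e p)
 show ?case
 proof (rule ht_assm)
  fix R M assume st: "st s d h R M"
  let ?m = "eval B f s e" and ?d = "d + 1 + 1"
  have le: "?m <= B" by (rule eval_le[OF st])
  define S where "S k = fold (%i s. run B Q f p (setv x i s)) [0..<k] s" for k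
  let ?I = "%k. st (S k) ?d (h(d := ?m - k, d + 1 := k))"
  let ?b = "Seq (Add (2 * x) (hid (d + 1)) 3) (Seq (Add (hid (d + 1)) (hid (d + 1)) 9) (Seq (ccmd ?d p) (Sub (hid d) (hid d) 9)))"
  have "ht X (?I 0) (WhileNZ (hid d) ?b) (?m * (1 + (1 + (ccost B Q p + 1)) + 1) + 1) (?I ?m)"
  proof (rule ht_While[where I = ?I])
   fix k R M assume k: "k <= ?m" and "?I k R M"
   hence "R (hid d) = ?m - k" using stD(11)[of "S k" ?d _ R M d] by fastforce
   thus "R (hid d) <= X & (R (hid d) = 0 \<longleftrightarrow> k = ?m)" using k le X_ge by auto
  next
   fix k assume k: "k < ?m"
   let ?h = "h(d := ?m - k, d + 1 := Suc k)" and ?s = "setv x k (S k)"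
   have "ht X (?I k) (Add (2 * x) (hid (d + 1)) 3) 1 (st ?s ?d (h(d := ?m - k, d + 1 := k)))"
   proof (rule ht_pre, rule ht_Add, goal_cases)
    case (1 R M)
    have "R (hid (d + 1)) = k" using stD(11)[OF 1, of "d + 1"] by simp
    thus ?case using st_setv[OF 1 _ le_refl, of k x] stD(4)[OF 1] k le X_ge by simp
   qed simp
   moreover have "ht X (st ?s ?d (h(d := ?m - k, d + 1 := k))) (Add (hid (d + 1)) (hid (d + 1)) 9) 1 (st ?s ?d ?h)"
   proof (rule ht_pre, rule ht_Add, goal_cases)
    case (1 R M)
    have "R (13 + 2 * d) = k" using stD(11)[OF 1, of "d + 1"] by simp
    note [simp] = this stD(7,11)[OF 1]
    show ?case using k le X_ge by (auto intro!: st_keep[OF 1] simp: less_Suc_eq)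
   qed simp
   moreover have "ht X (st (S (Suc k)) ?d ?h) (Sub (hid d) (hid d) 9) 1 (?I (Suc k))"
    by (rule ht_dec) (use le X_ge in auto)
   moreover have "ht X (st ?s ?d ?h) (ccmd ?d p) (ccost B Q p) (st (S (Suc k)) ?d ?h)"
    using For[of ?s ?d ?h] by (simp add: S_def del: fun_upd_apply)
   ultimately show "ht X (?I k) ?b (1 + (1 + (ccost B Q p + 1))) (?I (Suc k))" by (blast intro: ht_Seq)
  qed
  moreover have "ht X (st s (d + 1) (h(d := ?m))) (Const (hid (d + 1)) 0) 1 (?I 0)"
  proof (rule ht_pre, rule ht_Const, goal_cases)
   case (1 R M)
   show ?case using stD(11)[OF 1] by (auto intro!: st_keep[OF 1] simp: less_Suc_eq S_def)
  qed simp
  ultimately have "ht X (st s d h) (Seq (cexp d e) (Seq (Const (hid (d + 1)) 0) (WhileNZ (hid d) ?b)))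
   (ecost B e + (1 + (?m * (1 + (1 + (ccost B Q p + 1)) + 1) + 1))) (?I ?m)"
   by (rule ht_Seq[OF ht_Seq]) (rule cexp_correct)
  thus ?thesis unfolding ccmd.simps ccost.simps run.simps S_def[symmetric]
  proof (rule ht_mono)
   fix R M assume I: "?I ?m R M"
   show "st (S ?m) d h R M" using st_keep[OF I, of R d h] stD(11)[OF I] by simp
  qed (use mult_le_mono1[OF le, of "ccost B Q p + 4"] in \<open>simp_all add: algebra_simps\<close>)
 qed
next
 case (RepQ p)
 let ?I = "%k. st ((run B Q f p ^^ k) s) (d + 1) (h(d := Q - k))"
 have "ht X (?I 0) (WhileNZ (hid d) (Seq (ccmd (d + 1) p) (Sub (hid d) (hid d) 9))) (Q * (ccost B Q p + 1 + 1) + 1) (?I Q)"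
 proof (rule ht_While[where I = ?I])
  fix k R M assume k: "k <= Q" and "?I k R M"
  hence "R (hid d) = Q - k" using stD(11)[of _ "d + 1" _ R M d] by fastforce
  thus "R (hid d) <= X & (R (hid d) = 0 \<longleftrightarrow> k = Q)" using k Q by auto
 next
  fix k
  have "ht X (st (run B Q f p ((run B Q f p ^^ k) s)) (d + 1) (h(d := Q - k))) (Sub (hid d) (hid d) 9) 1 (?I (Suc k))"
   unfolding funpow.simps comp_apply by (rule ht_dec) (use Q in auto)
  thus "ht X (?I k) (Seq (ccmd (d + 1) p) (Sub (hid d) (hid d) 9)) (ccost B Q p + 1) (?I (Suc k))"
   by (rule ht_Seq) (rule RepQ)
 qed
 moreover have "ht X (st s d h) (Add (hid d) 5 3) 1 (?I 0)"
 proof (rule ht_pre, rule ht_Add, goal_cases)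
  case (1 R M)
  show ?case using Q by (auto intro!: st_keep[OF 1] simp: stD(4,5,11)[OF 1] less_Suc_eq)
 qed simp
 ultimately have "ht X (st s d h) (ccmd d (RepQ p)) (ccost B Q (RepQ p)) (?I Q)" unfolding ccmd.simps ccost.simps by (rule ht_Seq)
 thus ?case
 proof (rule ht_mono)
  fix R M assume I: "?I Q R M"
  show "st (run B Q f (RepQ p) s) d h R M" using st_keep[OF I, of R d h] stD(11)[OF I] by simp
 qed simp_all
next
 case Nop
 show ?case using ht_Skip by simp
qed

end

subsection \<open>Setting up the machine\<close>

text \<open>The offset 4 makes \<open>lg n\<close> at least 2 and \<open>2 ^ lg n\<close> larger
  than \<open>n\<close>, as the bound on the denominators requires, while \<open>lg n\<close>
  exceeds the binary logarithm of \<open>n\<close> only by a constant.\<close>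

definition lg :: "nat => nat" where
 "lg n = (LEAST r. n + 4 <= 2 ^ r)"

lemma lg_ge: "n + 4 <= 2 ^ lg n"
 unfolding lg_def by (rule LeastI[of _ "n + 4"]) (simp add: less_imp_le)

lemma lg_less: "r < lg n ==> 2 ^ r < n + 4"
 unfolding lg_def using not_less_Least not_le by blast

lemma lg_le: "lg n <= n + 4"
 unfolding lg_def by (rule Least_le) (simp add: less_imp_le)

lemma lg_gt_0: "lg n \<ge> 2"
proof (rule ccontr)
 assume "\<not> lg n \<ge> 2"
 hence "lg n = 0 \<or> lg n = 1" by linarith
 thus False using lg_ge[of n] by auto
qed

lemma lg_upper: "2 ^ lg n <= 2 * (n + 3)"
proof -
 have "2 ^ (lg n - 1) < n + 4" using lg_gt_0[of n] by (intro lg_less) simp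
 moreover have "(2 :: nat) ^ lg n = 2 * 2 ^ (lg n - 1)" using lg_gt_0[of n] by (simp add: power_eq_if)
 ultimately show ?thesis by simp
qed

text \<open>Large enough for the \<open>2 * n\<^sup>2\<close> input cells, for
  \<open>2 * 2 ^ lg n\<close>, which bounds sums modulo \<open>2 ^ lg n\<close> before reduction,
  for the loop bound \<open>2 * n + 1\<close>, and for the constants up to 16.\<close>

definition bnd :: "nat => nat" where
 "bnd n = 2 * n\<^sup>2 + 4 * n + 20"

text \<open>The number of tuples of \<open>lg n\<close> digits, each a vertex or blank.\<close>

definition qpar :: "nat => nat" where
 "qpar n = (n + 1) ^ lg n"

definition xpar :: "nat => nat" where
 "xpar n = 32 * (2 * bnd n + bnd n * (bnd n + 1)) + 32 + qpar n"

definition init_store :: "nat => store" where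
 "init_store n = ((%_. 0)(0 := n, 1 := 2 ^ lg n, 2 := 2 ^ (lg n - 1), 3 := lg n), %_ _ _. 0)"

definition mult_loop :: "nat => nat => ram" where
 "mult_loop x y = WhileNZ 11 (Seq (Add x x y) (Sub 11 11 9))"

text \<open>Register 13 holds the truncated difference of \<open>n + 4\<close> and
  \<open>2 ^ k\<close>, hence vanishes first at \<open>k = lg n\<close>. Along the way registers 2,
  4, 6 (variables 1, 2, 3) and 5 collect \<open>2 ^ k\<close>, its half, \<open>k\<close> and
  \<open>(n + 1) ^ k\<close>.\<close>

definition power_loop :: ram where
 "power_loop = WhileNZ 13 (Seq (Add 4 2 3) (Seq (Add 2 2 2) (Seq (Add 6 6 9) (Seq (Const 17 0) (Seq (Add 11 0 9)
   (Seq (mult_loop 17 5) (Seq (Add 5 17 3) (Sub 13 15 2))))))))"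

definition prelude :: ram where
 "prelude = Seq (Const 9 1) (Seq (Add 11 0 3) (Seq (Const 13 0) (Seq (mult_loop 13 0) (Seq (Add 1 13 13) (Seq (Add 15 0 0)
   (Seq (Add 15 15 15) (Seq (Add 1 1 15) (Seq (Const 15 20) (Seq (Add 1 1 15) (Seq (Add 7 1 9)
   (Seq (Const 15 4) (Seq (Add 15 15 0) (Seq (Const 17 1) (Seq (Const 5 1) (Seq (Const 2 1) (Seq (Sub 13 15 2) power_loop))))))))))))))))"

lemma qpar_mono: "r <= lg n ==> (n + 1) ^ r <= qpar n"
 unfolding qpar_def by (rule power_increasing) simp_all

lemma xpar_ge: "qpar n <= xpar n" "bnd n + 1 <= xpar n" "k <= 4 * (n + 4) ==> k <= xpar n" "n * n <= xpar n" "2 * (n * n) + 4 * n + 21 <= xpar n"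
proof -
 have "bnd n + 1 <= 32 * (2 * bnd n + bnd n * (bnd n + 1)) + 32" by simp
 thus b: "bnd n + 1 <= xpar n" unfolding xpar_def by linarith
 show "qpar n <= xpar n" unfolding xpar_def by simp
 show "k <= 4 * (n + 4) ==> k <= xpar n" "n * n <= xpar n" "2 * (n * n) + 4 * n + 21 <= xpar n"
  using b unfolding bnd_def power2_eq_square by simp_all
qed

abbreviation at_state :: "(nat => nat) => (nat => nat) => assn" where
 "at_state \<rho> \<mu> \<equiv> %R M. R = \<rho> & M = \<mu>"

lemma at_Const: "k <= X & v = k ==> ht X (at_state R M) (Const i k) 1 (at_state (R(i := v)) M)"
 by (rule ht_pre[OF ht_Const]) simp_all

lemma at_Add: "R j <= X & R k <= X & v = R j + R k ==> ht X (at_state R M) (Add i j k) 1 (at_state (R(i := v)) M)"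
 by (rule ht_pre[OF ht_Add]) simp_all

lemma at_Sub: "R j <= X & R k <= X & v = R j - R k ==> ht X (at_state R M) (Sub i j k) 1 (at_state (R(i := v)) M)"
 by (rule ht_pre[OF ht_Sub]) simp_all

lemmas at_intros = at_Const at_Add at_Sub

lemma ht_mult_loop:
 assumes R: "R y = c & R 9 = 1 & m <= X & m * c <= X & c <= X & 1 <= X & v = m * c" and xy: "x \<notin> {9, 11}" "y \<notin> {x, 11}"
 shows "ht X (at_state (R(11 := m, x := 0)) M) (mult_loop x y) (m * 3 + 1) (at_state (R(11 := 0, x := v)) M)"
proof -
 let ?I = "%k. at_state (R(11 := m - k, x := k * c)) M"
 have "ht X (?I 0) (mult_loop x y) (m * (1 + 1 + 1) + 1) (?I m)" unfolding mult_loop_def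
 proof (rule ht_While[where I = ?I])
  fix k assume k: "k < m"
  have "k * c <= m * c" by (rule mult_le_mono1) (use k in simp)
  hence le: "k * c <= X" "m - k <= X" using R by linarith+
  have "R(11 := m - Suc k, x := Suc k * c) = R(11 := m - k, x := k * c, x := Suc k * c, 11 := m - Suc k)"
   using xy by (auto simp: fun_eq_iff)
  moreover have "ht X (?I k) (Seq (Add x x y) (Sub 11 11 9)) (1 + 1) (at_state (R(11 := m - k, x := k * c, x := Suc k * c, 11 := m - Suc k)) M)"
   by ((rule ht_Seq)+, (rule at_intros, use R xy k le in simp)+)
  ultimately show "ht X (?I k) (Seq (Add x x y) (Sub 11 11 9)) (1 + 1) (?I (Suc k))" by simp
 qed (use R xy in auto)
 thus ?thesis using R by (simp add: numeral_3_eq_3)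
qed

lemma ht_power_loop:
 assumes R: "R 0 = n & R 3 = 0 & R 9 = 1 & R 15 = n + 4"
  and R0: "R 17 = 1 & R 5 = 1 & R 2 = 1 & R 13 = 3 + n & R 4 = 0 & R 6 = 0 & R 11 = 0"
 defines "S \<equiv> %k. R(17 := (n + 1) ^ k, 5 := (n + 1) ^ k, 2 := 2 ^ k, 13 := n + 4 - 2 ^ k, 4 := 2 ^ k div 2, 6 := k, 11 := 0)"
 shows "ht (xpar n) (at_state R M) power_loop (lg n * (3 * n + 12) + 1) (at_state (S (lg n)) M)"
proof -
 let ?X = "xpar n" and ?I = "%k. at_state (S k) M"
 have "ht ?X (?I 0) power_loop (lg n * (1 + (1 + (1 + (1 + (1 + ((n + 1) * 3 + 1 + (1 + 1)))))) + 1) + 1) (?I (lg n))"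
  unfolding power_loop_def
 proof (rule ht_While[where I = ?I])
  fix k R' M' assume k: "k <= lg n" and I: "?I k R' M'"
  have "k = lg n \<longleftrightarrow> n + 4 <= 2 ^ k" using k lg_less[of k n] lg_ge[of n] by (cases "k = lg n") simp_all
  thus "R' 13 <= ?X & (R' 13 = 0 \<longleftrightarrow> k = lg n)" using I xpar_ge(3)[of "n + 4 - 2 ^ k" n] by (simp add: S_def)
 next
  fix k assume k: "k < lg n"
  have lt: "2 ^ k < n + 4" by (rule lg_less[OF k])
  have q: "(n + 1) ^ k <= ?X" "(n + 1) ^ Suc k <= ?X"
   using xpar_ge(1)[of n] qpar_mono[of k n] qpar_mono[of "Suc k" n] k by simp_all
  have X: "2 ^ k <= ?X" "2 * 2 ^ k <= ?X" "k <= ?X" "n <= ?X" "n + 1 <= ?X" "n + 4 <= ?X" "1 <= ?X"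
   using lt k lg_le[of n] by (intro xpar_ge(3); simp)+
  let ?S = "(S k)(4 := 2 ^ k, 2 := 2 ^ k + 2 ^ k, 6 := k + 1)"
  let ?T = "?S(11 := 0, 17 := (n + 1) ^ Suc k, 5 := (n + 1) ^ Suc k, 13 := n + 4 - 2 ^ Suc k)"
  have "?S(11 := n + 1, 17 := 0) = ?S(17 := 0, 11 := n + 1)" by (auto simp: fun_eq_iff)
  hence loop: "ht ?X (at_state (?S(17 := 0, 11 := n + 1)) M) (mult_loop 17 5) ((n + 1) * 3 + 1) (at_state (?S(11 := 0, 17 := (n + 1) ^ Suc k)) M)"
   using ht_mult_loop[of ?S 5 "(n + 1) ^ k" "n + 1" ?X "(n + 1) ^ Suc k" 17 M] R q X by (simp add: S_def)
  have "S (Suc k) = ?T" by (auto simp: fun_eq_iff S_def)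
  thus "ht ?X (?I k) (Seq (Add 4 2 3) (Seq (Add 2 2 2) (Seq (Add 6 6 9) (Seq (Const 17 0) (Seq (Add 11 0 9)
   (Seq (mult_loop 17 5) (Seq (Add 5 17 3) (Sub 13 15 2)))))))) (1 + (1 + (1 + (1 + (1 + ((n + 1) * 3 + 1 + (1 + 1))))))) (?I (Suc k))"
   by (simp only:) ((rule ht_Seq)+, (rule at_intros, use R q X in "simp add: S_def")+, rule loop,
    (rule at_intros, use R q X in "simp add: S_def")+)
 qed
 moreover have "S 0 = R" using R0 by (auto simp: S_def fun_upd_idem)
 ultimately show ?thesis by (simp add: algebra_simps)
qed

lemma ht_prelude:
 assumes inp: "!!k. inp k <= 1" "!!k. 2 * n\<^sup>2 <= k ==> inp k = 0"
 shows "ht (xpar n) (at_state ((%_. 0)(0 := n)) inp) prelude (lg n * (3 * n + 12) + 3 * n + 18)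
  (ram_sim.st (bnd n) (qpar n) inp (init_store n) 0 (%_. 0))"
proof -
 let ?X = "xpar n" and ?N = "n * n"
 interpret ram_sim "bnd n" "qpar n" ?X inp
 proof
  show "16 <= bnd n" by (simp add: bnd_def)
  show "32 * (2 * bnd n + bnd n * (bnd n + 1)) + 32 <= ?X" "qpar n <= ?X" by (simp_all add: xpar_def)
  show "inp k <= bnd n" for k using inp(1)[of k] by (simp add: bnd_def)
 qed
 let ?R = "(%_. 0 :: nat)(0 := n, 9 := 1)"
 let ?S = "?R(11 := 0, 13 := ?N, 1 := ?N + ?N, 15 := n + n, 15 := n + n + (n + n), 1 := ?N + ?N + (n + n + (n + n)),
  15 := 20, 1 := bnd n, 7 := bnd n + 1, 15 := 4, 15 := 4 + n, 17 := 1, 5 := 1, 2 := 1, 13 := 3 + n)"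
 let ?T = "%k. ?S(17 := (n + 1) ^ k, 5 := (n + 1) ^ k, 2 := 2 ^ k, 13 := n + 4 - 2 ^ k, 4 := 2 ^ k div 2, 6 := k, 11 := 0)"
 have b: "bnd n = ?N + ?N + (n + n + (n + n)) + 20" by (simp add: bnd_def power2_eq_square)
 have X: "?N <= ?X" "?N + ?N + (n + n + (n + n)) <= ?X" "n <= ?X" "n + n <= ?X" "1 <= ?X" "4 <= ?X" "20 <= ?X" "n + 4 <= ?X" "bnd n <= ?X"
  using xpar_ge(2)[of n] b by linarith+
 have loop: "ht ?X (at_state (?R(11 := n, 13 := 0)) inp) (mult_loop 13 0) (n * 3 + 1) (at_state (?R(11 := 0, 13 := ?N)) inp)"
  using ht_mult_loop[of ?R 0 n n ?X ?N 13 inp] X by simp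
 have "ht ?X (at_state ?S inp) power_loop (lg n * (3 * n + 12) + 1) (at_state (?T (lg n)) inp)" by (rule ht_power_loop) simp_all
 hence "ht ?X (at_state ((%_. 0)(0 := n)) inp) prelude (1 + (1 + (1 + (n * 3 + 1 + (1 + (1 + (1 + (1 + (1 + (1 + (1 + (1 + (1 + (1 + (1 + (1 + (1 +
   (lg n * (3 * n + 12) + 1)))))))))))))))))) (at_state (?T (lg n)) inp)"
  unfolding prelude_def by - ((rule ht_Seq)+, assumption, (rule at_intros, use X b in simp)+, rule loop, (rule at_intros, use X in simp)+)
 thus ?thesis
 proof (rule ht_mono)
  fix R' M assume st: "at_state (?T (lg n)) inp R' M"
  have "2 * x ~= 17" "2 * x ~= 15" "2 * x ~= 13" "2 * x ~= 11" "2 * x ~= 9" "2 * x ~= 7" "2 * x ~= 5" "2 * x ~= 1" for x :: nat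
   by presburger+
  moreover have "(2 :: nat) ^ lg n div 2 = 2 ^ (lg n - 1)" using lg_gt_0[of n] by (cases "lg n") simp_all
  ultimately have v: "R' (2 * x) = fst (init_store n) x" for x
   by (cases "x = 0 \<or> x = 1 \<or> x = 2 \<or> x = 3") (auto simp: st init_store_def)
  have "(2 :: nat) ^ (lg n - 1) <= 2 ^ lg n" by (rule power_increasing) simp_all
  hence "2 ^ (lg n - 1) <= 2 * (n + 3)" using lg_upper[of n] by (rule le_trans)
  hence le: "fst (init_store n) x <= bnd n" for x
   using lg_upper[of n] lg_le[of n] by (simp add: init_store_def bnd_def)
  have z: "inp (addr (bnd n) a i j) = 0" for a i j
   by (rule inp(2)) (simp add: addr_def bnd_def)
  show "st (init_store n) 0 (%_. 0) R' M" unfolding st_def using v le z st by (simp add: init_store_def qpar_def)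
 qed simp_all
qed

section \<open>Reasoning about programs\<close>

lemma setv_simps [simp]:
 "fst (setv x k s) y = (if y = x then k else fst s y)" "snd (setv x k s) = snd s"
 by (simp_all add: setv_def)

lemma seta_simps [simp]:
 "fst (seta a i j k s) = fst s"
 "snd (seta a i j k s) a' i' j' = (if a' = a & i' = i & j' = j then k else snd s a' i' j')"
 by (simp_all add: seta_def)

lemma seta_other: "b ~= a ==> snd (seta a i j k s) b = snd s b"
 by (simp add: seta_def fun_eq_iff)

primrec mv :: "cmd => nat set" where
 "mv (Assign x e) = {x}"
| "mv (Put a i j e) = {}"
| "mv (p ;; q) = mv p \<union> mv q"
| "mv (Cond e p q) = mv p \<union> mv q"
| "mv (For x e p) = insert x (mv p)"
| "mv (RepQ p) = mv p"
| "mv Nop = {}"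

primrec ma :: "cmd => nat set" where
 "ma (Assign x e) = {}"
| "ma (Put a i j e) = {a mod 32}"
| "ma (p ;; q) = ma p \<union> ma q"
| "ma (Cond e p q) = ma p \<union> ma q"
| "ma (For x e p) = ma p"
| "ma (RepQ p) = ma p"
| "ma Nop = {}"

lemma frame_v: "x \<notin> mv p ==> fst (run B Q f p s) x = fst s x"
proof (induction p arbitrary: s)
 case (For y e p)
 have "fst (fold (%i s. run B Q f p (setv y i s)) xs s) x = fst s x" for xs s
  using For by (induction xs arbitrary: s) auto
 thus ?case by simp
next
 case (RepQ p)
 have "fst ((run B Q f p ^^ k) s) x = fst s x" for k using RepQ by (induction k) auto
 thus ?case by simp
qed auto

lemma frame_a: "a \<notin> ma p ==> snd (run B Q f p s) a = snd s a"
proof (induction p arbitrary: s)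
 case (Put b i j e)
 thus ?case by (simp add: seta_other)
next
 case (For y e p)
 have "snd (fold (%i s. run B Q f p (setv y i s)) xs s) a = snd s a" for xs s
  using For by (induction xs arbitrary: s) auto
 thus ?case by simp
next
 case (RepQ p)
 have "snd ((run B Q f p ^^ k) s) a = snd s a" for k using RepQ by (induction k) auto
 thus ?case by simp
qed auto

text \<open>The invariant has to speak only of what the body changes: variables outside
  \<open>mv\<close> and arrays outside \<open>ma\<close> are known in each round to have their
  initial values.\<close>

lemma run_For:
 assumes m: "eval B f s e = m" and 0: "I 0 s"
  and step: "!!i s'. i < m ==> (!!y. y \<notin> mv (For x e p) ==> fst s' y = fst s y) ==> (!!a. a \<notin> ma p ==> snd s' a = snd s a) ==>
   I i s' ==> I (Suc i) (run B Q f p (setv x i s'))"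
 shows "I m (run B Q f (For x e p) s)"
proof -
 let ?S = "%k. fold (%i s. run B Q f p (setv x i s)) [0..<k] s"
 have "I k (?S k) & (\<forall>y. y \<notin> mv (For x e p) --> fst (?S k) y = fst s y) & (\<forall>a. a \<notin> ma p --> snd (?S k) a = snd s a)"
  if "k <= m" for k
  using that
 proof (induction k)
  case (Suc k)
  hence IH: "I k (?S k)" "!!y. y \<notin> mv (For x e p) ==> fst (?S k) y = fst s y" "!!a. a \<notin> ma p ==> snd (?S k) a = snd s a"
   by simp_all
  have e: "?S (Suc k) = run B Q f p (setv x k (?S k))" by simp
  show ?case unfolding e using step[OF _ IH(2) IH(3) IH(1)] IH(2,3) Suc.prems by (simp add: frame_v frame_a)
 qed (use 0 in simp)
 thus ?thesis using m by simp
qed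

lemma run_RepQ:
 assumes 0: "I 0 s"
  and step: "!!i s'. i < Q ==> (!!y. y \<notin> mv p ==> fst s' y = fst s y) ==> (!!a. a \<notin> ma p ==> snd s' a = snd s a) ==>
   I i s' ==> I (Suc i) (run B Q f p s')"
 shows "I Q (run B Q f (RepQ p) s)"
proof -
 let ?S = "%k. (run B Q f p ^^ k) s"
 have "I k (?S k) & (\<forall>y. y \<notin> mv p --> fst (?S k) y = fst s y) & (\<forall>a. a \<notin> ma p --> snd (?S k) a = snd s a)" if "k <= Q" for k
  using that
 proof (induction k)
  case (Suc k)
  hence IH: "I k (?S k)" "!!y. y \<notin> mv p ==> fst (?S k) y = fst s y" "!!a. a \<notin> ma p ==> snd (?S k) a = snd s a"
   by simp_all
  have e: "?S (Suc k) = run B Q f p (?S k)" by simp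
  show ?case unfolding e using step[OF _ IH(2) IH(3) IH(1)] IH(2,3) Suc.prems by (simp add: frame_v frame_a)
 qed (use 0 in simp)
 thus ?thesis by simp
qed

definition ltE :: "expr => expr => expr" where
 "ltE a b = Minus b a"

definition eqE :: "expr => expr => expr" where
 "eqE a b = IfE (Minus a b) (Num 0) (IfE (Minus b a) (Num 0) (Num 1))"

text \<open>Variable 4 holds the modulus; for reduced summands a single subtraction reduces the
  sum.\<close>

definition addm :: "expr => expr => expr" where
 "addm a b = IfE (ltE (Plus a b) (Var 4)) (Plus a b) (Minus (Plus a b) (Var 4))"

lemma eval_ltE [simp]: "eval B f s (ltE a b) = eval B f s b - eval B f s a"
 by (simp add: ltE_def)

lemma eval_eqE [simp]: "eval B f s (eqE a b) = of_bool (eval B f s a = eval B f s b)"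
 by (simp add: eqE_def)

lemma eval_addm:
 assumes "eval B f s a < m" "eval B f s b < m" "fst s 4 = m" "2 * m <= B"
 shows "eval B f s (addm a b) = (eval B f s a + eval B f s b) mod m"
proof -
 let ?x = "eval B f s a + eval B f s b"
 have "?x <= B" using assms by linarith
 hence "eval B f s (addm a b) = (if ?x < m then ?x else ?x - m)"
  using assms(3) by (simp add: addm_def min_def)
 also have "... = ?x mod m" using assms(1,2) by (simp add: mod_if)
 finally show ?thesis .
qed

section \<open>Kernels modulo powers of two\<close>

text \<open>Subgroups of the vectors modulo \<open>M\<close> are stored by exactly \<open>N\<close>
  generators, dependent ones allowed, so the storage never grows.\<close>

definition gen_span :: "nat => nat => (nat => nat => nat) => (nat => int) set" where
 "gen_span N M G = {x. \<exists>c. \<forall>z<N. int M dvd x z - (\<Sum>i<N. c i * int (G i z))}"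

definition dotp :: "nat => (nat => nat) => (nat => int) => int" where
 "dotp N e x = (\<Sum>z<N. int (e z) * x z)"

lemma dvd_iff_diff: "(m :: int) dvd a - b ==> m dvd a \<longleftrightarrow> m dvd b"
 using dvd_add_right_iff[of m "a - b" b] by simp

lemma dotp_cong: "(!!z. z < N ==> int M dvd x z - y z) ==> int M dvd dotp N e x - dotp N e y"
 unfolding dotp_def sum_subtractf[symmetric] right_diff_distrib[symmetric]
 by (rule dvd_sum) simp

lemma dotp_sum: "dotp N e (%z. \<Sum>i<N. c i * g i z) = (\<Sum>i<N. c i * dotp N e (g i))"
 unfolding dotp_def sum_distrib_left by (subst sum.swap) (intro sum.cong refl mult.left_commute)

text \<open>One step of the elimination, for a linear form that takes only the values \<open>0\<close> and \<open>M / 2\<close> on the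
  generators: a generator on which it does not vanish is added to all others of this kind, and then doubled.\<close>

lemma gen_span_half:
 assumes M: "M = 2 * H" "H > 0"
  and w: "!!i. i < N ==> int H dvd dotp N F (%z. int (g i z))"
  and p: "p < N & \<not> int M dvd dotp N F (%z. int (g p z)) \<or> p = N & (\<forall>i<N. int M dvd dotp N F (%z. int (g i z)))"
  and g': "!!i z. i < N ==> z < N ==> g' i z = (if i = p then 2 * g p z mod M
   else if int M dvd dotp N F (%z. int (g i z)) then g i z else (g i z + g p z) mod M)"
 shows "gen_span N M g' = {x \<in> gen_span N M g. int M dvd dotp N F x}"
proof -
 let ?w = "%i. dotp N F (%z. int (g i z))"
 \<comment> \<open>Modulo \<open>M\<close> the form takes the value \<open>b i * H\<close> on
   generator \<open>i\<close>, so on a combination with coefficients \<open>c\<close> it vanishes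
   exactly if the sum of \<open>c i * b i\<close> is even.\<close>
 define b where "b i = (if int M dvd ?w i then 0 else 1 :: int)" for i
 have wb: "int M dvd ?w i - b i * int H" if i: "i < N" for i
 proof (cases "int M dvd ?w i")
  case False
  obtain q where q: "?w i = int H * q" using w[OF i] by blast
  have "odd q" using False unfolding q M(1) by auto
  hence "even (q - 1)" by simp
  then obtain t where t: "q - 1 = 2 * t" by blast
  hence "q = 1 + 2 * t" by simp
  hence "?w i - b i * int H = int M * t" using False unfolding b_def q M(1) by (simp add: algebra_simps)
  thus ?thesis by simp
 qed (simp add: b_def)
 have span_w: "int M dvd dotp N F x \<longleftrightarrow> even (\<Sum>i<N. c i * b i)"
  if c: "\<forall>z<N. int M dvd x z - (\<Sum>i<N. c i * int (g i z))" for x c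
 proof -
  have "int M dvd dotp N F x - dotp N F (%z. \<Sum>i<N. c i * int (g i z))" by (rule dotp_cong) (use c in simp)
  moreover have "int M dvd (\<Sum>i<N. c i * ?w i) - (\<Sum>i<N. c i * b i) * int H"
   unfolding sum_distrib_right sum_subtractf[symmetric]
  proof (rule dvd_sum)
   fix i assume "i \<in> {..<N}"
   hence "int M dvd c i * (?w i - b i * int H)" using wb[of i] by simp
   thus "int M dvd c i * ?w i - c i * b i * int H" by (simp add: algebra_simps)
  qed
  ultimately have "int M dvd dotp N F x \<longleftrightarrow> int M dvd (\<Sum>i<N. c i * b i) * int H"
   unfolding dotp_sum by (simp only: dvd_iff_diff)
  also have "... \<longleftrightarrow> even (\<Sum>i<N. c i * b i)" using M by simp
  finally show ?thesis .
 qed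
 show ?thesis
 proof (cases "p < N")
  case False
  hence pN: "p = N" and dv: "!!i. i < N ==> int M dvd ?w i" using p by simp_all
  hence all: "b i = 0" if "i < N" for i using that by (simp add: b_def)
  have "g' i z = g i z" if "i < N" "z < N" for i z using g'[OF that] dv[OF that(1)] that(1) pN by simp
  hence "gen_span N M g' = gen_span N M g" unfolding gen_span_def by simp
  moreover have "int M dvd dotp N F x" if "x \<in> gen_span N M g" for x
   using that span_w[of x] all unfolding gen_span_def by auto
  ultimately show ?thesis by blast
 next
  case pN: True
  hence bp: "b p = 1" using p by (auto simp: b_def)
  have G': "int M dvd int (g' i z) - (int (g i z) + (if i = p then 1 else b i) * int (g p z))" if "i < N" "z < N" for i z
  proof -
   have "int M dvd int (k mod M) - int k" for k
    using mod_eq_dvd_iff[of "int (k mod M)" "int M" "int k"] by (simp add: zmod_int)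
   from this[of "2 * g p z"] this[of "g i z + g p z"] show ?thesis using g'[OF that] by (auto simp: b_def)
  qed
  have sum': "int M dvd (\<Sum>i<N. c i * int (g' i z)) - ((\<Sum>i<N. c i * int (g i z)) + ((\<Sum>i<N. c i * b i)) * int (g p z))"
   if z: "z < N" for c z
  proof -
   have "int M dvd (\<Sum>i<N. c i * (int (g' i z) - (int (g i z) + (if i = p then 1 else b i) * int (g p z))))"
    by (rule dvd_sum) (use G'[OF _ z] in simp)
   also have "(\<Sum>i<N. c i * (int (g' i z) - (int (g i z) + (if i = p then 1 else b i) * int (g p z)))) =
    (\<Sum>i<N. c i * int (g' i z)) - ((\<Sum>i<N. c i * int (g i z)) + ((\<Sum>i<N. c i * b i)) * int (g p z))"
   proof -
    have "(if i = p then 1 else b i) = b i" for i using bp by simp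
    thus ?thesis by (simp add: algebra_simps sum.distrib sum_subtractf sum_distrib_left sum_distrib_right)
   qed
   finally show ?thesis .
  qed
  have sel: "(\<Sum>i<N. (c i + (if i = p then t else 0)) * y i) = (\<Sum>i<N. c i * y i) + t * y p" for c y and t :: int
   using pN by (simp add: algebra_simps sum.distrib sum.delta' if_distrib[of "%t. _ * t"] cong: if_cong)
  show ?thesis
  proof (intro equalityI subsetI)
   fix x assume "x \<in> gen_span N M g'"
   then obtain c where c: "\<forall>z<N. int M dvd x z - (\<Sum>i<N. c i * int (g' i z))" unfolding gen_span_def by (elim CollectE exE)
   define t where "t = (\<Sum>i<N. c i * b i)"
   let ?d = "%i. c i + (if i = p then t else 0)"
   have d: "\<forall>z<N. int M dvd x z - (\<Sum>i<N. ?d i * int (g i z))"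
   proof (intro allI impI)
    fix z assume z: "z < N"
    have "int M dvd (x z - (\<Sum>i<N. c i * int (g' i z))) + ((\<Sum>i<N. c i * int (g' i z)) - ((\<Sum>i<N. c i * int (g i z)) + t * int (g p z)))"
     using c z sum'[OF z, of c] unfolding t_def by (intro dvd_add) simp_all
    thus "int M dvd x z - (\<Sum>i<N. ?d i * int (g i z))" unfolding sel by (simp add: algebra_simps)
   qed
   have "(\<Sum>i<N. ?d i * b i) = 2 * t" unfolding sel bp t_def by simp
   hence "int M dvd dotp N F x" using span_w[OF d] by simp
   moreover have "x \<in> gen_span N M g" unfolding gen_span_def by (intro CollectI) (rule exI[of _ ?d], rule d)
   ultimately show "x \<in> {x \<in> gen_span N M g. int M dvd dotp N F x}" by (intro CollectI conjI)
  next
   fix x assume "x \<in> {x \<in> gen_span N M g. int M dvd dotp N F x}"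
   hence xg: "x \<in> gen_span N M g" and x: "int M dvd dotp N F x" by simp_all
   from xg obtain c where c: "\<forall>z<N. int M dvd x z - (\<Sum>i<N. c i * int (g i z))" unfolding gen_span_def by (elim CollectE exE)
   have "even (\<Sum>i<N. c i * b i)" using span_w[OF c] x by simp
   then obtain h where h: "(\<Sum>i<N. c i * b i) = 2 * h" by blast
   \<comment> \<open>The new generators are \<open>g i + b i * g p\<close>, also for
     \<open>i = p\<close> where \<open>b p = 1\<close>. Passing to them adds the sum of all
     \<open>c i * b i\<close> to the coefficient of \<open>g p\<close>; removing half of that even
     sum beforehand compensates for this.\<close>
   let ?d = "%i. c i + (if i = p then - h else 0)"
   have db: "(\<Sum>i<N. ?d i * b i) = h" unfolding sel bp h by simp
   have "\<forall>z<N. int M dvd x z - (\<Sum>i<N. ?d i * int (g' i z))"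
   proof (intro allI impI)
    fix z assume z: "z < N"
    have e: "(\<Sum>i<N. ?d i * int (g i z)) + (\<Sum>i<N. ?d i * b i) * int (g p z) = (\<Sum>i<N. c i * int (g i z))"
     unfolding db sel by simp
    show "int M dvd x z - (\<Sum>i<N. ?d i * int (g' i z))"
     using dvd_diff[OF c[rule_format, OF z] sum'[OF z, of ?d]] unfolding e by simp
   qed
   thus "x \<in> gen_span N M g'" unfolding gen_span_def by (intro CollectI) (rule exI)
  qed
 qed
qed

lemma gen_in_span: "i < N ==> (%z. int (g i z)) \<in> gen_span N M g"
 unfolding gen_span_def
proof (intro CollectI exI allI impI)
 fix z assume "i < N" "z < N"
 hence "(\<Sum>j<N. (if j = i then 1 else 0) * int (g j z)) = int (g i z)" by (simp add: if_distrib[of "%t. t * _"] cong: if_cong)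
 thus "int M dvd int (g i z) - (\<Sum>j<N. (if j = i then 1 else 0) * int (g j z))" by simp
qed

lemma gen_span_unit: "(!!i z. i < N ==> z < N ==> g i z = of_bool (i = z)) ==> gen_span N M g = UNIV"
proof -
 assume g: "!!i z. i < N ==> z < N ==> g i z = of_bool (i = z)"
 have "x \<in> gen_span N M g" for x
  unfolding gen_span_def
 proof (intro CollectI exI allI impI)
  fix z assume z: "z < N"
  have "(\<Sum>i<N. x i * int (g i z)) = (\<Sum>i<N. if i = z then x i else 0)" using g z by (intro sum.cong) simp_all
  thus "int M dvd x z - (\<Sum>i<N. x i * int (g i z))" using z by simp
 qed
 thus ?thesis by blast
qed

declare run.simps(5,6) [simp del]
lemmas run_simps = run.simps(1-4,7)

abbreviation "Arr1 a i \<equiv> Arr a i (Num 0)"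
abbreviation "Put1 a i \<equiv> Put a i (Num 0)"

context fixes B Q :: nat and f :: "nat => nat" begin

abbreviation rn where "rn \<equiv> run B Q f"
abbreviation ev where "ev \<equiv> eval B f"

text \<open>Products are formed by repeated addition, with an entry of array 2 as the number of
  rounds. Variable 10 selects the generator in array 0, and variable 13 receives the value of the
  form.\<close>

definition dot_cmd :: cmd where
 "dot_cmd = Assign 13 (Num 0) ;; For 11 (Var 6) (For 12 (Arr1 2 (Var 11))
   (Assign 13 (addm (Var 13) (Arr 0 (Var 10) (Var 11)))))"

lemma dot_mod: "mv dot_cmd = {11, 12, 13}" "ma dot_cmd = {}"
 by (auto simp: dot_cmd_def)

lemma run_dot:
 assumes s: "fst s 4 = m" "fst s 6 = N" and m: "0 < m" "2 * m <= B"
  and g: "!!z. z < N ==> snd s 0 (fst s 10) z < m"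
 shows "fst (rn dot_cmd s) 13 = (\<Sum>z<N. snd s 2 z 0 * snd s 0 (fst s 10) z) mod m"
 unfolding dot_cmd_def run_simps
proof (rule run_For[where m = N and I = "%k s'. fst s' 13 = (\<Sum>z<k. snd s 2 z 0 * snd s 0 (fst s 10) z) mod m"], goal_cases)
 case (3 z s')
 note fr = 3(2) and fa = 3(3) and I = 3(4)
 let ?S = "\<Sum>z<z. snd s 2 z 0 * snd s 0 (fst s 10) z" and ?g = "snd s 0 (fst s 10) z"
 have "fst (rn (For 12 (Arr1 2 (Var 11)) (Assign 13 (addm (Var 13) (Arr 0 (Var 10) (Var 11))))) (setv 11 z s')) 13 =
  (?S + snd s 2 z 0 * ?g) mod m"
 proof (rule run_For[where m = "snd s 2 z 0" and I = "%t s''. fst s'' 13 = (?S + t * ?g) mod m"], goal_cases)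
  case (3 t s'')
  note fr' = 3(2) and fa' = 3(3) and I' = 3(4)
  have v: "fst s'' 4 = m" "fst s'' 10 = fst s 10" "fst s'' 11 = z" "snd s'' 0 = snd s 0"
   using s by (simp_all add: fr' fr fa' fa)
  have "ev (setv 12 t s'') (addm (Var 13) (Arr 0 (Var 10) (Var 11))) = ((?S + t * ?g) mod m + ?g) mod m"
   using eval_addm[of B f "setv 12 t s''" "Var 13" m "Arr 0 (Var 10) (Var 11)"] v I' m g[OF \<open>z < N\<close>] by simp
  thus ?case by (simp add: mod_add_right_eq ac_simps)
 qed (simp_all add: I fa)
 thus ?case by simp
qed (simp_all add: s)

text \<open>Variable 14 is the index of the generator found to be nonzero, or \<open>N\<close>.\<close>

definition half_cmd :: cmd where
 "half_cmd = Assign 14 (Var 6) ;;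
   For 10 (Var 6) (dot_cmd ;; Cond (Var 13) (Cond (ltE (Var 14) (Var 6))
    (For 11 (Var 6) (Put 0 (Var 10) (Var 11) (addm (Arr 0 (Var 10) (Var 11)) (Arr 0 (Var 14) (Var 11)))))
    (Assign 14 (Var 10))) Nop) ;;
   Cond (ltE (Var 14) (Var 6)) (For 11 (Var 6) (Put 0 (Var 14) (Var 11) (addm (Arr 0 (Var 14) (Var 11)) (Arr 0 (Var 14) (Var 11))))) Nop"

lemma half_mod: "mv half_cmd = {10, 11, 12, 13, 14}" "ma half_cmd = {0}"
 by (auto simp: half_cmd_def dot_mod)

lemma run_row_add:
 assumes s: "fst s 4 = m" "fst s 6 = N" and m: "0 < m" "2 * m <= B" and xy: "x ~= 11" "y ~= 11"
  and g: "!!i z. i < N ==> z < N ==> snd s 0 i z < m" and i: "fst s x < N" "fst s y < N" and z: "z < N"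
 shows "snd (rn (For 11 (Var 6) (Put 0 (Var x) (Var 11) (addm (Arr 0 (Var x) (Var 11)) (Arr 0 (Var y) (Var 11))))) s) 0 i z =
  (if i = fst s x then (snd s 0 i z + snd s 0 (fst s y) z) mod m else snd s 0 i z)"
proof -
 let ?p = "Put 0 (Var x) (Var 11) (addm (Arr 0 (Var x) (Var 11)) (Arr 0 (Var y) (Var 11)))"
 have "\<forall>i z. snd (rn (For 11 (Var 6) ?p) s) 0 i z =
  (if i = fst s x & z < N then (snd s 0 i z + snd s 0 (fst s y) z) mod m else snd s 0 i z)"
 proof (rule run_For[where m = N and I = "%k s'. \<forall>i z. snd s' 0 i z =
  (if i = fst s x & z < k then (snd s 0 i z + snd s 0 (fst s y) z) mod m else snd s 0 i z)"], goal_cases)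
  case (3 k s')
  note fr = 3(2) and I = 3(4)
  have v: "fst s' 4 = m" "fst s' x = fst s x" "fst s' y = fst s y" using s xy by (simp_all add: fr)
  have "ev (setv 11 k s') (addm (Arr 0 (Var x) (Var 11)) (Arr 0 (Var y) (Var 11))) = (snd s 0 (fst s x) k + snd s 0 (fst s y) k) mod m"
   using eval_addm[of B f "setv 11 k s'" "Arr 0 (Var x) (Var 11)" m "Arr 0 (Var y) (Var 11)"] v I m g[OF i(1) \<open>k < N\<close>] g[OF i(2) \<open>k < N\<close>] xy
   by simp
  thus ?case using I v xy by (auto simp: less_Suc_eq)
 qed (simp_all add: s)
 thus ?thesis using z by simp
qed

lemma run_half:
 assumes s: "fst s 4 = m" "fst s 6 = N" and m: "0 < m" "2 * m <= B"
  and lt: "\<forall>i<N. \<forall>z<N. snd s 0 i z < m"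
 defines "w \<equiv> %i. (\<Sum>z<N. snd s 2 z 0 * snd s 0 i z) mod m"
 shows "\<exists>p. (p < N & w p ~= 0 \<or> p = N & (\<forall>i<N. w i = 0)) \<and>
  (\<forall>i<N. \<forall>z<N. snd (rn half_cmd s) 0 i z =
    (if i = p then 2 * snd s 0 p z mod m else if w i = 0 then snd s 0 i z else (snd s 0 i z + snd s 0 p z) mod m))"
proof -
 have g: "snd s 0 i z < m" if "i < N" "z < N" for i z using lt that by simp
 let ?g = "snd s 0"
 define I where "I = (%k (s' :: store). (fst s' 14 = N & (\<forall>i<k. w i = 0) \<or> fst s' 14 < k & w (fst s' 14) ~= 0) \<and>
  (\<forall>i<N. \<forall>z<N. snd s' 0 i z = (if i < k & i ~= fst s' 14 & w i ~= 0 then (?g i z + ?g (fst s' 14) z) mod m else ?g i z)))"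
 let ?b = "dot_cmd ;; Cond (Var 13) (Cond (ltE (Var 14) (Var 6))
    (For 11 (Var 6) (Put 0 (Var 10) (Var 11) (addm (Arr 0 (Var 10) (Var 11)) (Arr 0 (Var 14) (Var 11)))))
    (Assign 14 (Var 10))) Nop"
 let ?s1 = "rn (For 10 (Var 6) ?b) (setv 14 N s)"
 have "I N ?s1"
 proof (rule run_For[where m = N], goal_cases)
  case (3 k s')
  note fr = 3(2) and fa = 3(3) and k = 3(1)
  have v: "fst s' 4 = m" "fst s' 6 = N" "snd s' 2 = snd s 2" using s by (simp_all add: fr fa dot_mod)
  have I1: "fst s' 14 = N & (\<forall>i<k. w i = 0) \<or> fst s' 14 < k & w (fst s' 14) ~= 0"
   and I2: "!!i z. i < N ==> z < N ==> snd s' 0 i z = (if i < k & i ~= fst s' 14 & w i ~= 0 then (?g i z + ?g (fst s' 14) z) mod m else ?g i z)"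
   using 3(4) by (simp_all add: I_def)
  have lt: "snd s' 0 i z < m" if "i < N" "z < N" for i z using I2[OF that] g[OF that] m by simp
  let ?d = "rn dot_cmd (setv 10 k s')"
  have gk: "snd s' 0 k z = ?g k z" if "z < N" for z using I2[OF k that] by simp
  have "(\<Sum>z<N. snd s 2 z 0 * snd s' 0 k z) = (\<Sum>z<N. snd s 2 z 0 * ?g k z)"
   by (rule sum.cong) (simp_all add: gk)
  hence d13: "fst ?d 13 = w k"
   using run_dot[of "setv 10 k s'" m N] v m lt[OF k] by (simp add: w_def)
  have d: "fst ?d 4 = m" "fst ?d 6 = N" "fst ?d 10 = k" "fst ?d 14 = fst s' 14" "snd ?d = snd s'"
   using v by (simp_all add: frame_v frame_a dot_mod fun_eq_iff)
  show ?case
  proof (cases "w k = 0")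
   case True
   hence "rn ?b (setv 10 k s') = ?d" using d13 by simp
   moreover have "I (Suc k) ?d" unfolding I_def d using I1 I2 True by (auto simp: less_Suc_eq)
   ultimately show ?thesis by simp
  next
   case wk: False
   show ?thesis
   proof (cases "fst s' 14 < N")
    case False
    hence "rn ?b (setv 10 k s') = setv 14 k ?d" using d13 wk d by simp
    moreover have "I (Suc k) (setv 14 k ?d)" unfolding I_def using I1 I2 wk False k d by (auto simp: less_Suc_eq)
    ultimately show ?thesis by simp
   next
    case True
    let ?r = "rn (For 11 (Var 6) (Put 0 (Var 10) (Var 11) (addm (Arr 0 (Var 10) (Var 11)) (Arr 0 (Var 14) (Var 11))))) ?d"
    have e: "rn ?b (setv 10 k s') = ?r" using d13 wk d True by simp
    have p: "fst s' 14 < k" "w (fst s' 14) ~= 0" using I1 True by auto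
    have r14: "fst ?r 14 = fst s' 14" using d by (simp add: frame_v)
    have r0: "snd ?r 0 i z = (if i = k then (snd s' 0 i z + snd s' 0 (fst s' 14) z) mod m else snd s' 0 i z)" if "z < N" for i z
     using run_row_add[OF d(1,2) m, of 10 14 z i] d True k lt that by simp
    have "I (Suc k) ?r" unfolding I_def r14
    proof (intro conjI allI impI)
     show "fst s' 14 = N & (\<forall>i<Suc k. w i = 0) \<or> fst s' 14 < Suc k & w (fst s' 14) ~= 0" using p by simp
     fix i z assume iz: "i < N" "z < N"
     show "snd ?r 0 i z = (if i < Suc k & i ~= fst s' 14 & w i ~= 0 then (?g i z + ?g (fst s' 14) z) mod m else ?g i z)"
      unfolding r0[OF iz(2)] using I2[OF iz] I2[OF True iz(2)] gk[OF iz(2)] wk p by (auto simp: less_Suc_eq)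
    qed
    thus ?thesis unfolding e .
   qed
  qed
 qed (simp_all add: s I_def)
 hence I1: "fst ?s1 14 = N & (\<forall>i<N. w i = 0) \<or> fst ?s1 14 < N & w (fst ?s1 14) ~= 0"
  and I2: "!!i z. i < N ==> z < N ==> snd ?s1 0 i z = (if i ~= fst ?s1 14 & w i ~= 0 then (?g i z + ?g (fst ?s1 14) z) mod m else ?g i z)"
  by (simp_all add: I_def)
 have v: "fst ?s1 4 = m" "fst ?s1 6 = N" using s by (simp_all add: frame_v dot_mod)
 have lt: "snd ?s1 0 i z < m" if "i < N" "z < N" for i z using I2[OF that] g[OF that] m by simp
 show ?thesis
 proof (rule exI[of _ "fst ?s1 14"], intro conjI allI impI)
  show "fst ?s1 14 < N & w (fst ?s1 14) ~= 0 \<or> fst ?s1 14 = N & (\<forall>i<N. w i = 0)" using I1 by blast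
  fix i z assume iz: "i < N" "z < N"
  show "snd (rn half_cmd s) 0 i z = (if i = fst ?s1 14 then 2 * ?g (fst ?s1 14) z mod m
   else if w i = 0 then ?g i z else (?g i z + ?g (fst ?s1 14) z) mod m)"
  proof (cases "fst ?s1 14 < N")
   case False
   hence "rn half_cmd s = ?s1" using v by (simp add: half_cmd_def s)
   thus ?thesis using I2[OF iz] I1 False iz by auto
  next
   case True
   hence e: "rn half_cmd s = rn (For 11 (Var 6) (Put 0 (Var 14) (Var 11)
     (addm (Arr 0 (Var 14) (Var 11)) (Arr 0 (Var 14) (Var 11))))) ?s1" using v by (simp add: half_cmd_def s)
   show ?thesis unfolding e using run_row_add[OF v m, of 14 14 z i] lt True iz I2[OF iz] I2[OF True iz(2)]
    by (auto simp: mult_2)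
  qed
 qed
qed

text \<open>The condition that a linear form vanishes is imposed modulo increasing powers of two.\<close>

definition fill_cmd :: cmd where
 "fill_cmd = For 11 (Var 6) (Put1 2 (Var 11) (Arr1 20 (Var 11))) ;;
   For 12 (Minus (Minus (Var 5) (Num 1)) (Var 15)) (For 11 (Var 6) (Put1 2 (Var 11) (addm (Arr1 2 (Var 11)) (Arr1 2 (Var 11)))))"

lemma fill_mod: "mv fill_cmd = {11, 12}" "ma fill_cmd = {2}"
 by (auto simp: fill_cmd_def)

lemma run_fill:
 assumes s: "fst s 4 = m" "fst s 6 = N" and m: "0 < m" "2 * m <= B" and E: "!!z. z < N ==> snd s 20 z 0 < m" and z: "z < N"
 shows "snd (rn fill_cmd s) 2 z 0 = 2 ^ (fst s 5 - 1 - fst s 15) * snd s 20 z 0 mod m"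
proof -
 let ?s1 = "rn (For 11 (Var 6) (Put1 2 (Var 11) (Arr1 20 (Var 11)))) s"
 have 1: "\<forall>z<N. snd ?s1 2 z 0 = snd s 20 z 0"
  by (rule run_For[where m = N and I = "%k s'. \<forall>z<k. snd s' 2 z 0 = snd s 20 z 0"]) (auto simp: s less_Suc_eq)
 have v: "fst ?s1 4 = m" "fst ?s1 6 = N" "fst ?s1 5 = fst s 5" "fst ?s1 15 = fst s 15" using s by (simp_all add: frame_v)
 let ?p = "For 11 (Var 6) (Put1 2 (Var 11) (addm (Arr1 2 (Var 11)) (Arr1 2 (Var 11))))"
 have "\<forall>z<N. snd (rn (For 12 (Minus (Minus (Var 5) (Num 1)) (Var 15)) ?p) ?s1) 2 z 0 = 2 ^ (fst s 5 - 1 - fst s 15) * snd s 20 z 0 mod m"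
 proof (rule run_For[where m = "fst s 5 - 1 - fst s 15" and I = "%t s'. \<forall>z<N. snd s' 2 z 0 = 2 ^ t * snd s 20 z 0 mod m"], goal_cases)
  case (3 t s')
  note fr = 3(2) and I = 3(4)
  have "\<forall>z. snd (rn ?p (setv 12 t s')) 2 z 0 = (if z < N then 2 * snd s' 2 z 0 mod m else snd s' 2 z 0)"
  proof (rule run_For[where m = N and I = "%k s''. \<forall>z. snd s'' 2 z 0 = (if z < k then 2 * snd s' 2 z 0 mod m else snd s' 2 z 0)"], goal_cases)
   case (3 k s'')
   note fr' = 3(2) and I' = 3(4)
   have "fst s'' 4 = m" using v by (simp add: fr' fr)
   moreover have "snd s'' 2 k 0 = snd s' 2 k 0" "snd s' 2 k 0 < m" using I' I m \<open>k < N\<close> by simp_all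
   ultimately have "ev (setv 11 k s'') (addm (Arr1 2 (Var 11)) (Arr1 2 (Var 11))) = (snd s' 2 k 0 + snd s' 2 k 0) mod m"
    using eval_addm[of B f "setv 11 k s''" "Arr1 2 (Var 11)" m "Arr1 2 (Var 11)"] m by simp
   hence "ev (setv 11 k s'') (addm (Arr1 2 (Var 11)) (Arr1 2 (Var 11))) = 2 * snd s' 2 k 0 mod m"
    by (simp only: mult_2)
   thus ?case using I' by (auto simp: less_Suc_eq)
  qed (simp_all add: fr v)
  thus ?case using I by (simp add: mod_mult_right_eq mult.assoc)
 qed (simp_all add: v 1 E)
 thus ?thesis using z by (simp add: fill_cmd_def)
qed

definition cons_cmd :: cmd where
 "cons_cmd = For 15 (Var 5) (fill_cmd ;; half_cmd)"

lemma cons_mod: "mv cons_cmd = {10, 11, 12, 13, 14, 15}" "ma cons_cmd = {0, 2}"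
 by (auto simp: cons_cmd_def fill_mod half_mod)

text \<open>After \<open>l\<close> rounds the form is divisible by \<open>2 ^ l\<close> on all
  generators, so \<open>2 ^ (R - 1 - l)\<close> times it takes only the values 0 and
  \<open>2 ^ (R - 1)\<close> modulo \<open>2 ^ R\<close>. The halving step for this multiple makes
  the form divisible by \<open>2 ^ (l + 1)\<close>. In this way the elimination works with additions
  only.\<close>

lemma run_cons:
 assumes s: "fst s 4 = 2 ^ R" "fst s 5 = R" "fst s 6 = N" and B: "2 * 2 ^ R <= B"
  and g: "!!i z. i < N ==> z < N ==> snd s 0 i z < 2 ^ R" and E: "!!z. z < N ==> snd s 20 z 0 < 2 ^ R"
 shows "gen_span N (2 ^ R) (snd (rn cons_cmd s) 0) =
   {x \<in> gen_span N (2 ^ R) (snd s 0). 2 ^ R dvd dotp N (%z. snd s 20 z 0) x} \<and>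
  (\<forall>i<N. \<forall>z<N. snd (rn cons_cmd s) 0 i z < 2 ^ R)"
proof -
 let ?M = "2 ^ R :: nat" and ?E = "%z. snd s 20 z 0"
 let ?I = "%l s'. gen_span N ?M (snd s' 0) = {x \<in> gen_span N ?M (snd s 0). 2 ^ l dvd dotp N ?E x} & (\<forall>i<N. \<forall>z<N. snd s' 0 i z < ?M)"
 have "?I R (rn (For 15 (Var 5) (fill_cmd ;; half_cmd)) s)"
 proof (rule run_For[where m = R and I = ?I], goal_cases)
  case (3 l s')
  note l = 3(1) and fr = 3(2) and fa = 3(3)
  have span: "gen_span N ?M (snd s' 0) = {x \<in> gen_span N ?M (snd s 0). 2 ^ l dvd dotp N ?E x}"
   and lt: "!!i z. i < N ==> z < N ==> snd s' 0 i z < ?M" using 3(4) by simp_all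
  have v: "fst s' 4 = ?M" "fst s' 5 = R" "fst s' 6 = N" "snd s' 20 = snd s 20"
   using s by (simp_all add: fr fa fill_mod half_mod)
  let ?s1 = "rn fill_cmd (setv 15 l s')"
  define F where "F z = snd ?s1 2 z 0" for z
  define h where "h = R - 1 - l"
  have F: "F z = 2 ^ h * ?E z mod ?M" if "z < N" for z
   using run_fill[of "setv 15 l s'" ?M N z] v B E that by (simp add: F_def h_def)
  have v1: "fst ?s1 4 = ?M" "fst ?s1 6 = N" "snd ?s1 0 = snd s' 0" using v by (simp_all add: frame_v frame_a fill_mod)
  have lt1: "\<forall>i<N. \<forall>z<N. snd ?s1 0 i z < ?M" using lt v1(3) by simp
  have M0: "0 < ?M" by simp
  let ?w = "%i. (\<Sum>z<N. F z * snd s' 0 i z) mod ?M"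
  obtain p where p: "p < N & ?w p ~= 0 \<or> p = N & (\<forall>i<N. ?w i = 0)"
   and g': "\<forall>i<N. \<forall>z<N. snd (rn half_cmd ?s1) 0 i z =
    (if i = p then 2 * snd s' 0 p z mod ?M else if ?w i = 0 then snd s' 0 i z else (snd s' 0 i z + snd s' 0 p z) mod ?M)"
   using run_half[OF v1(1,2) M0 B lt1, unfolded v1(3), folded F_def] by (elim exE conjE)
  have Rl: "R = Suc (h + l)" using l by (simp add: h_def)
  have dF: "2 ^ R dvd dotp N F x - 2 ^ h * dotp N ?E x" for x
  proof -
   have "2 ^ R dvd (int (F z) - 2 ^ h * int (?E z)) * x z" if "z < N" for z
    using mod_eq_dvd_iff[of "int (F z)" "2 ^ R" "2 ^ h * int (?E z)"] F[OF that] by (simp add: zmod_int)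
   hence "2 ^ R dvd (\<Sum>z<N. (int (F z) - 2 ^ h * int (?E z)) * x z)" by (intro dvd_sum) simp
   thus ?thesis unfolding dotp_def by (simp add: left_diff_distrib sum_subtractf sum_distrib_left mult.assoc)
  qed
  have dv: "2 ^ R dvd dotp N F x \<longleftrightarrow> 2 ^ Suc l dvd dotp N ?E x" for x
  proof -
   have "2 ^ R dvd dotp N F x \<longleftrightarrow> 2 ^ h * 2 ^ Suc l dvd 2 ^ h * dotp N ?E x"
    using dvd_iff_diff[OF dF] by (simp add: Rl power_add)
   thus ?thesis by (simp only: dvd_mult_cancel_left) simp
  qed
  have w0: "?w i = 0 \<longleftrightarrow> int ?M dvd dotp N F (%z. int (snd s' 0 i z))" for i
  proof -
   have "dotp N F (%z. int (snd s' 0 i z)) = int (\<Sum>z<N. F z * snd s' 0 i z)" by (simp add: dotp_def)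
   thus ?thesis by (simp only: of_nat_dvd_iff mod_eq_0_iff_dvd)
  qed
  have "gen_span N ?M (snd (rn half_cmd ?s1) 0) = {x \<in> gen_span N ?M (snd s' 0). int ?M dvd dotp N F x}"
  proof (rule gen_span_half[where H = "2 ^ (R - 1)" and p = p])
   show "?M = 2 * 2 ^ (R - 1)" by (simp add: Rl)
   fix i assume i: "i < N"
   have "2 ^ l dvd dotp N ?E (%z. int (snd s' 0 i z))" using gen_in_span[OF i, of "snd s' 0" ?M] span by simp
   hence a: "2 ^ h * 2 ^ l dvd 2 ^ h * dotp N ?E (%z. int (snd s' 0 i z))" by (rule mult_dvd_mono[OF dvd_refl])
   have b: "2 ^ (R - 1) dvd dotp N F (%z. int (snd s' 0 i z)) - 2 ^ h * dotp N ?E (%z. int (snd s' 0 i z))"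
    by (rule dvd_trans[OF _ dF]) (simp add: le_imp_power_dvd)
   have "R - 1 = h + l" by (simp add: Rl)
   thus "int (2 ^ (R - 1)) dvd dotp N F (%z. int (snd s' 0 i z))"
    using dvd_iff_diff[OF b] a by (simp add: power_add)
  next
   show "p < N & \<not> int ?M dvd dotp N F (%z. int (snd s' 0 p z)) \<or> p = N & (\<forall>i<N. int ?M dvd dotp N F (%z. int (snd s' 0 i z)))"
    using p unfolding w0 .
  next
   fix i z assume "i < N" "z < N"
   thus "snd (rn half_cmd ?s1) 0 i z = (if i = p then 2 * snd s' 0 p z mod ?M
     else if int ?M dvd dotp N F (%z. int (snd s' 0 i z)) then snd s' 0 i z else (snd s' 0 i z + snd s' 0 p z) mod ?M)"
    using g' unfolding w0 by blast
  qed simp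
  also have "... = {x \<in> gen_span N ?M (snd s 0). 2 ^ Suc l dvd dotp N ?E x}"
   unfolding span using dv by (auto dest: dvd_mult_left)
  finally show ?case using g' lt by simp
 qed (use s g in simp_all)
 thus ?thesis by (simp add: cons_cmd_def)
qed

section \<open>Computing images of the stabilizer group\<close>

definition adj :: "store => nat => nat => nat set set => bool" where
 "adj s g n E \<longleftrightarrow> (\<forall>i<n. \<forall>j<n. snd s g i j = of_bool (j \<in> nbr E i))"

definition axE :: "nat => expr => expr => expr => expr" where
 "axE g t v w = IfE (eqE t (Num 1)) (Arr g v w) (IfE (eqE t (Num 3)) (IfE (eqE v w) (Num 1) (Arr g v w)) (eqE v w))"

definition cxE :: "nat => expr => expr => expr => expr" where
 "cxE g t v w = IfE (eqE t (Num 1)) (eqE v w) (IfE (eqE t (Num 3)) (eqE v w) (Arr g v w))"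

lemma eval_axE:
 assumes "simple_graph V E" "adj s g n E" "g < 32" "ev s v < n" "ev s w < n"
 shows "ev s (axE g t v w) = of_bool (fa (ev s t) (ev s w = ev s v, ev s w \<in> nbr E (ev s v)))"
  "ev s (cxE g t v w) = of_bool (fc (ev s t) (ev s w = ev s v, ev s w \<in> nbr E (ev s v)))"
 using assms nbr_irrefl[OF assms(1)] by (auto simp: axE_def cxE_def adj_def fa_def fc_def)

definition ind :: "nat set => nat => int" where
 "ind x z = of_bool (z \<in> x)"

definition ee :: "nat set set => nat => nat => nat => nat" where
 "ee E t v w = of_bool (fa t (w = v, w \<in> nbr E v))"

lemma dotp_ind: "x \<subseteq> {..<n} ==> dotp n (%w. of_bool (P w)) (ind x) = int (card {w \<in> x. P w})"
proof -
 assume x: "x \<subseteq> {..<n}"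
 have "dotp n (%w. of_bool (P w)) (ind x) = (\<Sum>w<n. if w \<in> {w \<in> x. P w} then 1 else 0)"
  unfolding dotp_def ind_def by (rule sum.cong) auto
 also have "... = (\<Sum>w\<in>{..<n} \<inter> {w \<in> x. P w}. 1)" by (subst sum.inter_restrict) simp_all
 also have "{..<n} \<inter> {w \<in> x. P w} = {w \<in> x. P w}" using x by blast
 finally show ?thesis by simp
qed

text \<open>The component \<open>fa t\<close> of the factor at \<open>v\<close> is GF(2)-linear in
  \<open>x\<close>, with coefficient vector \<open>ee E t v\<close>; being the identity or on the
  axis \<open>t\<close> is the vanishing of this form.\<close>

lemma dotp_ee:
 assumes G: "simple_graph V E" and x: "x \<subseteq> {..<n}"
 shows "2 dvd dotp n (ee E t v) (ind x) \<longleftrightarrow> \<not> fa t (cmp E x v)"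
proof -
 have fin: "finite x" using x finite_subset by blast
 have n: "v \<notin> nbr E v" by (rule nbr_irrefl[OF G])
 have e: "2 dvd dotp n (ee E t v) (ind x) \<longleftrightarrow> even (card {w \<in> x. fa t (w = v, w \<in> nbr E v)})"
 proof -
  have "ee E t v = (%w. of_bool (fa t (w = v, w \<in> nbr E v)))" by (rule ext) (simp add: ee_def)
  thus ?thesis using dotp_ind[OF x, of "%w. fa t (w = v, w \<in> nbr E v)"] by simp
 qed
 have eq: "nbr E v \<inter> x = {w \<in> x. w \<in> nbr E v}" by blast
 consider "t = 1" | "t = 3" | "t ~= 1" "t ~= 3" by blast
 thus ?thesis
 proof cases
  case 1
  thus ?thesis unfolding e by (simp add: fa_def cmp_def eq)
 next
  case 2
  have "{w \<in> x. (w = v) ~= (w \<in> nbr E v)} = (if v \<in> x then insert v (nbr E v \<inter> x) else nbr E v \<inter> x)" using n by auto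
  thus ?thesis unfolding e using 2 n fin by (auto simp: fa_def cmp_def)
 next
  case 3
  have "{w \<in> x. w = v} = (if v \<in> x then {v} else {})" by auto
  thus ?thesis unfolding e using 3 by (simp add: fa_def cmp_def)
 qed
qed

lemma not_fa_iff: "\<not> fa t p \<longleftrightarrow> p = pI \<or> p = axp t"
 by (cases p) (auto simp: fa_def axp_def)

lemma pcode_eq_0: "pcode p = 0 \<longleftrightarrow> p = pI"
 by (cases p) (auto simp: pcode_def)

lemma pcode_pI [simp]: "pcode pI = 0"
 by (simp add: pcode_eq_0)

text \<open>The axes to which the factor is confined. To be the identity means to be confined to the
  X and the Z axis at once, whence the types 1 and 2.\<close>

definition ktypes :: "nat set => (nat => nat) => nat => nat => nat => nat set" where
 "ktypes R al i j v = (if kst R i j v = 0 then {1, 2} else if kst R i j v = 1 then {al v} else {})"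

lemma Wst_types: "p \<in> Wst R al i j v \<longleftrightarrow> (\<forall>t\<in>ktypes R al i j v. \<not> fa t p)"
 unfolding Wst_def kset_def ktypes_def not_fa_iff by (cases p) (auto simp: axp_def)

lemma SW_types:
 assumes G: "simple_graph V E" and x: "x \<subseteq> {..<n}"
 shows "x \<in> SW {..<n} E (Wst R al i j) \<longleftrightarrow> (\<forall>v<n. \<forall>t\<in>ktypes R al i j v. 2 dvd dotp n (ee E t v) (ind x))"
 unfolding dotp_ee[OF G x] SW_def using x by (simp add: Wst_types Ball_def)

text \<open>The image at \<open>u\<close> is generated by the factors of the generators, so it is a
  single axis exactly if a nontrivial code occurs and all nontrivial codes agree: \<open>ac\<close>
  is a code seen, and \<open>bad\<close> flags two different ones.\<close>

lemma cimg_generators: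
 fixes u :: nat
 assumes G: "simple_graph V E"
  and S: "!!x. x \<subseteq> {..<n} ==> x \<in> SW {..<n} E W \<longleftrightarrow> ind x \<in> gen_span n 2 g" and g: "!!i z. i < n ==> z < n ==> g i z < 2"
 defines "c \<equiv> %i. pcode (cmp E {z. z < n & g i z = 1} u)"
 assumes ac: "ac = 0 \<or> (\<exists>i<n. c i = ac)" and cases: "bad = 0 & (\<forall>i<n. c i = 0 \<or> c i = ac) \<or>
   bad ~= (0 :: nat) & (\<exists>i<n. \<exists>j<n. c i ~= 0 & c j ~= 0 & c i ~= c j)"
 shows "cimg n E W u = (if bad ~= 0 then 0 else ac)"
proof -
 let ?x = "%i. {z. z < n & g i z = 1}" and ?I = "img {..<n} E W u"
 have xs: "?x i \<subseteq> {..<n}" for i by auto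
 have ig: "ind (?x i) z = int (g i z)" if "i < n" "z < n" for i z using g[OF that] that by (simp add: ind_def)
 have span: "ind (?x i) \<in> gen_span n 2 g" if i: "i < n" for i
  using gen_in_span[OF i, of g 2] ig[OF i] unfolding gen_span_def by simp
 have inI: "cmp E (?x i) u \<in> ?I" if "i < n" for i
  unfolding img_def using S[OF xs] span[OF that] by (intro imageI) blast
 have pII: "pI \<in> ?I"
 proof -
  have "ind {} \<in> gen_span n 2 g" unfolding gen_span_def by (intro CollectI exI[of _ "%_. 0"]) (simp add: ind_def)
  hence "{} \<in> SW {..<n} E W" using S[of "{}"] by simp
  hence "cmp E {} u \<in> ?I" unfolding img_def by (rule imageI)
  thus ?thesis by simp
 qed
 have lin: "p = pI \<or> p = axp t" if all: "!!i. i < n ==> \<not> fa t (cmp E (?x i) u)" and p: "p \<in> ?I" for p t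
 proof -
  obtain y where y: "y \<in> SW {..<n} E W" "p = cmp E y u" using p unfolding img_def by (elim imageE)
  have yV: "y \<subseteq> {..<n}" using y(1) by (simp add: SW_def)
  obtain d where d: "\<forall>z<n. int 2 dvd ind y z - (\<Sum>i<n. d i * int (g i z))"
   using y(1) unfolding S[OF yV] gen_span_def by (elim CollectE exE)
 have a: "int 2 dvd dotp n (ee E t u) (ind y) - dotp n (ee E t u) (%z. \<Sum>i<n. d i * int (g i z))"
   by (rule dotp_cong) (use d in simp)
  have b: "int 2 dvd dotp n (ee E t u) (%z. \<Sum>i<n. d i * int (g i z))"
   unfolding dotp_sum
  proof (rule dvd_sum)
   fix i assume "i \<in> {..<n}"
   hence i: "i < n" by simp
   have "dotp n (ee E t u) (%z. int (g i z)) = dotp n (ee E t u) (ind (?x i))"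
    unfolding dotp_def by (rule sum.cong) (use ig[OF i] in simp_all)
   hence "2 dvd dotp n (ee E t u) (%z. int (g i z))" using dotp_ee[OF G xs[of i], of t u] all[OF i] by simp
   thus "int 2 dvd d i * dotp n (ee E t u) (%z. int (g i z))" by simp
  qed
  have "2 dvd dotp n (ee E t u) (ind y)" using dvd_iff_diff[OF a] b by simp
  thus ?thesis unfolding dotp_ee[OF G yV] y(2)[symmetric] not_fa_iff .
 qed
 show ?thesis
 proof (cases "bad = 0")
  case bad: False
  then obtain i j where ij: "i < n" "j < n" "c i ~= 0" "c j ~= 0" "c i ~= c j" using cases by blast
  have "?I ~= {pI, p}" if "p ~= pI" for p
  proof
   assume I: "?I = {pI, p}"
   have "cmp E (?x k) u = p" if "k < n" "c k ~= 0" for k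
    using inI[OF that(1)] that(2) unfolding I c_def by (auto simp: pcode_eq_0)
   thus False using ij unfolding c_def by metis
  qed
  hence "\<not> (cimg n E W u ~= 0)" unfolding cimg_ne_0 by blast
  thus ?thesis using bad by simp
 next
  case True
  hence all: "!!i. i < n ==> c i = 0 \<or> c i = ac" using cases by blast
  show ?thesis
  proof (cases "ac = 0")
   case ac0: True
   hence z: "cmp E (?x i) u = pI" if "i < n" for i using all[OF that] by (simp add: c_def pcode_eq_0)
   have "p = pI" if "p \<in> ?I" for p
    using lin[of 1 p] lin[of 2 p] z that by (auto simp: not_fa_iff axp_def)
   hence "?I = {pI}" using pII by blast
   hence "?I ~= {pI, p}" if "p ~= pI" for p using that by auto
   hence "\<not> (cimg n E W u ~= 0)" unfolding cimg_ne_0 by blast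
   thus ?thesis using True ac0 by simp
  next
   case ac0: False
   then obtain i where i: "i < n" "c i = ac" using ac by blast
   let ?p = "cmp E (?x i) u"
   have p: "?p ~= pI" using ac0 i(2) by (auto simp: c_def pcode_eq_0)
   have pa: "?p = axp ac" using axp_pcode[OF p] i(2) by (simp add: c_def)
   have k: "\<not> fa ac (cmp E (?x k) u)" if "k < n" for k
   proof (cases "cmp E (?x k) u = pI")
    case False
    hence "c k = ac" using all[OF that] by (simp add: c_def pcode_eq_0)
    thus ?thesis unfolding not_fa_iff using axp_pcode[OF False] unfolding c_def by metis
   qed (simp add: not_fa_iff)
   have "q \<in> {pI, ?p}" if "q \<in> ?I" for q using lin[OF k that] pa by simp
   hence "?I = {pI, ?p}" using pII inI[OF i(1)] by blast
   from cimg_eq[OF p this] show ?thesis using True i(2) by (simp add: c_def)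
  qed
 qed
qed

definition unit_cmd :: cmd where
 "unit_cmd = For 10 (Var 6) (For 11 (Var 6) (Put 0 (Var 10) (Var 11) (eqE (Var 10) (Var 11))))"

lemma unit_mod: "mv unit_cmd = {10, 11}" "ma unit_cmd = {0}"
 by (auto simp: unit_cmd_def)

lemma run_unit:
 assumes "fst s 6 = N" "i < N" "z < N"
 shows "snd (rn unit_cmd s) 0 i z = of_bool (i = z)"
proof -
 have "\<forall>i<N. \<forall>z<N. snd (rn unit_cmd s) 0 i z = of_bool (i = z)"
  unfolding unit_cmd_def
 proof (rule run_For[where m = N and I = "%k s'. \<forall>i<k. \<forall>z<N. snd s' 0 i z = of_bool (i = z)"], goal_cases)
  case (3 k s')
  note fr = 3(2) and I = 3(4)
  let ?r = "rn (For 11 (Var 6) (Put 0 (Var 10) (Var 11) (eqE (Var 10) (Var 11)))) (setv 10 k s')"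
  have "\<forall>i z. snd ?r 0 i z = (if i = k & z < N then of_bool (i = z) else snd s' 0 i z)"
  proof (rule run_For[where m = N and I = "%l s''. \<forall>i z. snd s'' 0 i z = (if i = k & z < l then of_bool (i = z) else snd s' 0 i z)"], goal_cases)
   case (3 l s'')
   thus ?case by (auto simp: less_Suc_eq)
  qed (use assms(1) in "simp_all add: fr")
  thus ?case using I by (auto simp: less_Suc_eq)
 qed (simp_all add: assms(1))
 thus ?thesis using assms by simp
qed

definition mkc_cmd :: "nat => cmd" where
 "mkc_cmd g = For 11 (Var 0) (Put1 20 (Var 11) (axE g (Var 17) (Var 16) (Var 11))) ;; cons_cmd"

lemma mkc_mod: "mv (mkc_cmd g) = {10, 11, 12, 13, 14, 15}" "ma (mkc_cmd g) = {0, 2, 20}"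
 by (auto simp: mkc_cmd_def cons_mod)

lemma run_mkc:
 assumes G: "simple_graph V E" "adj s g n E" "g < 32" "g ~= 20"
  and s: "fst s 4 = 2" "fst s 5 = 1" "fst s 6 = n" "fst s 0 = n" "fst s 16 = v" "v < n" and B: "4 <= B"
  and lt: "!!i z. i < n ==> z < n ==> snd s 0 i z < 2"
 shows "gen_span n 2 (snd (rn (mkc_cmd g) s) 0) = {x \<in> gen_span n 2 (snd s 0). 2 dvd dotp n (ee E (fst s 17) v) x} \<and>
  (\<forall>i<n. \<forall>z<n. snd (rn (mkc_cmd g) s) 0 i z < 2)"
proof -
 let ?s1 = "rn (For 11 (Var 0) (Put1 20 (Var 11) (axE g (Var 17) (Var 16) (Var 11)))) s"
 have 1: "\<forall>z<n. snd ?s1 20 z 0 = ee E (fst s 17) v z"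
 proof (rule run_For[where m = n and I = "%k s'. \<forall>z<k. snd s' 20 z 0 = ee E (fst s 17) v z"], goal_cases)
  case (3 k s')
  note fr = 3(2) and fa = 3(3)
  have v: "fst s' 16 = v" "fst s' 17 = fst s 17" "snd s' g = snd s g" using s G by (simp_all add: fr fa)
  have "adj (setv 11 k s') g n E" using G(2) v(3) by (simp add: adj_def)
  from eval_axE(1)[OF G(1) this G(3), of "Var 16" "Var 11" "Var 17"]
  have "ev (setv 11 k s') (axE g (Var 17) (Var 16) (Var 11)) = ee E (fst s 17) v k"
   using v s(6) 3(1) by (simp add: ee_def)
  thus ?case using 3(4) by (auto simp: less_Suc_eq)
 qed (simp_all add: s)
 define s1 where "s1 = ?s1"
 have v: "fst s1 4 = 2 ^ 1" "fst s1 5 = 1" "fst s1 6 = n" "snd s1 0 = snd s 0"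
  using s by (simp_all add: s1_def frame_v frame_a)
 have E: "snd s1 20 z 0 < 2 ^ 1" if "z < n" for z using 1 that by (simp add: s1_def ee_def)
 have "2 * 2 ^ 1 <= B" "!!i z. i < n ==> z < n ==> snd s1 0 i z < 2 ^ 1" using B lt v(4) by simp_all
 note c = run_cons[of s1 1 n, OF v(1-3) this E]
 have d: "dotp n (%z. snd s1 20 z 0) x = dotp n (ee E (fst s 17) v) x" for x
  unfolding dotp_def by (rule sum.cong) (use 1 in "simp_all add: s1_def")
 have e: "rn (mkc_cmd g) s = rn cons_cmd s1" by (simp add: mkc_cmd_def s1_def)
 show ?thesis using c unfolding e d v(4) by simp
qed

text \<open>With \<open>zero_E\<close>, decides whether \<open>kst\<close> is 2 and, failing that,
  whether it is 0; for a resolved vertex \<open>v\<close> the stage in variable 21 is compared with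
  \<open>2 * v + 1\<close>.\<close>

definition free_E :: expr where
 "free_E = IfE (Arr1 9 (Var 16)) (ltE (Plus (Plus (Var 16) (Var 16)) (Num 1)) (Var 21)) (ltE (Var 16) (Var 20))"

definition zero_E :: expr where
 "zero_E = IfE (Arr1 9 (Var 16)) (ltE (Var 21) (Plus (Plus (Var 16) (Var 16)) (Num 1))) (Num 2)"

text \<open>A constrained vertex always gets two conditions; for a known axis the same one is
  imposed twice.\<close>

definition vstep_cmd :: "nat => nat => cmd" where
 "vstep_cmd g ax = Cond free_E Nop (Assign 17 (IfE zero_E (Num 1) (Arr1 ax (Var 16))) ;; mkc_cmd g ;;
   Assign 17 (IfE zero_E (Num 2) (Arr1 ax (Var 16))) ;; mkc_cmd g)"

lemma vstep_mod: "mv (vstep_cmd g ax) = {10, 11, 12, 13, 14, 15, 17}" "ma (vstep_cmd g ax) = {0, 2, 20}"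
 by (auto simp: vstep_cmd_def mkc_mod)

lemma run_vstep:
 assumes G: "simple_graph V E" "adj s g n E" "g < 32" "g \<notin> {0, 2, 20}"
  and s: "fst s 4 = 2" "fst s 5 = 1" "fst s 6 = n" "fst s 0 = n" "fst s 16 = v" "v < n" "fst s 20 = i" "fst s 21 = j"
  and R: "snd s 9 v 0 ~= 0 \<longleftrightarrow> v \<in> R" "v \<in> R ==> snd s ax v 0 = al v" "ax < 32" "ax \<notin> {0, 2, 20}" and B: "4 <= B" "2 * n <= B"
  and lt: "!!i z. i < n ==> z < n ==> snd s 0 i z < 2"
 shows "gen_span n 2 (snd (rn (vstep_cmd g ax) s) 0) = {x \<in> gen_span n 2 (snd s 0). \<forall>t\<in>ktypes R al i j v. 2 dvd dotp n (ee E t v) x} \<and>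
  (\<forall>i<n. \<forall>z<n. snd (rn (vstep_cmd g ax) s) 0 i z < 2)"
proof -
 have p: "ev s (Plus (Plus (Var 16) (Var 16)) (Num 1)) = 2 * v + 1" using s B by simp
 have free: "ev s free_E ~= 0 \<longleftrightarrow> kst R i j v = 2"
  using R(1) s p by (auto simp: free_E_def kst_def simp del: eval.simps(3))
 have zero: "ev s' zero_E ~= 0 \<longleftrightarrow> kst R i j v = 0" if "kst R i j v ~= 2" "fst s' 16 = v" "fst s' 21 = j" "snd s' 9 = snd s 9" for s'
 proof -
  have "ev s' (Plus (Plus (Var 16) (Var 16)) (Num 1)) = 2 * v + 1" using that s B by simp
  thus ?thesis using R(1) that by (auto simp: zero_E_def kst_def simp del: eval.simps(3) split: if_splits)
 qed
 show ?thesis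
 proof (cases "kst R i j v = 2")
  case True
  thus ?thesis using free lt by (simp add: vstep_cmd_def ktypes_def)
 next
  case False
  define t1 where "t1 = (if kst R i j v = 0 then 1 else al v)"
  define t2 where "t2 = (if kst R i j v = 0 then 2 else al v)"
  have vR: "v \<in> R" if "kst R i j v ~= 0" using that False by (auto simp: kst_def split: if_splits)
  have "kst R i j v = 0 \<or> kst R i j v = 1" using False unfolding kst_def by presburger
  hence k: "ktypes R al i j v = {t1, t2}" unfolding ktypes_def t1_def t2_def by (elim disjE) simp_all
  let ?s1 = "setv 17 (ev s (IfE zero_E (Num 1) (Arr1 ax (Var 16)))) s"
  have t1: "fst ?s1 17 = t1" using zero[of s] False s R(2,3) vR by (simp add: t1_def)
  have a1: "adj ?s1 g n E" using G(2) by (simp add: adj_def)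
  have g20: "g ~= 20" using G(4) by simp
  let ?s2 = "rn (mkc_cmd g) ?s1"
  have 1: "gen_span n 2 (snd ?s2 0) = {x \<in> gen_span n 2 (snd s 0). 2 dvd dotp n (ee E t1 v) x}"
    "!!i z. i < n ==> z < n ==> snd ?s2 0 i z < 2"
   using run_mkc[OF G(1) a1 G(3) g20, of v] s B lt unfolding t1 by simp_all
  have s2: "fst ?s2 x = fst s x" if "x \<in> {4, 5, 6, 0, 16, 20, 21}" for x
   using that by (auto simp: frame_v mkc_mod)
  have s2a: "snd ?s2 a = snd s a" if "a \<notin> {0, 2, 20}" for a using that by (simp add: frame_a mkc_mod)
  let ?s3 = "setv 17 (ev ?s2 (IfE zero_E (Num 2) (Arr1 ax (Var 16)))) ?s2"
  have t2: "fst ?s3 17 = t2" using zero[of ?s2] False s R(2,3,4) vR s2 s2a by (simp add: t2_def)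
  have a3: "adj ?s3 g n E" using G(2) s2a[OF G(4)] by (simp add: adj_def)
  let ?s4 = "rn (mkc_cmd g) ?s3"
  have 2: "gen_span n 2 (snd ?s4 0) = {x \<in> gen_span n 2 (snd ?s2 0). 2 dvd dotp n (ee E t2 v) x}"
    "!!i z. i < n ==> z < n ==> snd ?s4 0 i z < 2"
   using run_mkc[OF G(1) a3 G(3) g20, of v] s B 1(2) s2 unfolding t2 by simp_all
  have e: "rn (vstep_cmd g ax) s = ?s4" using free False by (simp add: vstep_cmd_def)
  show ?thesis unfolding e k using 2 1(1) by auto
 qed
qed

definition code_cmd :: "nat => cmd" where
 "code_cmd g = Assign 13 (Num 0) ;; For 11 (Var 6) (Cond (Arr g (Var 16) (Var 11)) (Assign 13 (addm (Var 13) (Arr 0 (Var 10) (Var 11)))) Nop) ;;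
   Assign 12 (Plus (Arr 0 (Var 10) (Var 16)) (Plus (Var 13) (Var 13)))"

lemma code_mod: "mv (code_cmd g) = {11, 12, 13}" "ma (code_cmd g) = {}"
 by (auto simp: code_cmd_def)

lemma run_code:
 assumes G: "adj s g n E" "g < 32" "simple_graph {..<n} E"
  and s: "fst s 4 = 2" "fst s 6 = n" "fst s 10 = i" "i < n" "fst s 16 = u" "u < n" and B: "4 <= B"
  and lt: "!!i z. i < n ==> z < n ==> snd s 0 i z < 2"
 shows "fst (rn (code_cmd g) s) 12 = pcode (cmp E {z. z < n & snd s 0 i z = 1} u)"
proof -
 let ?x = "{z. z < n & snd s 0 i z = 1}"
 let ?p = "For 11 (Var 6) (Cond (Arr g (Var 16) (Var 11)) (Assign 13 (addm (Var 13) (Arr 0 (Var 10) (Var 11)))) Nop)"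
 let ?s1 = "rn ?p (setv 13 0 s)"
 have "fst ?s1 13 = card {z \<in> nbr E u \<inter> ?x. z < n} mod 2"
 proof (rule run_For[where m = n and I = "%k s'. fst s' 13 = card {z \<in> nbr E u \<inter> ?x. z < k} mod 2"], goal_cases)
  case (3 k s')
  note fr = 3(2) and fa = 3(3) and I = 3(4) and k = 3(1)
  have v: "fst s' 4 = 2" "fst s' 10 = i" "fst s' 16 = u" "snd s' = snd s" using s by (simp_all add: fr fa fun_eq_iff)
  have A: "snd s g u k = of_bool (k \<in> nbr E u)" using G(1) s k by (simp add: adj_def)
  have S: "{z \<in> nbr E u \<inter> ?x. z < Suc k} = (if k \<in> nbr E u & snd s 0 i k = 1 then insert k {z \<in> nbr E u \<inter> ?x. z < k} else {z \<in> nbr E u \<inter> ?x. z < k})"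
   using k by (auto simp: less_Suc_eq)
  have c: "card {z \<in> nbr E u \<inter> ?x. z < Suc k} = card {z \<in> nbr E u \<inter> ?x. z < k} + of_bool (k \<in> nbr E u) * snd s 0 i k"
   unfolding S using lt[OF s(4) k] by auto
  show ?case
  proof (cases "k \<in> nbr E u")
   case True
   have "ev (setv 11 k s') (addm (Var 13) (Arr 0 (Var 10) (Var 11))) = (card {z \<in> nbr E u \<inter> ?x. z < k} mod 2 + snd s 0 i k) mod 2"
    using eval_addm[of B f "setv 11 k s'" "Var 13" 2 "Arr 0 (Var 10) (Var 11)"] v I B lt[OF s(4) k] by simp
   thus ?thesis unfolding c using True A v G(2) by (simp add: mod_add_left_eq)
  next
   case False
   thus ?thesis unfolding c using I A v G(2) by simp
  qed
 qed (simp_all add: s)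
 moreover have "{z \<in> nbr E u \<inter> ?x. z < n} = nbr E u \<inter> ?x" by auto
 ultimately have z: "fst ?s1 13 = of_bool (odd (card (nbr E u \<inter> ?x)))" by (simp only: mod_2_eq_odd)
 have v: "fst ?s1 10 = i" "fst ?s1 16 = u" "snd ?s1 = snd s" using s by (simp_all add: frame_v frame_a fun_eq_iff)
 have x: "snd s 0 i u = of_bool (u \<in> ?x)" using lt[OF s(4,6)] s(6) by auto
 have "fst (rn (code_cmd g) s) 12 = min (snd s 0 i u + min (fst ?s1 13 + fst ?s1 13) B) B"
  using v by (simp add: code_cmd_def)
 also have "... = pcode (cmp E ?x u)" unfolding z x pcode_def cmp_def using B by (simp del: mem_Collect_eq)
 finally show ?thesis .
qed

definition out_cmd :: "nat => nat => cmd" where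
 "out_cmd g out = Assign 18 (Num 0) ;; Assign 19 (Num 0) ;;
   For 10 (Var 6) (code_cmd g ;; Cond (Var 12) (Cond (Var 18) (Cond (eqE (Var 18) (Var 12)) Nop (Assign 19 (Num 2))) (Assign 18 (Var 12))) Nop) ;;
   Put1 out (Var 16) (IfE (Var 19) (Num 0) (Var 18))"

lemma out_mod: "mv (out_cmd g out) = {10, 11, 12, 13, 18, 19}" "ma (out_cmd g out) = {out mod 32}"
 by (auto simp: out_cmd_def code_mod)

lemma run_out:
 assumes G: "adj s g n E" "g < 32" "simple_graph {..<n} E"
  and s: "fst s 4 = 2" "fst s 6 = n" "fst s 16 = u" "u < n" and B: "4 <= B" and out: "out < 32"
  and lt: "!!i z. i < n ==> z < n ==> snd s 0 i z < 2"
  and S: "!!x. x \<subseteq> {..<n} ==> x \<in> SW {..<n} E W \<longleftrightarrow> ind x \<in> gen_span n 2 (snd s 0)"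
 shows "snd (rn (out_cmd g out) s) out u' 0 = (if u' = u then cimg n E W u else snd s out u' 0)"
proof -
 let ?c = "%i. pcode (cmp E {z. z < n & snd s 0 i z = 1} u)"
 let ?p = "code_cmd g ;; Cond (Var 12) (Cond (Var 18) (Cond (eqE (Var 18) (Var 12)) Nop (Assign 19 (Num 2))) (Assign 18 (Var 12))) Nop"
 let ?s1 = "rn (For 10 (Var 6) ?p) (setv 19 0 (setv 18 0 s))"
 let ?I = "%k s'. (fst s' 18 = 0 \<or> (\<exists>i<k. ?c i = fst s' 18)) & (fst s' 19 = 0 & (\<forall>i<k. ?c i = 0 \<or> ?c i = fst s' 18) \<or>
   fst s' 19 ~= 0 & (\<exists>i<k. \<exists>j<k. ?c i ~= 0 & ?c j ~= 0 & ?c i ~= ?c j))"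
 have I: "?I n ?s1"
 proof (rule run_For[where m = n and I = ?I], goal_cases)
  case (3 k s')
  note fr = 3(2) and fa = 3(3) and I = 3(4) and k = 3(1)
  have v: "fst s' 4 = 2" "fst s' 6 = n" "fst s' 16 = u" "snd s' = snd s" using s by (simp_all add: fr fa code_mod fun_eq_iff)
  let ?s2 = "rn (code_cmd g) (setv 10 k s')"
  have a: "adj (setv 10 k s') g n E" using G(1) v by (simp add: adj_def)
  have c: "fst ?s2 12 = ?c k" using run_code[OF a G(2,3), of k u] v s k lt B by simp
  have s2: "fst ?s2 18 = fst s' 18" "fst ?s2 19 = fst s' 19" by (simp_all add: frame_v code_mod)
  have less: "(\<exists>i<Suc k. P i) \<longleftrightarrow> (\<exists>i<k. P i) \<or> P k" "(\<forall>i<Suc k. P i) \<longleftrightarrow> (\<forall>i<k. P i) & P k" for P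
   by (auto simp: less_Suc_eq)
  show ?case
  proof (cases "?c k = 0")
   case True
   hence "rn ?p (setv 10 k s') = ?s2" using c by simp
   thus ?thesis unfolding less using I True s2 by auto
  next
   case ck: False
   show ?thesis
   proof (cases "fst s' 18 = 0")
    case True
    hence e: "rn ?p (setv 10 k s') = setv 18 (?c k) ?s2" using c s2 ck by simp
    show ?thesis unfolding e less using I True s2 ck by auto
   next
    case ac: False
    show ?thesis
    proof (cases "fst s' 18 = ?c k")
     case True
     hence e: "rn ?p (setv 10 k s') = ?s2" using c s2 ck by simp
     show ?thesis unfolding e less s2 using I True by auto
    next
     case False
     hence e: "rn ?p (setv 10 k s') = setv 19 2 ?s2" using c s2 ck ac by simp
     from I ac obtain i where i: "i < k" "?c i = fst s' 18" by blast
     hence "\<exists>i<k. ?c i ~= 0 & ?c k ~= 0 & ?c i ~= ?c k" using ac False ck by (intro exI[of _ i]) simp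
     thus ?thesis unfolding e less using I s2 by simp blast
    qed
   qed
  qed
 qed (simp_all add: s)
 have v: "snd ?s1 = snd s" "fst ?s1 16 = u" using s by (simp_all add: frame_a frame_v code_mod fun_eq_iff)
 have "cimg n E W u = (if fst ?s1 19 ~= 0 then 0 else fst ?s1 18)"
  by (rule cimg_generators[OF G(3) S lt]) (use I in auto)
 thus ?thesis using v out by (simp add: out_cmd_def)
qed

definition codes_cmd :: "nat => nat => nat => cmd" where
 "codes_cmd g ax out = Assign 4 (Num 2) ;; Assign 5 (Num 1) ;; Assign 6 (Var 0) ;; unit_cmd ;;
   For 16 (Var 0) (vstep_cmd g ax) ;; For 16 (Var 0) (out_cmd g out)"

lemma codes_mod: "mv (codes_cmd g ax out) = {4, 5, 6, 10, 11, 12, 13, 14, 15, 16, 17, 18, 19}"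
  "ma (codes_cmd g ax out) = {0, 2, 20, out mod 32}"
 by (auto simp: codes_cmd_def unit_mod vstep_mod out_mod)

lemma run_codes:
 assumes G: "simple_graph {..<n} E" "adj s g n E" "g < 32" "g \<notin> {0, 2, 20}"
  and s: "fst s 0 = n" "fst s 20 = i" "fst s 21 = j"
  and R: "!!v. v < n ==> snd s 9 v 0 ~= 0 \<longleftrightarrow> v \<in> R" "!!v. v < n ==> v \<in> R ==> snd s ax v 0 = al v"
  and ax: "ax < 32" "ax \<notin> {0, 2, 20}" and out: "out < 32" "out \<notin> {0, 2, 9, 20, g}" and B: "4 <= B" "2 * n <= B" and u: "u < n"
 shows "snd (rn (codes_cmd g ax out) s) out u 0 = cimg n E (Wst R al i j) u"
proof -
 define s0 where "s0 = rn unit_cmd (setv 6 n (setv 5 1 (setv 4 2 s)))"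
 have v0: "fst s0 4 = 2" "fst s0 5 = 1" "fst s0 6 = n" "fst s0 0 = n" "fst s0 20 = i" "fst s0 21 = j"
  using s by (simp_all add: s0_def frame_v unit_mod)
 have a0: "snd s0 a = snd s a" if "a ~= 0" for a using that by (simp add: s0_def frame_a unit_mod)
 have G0: "snd s0 0 i z = of_bool (i = z)" if "i < n" "z < n" for i z
  unfolding s0_def by (rule run_unit) (use that in simp_all)
 define s1 where "s1 = rn (For 16 (Var 0) (vstep_cmd g ax)) s0"
 let ?I = "%k s'. gen_span n 2 (snd s' 0) = {x. \<forall>v<k. \<forall>t\<in>ktypes R al i j v. 2 dvd dotp n (ee E t v) x} & (\<forall>i<n. \<forall>z<n. snd s' 0 i z < 2)"
 have I: "?I n s1"
  unfolding s1_def
 proof (rule run_For[where m = n and I = ?I], goal_cases)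
  case 2
  thus ?case using G0 gen_span_unit[of n "snd s0 0" 2] by simp
 next
  case (3 k s')
  note fr = 3(2) and fa = 3(3) and k = 3(1)
  have v: "fst s' 4 = 2" "fst s' 5 = 1" "fst s' 6 = n" "fst s' 0 = n" "fst s' 20 = i" "fst s' 21 = j"
   using v0 by (simp_all add: fr vstep_mod)
  have sa: "snd s' a = snd s a" if "a \<notin> {0, 2, 20}" for a using a0[of a] that by (simp add: fa vstep_mod)
  have a: "adj (setv 16 k s') g n E" using G(2) sa[OF G(4)] by (simp add: adj_def)
  have "gen_span n 2 (snd (rn (vstep_cmd g ax) (setv 16 k s')) 0) =
    {x \<in> gen_span n 2 (snd s' 0). \<forall>t\<in>ktypes R al i j k. 2 dvd dotp n (ee E t k) x} \<and>
   (\<forall>i<n. \<forall>z<n. snd (rn (vstep_cmd g ax) (setv 16 k s')) 0 i z < 2)"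
   using run_vstep[OF G(1) a G(3,4), of k i j R ax al] v k R(1,2)[OF k] ax sa B 3(4) by simp
  thus ?case using 3(4) by (auto simp: less_Suc_eq)
 qed (simp add: v0)
 have v1: "fst s1 4 = 2" "fst s1 6 = n" "fst s1 0 = n" using v0 by (simp_all add: s1_def frame_v vstep_mod)
 have a1: "adj s1 g n E" using G(2) G(4) a0[of g] by (simp add: s1_def frame_a vstep_mod adj_def)
 have S: "x \<in> SW {..<n} E (Wst R al i j) \<longleftrightarrow> ind x \<in> gen_span n 2 (snd s1 0)" if "x \<subseteq> {..<n}" for x
  using I SW_types[OF G(1) that] by simp
 have "\<forall>u<n. snd (rn (For 16 (Var 0) (out_cmd g out)) s1) out u 0 = cimg n E (Wst R al i j) u"
 proof (rule run_For[where m = n and I = "%k s'. \<forall>u<k. snd s' out u 0 = cimg n E (Wst R al i j) u"], goal_cases)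
  case (3 k s')
  note fr = 3(2) and fa = 3(3) and k = 3(1)
  have v: "fst s' 4 = 2" "fst s' 6 = n" using v1 by (simp_all add: fr out_mod)
  have sa: "snd s' a = snd s1 a" if "a ~= out" for a using that out by (simp add: fa out_mod)
  have a: "adj (setv 16 k s') g n E" using a1 sa[of g] out by (simp add: adj_def)
  have o0: "snd s' 0 = snd s1 0" using sa[of 0] out by simp
  show ?case using run_out[OF a G(3,1), of k out "Wst R al i j"] v k B out(1) I S 3(4) unfolding o0
   by (simp add: less_Suc_eq o0)
 qed (simp_all add: v1)
 thus ?thesis using u s by (simp add: codes_cmd_def s0_def s1_def)
qed

text \<open>Arrays 5 and 6 hold the graphs, 7 and 8 the axis codes, and 9 marks the resolved
  vertices. Both images are computed before array 9 is touched, so that they refer to the same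
  \<open>R\<close>.\<close>

definition astep_cmd :: cmd where
 "astep_cmd = codes_cmd 5 7 10 ;; codes_cmd 6 8 11 ;;
   For 16 (Var 20) (Cond (Arr1 9 (Var 16)) Nop (Cond (Arr1 10 (Var 16))
    (Put1 7 (Var 16) (Arr1 10 (Var 16)) ;; Put1 8 (Var 16) (Arr1 11 (Var 16)) ;;
    Put1 9 (Var 16) (Num 2)) Nop))"

lemma astep_mod: "mv astep_cmd = {4, 5, 6, 10, 11, 12, 13, 14, 15, 16, 17, 18, 19}"
  "ma astep_cmd = {0, 2, 7, 8, 9, 10, 11, 20}"
 by (auto simp: astep_cmd_def codes_mod)

definition reps :: "nat => store => axes => bool" where
 "reps n s t \<longleftrightarrow> (\<forall>v<n. (snd s 9 v 0 ~= 0 \<longleftrightarrow> v \<in> fst t) & snd s 7 v 0 = fst (snd t) v & snd s 8 v 0 = snd (snd t) v)"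

lemma run_astep:
 assumes G: "simple_graph {..<n} E1" "simple_graph {..<n} E2" "adj s 5 n E1" "adj s 6 n E2"
  and s: "fst s 0 = n" "fst s 20 = i" "fst s 21 = j" "i <= n" and B: "4 <= B" "2 * n <= B" and t: "reps n s t"
 shows "reps n (rn astep_cmd s) (astep n E1 E2 i j t)"
proof -
 obtain R al be where t': "t = (R, al, be)" by (cases t)
 have R: "v < n ==> snd s 9 v 0 ~= 0 \<longleftrightarrow> v \<in> R" "v < n ==> snd s 7 v 0 = al v" "v < n ==> snd s 8 v 0 = be v" for v
  using t by (simp_all add: reps_def t')
 define s1 where "s1 = rn (codes_cmd 5 7 10) s"
 have v1: "fst s1 0 = n" "fst s1 20 = i" "fst s1 21 = j" using s by (simp_all add: s1_def frame_v codes_mod)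
 have a1: "snd s1 a = snd s a" if "a \<notin> {0, 2, 20, 10}" for a using that by (simp add: s1_def frame_a codes_mod)
 have c1: "snd s1 10 u 0 = cimg n E1 (Wst R al i j) u" if "u < n" for u
  unfolding s1_def by (rule run_codes[OF G(1,3)]) (use s R B that in simp_all)
 define s2 where "s2 = rn (codes_cmd 6 8 11) s1"
 have v2: "fst s2 0 = n" "fst s2 20 = i" "fst s2 21 = j" using v1 by (simp_all add: s2_def frame_v codes_mod)
 have a2: "snd s2 a = snd s1 a" if "a \<notin> {0, 2, 20, 11}" for a using that by (simp add: s2_def frame_a codes_mod)
 have G2: "adj s1 6 n E2" using G(4) by (simp add: adj_def a1)
 have c2: "snd s2 11 u 0 = cimg n E2 (Wst R be i j) u" if "u < n" for u
  unfolding s2_def by (rule run_codes[OF G(2) G2]) (use v1 R a1 B that in simp_all)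
 have c1': "snd s2 10 u 0 = cimg n E1 (Wst R al i j) u" if "u < n" for u using c1[OF that] by (simp add: a2)
 have R2: "v < n ==> snd s2 9 v 0 ~= 0 \<longleftrightarrow> v \<in> R" "v < n ==> snd s2 7 v 0 = al v" "v < n ==> snd s2 8 v 0 = be v" for v
  using R[of v] by (simp_all add: a2 a1)
 let ?N = "newly n E1 i j t"
 let ?I = "%k s'. \<forall>v<n. (snd s' 9 v 0 ~= 0 \<longleftrightarrow> v \<in> R \<or> v \<in> ?N & v < k) \<and>
  snd s' 7 v 0 = (if v \<in> ?N & v < k then cimg n E1 (Wst R al i j) v else al v) \<and>
  snd s' 8 v 0 = (if v \<in> ?N & v < k then cimg n E2 (Wst R be i j) v else be v)"
 let ?p = "Cond (Arr1 9 (Var 16)) Nop (Cond (Arr1 10 (Var 16))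
    (Put1 7 (Var 16) (Arr1 10 (Var 16)) ;; Put1 8 (Var 16) (Arr1 11 (Var 16)) ;;
    Put1 9 (Var 16) (Num 2)) Nop)"
 have I: "?I i (rn (For 16 (Var 20) ?p) s2)"
 proof (rule run_For[where m = i and I = ?I], goal_cases)
  case (3 k s')
  note fa = 3(3) and I = 3(4) and k = 3(1)
  have kn: "k < n" using k s(4) by simp
  have c: "snd s' 10 k 0 = cimg n E1 (Wst R al i j) k" "snd s' 11 k 0 = cimg n E2 (Wst R be i j) k"
   using c1'[OF kn] c2[OF kn] by (simp_all add: fa)
  have kR: "snd s' 9 k 0 ~= 0 \<longleftrightarrow> k \<in> R" using I kn by simp
  have kN: "k \<in> ?N \<longleftrightarrow> k \<notin> R & cimg n E1 (Wst R al i j) k ~= 0" using k by (simp add: newly_def t')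
  show ?case
  proof (cases "k \<in> ?N")
   case True
   thus ?thesis using I kR kN c by (auto simp: less_Suc_eq)
  next
   case False
   have e: "rn ?p (setv 16 k s') = setv 16 k s'" using False kR kN c by (cases "k \<in> R") simp_all
   have "v \<in> ?N & v < Suc k \<longleftrightarrow> v \<in> ?N & v < k" for v using False by (auto simp: less_Suc_eq)
   thus ?thesis unfolding e using I by simp
  qed
 qed (use v2 R2 in simp_all)
 have N: "v \<in> ?N & v < i \<longleftrightarrow> v \<in> ?N" for v using newly_subset[of n E1 i j t] by blast
 have e: "rn astep_cmd s = rn (For 16 (Var 20) ?p) s2" by (simp add: astep_cmd_def s1_def s2_def)
 show ?thesis unfolding e reps_def using I unfolding N by (simp add: astep_def t' Let_def)
qed

definition seed_cmd :: cmd where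
 "seed_cmd = For 16 (Var 0) (Put1 9 (Var 16) (Num 0) ;; Put1 7 (Var 16) (Num 0) ;; Put1 8 (Var 16) (Num 0)) ;;
   Put1 9 (Var 23) (Num 2) ;; Put1 7 (Var 23) (Var 24) ;; Put1 8 (Var 23) (Var 25)"

lemma seed_mod: "mv seed_cmd = {16}" "ma seed_cmd = {7, 8, 9}"
 by (auto simp: seed_cmd_def)

lemma run_seed:
 assumes s: "fst s 0 = n" "fst s 23 = r" "fst s 24 = p" "fst s 25 = q"
 shows "reps n (rn seed_cmd s) (seed_axes r p q)"
proof -
 let ?p = "Put1 9 (Var 16) (Num 0) ;; Put1 7 (Var 16) (Num 0) ;; Put1 8 (Var 16) (Num 0)"
 define s1 where "s1 = rn (For 16 (Var 0) ?p) s"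
 have "\<forall>v<n. snd s1 9 v 0 = 0 & snd s1 7 v 0 = 0 & snd s1 8 v 0 = 0"
  unfolding s1_def
 proof (rule run_For[where m = n and I = "%k s'. \<forall>v<k. snd s' 9 v 0 = 0 & snd s' 7 v 0 = 0 & snd s' 8 v 0 = 0"], goal_cases)
  case (3 k s')
  thus ?case by (auto simp: less_Suc_eq)
 qed (simp_all add: s)
 moreover have "fst s1 23 = r" "fst s1 24 = p" "fst s1 25 = q" using s by (simp_all add: s1_def frame_v)
 ultimately show ?thesis by (simp add: seed_cmd_def reps_def seed_axes_def flip: s1_def)
qed

definition prop_cmd :: cmd where
 "prop_cmd = seed_cmd ;; For 26 (Var 0) (For 22 (Var 0) (Assign 20 (Plus (Var 22) (Num 1)) ;;
   For 21 (Plus (Plus (Var 0) (Var 0)) (Num 1)) astep_cmd))"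

lemma prop_mod: "mv prop_cmd = {4, 5, 6, 10, 11, 12, 13, 14, 15, 16, 17, 18, 19, 20, 21, 22, 26}"
  "ma prop_cmd = {0, 2, 7, 8, 9, 10, 11, 20}"
 by (auto simp: prop_cmd_def seed_mod astep_mod)

lemma run_prop:
 assumes G: "simple_graph {..<n} E1" "simple_graph {..<n} E2" "adj s 5 n E1" "adj s 6 n E2"
  and s: "fst s 0 = n" "fst s 23 = r" "fst s 24 = p" "fst s 25 = q" and B: "4 <= B" "2 * n + 1 <= B"
 shows "reps n (rn prop_cmd s) (ploop n E1 E2 n (seed_axes r p q))"
proof -
 define s1 where "s1 = rn seed_cmd s"
 have s1: "reps n s1 (seed_axes r p q)" unfolding s1_def by (rule run_seed[OF s])
 have v1: "fst s1 0 = n" "adj s1 5 n E1" "adj s1 6 n E2" using s G by (simp_all add: s1_def frame_v frame_a seed_mod adj_def)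
 let ?pj = "For 21 (Plus (Plus (Var 0) (Var 0)) (Num 1)) astep_cmd"
 let ?pi = "For 22 (Var 0) (Assign 20 (Plus (Var 22) (Num 1)) ;; ?pj)"
 have "reps n (rn (For 26 (Var 0) ?pi) s1) (ploop n E1 E2 n (seed_axes r p q))"
 proof (rule run_For[where m = n and I = "%k s'. reps n s' (ploop n E1 E2 k (seed_axes r p q))"], goal_cases)
  case 2
  thus ?case using s1 by (simp add: loop_0)
 next
  case (3 k s')
  note fr = 3(2) and fa = 3(3) and I = 3(4)
  let ?t = "ploop n E1 E2 k (seed_axes r p q)"
  have v: "fst s' 0 = n" "snd s' 5 = snd s1 5" "snd s' 6 = snd s1 6" using v1 by (simp_all add: fr fa astep_mod)
  have "reps n (rn ?pi (setv 26 k s')) (iloop n E1 E2 n ?t)"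
  proof (rule run_For[where m = n and I = "%k s'. reps n s' (iloop n E1 E2 k ?t)"], goal_cases)
   case 2
   thus ?case using I by (simp add: loop_0 reps_def)
  next
   case (3 i s'')
   note fr' = 3(2) and fa' = 3(3) and I' = 3(4) and i = 3(1)
   let ?t' = "iloop n E1 E2 i ?t"
   have v': "fst s'' 0 = n" "snd s'' 5 = snd s1 5" "snd s'' 6 = snd s1 6" using v by (simp_all add: fr' fa' astep_mod)
   have e: "ev (setv 22 i s'') (Plus (Var 22) (Num 1)) = Suc i" using i B by simp
   let ?s3 = "setv 20 (Suc i) (setv 22 i s'')"
   have "reps n (rn ?pj ?s3) (jloop n E1 E2 (Suc i) (2 * n + 1) ?t')"
   proof (rule run_For[where m = "2 * n + 1" and I = "%k s'. reps n s' (jloop n E1 E2 (Suc i) k ?t')"], goal_cases)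
    case 1
    thus ?case using v'(1) B by simp
   next
    case 2
    thus ?case using I' by (simp add: loop_0 reps_def)
   next
    case (3 j s4)
    note fr4 = 3(2) and fa4 = 3(3) and I4 = 3(4)
    have v4: "fst s4 0 = n" "snd s4 5 = snd s1 5" "snd s4 6 = snd s1 6" "fst s4 20 = Suc i"
     using v' by (simp_all add: fr4 fa4 astep_mod)
    show ?case unfolding loop_Suc(1)
     by (rule run_astep[OF G(1,2)]) (use v4 v1 B i I4 in "simp_all add: adj_def reps_def")
   qed
   thus ?case unfolding loop_Suc(2) run_simps e by simp
  qed (simp add: v)
  thus ?case unfolding loop_Suc(3) .
 qed (simp add: v1)
 thus ?thesis by (simp add: prop_cmd_def s1_def)
qed

section \<open>Solving the linear system\<close>

text \<open>The digits of a counter in base \<open>n + 1\<close> run through the families of at most \<open>r\<close> vertices; the digit \<open>n\<close>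
 stands for no vertex.\<close>

definition digit :: "nat => nat => nat => nat" where
 "digit b q t = q div b ^ t mod b"

definition dset :: "nat => nat => nat => nat set" where
 "dset n r q = {j. j < n & (\<exists>t<r. digit (n + 1) q t = j)}"

lemma ex_digits: "(!!t. t < r ==> e t < b) ==> \<exists>q<b ^ r. \<forall>t<r. digit b q t = e t"
proof (induction r arbitrary: e)
 case (Suc r)
 hence "\<exists>q<b ^ r. \<forall>t<r. digit b q t = e (Suc t)" by simp
 then obtain q where q: "q < b ^ r" "!!t. t < r ==> digit b q t = e (Suc t)" by blast
 have e0: "e 0 < b" using Suc.prems by simp
 hence d: "(e 0 + b * q) div b ^ Suc t = q div b ^ t" for t
  by (simp add: div_mult2_eq)
 have "e 0 + b * q < b * Suc q" using e0 by simp
 also have "... <= b * b ^ r" by (rule mult_le_mono2) (use q(1) in simp)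
 finally have "e 0 + b * q < b ^ Suc r" by simp
 moreover have "digit b (e 0 + b * q) t = e t" if "t < Suc r" for t
 proof (cases t)
  case 0
  thus ?thesis using e0 by (simp add: digit_def)
 next
  case (Suc t')
  thus ?thesis using q(2)[of t'] that d[of t'] by (simp add: digit_def)
 qed
 ultimately show ?case by blast
qed simp

text \<open>The elements of \<open>J\<close> fill the first \<open>card J\<close> digits, and the
  rest is padded by the blank digit \<open>n\<close>.\<close>

lemma ex_dset:
 assumes "J \<subseteq> {..<n}" "card J <= r"
 shows "\<exists>q<(n + 1) ^ r. dset n r q = J"
proof -
 have "finite J" using assms(1) finite_subset by blast
 then obtain h where h: "bij_betw h {..<card J} J" using ex_bij_betw_nat_finite[of J] by (auto simp: atLeast0LessThan)
 let ?e = "%t. if t < card J then h t else n"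
 have hJ: "h t \<in> J" if "t < card J" for t using h that by (auto simp: bij_betw_def)
 hence hn: "h t < n" if "t < card J" for t using assms(1) that by blast
 hence "?e t < n + 1" for t by (simp add: less_SucI)
 then obtain q where q: "q < (n + 1) ^ r" "!!t. t < r ==> digit (n + 1) q t = ?e t" using ex_digits[of r ?e "n + 1"] by blast
 have "dset n r q = J"
 proof (intro equalityI subsetI)
  fix j assume "j \<in> dset n r q"
  then obtain t where "t < r" "?e t = j" "j < n" using q(2) by (auto simp: dset_def)
  thus "j \<in> J" using hJ by (auto split: if_splits)
 next
  fix j assume j: "j \<in> J"
  hence "j \<in> h ` {..<card J}" using h by (simp add: bij_betw_def)
  then obtain t where t: "t < card J" "h t = j" by (elim imageE) simp
  hence "t < r" "digit (n + 1) q t = j" "j < n" using q(2)[of t] hn[of t] assms(2) by auto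
  thus "j \<in> dset n r q" unfolding dset_def by blast
 qed
 thus ?thesis using q(1) by blast
qed

text \<open>A carry reaches position \<open>t\<close> exactly if \<open>b ^ t\<close> divides the
  new counter value.\<close>

lemma digit_Suc:
 assumes "b > 0"
 shows "digit b (Suc q) t = (if b ^ t dvd Suc q then (if digit b q t = b - 1 then 0 else Suc (digit b q t)) else digit b q t)"
  and "b ^ Suc t dvd Suc q \<longleftrightarrow> b ^ t dvd Suc q & digit b q t = b - 1"
proof -
 have d: "Suc q div b ^ t = (if b ^ t dvd Suc q then Suc (q div b ^ t) else q div b ^ t)"
  by (simp add: div_Suc dvd_eq_mod_eq_0)
 have s: "Suc (x mod b) = b \<longleftrightarrow> x mod b = b - 1" for x using assms by auto
 show "digit b (Suc q) t = (if b ^ t dvd Suc q then (if digit b q t = b - 1 then 0 else Suc (digit b q t)) else digit b q t)"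
  unfolding digit_def d by (simp add: mod_Suc s)
 show "b ^ Suc t dvd Suc q \<longleftrightarrow> b ^ t dvd Suc q & digit b q t = b - 1"
 proof (cases "b ^ t dvd Suc q")
  case True
  hence q: "Suc q = b ^ t * Suc (q div b ^ t)" using d by (metis dvd_mult_div_cancel)
  have "b ^ Suc t dvd Suc q \<longleftrightarrow> b ^ t * b dvd b ^ t * Suc (q div b ^ t)" using q by (simp add: mult.commute)
  also have "... \<longleftrightarrow> b dvd Suc (q div b ^ t)" using assms nat_mult_dvd_cancel_disj[of "b ^ t" b "Suc (q div b ^ t)"] by (simp del: mult_Suc_right)
  also have "... \<longleftrightarrow> digit b q t = b - 1" unfolding digit_def dvd_eq_mod_eq_0 mod_Suc using s[of "q div b ^ t"] by simp
  finally show ?thesis using True by simp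
 next
  case False
  thus ?thesis using dvd_trans[of "b ^ t" "b ^ Suc t" "Suc q"] by auto
 qed
qed

definition inc_cmd :: cmd where
 "inc_cmd = Assign 34 (Num 2) ;; For 30 (Var 3) (Cond (Var 34) (Cond (ltE (Arr1 12 (Var 30)) (Var 0))
   (Put1 12 (Var 30) (Plus (Arr1 12 (Var 30)) (Num 1)) ;; Assign 34 (Num 0)) (Put1 12 (Var 30) (Num 0))) Nop)"

lemma inc_mod: "mv inc_cmd = {30, 34}" "ma inc_cmd = {12}"
 by (auto simp: inc_cmd_def)

lemma run_inc:
 assumes s: "fst s 0 = n" "fst s 3 = r" and B: "n < B" and d: "!!t. t < r ==> snd s 12 t 0 = digit (n + 1) q t" and t: "t < r"
 shows "snd (rn inc_cmd s) 12 t 0 = digit (n + 1) (Suc q) t"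
proof -
 let ?b = "n + 1"
 let ?p = "Cond (Var 34) (Cond (ltE (Arr1 12 (Var 30)) (Var 0))
   (Put1 12 (Var 30) (Plus (Arr1 12 (Var 30)) (Num 1)) ;; Assign 34 (Num 0)) (Put1 12 (Var 30) (Num 0))) Nop"
 let ?I = "%k s'. (fst s' 34 ~= 0 \<longleftrightarrow> ?b ^ k dvd Suc q) & (\<forall>t<r. snd s' 12 t 0 = digit ?b (if t < k then Suc q else q) t)"
 have "?I r (rn (For 30 (Var 3) ?p) (setv 34 2 s))"
 proof (rule run_For[where m = r and I = ?I], goal_cases)
  case (3 k s')
  note fr = 3(2) and I = 3(4) and k = 3(1)
  have v: "fst s' 0 = n" using s by (simp add: fr)
  have dk: "snd s' 12 k 0 = digit ?b q k" using I k by simp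
  have le: "digit ?b q k <= n" by (simp add: digit_def less_Suc_eq_le[symmetric])
  have D: "digit ?b (Suc q) k = (if ?b ^ k dvd Suc q then (if digit ?b q k = n then 0 else Suc (digit ?b q k)) else digit ?b q k)"
   "?b ^ Suc k dvd Suc q \<longleftrightarrow> ?b ^ k dvd Suc q & digit ?b q k = n"
   using digit_Suc(1)[of ?b q k] digit_Suc(2)[of ?b k q] by (simp_all del: power_Suc)
  show ?case
  proof (cases "?b ^ k dvd Suc q")
   case False
   hence e: "rn ?p (setv 30 k s') = setv 30 k s'" using I by simp
   show ?thesis unfolding e using I False D by (auto simp: less_Suc_eq simp del: power_Suc)
  next
   case True
   hence c: "fst s' 34 ~= 0" using I by simp
   show ?thesis
   proof (cases "digit ?b q k = n")
    case eq: True
    hence e: "rn ?p (setv 30 k s') = seta 12 k 0 0 (setv 30 k s')" using c dk v by simp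
    show ?thesis unfolding e using I c True eq D by (auto simp: less_Suc_eq simp del: power_Suc)
   next
    case ne: False
    hence lt: "digit ?b q k < n" using le by simp
    hence e: "rn ?p (setv 30 k s') = setv 34 0 (seta 12 k 0 (Suc (digit ?b q k)) (setv 30 k s'))"
     using c dk v B by simp
    show ?thesis unfolding e using I True ne D by (auto simp: less_Suc_eq simp del: power_Suc)
   qed
  qed
 qed (use s d in simp_all)
 thus ?thesis using t by (simp add: inc_cmd_def)
qed

text \<open>Variable 36 counts \<open>J\<close> and variable 35 becomes the coefficient
  \<open>2 ^ card J\<close> modulo \<open>2 ^ r\<close>. For the empty set it is reset to 0, which
  makes the equation trivial, as the system ranges over nonempty \<open>J\<close>.\<close>

definition mark_cmd :: cmd where
 "mark_cmd = For 30 (Var 0) (Put1 13 (Var 30) (Num 0)) ;;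
   For 30 (Var 3) (Cond (ltE (Arr1 12 (Var 30)) (Var 0)) (Put1 13 (Arr1 12 (Var 30)) (Num 2)) Nop) ;;
   Assign 35 (Num 1) ;; Assign 36 (Num 0) ;;
   For 30 (Var 0) (Cond (Arr1 13 (Var 30)) (Assign 35 (addm (Var 35) (Var 35)) ;; Assign 36 (Plus (Var 36) (Num 1))) Nop) ;;
   Cond (Var 36) Nop (Assign 35 (Num 0))"

lemma mark_mod: "mv mark_cmd = {30, 35, 36}" "ma mark_cmd = {13}"
 by (auto simp: mark_cmd_def)

lemma run_mark:
 assumes s: "fst s 0 = n" "fst s 3 = r" "fst s 4 = M" and B: "n < B" "2 * M <= B" "1 < M"
  and d: "!!t. t < r ==> snd s 12 t 0 = digit (n + 1) q t"
 defines "J \<equiv> dset n r q" and "s' \<equiv> rn mark_cmd s"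
 shows "\<forall>j<n. snd s' 13 j 0 ~= 0 \<longleftrightarrow> j \<in> J" "fst s' 36 = card J" "fst s' 35 = (if J = {} then 0 else 2 ^ card J mod M)"
proof -
 have Jn: "J \<subseteq> {..<n}" by (auto simp: J_def dset_def)
 hence fin: "finite J" using finite_subset by blast
 let ?p1 = "Put1 13 (Var 30) (Num 0)"
 let ?p2 = "Cond (ltE (Arr1 12 (Var 30)) (Var 0)) (Put1 13 (Arr1 12 (Var 30)) (Num 2)) Nop"
 let ?p3 = "Cond (Arr1 13 (Var 30)) (Assign 35 (addm (Var 35) (Var 35)) ;; Assign 36 (Plus (Var 36) (Num 1))) Nop"
 define s1 where "s1 = rn (For 30 (Var 0) ?p1) s"
 have 1: "\<forall>j<n. snd s1 13 j 0 = 0"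
  unfolding s1_def by (rule run_For[where m = n and I = "%k s'. \<forall>j<k. snd s' 13 j 0 = 0"]) (auto simp: s less_Suc_eq)
 have v1: "fst s1 0 = n" "fst s1 3 = r" "fst s1 4 = M" "snd s1 12 = snd s 12" using s by (simp_all add: s1_def frame_v frame_a)
 define s2 where "s2 = rn (For 30 (Var 3) ?p2) s1"
 have "\<forall>j<n. snd s2 13 j 0 ~= 0 \<longleftrightarrow> (\<exists>t<r. digit (n + 1) q t = j)"
  unfolding s2_def
 proof (rule run_For[where m = r and I = "%k s'. \<forall>j<n. snd s' 13 j 0 ~= 0 \<longleftrightarrow> (\<exists>t<k. digit (n + 1) q t = j)"], goal_cases)
  case (3 k s')
  have v: "fst s' 0 = n" "snd s' 12 k 0 = digit (n + 1) q k" using v1 d[OF 3(1)] by (simp_all add: 3(2,3))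
  thus ?case using 3(4) by (auto simp: less_Suc_eq)
 qed (use v1 1 in simp_all)
 hence 2: "\<forall>j<n. snd s2 13 j 0 ~= 0 \<longleftrightarrow> j \<in> J" by (simp add: J_def dset_def)
 have v2: "fst s2 0 = n" "fst s2 4 = M" using v1 by (simp_all add: s2_def frame_v)
 define s3 where "s3 = rn (For 30 (Var 0) ?p3) (setv 36 0 (setv 35 1 s2))"
 have m3: "snd s3 13 = snd s2 13" by (simp add: s3_def frame_a)
 have "fst s3 35 = 2 ^ card (J \<inter> {..<n}) mod M & fst s3 36 = card (J \<inter> {..<n})"
  unfolding s3_def
 proof (rule run_For[where m = n and I = "%k s'. fst s' 35 = 2 ^ card (J \<inter> {..<k}) mod M & fst s' 36 = card (J \<inter> {..<k})"], goal_cases)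
  case (3 k s')
  note fr = 3(2) and fa = 3(3) and I = 3(4) and k = 3(1)
  have v: "fst s' 4 = M" "snd s' 13 k 0 ~= 0 \<longleftrightarrow> k \<in> J" using v2 2 k by (simp_all add: fr fa)
  show ?case
  proof (cases "k \<in> J")
   case True
   have c: "card (J \<inter> {..<Suc k}) = Suc (card (J \<inter> {..<k}))"
   proof -
    have "J \<inter> {..<Suc k} = insert k (J \<inter> {..<k})" using True by auto
    thus ?thesis using fin by simp
   qed
   have "card (J \<inter> {..<k}) <= k" using card_mono[of "{..<k}" "J \<inter> {..<k}"] by simp
   moreover have "ev (setv 30 k s') (addm (Var 35) (Var 35)) = 2 ^ Suc (card (J \<inter> {..<k})) mod M"
   proof -
    have "ev (setv 30 k s') (addm (Var 35) (Var 35)) = (2 ^ card (J \<inter> {..<k}) mod M + 2 ^ card (J \<inter> {..<k}) mod M) mod M"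
     using eval_addm[of B f "setv 30 k s'" "Var 35" M "Var 35"] I v B by simp
    also have "... = (2 ^ card (J \<inter> {..<k}) + 2 ^ card (J \<inter> {..<k})) mod M" by (rule mod_add_eq)
    finally show ?thesis by (simp add: mult_2)
   qed
   ultimately show ?thesis unfolding c using I v True k B by simp
  next
   case False
   hence "J \<inter> {..<Suc k} = J \<inter> {..<k}" by (auto simp: less_Suc_eq)
   thus ?thesis using I v False by simp
  qed
 qed (use v2 B in simp_all)
 moreover have "J \<inter> {..<n} = J" using Jn by blast
 ultimately have 3: "fst s3 35 = 2 ^ card J mod M" "fst s3 36 = card J" by simp_all
 have e: "s' = (if card J = 0 then setv 35 0 s3 else s3)"
  using 3(2) by (simp add: s'_def mark_cmd_def s1_def s2_def s3_def)
 show "\<forall>j<n. snd s' 13 j 0 ~= 0 \<longleftrightarrow> j \<in> J" using 2 m3 by (simp add: e)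
 show "fst s' 36 = card J" "fst s' 35 = (if J = {} then 0 else 2 ^ card J mod M)" using 3 fin by (simp_all add: e)
qed

definition sysrel :: "nat => nat set set => nat set set => (nat => nat) => (nat => nat) => store => bool" where
 "sysrel n E1 E2 al be s \<longleftrightarrow> fst s 0 = n & adj s 5 n E1 & adj s 6 n E2 & (\<forall>u<n. snd s 7 u 0 = al u & snd s 8 u 0 = be u)"

definition oddp :: "nat => nat set set => nat set set => (nat => nat) => (nat => nat) => nat set => nat => bool" where
 "oddp n E1 E2 al be J k \<longleftrightarrow> (\<exists>j. J = {j} \<and>
   odd (card (gena al E1 {..<n} j \<inter> genc be E2 {..<n} k) + card (genc al E1 {..<n} j \<inter> gena be E2 {..<n} k)))"

text \<open>The condition imposed for the pair \<open>(J, k)\<close> on a solution, homogenized with the coordinate \<open>n\<close>.\<close>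

definition jcon :: "nat => nat => nat set set => nat set set => (nat => nat) => (nat => nat) => nat set => nat => (nat => int) => bool" where
 "jcon r n E1 E2 al be J k x \<longleftrightarrow> J ~= {} -->
   2 ^ r dvd 2 ^ card J * (\<Sum>u\<in>{u \<in> gena be E2 {..<n} k. \<forall>j\<in>J. u \<in> gena al E1 {..<n} j}. x u)
    - (if oddp n E1 E2 al be J k then 2 ^ (r - 1) else 0) * x n"

context
 fixes n :: nat and E1 E2 :: "nat set set" and al be :: "nat => nat"
begin

abbreviation ga where "ga \<equiv> gena al E1 {..<n}"
abbreviation gb where "gb \<equiv> gena be E2 {..<n}"
abbreviation ca where "ca \<equiv> genc al E1 {..<n}"
abbreviation cb where "cb \<equiv> genc be E2 {..<n}"
abbreviation sys where "sys \<equiv> sysrel n E1 E2 al be"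
abbreviation odp where "odp \<equiv> oddp n E1 E2 al be"
abbreviation jc where "jc r \<equiv> jcon r n E1 E2 al be"

abbreviation "gaE \<equiv> axE 5 (Arr1 7 (Var 38)) (Var 30) (Var 38)"
abbreviation "gbE \<equiv> axE 6 (Arr1 8 (Var 38)) (Var 37) (Var 38)"
abbreviation "caE \<equiv> cxE 5 (Arr1 7 (Var 38)) (Var 30) (Var 38)"
abbreviation "cbE \<equiv> cxE 6 (Arr1 8 (Var 38)) (Var 37) (Var 38)"

lemma sysrel_cong:
 "sys s ==> fst s' 0 = fst s 0 ==> snd s' 5 = snd s 5 ==> snd s' 6 = snd s 6 ==> snd s' 7 = snd s 7 ==>
  snd s' 8 = snd s 8 ==> sys s'"
 by (simp add: sysrel_def adj_def)

lemma eval_sys: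
 assumes G: "simple_graph {..<n} E1" "simple_graph {..<n} E2" and s: "sys s"
  and U: "ev s U < n" "ev s J < n"
 shows "ev s (axE 5 (Arr1 7 U) J U) = of_bool (ev s U \<in> ga (ev s J))"
  "ev s (cxE 5 (Arr1 7 U) J U) = of_bool (ev s U \<in> ca (ev s J))"
  "ev s (axE 6 (Arr1 8 U) J U) = of_bool (ev s U \<in> gb (ev s J))"
  "ev s (cxE 6 (Arr1 8 U) J U) = of_bool (ev s U \<in> cb (ev s J))"
proof -
 have a: "adj s 5 n E1" "adj s 6 n E2" "snd s 7 (ev s U) 0 = al (ev s U)" "snd s 8 (ev s U) 0 = be (ev s U)"
  using s U by (simp_all add: sysrel_def)
 note e1 = eval_axE[OF G(1) a(1) _ U(2,1), of "Arr1 7 U"] and e2 = eval_axE[OF G(2) a(2) _ U(2,1), of "Arr1 8 U"]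
 show "ev s (axE 5 (Arr1 7 U) J U) = of_bool (ev s U \<in> ga (ev s J))"
  "ev s (cxE 5 (Arr1 7 U) J U) = of_bool (ev s U \<in> ca (ev s J))"
  using e1 a(3) U by (simp_all add: gena_def genc_def)
 show "ev s (axE 6 (Arr1 8 U) J U) = of_bool (ev s U \<in> gb (ev s J))"
  "ev s (cxE 6 (Arr1 8 U) J U) = of_bool (ev s U \<in> cb (ev s J))"
  using e2 a(4) U by (simp_all add: gena_def genc_def)
qed

definition row_cmd :: cmd where
 "row_cmd = For 38 (Var 0) (Assign 39 gbE ;;
   For 30 (Var 0) (Cond (Arr1 13 (Var 30)) (Cond gaE Nop (Assign 39 (Num 0))) Nop) ;;
   Put1 20 (Var 38) (IfE (Var 39) (Var 35) (Num 0)))"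

lemma row_mod: "mv row_cmd = {30, 38, 39}" "ma row_cmd = {20}"
 by (auto simp: row_cmd_def)

lemma run_row:
 assumes G: "simple_graph {..<n} E1" "simple_graph {..<n} E2" and s: "sys s" "fst s 37 = k" "k < n"
  and J: "\<forall>j<n. snd s 13 j 0 ~= 0 \<longleftrightarrow> j \<in> J" "J \<subseteq> {..<n}" and u: "u < n"
 shows "snd (rn row_cmd s) 20 u 0 =
  (if u \<in> gb k & (\<forall>j\<in>J. u \<in> ga j) then fst s 35 else 0)"
proof -
 let ?b = "gb" and ?a = "ga"
 let ?q = "Cond (Arr1 13 (Var 30)) (Cond gaE Nop (Assign 39 (Num 0))) Nop"
 let ?e = "%u. if u \<in> ?b k & (\<forall>j\<in>J. u \<in> ?a j) then fst s 35 else 0"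
 have n0: "fst s 0 = n" using s(1) by (simp add: sysrel_def)
 have "\<forall>u<n. snd (rn row_cmd s) 20 u 0 = ?e u"
  unfolding row_cmd_def
 proof (rule run_For[where m = n and I = "%l s'. \<forall>u<l. snd s' 20 u 0 = ?e u"], goal_cases)
  case (3 u s')
  note fr = 3(2) and fa = 3(3) and u = 3(1)
  have s1: "sys (setv 38 u s')" by (rule sysrel_cong[OF s(1)]) (simp_all add: fr fa)
  have e1: "ev (setv 38 u s') gbE = of_bool (u \<in> ?b k)"
   using eval_sys(3)[OF G s1, of "Var 38" "Var 37"] s u by (simp add: fr)
  define s2 where "s2 = setv 39 (of_bool (u \<in> ?b k)) (setv 38 u s')"
  have v2: "fst s2 0 = n" "fst s2 38 = u" "fst s2 35 = fst s 35" "snd s2 13 = snd s 13" using n0 by (simp_all add: s2_def fr fa)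
  have s2: "sys s2" by (rule sysrel_cong[OF s1]) (simp_all add: s2_def)
  define s3 where "s3 = rn (For 30 (Var 0) ?q) s2"
  have "fst s3 39 ~= 0 \<longleftrightarrow> u \<in> ?b k & (\<forall>j\<in>J. j < n --> u \<in> ?a j)"
   unfolding s3_def
  proof (rule run_For[where m = n and I = "%l s'. fst s' 39 ~= 0 \<longleftrightarrow> u \<in> ?b k & (\<forall>j\<in>J. j < l --> u \<in> ?a j)"], goal_cases)
   case (3 j s4)
   note fr' = 3(2) and fa' = 3(3) and I = 3(4) and j = 3(1)
   have s4: "sys (setv 30 j s4)" by (rule sysrel_cong[OF s2]) (simp_all add: fr' fa')
   have v4: "fst s4 38 = u" "snd s4 13 j 0 ~= 0 \<longleftrightarrow> j \<in> J" using v2 J(1) j by (simp_all add: fr' fa')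
   have e: "ev (setv 30 j s4) gaE = of_bool (u \<in> ?a j)"
    using eval_sys(1)[OF G s4, of "Var 38" "Var 30"] v4 u j by simp
   have l: "(\<forall>i\<in>J. i < Suc j --> u \<in> ?a i) \<longleftrightarrow> (\<forall>i\<in>J. i < j --> u \<in> ?a i) & (j \<in> J --> u \<in> ?a j)"
    by (auto simp: less_Suc_eq)
   show ?case unfolding l using I v4 e by (cases "j \<in> J"; cases "u \<in> ?a j") simp_all
  qed (use v2 in "simp_all add: s2_def")
  hence e39: "fst s3 39 ~= 0 \<longleftrightarrow> u \<in> ?b k & (\<forall>j\<in>J. u \<in> ?a j)" using J(2) by auto
  have v3: "fst s3 35 = fst s 35" "fst s3 38 = u" "snd s3 20 = snd s' 20" using v2 by (simp_all add: s3_def frame_v frame_a s2_def)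
  have e: "rn (Assign 39 gbE ;; For 30 (Var 0) ?q ;;
    Put1 20 (Var 38) (IfE (Var 39) (Var 35) (Num 0))) (setv 38 u s') = seta 20 u 0 (?e u) s3"
   unfolding run_simps e1 s2_def[symmetric] s3_def[symmetric] using e39 v3 by simp
  show ?case unfolding e using 3(4) v3 by (auto simp: less_Suc_eq)
 qed (simp_all add: n0)
 thus ?thesis using u by simp
qed

definition par_cmd :: cmd where
 "par_cmd = For 38 (Var 0)
   (Cond gaE (Cond cbE (Assign 40 (Minus (Num 1) (Var 40))) Nop) Nop ;;
   Cond caE (Cond gbE (Assign 40 (Minus (Num 1) (Var 40))) Nop) Nop)"

lemma par_mod: "mv par_cmd = {38, 40}" "ma par_cmd = {}"
 by (auto simp: par_cmd_def)

lemma run_par: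
 assumes G: "simple_graph {..<n} E1" "simple_graph {..<n} E2" and s: "sys s" "fst s 37 = k" "k < n" "fst s 30 = j" "j < n" "fst s 40 = 0"
 shows "fst (rn par_cmd s) 40 = of_bool (odd (card (ga j \<inter> cb k) + card (ca j \<inter> gb k)))"
proof -
 let ?x = "ga j \<inter> cb k" and ?y = "ca j \<inter> gb k"
 have n0: "fst s 0 = n" using s(1) by (simp add: sysrel_def)
 have "fst (rn par_cmd s) 40 = of_bool (odd (card (?x \<inter> {..<n}) + card (?y \<inter> {..<n})))"
  unfolding par_cmd_def
 proof (rule run_For[where m = n and I = "%l s'. fst s' 40 = of_bool (odd (card (?x \<inter> {..<l}) + card (?y \<inter> {..<l})))"], goal_cases)
  case (3 u s')
  note fr = 3(2) and fa = 3(3) and u = 3(1) and I = 3(4)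
  have c: "card (z \<inter> {..<Suc u}) = card (z \<inter> {..<u}) + of_bool (u \<in> z)" for z
  proof -
   have "z \<inter> {..<Suc u} = (if u \<in> z then insert u (z \<inter> {..<u}) else z \<inter> {..<u})" by (auto simp: less_Suc_eq)
   thus ?thesis by simp
  qed
  have v: "fst s' 37 = k" "fst s' 30 = j" using s by (simp_all add: fr)
  have ev: "ev t gaE = of_bool (u \<in> ga j)"
    "ev t caE = of_bool (u \<in> ca j)"
    "ev t gbE = of_bool (u \<in> gb k)"
    "ev t cbE = of_bool (u \<in> cb k)"
   if t: "!!y. y ~= 40 ==> fst t y = fst (setv 38 u s') y" "snd t = snd s'" for t
  proof -
   have 1: "sys t" by (rule sysrel_cong[OF s(1)]) (simp_all add: t fr fa)
   have 2: "fst t 38 = u" "fst t 30 = j" "fst t 37 = k" using t(1)[of 38] t(1)[of 30] t(1)[of 37] v by simp_all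
   show "ev t gaE = of_bool (u \<in> ga j)"
    "ev t caE = of_bool (u \<in> ca j)"
    using eval_sys(1,2)[OF G 1, of "Var 38" "Var 30"] 2 u s by simp_all
   show "ev t gbE = of_bool (u \<in> gb k)"
    "ev t cbE = of_bool (u \<in> cb k)"
    using eval_sys(3,4)[OF G 1, of "Var 38" "Var 37"] 2 u s by simp_all
  qed
  define t where "t = (if u \<in> ?x then setv 40 (1 - fst s' 40) (setv 38 u s') else setv 38 u s')"
  have t: "!!y. y ~= 40 ==> fst t y = fst (setv 38 u s') y" "snd t = snd s'" by (simp_all add: t_def)
  have t40: "fst t 40 = (if u \<in> ?x then 1 - fst s' 40 else fst s' 40)" by (simp add: t_def)
  note ev1 = ev[of "setv 38 u s'", simplified] and ev2 = ev[OF t]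
  show ?case
  proof -
   have e1: "rn (Cond gaE (Cond cbE (Assign 40 (Minus (Num 1) (Var 40))) Nop) Nop)
     (setv 38 u s') = t" unfolding t_def by (simp add: ev1)
   show ?thesis unfolding run.simps(3) e1 c using I t40 by (auto simp: ev2)
  qed
 qed (simp_all add: n0 s)
 moreover have "?x \<inter> {..<n} = ?x" "?y \<inter> {..<n} = ?y" by (auto simp: gena_def genc_def)
 ultimately show ?thesis by simp
qed

definition beta_cmd :: cmd where
 "beta_cmd = Assign 40 (Num 0) ;; Cond (eqE (Var 36) (Num 1)) (For 30 (Var 0) (Cond (Arr1 13 (Var 30)) par_cmd Nop)) Nop"

lemma beta_mod: "mv beta_cmd = {30, 38, 40}" "ma beta_cmd = {}"
 by (auto simp: beta_cmd_def par_mod)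

lemma run_beta:
 assumes G: "simple_graph {..<n} E1" "simple_graph {..<n} E2" and s: "sys s" "fst s 37 = k" "k < n" "fst s 36 = card J"
  and J: "\<forall>j<n. snd s 13 j 0 ~= 0 \<longleftrightarrow> j \<in> J" "J \<subseteq> {..<n}"
 shows "fst (rn beta_cmd s) 40 = of_bool (odp J k)"
proof (cases "card J = 1")
 case False
 hence "\<not> odp J k" by (auto simp: oddp_def)
 thus ?thesis using False s(4) by (simp add: beta_cmd_def)
next
 case True
 then obtain i where i: "J = {i}" by (rule card_1_singletonE)
 have iN: "i < n" using J(2) i by simp
 have n0: "fst s 0 = n" using s(1) by (simp add: sysrel_def)
 let ?p = "Cond (Arr1 13 (Var 30)) par_cmd Nop"
 have "fst (rn (For 30 (Var 0) ?p) (setv 40 0 s)) 40 = of_bool (i < n & odp J k)"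
 proof (rule run_For[where m = n and I = "%l s'. fst s' 40 = of_bool (i < l & odp J k)"], goal_cases)
  case (3 j s')
  note fr = 3(2) and fa = 3(3) and j = 3(1) and I = 3(4)
  have v: "fst s' 37 = k" "snd s' 13 j 0 ~= 0 \<longleftrightarrow> j = i" using s J(1) j i by (simp_all add: fr fa par_mod)
  show ?case
  proof (cases "j = i")
   case True
   have 1: "sys (setv 30 j s')" by (rule sysrel_cong[OF s(1)]) (simp_all add: fr fa par_mod)
   have "fst (rn par_cmd (setv 30 j s')) 40 = of_bool (odp J k)"
    using run_par[OF G 1, of k j] v s j I True unfolding oddp_def i by simp
   thus ?thesis using v True by simp
  next
   case False
   thus ?thesis using v I by auto
  qed
 qed (simp_all add: n0)
 thus ?thesis using True s(4) iN by (simp add: beta_cmd_def)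
qed

definition eqn_cmd :: cmd where
 "eqn_cmd = row_cmd ;; beta_cmd ;; Put1 20 (Var 0) (IfE (Var 40) (Var 2) (Num 0)) ;; cons_cmd"

lemma eqn_mod: "mv eqn_cmd = {10, 11, 12, 13, 14, 15, 30, 38, 39, 40}" "ma eqn_cmd = {0, 2, 20}"
 by (auto simp: eqn_cmd_def row_mod beta_mod cons_mod)

lemma run_eqn:
 assumes G: "simple_graph {..<n} E1" "simple_graph {..<n} E2" and s: "sys s" "fst s 37 = k" "k < n" "fst s 36 = card J"
  and J: "\<forall>j<n. snd s 13 j 0 ~= 0 \<longleftrightarrow> j \<in> J" "J \<subseteq> {..<n}"
  and v: "fst s 35 = (if J = {} then 0 else 2 ^ card J mod 2 ^ r)" "fst s 2 = 2 ^ (r - 1)" "r \<ge> 1"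
  and m: "fst s 4 = 2 ^ r" "fst s 5 = r" "fst s 6 = n + 1" "2 * 2 ^ r <= B"
  and lt: "!!i z. i < n + 1 ==> z < n + 1 ==> snd s 0 i z < 2 ^ r"
 shows "gen_span (n + 1) (2 ^ r) (snd (rn eqn_cmd s) 0) = {x \<in> gen_span (n + 1) (2 ^ r) (snd s 0). jc r J k x} \<and>
  (\<forall>i<n + 1. \<forall>z<n + 1. snd (rn eqn_cmd s) 0 i z < 2 ^ r)"
proof -
 let ?S = "{u \<in> gb k. \<forall>j\<in>J. u \<in> ga j}"
 let ?h = "if odp J k then 2 ^ (r - 1) else 0 :: nat"
 define s1 where "s1 = rn row_cmd s"
 have r1: "snd s1 20 u 0 = (if u \<in> ?S then fst s 35 else 0)" if "u < n" for u
  unfolding s1_def using run_row[OF G s(1-3) J that] by simp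
 have s1: "sys s1" by (rule sysrel_cong[OF s(1)]) (simp_all add: s1_def frame_v frame_a row_mod)
 have v1: "fst s1 37 = k" "fst s1 36 = card J" "snd s1 13 = snd s 13" "snd s1 0 = snd s 0" "fst s1 0 = n" "fst s1 2 = 2 ^ (r - 1)"
  "fst s1 4 = 2 ^ r" "fst s1 5 = r" "fst s1 6 = n + 1"
  using s v m by (simp_all add: s1_def frame_v frame_a row_mod sysrel_def)
 define s2 where "s2 = rn beta_cmd s1"
 have b2: "fst s2 40 = of_bool (odp J k)"
  unfolding s2_def by (rule run_beta[OF G s1]) (use v1 s(3) J in simp_all)
 have v2: "snd s2 = snd s1" "fst s2 0 = n" "fst s2 2 = 2 ^ (r - 1)" "fst s2 4 = 2 ^ r" "fst s2 5 = r" "fst s2 6 = n + 1"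
  using v1 by (simp_all add: s2_def frame_v frame_a beta_mod fun_eq_iff)
 define s3 where "s3 = seta 20 n 0 ?h s2"
 have e: "rn eqn_cmd s = rn cons_cmd s3"
  using v2 b2 by (simp add: eqn_cmd_def s3_def flip: s1_def s2_def)
 have v3: "fst s3 4 = 2 ^ r" "fst s3 5 = r" "fst s3 6 = n + 1" "snd s3 0 = snd s 0" using v2 v1 by (simp_all add: s3_def seta_other)
 have E3: "snd s3 20 z 0 = (if z < n then (if z \<in> ?S then fst s 35 else 0) else ?h)" if "z < n + 1" for z
  using r1[of z] that v2(1) by (auto simp: s3_def less_Suc_eq)
 have h: "?h < 2 ^ r" using v(3) by simp
 have p: "fst s 35 < 2 ^ r" using v(1) by simp
 have E: "snd s3 20 z 0 < 2 ^ r" if "z < n + 1" for z using E3[OF that] h p by simp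
 have lt3: "!!i z. i < n + 1 ==> z < n + 1 ==> snd s3 0 i z < 2 ^ r" using lt v3(4) by simp
 note c = run_cons[OF v3(1-3) m(4) lt3 E, unfolded v3(4)]
 have "2 ^ r dvd dotp (n + 1) (%z. snd s3 20 z 0) x \<longleftrightarrow> jc r J k x" for x
 proof -
  have Sn: "?S \<subseteq> {..<n}" by (auto simp: gena_def)
  have "dotp (n + 1) (%z. snd s3 20 z 0) x = (\<Sum>z<n. int (snd s3 20 z 0) * x z) + int (snd s3 20 n 0) * x n"
   by (simp add: dotp_def)
  also have "(\<Sum>z<n. int (snd s3 20 z 0) * x z) = (\<Sum>z<n. if z \<in> ?S then int (fst s 35) * x z else 0)"
   by (rule sum.cong) (use E3 in simp_all)
  also have "... = (\<Sum>z\<in>{..<n} \<inter> ?S. int (fst s 35) * x z)" by (rule sum.inter_restrict[symmetric]) simp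
  also have "{..<n} \<inter> ?S = ?S" using Sn by blast
  also have "(\<Sum>z\<in>?S. int (fst s 35) * x z) = int (fst s 35) * sum x ?S" by (simp add: sum_distrib_left)
  finally have d: "dotp (n + 1) (%z. snd s3 20 z 0) x = int (fst s 35) * sum x ?S + int ?h * x n" using E3[of n] by simp
  show ?thesis
  proof (cases "J = {}")
   case True
   thus ?thesis unfolding d using v(1) by (simp add: jcon_def oddp_def)
  next
   case False
   let ?w = "2 ^ card J * sum x ?S - int ?h * x n"
   have a: "2 ^ r dvd int (fst s 35) - 2 ^ card J"
    using v(1) False mod_eq_dvd_iff[of "int (fst s 35)" "2 ^ r" "2 ^ card J"] by (simp add: zmod_int)
   \<comment> \<open>The stored coefficient of \<open>x n\<close> is \<open>?h\<close> where the
     equation has its negative; since \<open>?h + ?h\<close> is 0 or \<open>2 ^ r\<close>, the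
     congruence is the same.\<close>
   have b: "2 ^ r dvd int ?h + int ?h"
   proof -
    have "(2 :: int) ^ (r - 1) + 2 ^ (r - 1) = 2 ^ r" using v(3) by (simp add: power_eq_if)
    thus ?thesis by simp
   qed
   have "int (fst s 35) * sum x ?S + int ?h * x n - ?w = (int (fst s 35) - 2 ^ card J) * sum x ?S + (int ?h + int ?h) * x n"
    by (simp add: algebra_simps)
   also have "2 ^ r dvd ..." by (rule dvd_add[OF dvd_mult2[OF a] dvd_mult2[OF b]])
   finally have "2 ^ r dvd dotp (n + 1) (%z. snd s3 20 z 0) x \<longleftrightarrow> 2 ^ r dvd ?w" unfolding d by (rule dvd_iff_diff)
   thus ?thesis using False by (simp add: jcon_def)
  qed
 qed
 thus ?thesis using c unfolding e by simp
qed

definition tuple_cmd :: cmd where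
 "tuple_cmd = mark_cmd ;; For 37 (Var 0) eqn_cmd"

lemma tuple_mod: "mv tuple_cmd = {10, 11, 12, 13, 14, 15, 30, 35, 36, 37, 38, 39, 40}" "ma tuple_cmd = {0, 2, 13, 20}"
 by (auto simp: tuple_cmd_def mark_mod eqn_mod)

lemma run_tuple:
 assumes G: "simple_graph {..<n} E1" "simple_graph {..<n} E2" and s: "sys s" "fst s 3 = r"
  and v: "fst s 2 = 2 ^ (r - 1)" "r \<ge> 1"
  and m: "fst s 4 = 2 ^ r" "fst s 5 = r" "fst s 6 = n + 1" "2 * 2 ^ r <= B" "n < B"
  and d: "!!t. t < r ==> snd s 12 t 0 = digit (n + 1) q t"
  and lt: "\<forall>i<n + 1. \<forall>z<n + 1. snd s 0 i z < 2 ^ r"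
 shows "gen_span (n + 1) (2 ^ r) (snd (rn tuple_cmd s) 0) =
   {x \<in> gen_span (n + 1) (2 ^ r) (snd s 0). \<forall>k<n. jc r (dset n r q) k x} \<and>
  (\<forall>i<n + 1. \<forall>z<n + 1. snd (rn tuple_cmd s) 0 i z < 2 ^ r)"
proof -
 let ?J = "dset n r q"
 have J: "?J \<subseteq> {..<n}" by (auto simp: dset_def)
 have n0: "fst s 0 = n" using s(1) by (simp add: sysrel_def)
 have r2: "1 < (2 :: nat) ^ r" by (rule one_less_power) (use v(2) in simp_all)
 define s1 where "s1 = rn mark_cmd s"
 have 1: "\<forall>j<n. snd s1 13 j 0 ~= 0 \<longleftrightarrow> j \<in> ?J" "fst s1 36 = card ?J" "fst s1 35 = (if ?J = {} then 0 else 2 ^ card ?J mod 2 ^ r)"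
  using run_mark[OF n0 s(2) m(1,5,4) r2 d] unfolding s1_def by simp_all
 have s1: "sys s1" by (rule sysrel_cong[OF s(1)]) (simp_all add: s1_def frame_v frame_a mark_mod)
 have v1: "fst s1 0 = n" "fst s1 2 = 2 ^ (r - 1)" "fst s1 4 = 2 ^ r" "fst s1 5 = r" "fst s1 6 = n + 1" "snd s1 0 = snd s 0"
  using n0 v m by (simp_all add: s1_def frame_v frame_a mark_mod)
 let ?I = "%l s'. gen_span (n + 1) (2 ^ r) (snd s' 0) = {x \<in> gen_span (n + 1) (2 ^ r) (snd s 0). \<forall>k<l. jc r ?J k x} \<and>
  (\<forall>i<n + 1. \<forall>z<n + 1. snd s' 0 i z < 2 ^ r)"
 have "?I n (rn (For 37 (Var 0) eqn_cmd) s1)"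
 proof (rule run_For[where m = n and I = ?I], goal_cases)
  case (3 k s')
  note fr = 3(2) and fa = 3(3) and k = 3(1)
  have I: "gen_span (n + 1) (2 ^ r) (snd s' 0) = {x \<in> gen_span (n + 1) (2 ^ r) (snd s 0). \<forall>i<k. jc r ?J i x}"
   "!!i z. i < n + 1 ==> z < n + 1 ==> snd s' 0 i z < 2 ^ r" using 3(4) by blast+
  let ?s = "setv 37 k s'"
  have s2: "sys ?s" by (rule sysrel_cong[OF s1]) (simp_all add: fr fa eqn_mod)
  have v2: "fst ?s 36 = card ?J" "\<forall>j<n. snd ?s 13 j 0 ~= 0 \<longleftrightarrow> j \<in> ?J" "fst ?s 35 = (if ?J = {} then 0 else 2 ^ card ?J mod 2 ^ r)"
   "fst ?s 2 = 2 ^ (r - 1)" "fst ?s 4 = 2 ^ r" "fst ?s 5 = r" "fst ?s 6 = n + 1" "fst ?s 37 = k"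
   using v1 1 by (simp_all add: fr fa eqn_mod)
  have lt2: "!!i z. i < n + 1 ==> z < n + 1 ==> snd ?s 0 i z < 2 ^ r" using I(2) by simp
  have "gen_span (n + 1) (2 ^ r) (snd (rn eqn_cmd ?s) 0) = {x \<in> gen_span (n + 1) (2 ^ r) (snd ?s 0). jc r ?J k x} \<and>
   (\<forall>i<n + 1. \<forall>z<n + 1. snd (rn eqn_cmd ?s) 0 i z < 2 ^ r)"
   by (rule run_eqn[OF G s2 v2(8) k v2(1,2) J v2(3,4) v(2) v2(5-7) m(4) lt2])
  moreover have "(\<forall>i<Suc k. P i) \<longleftrightarrow> (\<forall>i<k. P i) & P k" for P by (auto simp: less_Suc_eq)
  ultimately show ?case using I(1) by auto
 qed (use v1 lt in simp_all)
 thus ?thesis by (simp add: tuple_cmd_def s1_def)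
qed

text \<open>For \<open>card J > r\<close> the coefficient vanishes modulo \<open>2 ^ r\<close>, and
  \<open>J\<close>, having more than one element, has no parity term. This limits the enumeration to
  \<open>r\<close> digits.\<close>

lemma jcon_trivial:
 assumes "J \<subseteq> {..<n}" "r < card J" "r \<ge> 1"
 shows "jc r J k x"
proof -
 have "\<not> odp J k" using assms(2,3) by (auto simp: oddp_def)
 moreover have "(2 :: int) ^ r dvd 2 ^ card J" using assms(2) by (simp add: le_imp_power_dvd)
 ultimately show ?thesis by (simp add: jcon_def)
qed

text \<open>Solutions of the inhomogeneous system are those of the homogenized one with last
  coordinate 1. An odd last coordinate is invertible modulo \<open>2 ^ r\<close> and can be scaled
  to 1; and if all generators had even last coordinate, so would all combinations.\<close>

lemma solvable_iff:
 assumes r: "r \<ge> 1"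
  and span: "gen_span (n + 1) (2 ^ r) g = {x. \<forall>q<(n + 1) ^ r. \<forall>k<n. jc r (dset n r q) k x}"
 shows "(\<exists>i<n + 1. odd (g i n)) \<longleftrightarrow> solvable n (2 ^ r) E1 E2 al be"
proof -
 have h: "(2 :: int) ^ r div 2 = 2 ^ (r - 1)" using r by (cases r) simp_all
 have all: "x \<in> gen_span (n + 1) (2 ^ r) g \<longleftrightarrow> (\<forall>k<n. \<forall>J\<subseteq>{..<n}. jc r J k x)" for x
 proof
  assume x: "x \<in> gen_span (n + 1) (2 ^ r) g"
  show "\<forall>k<n. \<forall>J\<subseteq>{..<n}. jc r J k x"
  proof (intro allI impI)
   fix k J assume k: "k < n" and J: "J \<subseteq> {..<n}"
   show "jc r J k x"
   proof (cases "card J <= r")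
    case True
    then obtain q where "q < (n + 1) ^ r" "dset n r q = J" using ex_dset[OF J] by blast
    thus ?thesis using x k unfolding span by blast
   qed (use jcon_trivial[OF J _ r] in simp)
  qed
 next
  assume a: "\<forall>k<n. \<forall>J\<subseteq>{..<n}. jc r J k x"
  have "dset n r q \<subseteq> {..<n}" for q by (auto simp: dset_def)
  thus "x \<in> gen_span (n + 1) (2 ^ r) g" unfolding span using a by blast
 qed
 have lin: "lin_ok {..<n} (2 ^ r) ga ca gb cb s \<longleftrightarrow>
  (\<forall>k<n. \<forall>J\<subseteq>{..<n}. jc r J k (s(n := 1)))" for s
 proof -
  have sm: "(\<Sum>u\<in>{u \<in> gb k. P u}. (s(n := 1)) u) = (\<Sum>u\<in>{u \<in> gb k. P u}. s u)" for k P
   by (rule sum.cong) (auto simp: gena_def)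
  have "(s(n := 1)) n = 1" by simp
  thus ?thesis unfolding lin_ok_def jcon_def oddp_def h sm mult_1_right Ball_def lessThan_iff by (simp only: mult_1_right)
 qed
 show ?thesis
 proof
  assume "\<exists>i<n + 1. odd (g i n)"
  then obtain i where i: "i < n + 1" "odd (g i n)" by blast
  have "gcd (int (g i n)) (2 ^ r) = 1" using i(2) by (simp flip: coprime_iff_gcd_eq_1)
  then obtain v w where vw: "v * int (g i n) + w * 2 ^ r = 1" using bezout_int[of "int (g i n)" "2 ^ r"] by auto
  have "int (g i n) * v - 1 = 2 ^ r * (- w)" using vw by (simp add: algebra_simps)
  hence v: "2 ^ r dvd int (g i n) * v - 1" by simp
  let ?x = "%z. int (g i z)" let ?s = "%z. v * ?x z"
  have x: "?x \<in> gen_span (n + 1) (2 ^ r) g" by (rule gen_in_span[OF i(1)])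
  have "jc r J k (?s(n := 1))" if k: "k < n" and J: "J \<subseteq> {..<n}" for k J
  proof (cases "J = {}")
   case False
   let ?S = "{u \<in> gb k. \<forall>j\<in>J. u \<in> ga j}"
   let ?h = "if odp J k then 2 ^ (r - 1) else 0 :: int"
   have "2 ^ r dvd 2 ^ card J * sum ?x ?S - ?h * ?x n"
    using x k J False unfolding all jcon_def by blast
   hence 1: "2 ^ r dvd v * (2 ^ card J * sum ?x ?S - ?h * ?x n)" by (rule dvd_mult)
   have 2: "2 ^ r dvd ?h * (?x n * v - 1)" by (rule dvd_mult) (rule v)
   have "sum (?s(n := 1)) ?S = sum ?s ?S" by (rule sum.cong) (auto simp: gena_def)
   hence "2 ^ card J * sum (?s(n := 1)) ?S - ?h * (?s(n := 1)) n =
     v * (2 ^ card J * sum ?x ?S - ?h * ?x n) + ?h * (?x n * v - 1)"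
    by (simp add: sum_distrib_left[symmetric] algebra_simps)
   thus ?thesis using dvd_add[OF 1 2] unfolding jcon_def by simp
  qed (simp add: jcon_def)
  hence "lin_ok {..<n} (2 ^ r) ga ca gb cb ?s"
   unfolding lin by blast
  thus "solvable n (2 ^ r) E1 E2 al be" unfolding solvable_def by blast
 next
  assume "solvable n (2 ^ r) E1 E2 al be"
  then obtain s where "lin_ok {..<n} (2 ^ r) ga ca gb cb s"
   unfolding solvable_def by blast
  hence "s(n := 1) \<in> gen_span (n + 1) (2 ^ r) g" unfolding lin all .
  then obtain c where "\<forall>z<n + 1. int (2 ^ r) dvd (s(n := 1)) z - (\<Sum>i<n + 1. c i * int (g i z))"
   unfolding gen_span_def by (elim CollectE exE)
  hence "int (2 ^ r) dvd (s(n := 1)) n - (\<Sum>i<n + 1. c i * int (g i n))" by (rule allE[of _ n]) simp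
  hence d: "(2 :: int) ^ r dvd 1 - (\<Sum>i<n + 1. c i * int (g i n))" by simp
  show "\<exists>i<n + 1. odd (g i n)"
  proof (rule ccontr)
   assume "\<not> (\<exists>i<n + 1. odd (g i n))"
   hence "even (\<Sum>i<n + 1. c i * int (g i n))" by (intro dvd_sum) simp
   moreover have "(2 :: int) dvd 2 ^ r" using r by simp
   hence "2 dvd 1 - (\<Sum>i<n + 1. c i * int (g i n))" using d dvd_trans by blast
   ultimately show False by simp
  qed
 qed
qed

text \<open>Whether a last coordinate is odd is found by toggling variable 33 that many
  times.\<close>

definition solve_cmd :: cmd where
 "solve_cmd = Assign 4 (Var 7) ;; Assign 5 (Var 3) ;; Assign 6 (Plus (Var 0) (Num 1)) ;; unit_cmd ;;
   For 30 (Var 3) (Put1 12 (Var 30) (Num 0)) ;; RepQ (tuple_cmd ;; inc_cmd) ;; Assign 31 (Num 0) ;;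
   For 30 (Var 6) (Assign 33 (Num 0) ;; For 32 (Arr 0 (Var 30) (Var 0)) (Assign 33 (Minus (Num 1) (Var 33))) ;;
    Cond (Var 33) (Assign 31 (Num 2)) Nop)"

lemma solve_mod: "mv solve_cmd = {4, 5, 6, 10, 11, 12, 13, 14, 15, 30, 31, 32, 33, 34, 35, 36, 37, 38, 39, 40}"
  "ma solve_cmd = {0, 2, 12, 13, 20}"
 by (auto simp: solve_cmd_def unit_mod tuple_mod inc_mod)

lemma run_solve:
 assumes G: "simple_graph {..<n} E1" "simple_graph {..<n} E2" and s: "sys s" "fst s 3 = r"
  and v: "fst s 2 = 2 ^ (r - 1)" "fst s 7 = 2 ^ r" "r \<ge> 1" and B: "2 * 2 ^ r <= B" "n < B" and Q: "Q = (n + 1) ^ r"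
 shows "fst (rn solve_cmd s) 31 ~= 0 \<longleftrightarrow> solvable n (2 ^ r) E1 E2 al be"
proof -
 have n0: "fst s 0 = n" using s(1) by (simp add: sysrel_def)
 have e6: "ev (setv 5 r (setv 4 (2 ^ r) s)) (Plus (Var 0) (Num 1)) = n + 1" using n0 B by simp
 define s1 where "s1 = rn unit_cmd (setv 6 (n + 1) (setv 5 r (setv 4 (2 ^ r) s)))"
 have G1: "snd s1 0 i z = of_bool (i = z)" if "i < n + 1" "z < n + 1" for i z
  unfolding s1_def by (rule run_unit) (use that in simp_all)
 define s2 where "s2 = rn (For 30 (Var 3) (Put1 12 (Var 30) (Num 0))) s1"
 have v1: "fst s1 3 = r" "fst s1 0 = n" "fst s1 2 = 2 ^ (r - 1)" "fst s1 4 = 2 ^ r" "fst s1 5 = r" "fst s1 6 = n + 1"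
  using s n0 v by (simp_all add: s1_def frame_v unit_mod)
 have d2: "\<forall>t<r. snd s2 12 t 0 = 0"
  unfolding s2_def by (rule run_For[where m = r and I = "%k s'. \<forall>t<k. snd s' 12 t 0 = 0"]) (auto simp: v1 less_Suc_eq)
 have v2: "fst s2 3 = r" "fst s2 0 = n" "fst s2 2 = 2 ^ (r - 1)" "fst s2 4 = 2 ^ r" "fst s2 5 = r" "fst s2 6 = n + 1" "snd s2 0 = snd s1 0"
  using v1 by (simp_all add: s2_def frame_v frame_a)
 have s2: "sys s2" by (rule sysrel_cong[OF s(1)]) (simp_all add: s1_def s2_def frame_v frame_a unit_mod)
 let ?N = "n + 1"
 let ?I = "%q s'. (\<forall>t<r. snd s' 12 t 0 = digit ?N q t) \<and>
  gen_span ?N (2 ^ r) (snd s' 0) = {x. \<forall>q'<q. \<forall>k<n. jc r (dset n r q') k x} \<and>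
  (\<forall>i<?N. \<forall>z<?N. snd s' 0 i z < 2 ^ r)"
 define s3 where "s3 = rn (RepQ (tuple_cmd ;; inc_cmd)) s2"
 have r2: "1 < (2 :: nat) ^ r" by (rule one_less_power) (use v(3) in simp_all)
 have I: "?I Q s3"
  unfolding s3_def
 proof (rule run_RepQ[where I = ?I], goal_cases)
  case 1
  have "gen_span ?N (2 ^ r) (snd s1 0) = UNIV" by (rule gen_span_unit) (rule G1)
  moreover have "\<forall>i<?N. \<forall>z<?N. snd s1 0 i z < 2 ^ r" using G1 r2 by simp
  ultimately show ?case using d2 v2 by (simp add: digit_def)
 next
  case (2 q s')
  note fr = 2(2) and fa = 2(3)
  have v': "fst s' 3 = r" "fst s' 0 = n" "fst s' 2 = 2 ^ (r - 1)" "fst s' 4 = 2 ^ r" "fst s' 5 = r" "fst s' 6 = ?N"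
   using v2 by (simp_all add: fr tuple_mod inc_mod)
  have s': "sys s'" by (rule sysrel_cong[OF s2]) (simp_all add: fr fa tuple_mod inc_mod)
  have d': "!!t. t < r ==> snd s' 12 t 0 = digit ?N q t" and span: "gen_span ?N (2 ^ r) (snd s' 0) = {x. \<forall>q'<q. \<forall>k<n. jc r (dset n r q') k x}"
   and lt: "\<forall>i<?N. \<forall>z<?N. snd s' 0 i z < 2 ^ r" using 2(4) by blast+
  define s4 where "s4 = rn tuple_cmd s'"
  have t: "gen_span ?N (2 ^ r) (snd s4 0) = {x \<in> gen_span ?N (2 ^ r) (snd s' 0). \<forall>k<n. jc r (dset n r q) k x} \<and>
    (\<forall>i<?N. \<forall>z<?N. snd s4 0 i z < 2 ^ r)"
   unfolding s4_def by (rule run_tuple[OF G s' v'(1,3) v(3) v'(4-6) B d' lt])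
  have v4: "fst s4 3 = r" "fst s4 0 = n" "snd s4 12 = snd s' 12" using v' by (simp_all add: s4_def frame_v frame_a tuple_mod)
  have d4: "!!t. t < r ==> snd s4 12 t 0 = digit ?N q t" using d' v4(3) by simp
  define s5 where "s5 = rn inc_cmd s4"
  have d5: "\<forall>t<r. snd s5 12 t 0 = digit ?N (Suc q) t"
   unfolding s5_def using run_inc[OF v4(2,1) B(2) d4] by blast
  have g5: "snd s5 0 = snd s4 0" by (simp add: s5_def frame_a inc_mod)
  have l: "(\<forall>i<Suc q. P i) \<longleftrightarrow> (\<forall>i<q. P i) & P q" for P by (auto simp: less_Suc_eq)
  have e: "rn (tuple_cmd ;; inc_cmd) s' = s5" by (simp add: s4_def s5_def)
  show ?case unfolding e using d5 t unfolding g5 l span by blast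
 qed
 have v3: "fst s3 0 = n" "fst s3 6 = ?N" using v2 by (simp_all add: s3_def frame_v tuple_mod inc_mod)
 let ?p = "For 32 (Arr 0 (Var 30) (Var 0)) (Assign 33 (Minus (Num 1) (Var 33)))"
 let ?q = "Assign 33 (Num 0) ;; ?p ;; Cond (Var 33) (Assign 31 (Num 2)) Nop"
 define s4 where "s4 = rn (For 30 (Var 6) ?q) (setv 31 0 s3)"
 have "fst s4 31 ~= 0 \<longleftrightarrow> (\<exists>i<?N. odd (snd s3 0 i n))"
  unfolding s4_def
 proof (rule run_For[where m = ?N and I = "%k s'. fst s' 31 ~= 0 \<longleftrightarrow> (\<exists>i<k. odd (snd s3 0 i n))"], goal_cases)
  case (3 k s')
  note fr = 3(2) and fa = 3(3) and I = 3(4)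
  have v': "fst s' 0 = n" "snd s' 0 = snd s3 0" using v3 by (simp_all add: fr fa)
  define s5 where "s5 = rn ?p (setv 33 0 (setv 30 k s'))"
  have "fst s5 33 = of_bool (odd (snd s3 0 k n))"
   unfolding s5_def
   by (rule run_For[where m = "snd s3 0 k n" and I = "%l s'. fst s' 33 = of_bool (odd l)"]) (use v' in auto)
  moreover have "fst s5 31 = fst s' 31" by (simp add: s5_def frame_v)
  moreover have "rn ?q (setv 30 k s') = (if fst s5 33 ~= 0 then setv 31 2 s5 else s5)" by (simp add: s5_def)
  moreover have "(\<exists>i<Suc k. P i) \<longleftrightarrow> (\<exists>i<k. P i) \<or> P k" for P by (auto simp: less_Suc_eq)
  ultimately show ?case using I by simp
 qed (simp_all add: v3)
 moreover have "(\<exists>i<?N. odd (snd s3 0 i n)) \<longleftrightarrow> solvable n (2 ^ r) E1 E2 al be"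
  by (rule solvable_iff[OF v(3)]) (use I Q in blast)
 moreover have "rn solve_cmd s = s4"
  unfolding solve_cmd_def s4_def s3_def s2_def s1_def run.simps(1,3) using e6 s(2) v(2) by simp
 ultimately show ?thesis by simp
qed

end

section \<open>The decision procedure\<close>

text \<open>The connected component as the least closed set containing \<open>r\<close>; minimality
  is what \<open>conn\<close> in \<open>connected_LUc_iff\<close> asks for.\<close>

definition comp :: "nat => nat set set => nat => nat set" where
 "comp n E r = \<Inter> {T. T \<subseteq> {..<n} & r \<in> T & closed_in E T}"

lemma comp_props:
 assumes G: "simple_graph {..<n} E" and r: "r < n"
 shows "r \<in> comp n E r" "comp n E r \<subseteq> {..<n}" "closed_in E (comp n E r)"
  "!!T. T \<subseteq> {..<n} ==> r \<in> T ==> closed_in E T ==> comp n E r \<subseteq> T"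
proof -
 have "closed_in E {..<n}" using nbr_subset[OF G] by (auto simp: closed_in_def)
 thus "comp n E r \<subseteq> {..<n}" using r by (auto simp: comp_def)
 show "r \<in> comp n E r" by (simp add: comp_def)
 show "closed_in E (comp n E r)" unfolding comp_def closed_in_def by blast
 show "!!T. T \<subseteq> {..<n} ==> r \<in> T ==> closed_in E T ==> comp n E r \<subseteq> T" by (auto simp: comp_def)
qed

lemma LUc_root_tests:
 assumes G1: "simple_graph {..<n} E1" and G2: "simple_graph {..<n} E2" and k: "n < 2 ^ k" "k \<ge> 2"
 shows "LUc {..<n} E1 E2 \<longleftrightarrow> (\<forall>r<n. closed_in E2 (comp n E1 r) & (\<exists>p\<in>{1, 2, 3}. \<exists>q\<in>{1, 2, 3}.
  root_test n (2 ^ k) (induced_edges E1 (comp n E1 r)) (induced_edges E2 (comp n E1 r)) r p q))"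
proof -
 let ?C = "comp n E1"
 have root: "LUc {..<n} (induced_edges E1 (?C r)) (induced_edges E2 (?C r)) \<longleftrightarrow> (\<exists>p\<in>{1, 2, 3}. \<exists>q\<in>{1, 2, 3}.
   root_test n (2 ^ k) (induced_edges E1 (?C r)) (induced_edges E2 (?C r)) r p q)" if r: "r < n" for r
 proof (rule connected_LUc_iff[OF simple_graph_induced[OF G1] simple_graph_induced[OF G2] r _ k])
  fix T assume T: "T \<subseteq> {..<n}" "r \<in> T" "closed_in (induced_edges E1 (?C r)) T"
  have "nbr E1 u \<subseteq> T \<inter> ?C r" if u: "u \<in> T \<inter> ?C r" for u
  proof -
   have "nbr E1 u \<subseteq> ?C r" using comp_props(3)[OF G1 r] u by (simp add: closed_in_def)
   moreover have "nbr E1 u \<inter> ?C r \<subseteq> T" using T(3) u unfolding closed_in_def nbr_induced by (metis IntD1 IntD2)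
   ultimately show ?thesis by blast
  qed
  hence cl: "closed_in E1 (T \<inter> ?C r)" unfolding closed_in_def by blast
  have "T \<inter> ?C r \<subseteq> {..<n}" "r \<in> T \<inter> ?C r" using T(1,2) comp_props(1)[OF G1 r] by blast+
  from comp_props(4)[OF G1 r this cl] have "?C r \<subseteq> T" by blast
  thus "\<forall>u\<in>{..<n} - T. nbr (induced_edges E1 (?C r)) u = {} & nbr (induced_edges E2 (?C r)) u = {}"
   by (auto simp: nbr_induced)
 qed
 have "LUc {..<n} E1 E2 \<longleftrightarrow>
  (\<forall>r\<in>{..<n}. closed_in E2 (?C r) & LUc {..<n} (induced_edges E1 (?C r)) (induced_edges E2 (?C r)))"
  by (rule LUc_components[OF G1 G2]) (use comp_props[OF G1] in simp)
 also have "... \<longleftrightarrow> (\<forall>r<n. closed_in E2 (?C r) & (\<exists>p\<in>{1, 2, 3}. \<exists>q\<in>{1, 2, 3}.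
   root_test n (2 ^ k) (induced_edges E1 (?C r)) (induced_edges E2 (?C r)) r p q))"
  unfolding Ball_def[of "{..<n}"] lessThan_iff by (rule all_cong1, rule imp_cong[OF refl], rule conj_cong[OF refl], rule root)
 finally show ?thesis .
qed

section \<open>Computing the components\<close>

definition pass_cmd :: cmd where
 "pass_cmd = For 42 (Var 0) (For 43 (Var 0) (Cond (Arr1 14 (Var 42)) (Cond (Arr 3 (Var 42) (Var 43))
   (Put1 14 (Var 43) (Num 2)) Nop) Nop))"

lemma pass_mod: "mv pass_cmd = {42, 43}" "ma pass_cmd = {14}"
 by (auto simp: pass_cmd_def)

definition marked :: "nat => store => nat set" where
 "marked n s = {u. u < n & snd s 14 u 0 ~= 0}"

text \<open>Marks set during a pass are already used by it, so the outcome is not exactly one step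
  of the search; it is only confined between the neighbours of \<open>X\<close> and every closed set
  containing \<open>X\<close>.\<close>

lemma run_pass:
 assumes s: "fst s 0 = n" "adj s 3 n E"
 defines "X \<equiv> marked n s" and "Y \<equiv> marked n (rn pass_cmd s)"
 shows "X \<subseteq> Y & (\<forall>T. closed_in E T --> X \<subseteq> T --> Y \<subseteq> T) & (\<forall>u\<in>X. \<forall>w\<in>nbr E u. w < n --> w \<in> Y)"
proof -
 let ?q = "Cond (Arr1 14 (Var 42)) (Cond (Arr 3 (Var 42) (Var 43)) (Put1 14 (Var 43) (Num 2)) Nop) Nop"
 let ?I = "%k Z. X \<subseteq> Z & (\<forall>T. closed_in E T --> X \<subseteq> T --> Z \<subseteq> T) & (\<forall>u\<in>X. \<forall>w\<in>nbr E u. u < k --> w < n --> w \<in> Z)"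
 have "?I n (marked n (rn pass_cmd s))"
  unfolding pass_cmd_def
 proof (rule run_For[where m = n and I = "%k s'. ?I k (marked n s')"], goal_cases)
  case 2
  thus ?case by (simp add: X_def)
 next
  case (3 u s')
  note fr = 3(2) and fa = 3(3) and I = 3(4) and u = 3(1)
  let ?J = "%l Z. X \<subseteq> Z & (\<forall>T. closed_in E T --> X \<subseteq> T --> Z \<subseteq> T) \<and>
   (\<forall>v\<in>X. \<forall>w\<in>nbr E v. v < u --> w < n --> w \<in> Z) & (u \<in> X --> (\<forall>w\<in>nbr E u. w < l --> w \<in> Z))"
  have J': "?J n (marked n (rn (For 43 (Var 0) ?q) (setv 42 u s')))"
  proof (rule run_For[where m = n and I = "%l s'. ?J l (marked n s')"], goal_cases)
   case 1
   thus ?case using s by (simp add: fr)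
  next
   case 2
   have "marked n (setv 42 u s') = marked n s'" by (simp add: marked_def)
   thus ?case using I by simp
  next
   case (3 w s2)
   note fr' = 3(2) and fa' = 3(3) and J = 3(4) and w = 3(1)
   have v: "fst s2 42 = u" by (simp add: fr')
   have a: "snd s2 3 u w = of_bool (w \<in> nbr E u)" using s(2) u w by (simp add: fa' fa adj_def)
   have l: "(\<forall>x\<in>nbr E u. x < Suc w --> x \<in> Z) \<longleftrightarrow> (\<forall>x\<in>nbr E u. x < w --> x \<in> Z) & (w \<in> nbr E u --> w \<in> Z)" for Z
    by (auto simp: less_Suc_eq)
   show ?case
   proof (cases "u \<in> marked n s2 & w \<in> nbr E u")
    case True
    hence e: "rn ?q (setv 43 w s2) = seta 14 w 0 2 (setv 43 w s2)" using v a by (simp add: marked_def)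
    have m: "marked n (seta 14 w 0 2 (setv 43 w s2)) = insert w (marked n s2)" using w by (auto simp: marked_def)
    have "insert w (marked n s2) \<subseteq> T" if T: "closed_in E T" "X \<subseteq> T" for T
    proof -
     have "marked n s2 \<subseteq> T" using J T by blast
     moreover from this have "w \<in> T" using T(1) True unfolding closed_in_def by blast
     ultimately show ?thesis by blast
    qed
    thus ?thesis unfolding e m l using J by blast
   next
    case False
    hence e: "rn ?q (setv 43 w s2) = setv 43 w s2" using v a u by (auto simp: marked_def)
    have m: "marked n (setv 43 w s2) = marked n s2" by (simp add: marked_def)
    have "w \<notin> nbr E u" if "u \<in> X" using that J False by blast
    thus ?thesis unfolding e m l using J by blast
   qed
  qed
  have eq: "(\<forall>v\<in>X. \<forall>w\<in>nbr E v. v < Suc u --> w < n --> w \<in> Z) \<longleftrightarrow> (\<forall>v\<in>X. \<forall>w\<in>nbr E v. v < u --> w < n --> w \<in> Z) \<and>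
   (u \<in> X --> (\<forall>w\<in>nbr E u. w < n --> w \<in> Z))" for Z by (auto simp: less_Suc_eq)
  show ?case unfolding eq by (rule J')
 qed (simp add: s)
 moreover have "u < n" if "u \<in> X" for u using that by (simp add: X_def marked_def)
 ultimately show ?thesis unfolding Y_def by blast
qed

definition comp_cmd :: cmd where
 "comp_cmd = For 42 (Var 0) (Put1 14 (Var 42) (Num 0)) ;; Put1 14 (Var 23) (Num 2) ;; For 48 (Var 0) pass_cmd"

lemma comp_mod: "mv comp_cmd = {42, 43, 48}" "ma comp_cmd = {14}"
 by (auto simp: comp_cmd_def pass_mod)

text \<open>A pass that starts from a set not yet closed enlarges it, and the set cannot exceed
  \<open>n\<close> vertices.\<close>

lemma run_comp:
 assumes G: "simple_graph {..<n} E" and s: "fst s 0 = n" "adj s 3 n E" "fst s 23 = r" "r < n"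
 shows "marked n (rn comp_cmd s) = comp n E r"
proof -
 define s1 where "s1 = seta 14 r 0 2 (rn (For 42 (Var 0) (Put1 14 (Var 42) (Num 0))) s)"
 have "\<forall>u<n. snd (rn (For 42 (Var 0) (Put1 14 (Var 42) (Num 0))) s) 14 u 0 = 0"
  by (rule run_For[where m = n and I = "%k s'. \<forall>u<k. snd s' 14 u 0 = 0"]) (auto simp: s less_Suc_eq)
 hence m1: "marked n s1 = {r}" using s(4) by (auto simp: s1_def marked_def)
 have v1: "fst s1 0 = n" "adj s1 3 n E" using s by (simp_all add: s1_def frame_v frame_a adj_def)
 note cp = comp_props[OF G s(4)]
 let ?s2 = "rn (For 48 (Var 0) pass_cmd) s1"
 have "r \<in> marked n ?s2 & marked n ?s2 \<subseteq> comp n E r & (closed_in E (marked n ?s2) \<or> n < card (marked n ?s2))"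
 proof (rule run_For[where m = n and I = "%k s'. r \<in> marked n s' & marked n s' \<subseteq> comp n E r \<and>
   (closed_in E (marked n s') \<or> k < card (marked n s'))"], goal_cases)
  case 2
  thus ?case using m1 cp(1) by simp
 next
  case (3 k s')
  note fr = 3(2) and fa = 3(3) and I = 3(4)
  let ?s = "setv 48 k s'"
  have v: "fst ?s 0 = n" "adj ?s 3 n E" using v1 by (simp_all add: fr fa pass_mod adj_def)
  have m: "marked n ?s = marked n s'" by (simp add: marked_def)
  let ?X = "marked n s'" and ?Y = "marked n (rn pass_cmd ?s)"
  have P: "?X \<subseteq> ?Y" "!!T. closed_in E T ==> ?X \<subseteq> T ==> ?Y \<subseteq> T" "!!u w. u \<in> ?X ==> w \<in> nbr E u ==> w < n ==> w \<in> ?Y"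
   using run_pass[OF v] unfolding m by blast+
  have fin: "finite ?Y" by (simp add: marked_def)
  have "closed_in E ?Y \<or> Suc k < card ?Y"
  proof (cases "closed_in E ?X")
   case True
   hence "?Y = ?X" using P(1) P(2)[OF True] by blast
   thus ?thesis using True by simp
  next
   case False
   have "?Y ~= ?X"
   proof
    assume eq: "?Y = ?X"
    have "nbr E u \<subseteq> {..<n}" for u by (rule nbr_subset[OF G])
    hence "closed_in E ?X" unfolding closed_in_def using P(3) eq by blast
    thus False using False by simp
   qed
   hence "?X \<subset> ?Y" using P(1) by blast
   hence "card ?X < card ?Y" by (rule psubset_card_mono[OF fin])
   thus ?thesis using I False by simp
  qed
  moreover have "?Y \<subseteq> comp n E r" using P(2)[OF cp(3)] I by blast
  ultimately show ?case using P(1) I by blast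
 qed (simp add: v1)
 moreover have "card (marked n ?s2) <= n"
  using card_mono[of "{..<n}" "marked n ?s2"] by (auto simp: marked_def)
 moreover have "marked n ?s2 \<subseteq> {..<n}" by (auto simp: marked_def)
 ultimately have "marked n ?s2 = comp n E r" using cp(4)[of "marked n ?s2"] by auto
 thus ?thesis using s(3) by (simp add: comp_cmd_def s1_def frame_v)
qed

end

section \<open>Reading the input and testing one component\<close>

definition read_cmd :: "nat => cmd" where
 "read_cmd g = For 42 (Var 0) (For 43 (Var 0) (Put g (Var 42) (Var 43) (Inp (Var 41)) ;; Assign 41 (Plus (Var 41) (Num 1))))"

lemma read_mod: "mv (read_cmd g) = {41, 42, 43}" "ma (read_cmd g) = {g mod 32}"
 by (auto simp: read_cmd_def)

lemma run_read:
 assumes s: "fst s 0 = n" "fst s 41 = c" and B: "c + n * n <= B" and g: "g < 32"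
  and f: "!!i j. i < n ==> j < n ==> f (c + i * n + j) = of_bool (j \<in> nbr E i)"
 shows "adj (run B Q f (read_cmd g) s) g n E & fst (run B Q f (read_cmd g) s) 41 = c + n * n"
proof -
 let ?I = "%k s'. (\<forall>i<k. \<forall>j<n. snd s' g i j = of_bool (j \<in> nbr E i)) & fst s' 41 = c + k * n"
 have "?I n (run B Q f (read_cmd g) s)"
  unfolding read_cmd_def
 proof (rule run_For[where m = n and I = ?I], goal_cases)
  case (3 i s')
  note fr = 3(2) and I = 3(4) and i = 3(1)
  let ?p = "Put g (Var 42) (Var 43) (Inp (Var 41)) ;; Assign 41 (Plus (Var 41) (Num 1))"
  let ?J = "%l s'. (\<forall>i'<i. \<forall>j<n. snd s' g i' j = of_bool (j \<in> nbr E i')) & (\<forall>j<l. snd s' g i j = of_bool (j \<in> nbr E i)) \<and>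
   fst s' 41 = c + i * n + l"
  have "?J n (run B Q f (For 43 (Var 0) ?p) (setv 42 i s'))"
  proof (rule run_For[where m = n and I = ?J], goal_cases)
   case (3 j s2)
   note fr' = 3(2) and J = 3(4) and j = 3(1)
   have v: "fst s2 42 = i" by (simp add: fr')
   have "i * n + j < n * n"
   proof -
    have "i * n + j < Suc i * n" using j by simp
    also have "... <= n * n" by (rule mult_le_mono1) (use i in simp)
    finally show ?thesis .
   qed
   hence "c + i * n + j + 1 <= B" using B by linarith
   thus ?case using J v g f[OF i j] by (auto simp: less_Suc_eq)
  qed (use s I in "simp_all add: fr")
  thus ?case by (auto simp: less_Suc_eq)
 qed (simp_all add: s)
 thus ?thesis by (simp add: adj_def)
qed

text \<open>Besides producing the two induced graphs, it checks that no edge of the second graph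
  leaves the component of the first; variable 44 carries the overall verdict.\<close>

definition split_cmd :: cmd where
 "split_cmd = For 42 (Var 0) (For 43 (Var 0)
   (Put 5 (Var 42) (Var 43) (IfE (Arr1 14 (Var 42)) (IfE (Arr1 14 (Var 43)) (Arr 3 (Var 42) (Var 43)) (Num 0)) (Num 0)) ;;
   Put 6 (Var 42) (Var 43) (IfE (Arr1 14 (Var 42)) (IfE (Arr1 14 (Var 43)) (Arr 4 (Var 42) (Var 43)) (Num 0)) (Num 0)) ;;
   Cond (IfE (Arr1 14 (Var 42)) (IfE (Arr1 14 (Var 43)) (Num 0) (Arr 4 (Var 42) (Var 43))) (Num 0)) (Assign 44 (Num 0)) Nop))"

lemma split_mod: "mv split_cmd = {42, 43, 44}" "ma split_cmd = {5, 6}"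
 by (auto simp: split_cmd_def)

lemma run_split:
 assumes G: "simple_graph {..<n} E2" and s: "fst s 0 = n" "adj s 3 n E1" "adj s 4 n E2" "marked n s = C"
 shows "adj (run B Q f split_cmd s) 5 n (induced_edges E1 C)" "adj (run B Q f split_cmd s) 6 n (induced_edges E2 C)"
  "fst (run B Q f split_cmd s) 44 ~= 0 \<longleftrightarrow> fst s 44 ~= 0 & closed_in E2 C"
proof -
 have Cn: "C \<subseteq> {..<n}" using s(4) by (auto simp: marked_def)
 let ?A = "%E i j. of_bool (j \<in> nbr (induced_edges E C) i) :: nat"
 let ?b = "%i j. i \<in> C & j \<notin> C & j \<in> nbr E2 i"
 let ?R = "%P s'. (\<forall>i j. P i j --> j < n --> snd s' 5 i j = ?A E1 i j & snd s' 6 i j = ?A E2 i j) \<and>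
  (fst s' 44 ~= 0 \<longleftrightarrow> fst s 44 ~= 0 & (\<forall>i j. P i j --> j < n --> \<not> ?b i j))"
 let ?p = "Put 5 (Var 42) (Var 43) (IfE (Arr1 14 (Var 42)) (IfE (Arr1 14 (Var 43)) (Arr 3 (Var 42) (Var 43)) (Num 0)) (Num 0)) ;;
   Put 6 (Var 42) (Var 43) (IfE (Arr1 14 (Var 42)) (IfE (Arr1 14 (Var 43)) (Arr 4 (Var 42) (Var 43)) (Num 0)) (Num 0)) ;;
   Cond (IfE (Arr1 14 (Var 42)) (IfE (Arr1 14 (Var 43)) (Num 0) (Arr 4 (Var 42) (Var 43))) (Num 0)) (Assign 44 (Num 0)) Nop"
 have "?R (%i j. i < n) (run B Q f split_cmd s)"
  unfolding split_cmd_def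
 proof (rule run_For[where m = n and I = "%k. ?R (%i j. i < k)"], goal_cases)
  case (3 i s')
  note fr = 3(2) and fa = 3(3) and I = 3(4) and i = 3(1)
  have "?R (%i' j. i' < i \<or> i' = i & j < n) (run B Q f (For 43 (Var 0) ?p) (setv 42 i s'))"
  proof (rule run_For[where m = n and I = "%l. ?R (%i' j. i' < i \<or> i' = i & j < l)"], goal_cases)
   case (3 j s2)
   note fr' = 3(2) and fa' = 3(3) and J = 3(4) and j = 3(1)
   have v: "fst s2 42 = i" "snd s2 14 = snd s 14" "snd s2 3 = snd s 3" "snd s2 4 = snd s 4"
    by (simp_all add: fr' fa' fa)
   have m: "snd s 14 x 0 ~= 0 \<longleftrightarrow> x \<in> C" if "x < n" for x using s(4) that by (auto simp: marked_def)
   have a: "snd s 3 i j = of_bool (j \<in> nbr E1 i)" "snd s 4 i j = of_bool (j \<in> nbr E2 i)" using s(2,3) i j by (simp_all add: adj_def)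
   define t where "t = seta 6 i j (?A E2 i j) (seta 5 i j (?A E1 i j) (setv 43 j s2))"
   have e: "run B Q f ?p (setv 43 j s2) = (if ?b i j then setv 44 0 t else t)"
    using v m[OF i] m[OF j] a by (auto simp: t_def nbr_induced)
   have P: "i' < i \<or> i' = i & j' < Suc j \<longleftrightarrow> (i' < i \<or> i' = i & j' < j) \<or> i' = i & j' = j" for i' j' by auto
   have t5: "snd t 5 i' j' = (if i' = i & j' = j then ?A E1 i j else snd s2 5 i' j')"
    "snd t 6 i' j' = (if i' = i & j' = j then ?A E2 i j else snd s2 6 i' j')" "fst t 44 = fst s2 44" for i' j'
    by (simp_all add: t_def)
   let ?u = "if ?b i j then setv 44 0 t else t"
   have u: "snd ?u = snd t" "fst ?u 44 ~= 0 \<longleftrightarrow> fst s2 44 ~= 0 & \<not> ?b i j" using t5(3) by simp_all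
   show ?case unfolding e
   proof (intro conjI allI impI)
    fix i' j' assume "i' < i \<or> i' = i & j' < Suc j" "j' < n"
    thus "snd ?u 5 i' j' = ?A E1 i' j'" "snd ?u 6 i' j' = ?A E2 i' j'"
     unfolding u t5 P using J by auto
   next
    show "fst ?u 44 ~= 0 \<longleftrightarrow> fst s 44 ~= 0 & (\<forall>i' j'. i' < i \<or> i' = i & j' < Suc j --> j' < n --> \<not> ?b i' j')"
     unfolding u P using J j by blast
   qed
  qed (use s I in "simp_all add: fr")
  thus ?case by (auto simp: less_Suc_eq)
 qed (simp_all add: s)
 moreover have "closed_in E2 C \<longleftrightarrow> (\<forall>i j. i < n --> j < n --> \<not> ?b i j)"
  using Cn nbr_subset[OF G] unfolding closed_in_def by blast
 ultimately show "adj (run B Q f split_cmd s) 5 n (induced_edges E1 C)" "adj (run B Q f split_cmd s) 6 n (induced_edges E2 C)"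
  "fst (run B Q f split_cmd s) 44 ~= 0 \<longleftrightarrow> fst s 44 ~= 0 & closed_in E2 C"
  unfolding adj_def by blast+
qed

definition try_cmd :: cmd where
 "try_cmd = Assign 24 (Plus (Var 46) (Num 1)) ;; Assign 25 (Plus (Var 47) (Num 1)) ;; prop_cmd ;; solve_cmd ;;
   Cond (Var 31) (Assign 45 (Num 2)) Nop"

lemma try_mod: "mv try_cmd = {4, 5, 6, 10, 11, 12, 13, 14, 15, 16, 17, 18, 19, 20, 21, 22, 24, 25, 26,
  30, 31, 32, 33, 34, 35, 36, 37, 38, 39, 40, 45}" "ma try_cmd = {0, 2, 7, 8, 9, 10, 11, 12, 13, 20}"
 by (auto simp: try_cmd_def prop_mod solve_mod)

lemma run_try:
 assumes G: "simple_graph {..<n} E1" "simple_graph {..<n} E2" "adj s 5 n E1" "adj s 6 n E2"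
  and s: "fst s 0 = n" "fst s 23 = r" "fst s 46 = p" "fst s 47 = q" "p < 3" "q < 3"
  and k: "fst s 3 = k" "fst s 2 = 2 ^ (k - 1)" "fst s 7 = 2 ^ k" "k \<ge> 1" and B: "4 <= B" "2 * n + 1 <= B" "2 * 2 ^ k <= B" and Q: "Q = (n + 1) ^ k"
 shows "fst (run B Q f try_cmd s) 45 ~= 0 \<longleftrightarrow> fst s 45 ~= 0 \<or> root_test n (2 ^ k) E1 E2 r (p + 1) (q + 1)"
proof -
 define s1 where "s1 = setv 25 (q + 1) (setv 24 (p + 1) s)"
 define s2 where "s2 = run B Q f prop_cmd s1"
 obtain R al be where t: "ploop n E1 E2 n (seed_axes r (p + 1) (q + 1)) = (R, al, be)"
  by (cases "ploop n E1 E2 n (seed_axes r (p + 1) (q + 1))")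
 have a1: "adj s1 5 n E1" "adj s1 6 n E2" using G by (simp_all add: s1_def adj_def)
 have "reps n s2 (ploop n E1 E2 n (seed_axes r (p + 1) (q + 1)))"
  unfolding s2_def by (rule run_prop[OF G(1,2) a1]) (use s B in "simp_all add: s1_def")
 hence sy: "sysrel n E1 E2 al be s2"
  using a1 s(1) unfolding t by (simp add: reps_def sysrel_def s2_def s1_def frame_v frame_a prop_mod adj_def)
 have v2: "fst s2 3 = k" "fst s2 2 = 2 ^ (k - 1)" "fst s2 7 = 2 ^ k" "fst s2 45 = fst s 45"
  using k by (simp_all add: s2_def s1_def frame_v prop_mod)
 have "n < B" using B by linarith
 note so = run_solve[OF G(1,2) sy v2(1-3) k(4) B(3) this Q, of f]
 have "eval B f s (Plus (Var 46) (Num 1)) = p + 1" "eval B f (setv 24 (p + 1) s) (Plus (Var 47) (Num 1)) = q + 1"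
  using s B by simp_all
 hence "run B Q f try_cmd s = (if fst (run B Q f solve_cmd s2) 31 ~= 0 then setv 45 2 (run B Q f solve_cmd s2) else run B Q f solve_cmd s2)"
  unfolding try_cmd_def run.simps(1,3) s2_def s1_def by simp
 moreover have "fst (run B Q f solve_cmd s2) 45 = fst s 45" using v2 by (simp add: frame_v solve_mod)
 ultimately show ?thesis using so unfolding root_test_def t by simp
qed

definition root_cmd :: cmd where
 "root_cmd = comp_cmd ;; split_cmd ;; Assign 45 (Num 0) ;; For 46 (Num 3) (For 47 (Num 3) try_cmd) ;; Cond (Var 45) Nop (Assign 44 (Num 0))"

lemma root_mod: "mv root_cmd = {4, 5, 6, 10, 11, 12, 13, 14, 15, 16, 17, 18, 19, 20, 21, 22, 24, 25, 26,
  30, 31, 32, 33, 34, 35, 36, 37, 38, 39, 40, 42, 43, 44, 45, 46, 47, 48}" "ma root_cmd = {0, 2, 5, 6, 7, 8, 9, 10, 11, 12, 13, 14, 20}"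
 by (auto simp: root_cmd_def comp_mod split_mod try_mod)

lemma run_root:
 assumes G: "simple_graph {..<n} E1" "simple_graph {..<n} E2" "adj s 3 n E1" "adj s 4 n E2"
  and s: "fst s 0 = n" "fst s 23 = r" "r < n"
  and k: "fst s 3 = k" "fst s 2 = 2 ^ (k - 1)" "fst s 7 = 2 ^ k" "k \<ge> 1" and B: "4 <= B" "2 * n + 1 <= B" "2 * 2 ^ k <= B" and Q: "Q = (n + 1) ^ k"
 defines "C \<equiv> comp n E1 r"
 shows "fst (run B Q f root_cmd s) 44 ~= 0 \<longleftrightarrow> fst s 44 ~= 0 & closed_in E2 C \<and>
  (\<exists>p\<in>{1, 2, 3}. \<exists>q\<in>{1, 2, 3}. root_test n (2 ^ k) (induced_edges E1 C) (induced_edges E2 C) r p q)"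
proof -
 let ?T = "%p q. root_test n (2 ^ k) (induced_edges E1 C) (induced_edges E2 C) r (p + 1) (q + 1)"
 define s1 where "s1 = run B Q f comp_cmd s"
 have m1: "marked n s1 = C" unfolding s1_def C_def by (rule run_comp[OF G(1) s(1) G(3) s(2,3)])
 have v1: "fst s1 0 = n" "adj s1 3 n E1" "adj s1 4 n E2" "fst s1 44 = fst s 44"
  using s G by (simp_all add: s1_def frame_v frame_a comp_mod adj_def)
 define s2 where "s2 = run B Q f split_cmd s1"
 have sp: "adj s2 5 n (induced_edges E1 C)" "adj s2 6 n (induced_edges E2 C)" "fst s2 44 ~= 0 \<longleftrightarrow> fst s 44 ~= 0 & closed_in E2 C"
  using run_split[OF G(2) v1(1-3) m1, of B Q f] v1(4) unfolding s2_def by simp_all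
 have v2: "fst s2 0 = n" "fst s2 23 = r" "fst s2 3 = k" "fst s2 2 = 2 ^ (k - 1)" "fst s2 7 = 2 ^ k"
  using s k by (simp_all add: s2_def s1_def frame_v comp_mod split_mod)
 define s3 where "s3 = run B Q f (For 46 (Num 3) (For 47 (Num 3) try_cmd)) (setv 45 0 s2)"
 have "fst s3 45 ~= 0 \<longleftrightarrow> (\<exists>p<3. \<exists>q<3. ?T p q)"
  unfolding s3_def
 proof (rule run_For[where m = 3 and I = "%l s'. fst s' 45 ~= 0 \<longleftrightarrow> (\<exists>p<l. \<exists>q<3. ?T p q)"], goal_cases)
  case (3 p s')
  note fr = 3(2) and fa = 3(3) and I = 3(4) and p = 3(1)
  have X: "fst (run B Q f (For 47 (Num 3) try_cmd) (setv 46 p s')) 45 ~= 0 \<longleftrightarrow> (\<exists>p'<p. \<exists>q<3. ?T p' q) \<or> (\<exists>q<3. ?T p q)"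
  proof (rule run_For[where m = 3 and I = "%l s'. fst s' 45 ~= 0 \<longleftrightarrow> (\<exists>p'<p. \<exists>q<3. ?T p' q) \<or> (\<exists>q<l. ?T p q)"], goal_cases)
   case 2
   have "fst (setv 46 p s') 45 = fst s' 45" by simp
   thus ?case using I by (metis not_less_zero)
  next
   case (3 q s4)
   note fr' = 3(2) and fa' = 3(3) and J = 3(4) and q = 3(1)
   have v: "fst s4 0 = n" "fst s4 23 = r" "fst s4 3 = k" "fst s4 2 = 2 ^ (k - 1)" "fst s4 7 = 2 ^ k" "fst s4 46 = p"
    using v2 by (simp_all add: fr' fr try_mod)
   have a: "adj (setv 47 q s4) 5 n (induced_edges E1 C)" "adj (setv 47 q s4) 6 n (induced_edges E2 C)"
    using sp(1,2) by (simp_all add: fa' fa try_mod adj_def)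
   have l: "(\<exists>i<Suc q. P i) \<longleftrightarrow> (\<exists>i<q. P i) \<or> P q" for P by (auto simp: less_Suc_eq)
   have "fst (run B Q f try_cmd (setv 47 q s4)) 45 ~= 0 \<longleftrightarrow> fst (setv 47 q s4) 45 ~= 0 \<or> ?T p q"
    by (rule run_try[OF simple_graph_induced[OF G(1)] simple_graph_induced[OF G(2)] a _ _ _ _ p q _ _ _ k(4) B Q]) (use v in simp_all)
   moreover have "fst (setv 47 q s4) 45 = fst s4 45" by simp
   ultimately show ?case unfolding l using J by metis
  qed simp
  have l: "(\<exists>i<Suc p. P i) \<longleftrightarrow> (\<exists>i<p. P i) \<or> P p" for P by (auto simp: less_Suc_eq)
  show ?case unfolding l by (rule X)
 qed simp_all
 moreover have bex: "(\<exists>p\<in>{1, 2, 3}. P p) \<longleftrightarrow> (\<exists>p<3. P (p + 1))" for P :: "nat => bool"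
 proof -
  have "{1, 2, 3 :: nat} = (%p. p + 1) ` {..<3}" by (auto simp: image_iff numeral_3_eq_3 less_Suc_eq)
  thus ?thesis by (simp add: Bex_def)
 qed
 moreover have "fst s3 44 = fst s2 44" by (simp add: s3_def frame_v try_mod)
 moreover have "run B Q f root_cmd s = (if fst s3 45 ~= 0 then s3 else setv 44 0 s3)"
  by (simp add: root_cmd_def s3_def flip: s2_def s1_def)
 ultimately show ?thesis unfolding bex using sp(3) by simp
qed

definition main_cmd :: cmd where
 "main_cmd = Assign 7 (Var 1) ;; Assign 41 (Num 0) ;; read_cmd 3 ;; read_cmd 4 ;; Assign 44 (Num 2) ;; For 23 (Var 0) root_cmd ;; Assign 0 (Var 44)"

lemma run_main:
 assumes G: "simple_graph {..<n} E1" "simple_graph {..<n} E2"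
  and f: "!!i j. i < n ==> j < n ==> f (i * n + j) = of_bool (j \<in> nbr E1 i)"
   "!!i j. i < n ==> j < n ==> f (n * n + i * n + j) = of_bool (j \<in> nbr E2 i)"
 shows "fst (run (bnd n) (qpar n) f main_cmd (init_store n)) 0 ~= 0 \<longleftrightarrow> LUc {..<n} E1 E2"
proof -
 let ?B = "bnd n" and ?Q = "qpar n" and ?k = "lg n"
 have B: "4 <= ?B" "2 * n + 1 <= ?B" "2 * 2 ^ ?k <= ?B" "n * n + n * n <= ?B"
  using lg_upper[of n] by (simp_all add: bnd_def power2_eq_square)
 have k: "n < 2 ^ ?k" "?k \<ge> 2" using lg_ge[of n] lg_gt_0[of n] by simp_all
 define s0 where "s0 = setv 41 0 (setv 7 (2 ^ ?k) (init_store n))"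
 have v0: "fst s0 0 = n" "fst s0 3 = ?k" "fst s0 2 = 2 ^ (?k - 1)" "fst s0 7 = 2 ^ ?k" "fst s0 41 = 0"
  by (simp_all add: s0_def init_store_def)
 define s1 where "s1 = run ?B ?Q f (read_cmd 3) s0"
 have 1: "adj s1 3 n E1" "fst s1 41 = n * n"
  using run_read[OF v0(1,5), of ?B 3 f E1 ?Q] B f(1) unfolding s1_def by simp_all
 have v1: "fst s1 0 = n" using v0 by (simp add: s1_def frame_v read_mod)
 define s2 where "s2 = run ?B ?Q f (read_cmd 4) s1"
 have 2: "adj s2 4 n E2" using run_read[OF v1 1(2) B(4), of 4 f E2 ?Q] f(2) unfolding s2_def by simp
 have 3: "adj s2 3 n E1" using 1(1) by (simp add: s2_def frame_a read_mod adj_def)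
 have v2: "fst s2 0 = n" "fst s2 3 = ?k" "fst s2 2 = 2 ^ (?k - 1)" "fst s2 7 = 2 ^ ?k"
  using v0 by (simp_all add: s2_def s1_def frame_v read_mod)
 let ?P = "%r. closed_in E2 (comp n E1 r) & (\<exists>p\<in>{1, 2, 3}. \<exists>q\<in>{1, 2, 3}.
  root_test n (2 ^ ?k) (induced_edges E1 (comp n E1 r)) (induced_edges E2 (comp n E1 r)) r p q)"
 define s3 where "s3 = run ?B ?Q f (For 23 (Var 0) root_cmd) (setv 44 2 s2)"
 have "fst s3 44 ~= 0 \<longleftrightarrow> (\<forall>r<n. ?P r)"
  unfolding s3_def
 proof (rule run_For[where m = n and I = "%l s'. fst s' 44 ~= 0 \<longleftrightarrow> (\<forall>r<l. ?P r)"], goal_cases)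
  case (3 r s')
  note fr = 3(2) and fa = 3(3) and I = 3(4) and r = 3(1)
  let ?s = "setv 23 r s'"
  have v: "fst ?s 0 = n" "fst ?s 23 = r" "fst ?s 3 = ?k" "fst ?s 2 = 2 ^ (?k - 1)" "fst ?s 7 = 2 ^ ?k"
   using v2 by (simp_all add: fr root_mod)
  have a: "adj ?s 3 n E1" "adj ?s 4 n E2" using 2 \<open>adj s2 3 n E1\<close> by (simp_all add: fa root_mod adj_def)
  have "?k \<ge> 1" using k by simp
  from run_root[OF G a v(1,2) r v(3-5) this B(1-3) qpar_def[of n], of f]
  have X: "fst (run ?B ?Q f root_cmd ?s) 44 ~= 0 \<longleftrightarrow> fst s' 44 ~= 0 & ?P r" by simp
  have l: "(\<forall>i<Suc r. P i) \<longleftrightarrow> (\<forall>i<r. P i) & P r" for P by (auto simp: less_Suc_eq)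
  show ?case unfolding l X I ..
 qed (simp_all add: v2)
 moreover have "run ?B ?Q f main_cmd (init_store n) = setv 0 (fst s3 44) s3"
 proof -
  have "fst (init_store n) 1 = 2 ^ ?k" by (simp add: init_store_def)
  thus ?thesis by (simp only: main_cmd_def run.simps(1,3) eval.simps s3_def s2_def s1_def s0_def) simp
 qed
 ultimately show ?thesis using LUc_root_tests[OF G k] by simp
qed

section \<open>Relabelling the vertices\<close>

lemma LUc_image:
 assumes h: "inj_on h V0" and E: "\<Union>E1 \<subseteq> V0" "\<Union>E2 \<subseteq> V0" and LU: "LUc V0 E1 E2"
 shows "LUc (h ` V0) ((`) h ` E1) ((`) h ` E2)"
proof -
 obtain m c where c: "c ~= 0" and m: "!!u. u \<in> V0 ==> uni (m u)"
  and eq: "!!y. y \<in> Pow V0 ==> lap V0 m (sgn_st E1) y = c * sgn_st E2 y"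
  using LU unfolding LUc_def by blast
 let ?g = "inv_into V0 h"
 have mem: "h u \<in> h ` x \<longleftrightarrow> u \<in> x" if "u \<in> V0" "x \<subseteq> V0" for u x by (rule inj_on_image_mem_iff[OF h that])
 have sgn: "sgn_st ((`) h ` E) (h ` x) = sgn_st E x" if E: "\<Union>E \<subseteq> V0" and x: "x \<subseteq> V0" for E x
 proof -
  have "induced_edges ((`) h ` E) (h ` x) = (`) h ` induced_edges E x"
  proof -
   have "h ` e \<subseteq> h ` x \<longleftrightarrow> e \<subseteq> x" if "e \<in> E" for e
   proof -
    have e: "e \<subseteq> V0" using that E by blast
    show ?thesis unfolding image_subset_iff using mem[OF _ x] e by blast
   qed
   thus ?thesis by (auto simp: induced_edges_def)
  qed
  moreover have "inj_on ((`) h) (induced_edges E x)"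
  proof (rule inj_onI)
   fix a b assume ab: "a \<in> induced_edges E x" "b \<in> induced_edges E x" "h ` a = h ` b"
   hence "a \<subseteq> V0" "b \<subseteq> V0" using E by (auto simp: induced_edges_def)
   thus "a = b" using inj_on_image_eq_iff[OF h] ab(3) by blast
  qed
  ultimately show ?thesis by (simp add: sgn_st_def card_image)
 qed
 have inj: "inj_on ((`) h) (Pow V0)" by (rule inj_on_image_Pow[OF h])
 have "lap (h ` V0) (m \<circ> ?g) (sgn_st ((`) h ` E1)) y = c * sgn_st ((`) h ` E2) y" if "y \<in> Pow (h ` V0)" for y
 proof -
  from that have "y \<subseteq> h ` V0" by simp
  then obtain z where z: "z \<subseteq> V0" "y = h ` z" by (rule subset_imageE)
  have "lap (h ` V0) (m \<circ> ?g) (sgn_st ((`) h ` E1)) y =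
    (\<Sum>x\<in>(`) h ` Pow V0. (\<Prod>u\<in>h ` V0. (m \<circ> ?g) u (u \<in> y) (u \<in> x)) * sgn_st ((`) h ` E1) x)"
   unfolding lap_def image_Pow_surj[OF refl] ..
  also have "... = (\<Sum>x\<in>Pow V0. (\<Prod>u\<in>h ` V0. (m \<circ> ?g) u (u \<in> y) (u \<in> h ` x)) * sgn_st ((`) h ` E1) (h ` x))"
   by (subst sum.reindex[OF inj]) simp
  also have "... = lap V0 m (sgn_st E1) z"
   unfolding lap_def
  proof (rule sum.cong[OF refl])
   fix x assume "x \<in> Pow V0"
   hence x: "x \<subseteq> V0" by simp
   have "(\<Prod>u\<in>h ` V0. (m \<circ> ?g) u (u \<in> y) (u \<in> h ` x)) = (\<Prod>u\<in>V0. m u (u \<in> z) (u \<in> x))"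
    by (subst prod.reindex[OF h], rule prod.cong[OF refl]) (simp add: h z mem x)
   thus "(\<Prod>u\<in>h ` V0. (m \<circ> ?g) u (u \<in> y) (u \<in> h ` x)) * sgn_st ((`) h ` E1) (h ` x) =
     (\<Prod>u\<in>V0. m u (u \<in> z) (u \<in> x)) * sgn_st E1 x" using sgn[OF E(1) x] by simp
  qed
  also have "... = c * sgn_st ((`) h ` E2) y" using eq z sgn[OF E(2) z(1)] by simp
  finally show ?thesis .
 qed
 moreover have "uni ((m \<circ> ?g) u)" if "u \<in> h ` V0" for u using that m h by auto
 ultimately show ?thesis unfolding LUc_def using c by blast
qed

lemma LUc_relabel:
 assumes h: "inj_on h V0" and E: "\<Union>E1 \<subseteq> V0" "\<Union>E2 \<subseteq> V0"
 shows "LUc (h ` V0) ((`) h ` E1) ((`) h ` E2) \<longleftrightarrow> LUc V0 E1 E2"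
proof
 assume LU: "LUc (h ` V0) ((`) h ` E1) ((`) h ` E2)"
 let ?g = "inv_into V0 h"
 have "inj_on ?g (h ` V0)" by (rule inj_on_inv_into) simp
 moreover have "\<Union> ((`) h ` E1) \<subseteq> h ` V0" "\<Union> ((`) h ` E2) \<subseteq> h ` V0" using E by blast+
 ultimately have "LUc (?g ` h ` V0) ((`) ?g ` (`) h ` E1) ((`) ?g ` (`) h ` E2)" using LU by (rule LUc_image)
 moreover have im: "?g ` h ` x = x" if "x \<subseteq> V0" for x using inv_into_image_cancel[OF h that] .
 moreover have "(`) ?g ` (`) h ` E = E" if "\<Union>E \<subseteq> V0" for E
 proof -
  have "?g ` h ` e = e" if "e \<in> E" for e using that \<open>\<Union>E \<subseteq> V0\<close> by (intro im) blast
  thus ?thesis by (simp add: image_image)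
 qed
 ultimately show "LUc V0 E1 E2" using E by simp
qed (rule LUc_image[OF assms])

definition relabel :: "nat set => nat set set => nat set set" where
 "relabel V E = (%e. {i. i < card V & sorted_list_of_set V ! i \<in> e}) ` E"

lemma relabel_props:
 assumes G: "simple_graph V E"
 defines "h \<equiv> %i. sorted_list_of_set V ! i"
 shows "inj_on h {..<card V}" "h ` {..<card V} = V" "(`) h ` relabel V E = E" "simple_graph {..<card V} (relabel V E)"
  "i < card V ==> j < card V ==> adjacency V E i j = of_bool (j \<in> nbr (relabel V E) i)"
proof -
 have fin: "finite V" using G by (simp add: simple_graph_def)
 let ?l = "sorted_list_of_set V"
 have l: "set ?l = V" "distinct ?l" "length ?l = card V" using fin by simp_all
 show inj: "inj_on h {..<card V}" unfolding h_def by (rule inj_on_nth) (use l in simp_all)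
 have "V = {?l ! i | i. i < card V}" using set_conv_nth[of ?l] l by simp
 thus img: "h ` {..<card V} = V" unfolding h_def by blast
 have eV: "e \<subseteq> V" "card e = 2" if "e \<in> E" for e using G that by (simp_all add: simple_graph_def)
 have he: "h ` {i. i < card V & h i \<in> e} = e" if "e \<in> E" for e using eV(1)[OF that] img by auto
 show im: "(`) h ` relabel V E = E" unfolding relabel_def image_image using he by (simp add: h_def)
 have sub: "e \<subseteq> {..<card V}" if "e \<in> relabel V E" for e using that by (auto simp: relabel_def)
 have "card e = 2" if "e \<in> relabel V E" for e
 proof -
  have "h ` e \<in> E" using that im by blast
  hence "card (h ` e) = 2" by (rule eV)
  thus ?thesis using card_image[OF inj_on_subset[OF inj sub[OF that]]] by simp
 qed
 thus "simple_graph {..<card V} (relabel V E)" using sub by (simp add: simple_graph_def)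
 show "adjacency V E i j = of_bool (j \<in> nbr (relabel V E) i)" if ij: "i < card V" "j < card V"
 proof -
  have "{h i, h j} \<in> E \<longleftrightarrow> {i, j} \<in> relabel V E"
  proof
   assume "{h i, h j} \<in> E"
   hence "{k. k < card V & h k \<in> {h i, h j}} \<in> relabel V E" unfolding relabel_def h_def by blast
   moreover have "{k. k < card V & h k \<in> {h i, h j}} = {i, j}" using ij inj by (auto simp: inj_on_def)
   ultimately show "{i, j} \<in> relabel V E" by simp
  next
   assume "{i, j} \<in> relabel V E"
   hence "h ` {i, j} \<in> (`) h ` relabel V E" by (rule imageI)
   thus "{h i, h j} \<in> E" unfolding im by simp
  qed
  thus ?thesis by (simp add: adjacency_def nbr_def h_def)
 qed
qed

section \<open>Running time\<close>

text \<open>The nesting depth of \<open>RepQ\<close> is the power of \<open>qpar n\<close> in the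
  running time; all other loops are bounded by \<open>bnd n\<close>.\<close>

primrec qdepth :: "cmd => nat" where
 "qdepth (Assign x e) = 0"
| "qdepth (Put a i j e) = 0"
| "qdepth (p ;; q) = max (qdepth p) (qdepth q)"
| "qdepth (Cond e p q) = max (qdepth p) (qdepth q)"
| "qdepth (For x e p) = qdepth p"
| "qdepth (RepQ p) = Suc (qdepth p)"
| "qdepth Nop = 0"

text \<open>Polynomial bounds up to a power of \<open>qpar n\<close>. For \<open>n \<ge> 2\<close>
  constant factors are absorbed into powers of \<open>n\<close>.\<close>

definition pb :: "nat => (nat => nat) => bool" where
 "pb k g \<longleftrightarrow> (\<exists>c. \<forall>n\<ge>2. g n <= n ^ c * qpar n ^ k)"

lemma pb_le: "pb k g ==> k <= l ==> pb l g"
proof -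
 assume "pb k g" "k <= l"
 moreover have "n ^ c * qpar n ^ k <= n ^ c * qpar n ^ l" for n c
  using \<open>k <= l\<close> by (intro mult_le_mono2 power_increasing) (simp_all add: qpar_def)
 ultimately show ?thesis unfolding pb_def by (meson le_trans)
qed

lemma pb_mono: "pb k g ==> (!!n. n \<ge> 2 ==> g' n <= g n) ==> pb k g'"
 unfolding pb_def by (meson le_trans)

lemma pb_const: "pb k (%n. m)"
proof -
 have "m <= n ^ m" if "n \<ge> 2" for n :: nat
  using less_exp[of m] power_mono[OF that, of m] by linarith
 hence "pb 0 (%n. m)" unfolding pb_def by (intro exI[of _ m]) simp
 thus ?thesis by (rule pb_le) simp
qed

lemma pb_id: "pb 0 (%n. n)"
 unfolding pb_def by (rule exI[of _ 1]) simp

lemma pb_qpar: "pb 1 qpar"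
 unfolding pb_def by (rule exI[of _ 0]) simp

lemma pb_mult: "pb k g ==> pb l g' ==> pb (k + l) (%n. g n * g' n)"
proof -
 assume "pb k g" "pb l g'"
 then obtain c c' where c: "!!n. n \<ge> 2 ==> g n <= n ^ c * qpar n ^ k" "!!n. n \<ge> 2 ==> g' n <= n ^ c' * qpar n ^ l"
  unfolding pb_def by metis
 have "g n * g' n <= n ^ (c + c') * qpar n ^ (k + l)" if "n \<ge> 2" for n
  using mult_le_mono[OF c(1)[OF that] c(2)[OF that]] by (simp add: power_add mult_ac)
 thus ?thesis unfolding pb_def by blast
qed

lemma pb_add: "pb k g ==> pb k g' ==> pb k (%n. g n + g' n)"
proof -
 assume "pb k g" "pb k g'"
 then obtain c c' where c: "!!n. n \<ge> 2 ==> g n <= n ^ c * qpar n ^ k" "!!n. n \<ge> 2 ==> g' n <= n ^ c' * qpar n ^ k"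
  unfolding pb_def by metis
 have "g n + g' n <= n ^ (c + c' + 1) * qpar n ^ k" if n: "n \<ge> 2" for n
 proof -
  have "n ^ c <= n ^ (c + c')" "n ^ c' <= n ^ (c + c')" using n by (intro power_increasing; simp)+
  hence "n ^ c * qpar n ^ k <= n ^ (c + c') * qpar n ^ k" "n ^ c' * qpar n ^ k <= n ^ (c + c') * qpar n ^ k" by (simp_all only: mult_le_mono1)
  hence "g n + g' n <= 2 * (n ^ (c + c') * qpar n ^ k)" using c(1)[OF n] c(2)[OF n] by linarith
  also have "... <= n * (n ^ (c + c') * qpar n ^ k)" using n by (rule mult_le_mono1)
  finally show ?thesis by (simp add: mult.assoc)
 qed
 thus ?thesis unfolding pb_def by blast
qed

lemmas pb_mult_0 = pb_mult[where k = 0, unfolded add_0]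

lemma pb_lg: "pb 0 lg"
 by (rule pb_mono[of _ "%n. n + 4"]) (intro pb_add pb_id pb_const lg_le)+

lemma pb_bnd: "pb 0 bnd"
 unfolding bnd_def power2_eq_square by (intro pb_add pb_mult_0 pb_id pb_const)

lemmas pb_intros = pb_add pb_mult_0 pb_id pb_lg pb_bnd pb_const

lemma pb_ecost: "pb 0 (%n. ecost (bnd n) e)"
 by (induction e) (unfold ecost.simps, (intro pb_intros; assumption)+)

lemma pb_ccost: "pb (qdepth p) (%n. ccost (bnd n) (qpar n) p)"
proof (induction p)
 case (RepQ p)
 have "pb (1 + qdepth p) (%n. qpar n * (ccost (bnd n) (qpar n) p + 1 + 1))" by (intro pb_mult pb_qpar pb_add RepQ pb_const)
 from this[unfolded plus_1_eq_Suc] show ?case unfolding ccost.simps qdepth.simps by (intro pb_add pb_const)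
qed (unfold ccost.simps qdepth.simps, (intro pb_intros pb_ecost pb_le[OF pb_ecost]; (erule pb_le)?; simp)+)

lemma bit_length_le: "x < 2 ^ k ==> bit_length x <= k"
 using floorlog_le_iff[of 2 x k] by simp

text \<open>\<open>(n + 1) ^ lg n\<close> is at most \<open>(n * 2) ^ lg n\<close>, and
  \<open>2 ^ lg n\<close> is linear in \<open>n\<close>: passing from base \<open>n + 1\<close> to
  base \<open>n\<close> costs only a polynomial factor.\<close>

lemma qpar_le: "n \<ge> 1 ==> qpar n <= n ^ lg n * (2 * (n + 3))"
proof -
 assume n: "n \<ge> 1"
 have "qpar n <= (n * 2) ^ lg n" unfolding qpar_def using n by (intro power_mono) simp_all
 also have "... = n ^ lg n * 2 ^ lg n" by (rule power_mult_distrib)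
 also have "... <= n ^ lg n * (2 * (n + 3))" by (rule mult_le_mono2[OF lg_upper])
 finally show ?thesis .
qed

text \<open>\<open>qpar n\<close> is at most \<open>2 ^ (n * lg n)\<close>, so the logarithmic cost
  of an operation is polynomial in \<open>n\<close>.\<close>

lemma pb_bit_length: "pb 0 (%n. bit_length (xpar n))"
proof (rule pb_mono)
 let ?P = "%n. 32 * (2 * bnd n + bnd n * (bnd n + 1)) + 32"
 show "pb 0 (%n. ?P n + n * lg n + 1)" by (intro pb_intros)
 fix n :: nat assume n: "n \<ge> 2"
 have "qpar n <= 2 ^ (n * lg n)"
 proof -
  have "n + 1 <= 2 ^ n" using less_exp[of n] by (simp add: Suc_le_eq)
  hence "(n + 1) ^ lg n <= (2 ^ n) ^ lg n" by (rule power_mono) simp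
  thus ?thesis by (simp add: qpar_def power_mult)
 qed
 also have "... <= 2 ^ (?P n + n * lg n)" by (rule power_increasing) simp_all
 finally have "qpar n <= 2 ^ (?P n + n * lg n)" .
 moreover have "?P n < 2 ^ (?P n + n * lg n)"
 proof -
  have "?P n < 2 ^ ?P n" by (rule less_exp)
  also have "... <= 2 ^ (?P n + n * lg n)" by (rule power_increasing) simp_all
  finally show ?thesis .
 qed
 moreover have "x + q < 2 ^ (K + 1)" if "q <= 2 ^ K" "x < 2 ^ K" for x q K :: nat using that by simp
 ultimately have "xpar n < 2 ^ (?P n + n * lg n + 1)" unfolding xpar_def by blast
 thus "bit_length (xpar n) <= ?P n + n * lg n + 1" by (rule bit_length_le)
qed

definition algorithm :: ram where
 "algorithm = Seq prelude (ccmd 0 main_cmd)"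

definition steps :: "nat => nat" where
 "steps n = lg n * (3 * n + 12) + 3 * n + 18 + ccost (bnd n) (qpar n) main_cmd"

lemma algorithm_run:
 assumes G: "simple_graph V E1" "simple_graph V E2"
 shows "\<exists>t s. exec algorithm (input_state V E1 E2) t s & (accepting s \<longleftrightarrow> LU_equivalent V E1 E2) \<and>
  t <= steps (card V) * (1 + 2 * bit_length (xpar (card V)))"
proof -
 define n where "n = card V"
 let ?f = "input_memory V E1 E2" and ?h = "%i. sorted_list_of_set V ! i"
 note p1 = relabel_props[OF G(1), folded n_def] and p2 = relabel_props[OF G(2), folded n_def]
 let ?E1 = "relabel V E1" and ?E2 = "relabel V E2"
 have f1: "?f k <= 1" for k by (simp add: input_memory_def adjacency_def Let_def)
 have f0: "?f k = 0" if "2 * n\<^sup>2 <= k" for k using that by (simp add: input_memory_def Let_def n_def)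
 have lt: "i * n + j < n\<^sup>2" if ij: "i < n" "j < n" for i j
 proof -
  have "i * n + j < Suc i * n" using ij by simp
  also have "... <= n * n" by (rule mult_le_mono1) (use ij in simp)
  finally show ?thesis by (simp add: power2_eq_square)
 qed
 have fE: "?f (i * n + j) = of_bool (j \<in> nbr ?E1 i)" "?f (n * n + i * n + j) = of_bool (j \<in> nbr ?E2 i)" if ij: "i < n" "j < n" for i j
 proof -
  have d: "(i * n + j) div n = i" "(i * n + j) mod n = j" using ij by simp_all
  show "?f (i * n + j) = of_bool (j \<in> nbr ?E1 i)"
   using lt[OF ij] p1(5)[OF ij] d by (simp add: input_memory_def Let_def flip: n_def)
  have "n * n + i * n + j = n\<^sup>2 + (i * n + j)" by (simp add: power2_eq_square)
  thus "?f (n * n + i * n + j) = of_bool (j \<in> nbr ?E2 i)"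
   using lt[OF ij] p2(5)[OF ij] d by (simp add: input_memory_def Let_def flip: n_def)
 qed
 interpret ram_sim "bnd n" "qpar n" "xpar n" ?f
 proof
  show "16 <= bnd n" by (simp add: bnd_def)
  show "32 * (2 * bnd n + bnd n * (bnd n + 1)) + 32 <= xpar n" "qpar n <= xpar n" by (simp_all add: xpar_def)
  show "?f k <= bnd n" for k using f1[of k] by (simp add: bnd_def)
 qed
 have "ht (xpar n) (at_state ((%_. 0)(0 := n)) ?f) algorithm (steps n) (st (run (bnd n) (qpar n) ?f main_cmd (init_store n)) 0 (%_. 0))"
  unfolding algorithm_def steps_def by (rule ht_Seq[OF ccmd_correct ht_prelude[OF f1 f0]])
 from htD[OF this] obtain t R' M' where t: "exec algorithm (input_state V E1 E2) t (R', M')" "t <= steps n * (1 + 2 * bit_length (xpar n))"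
  and R': "st (run (bnd n) (qpar n) ?f main_cmd (init_store n)) 0 (%_. 0) R' M'"
  unfolding input_state_def n_def[symmetric] by blast
 have "accepting (R', M') \<longleftrightarrow> LUc {..<n} ?E1 ?E2"
  using stD(1)[OF R', of 0] run_main[OF p1(4) p2(4) fE] by (simp add: accepting_def)
 also have "... \<longleftrightarrow> LUc V E1 E2"
 proof -
  have "\<Union>?E1 \<subseteq> {..<n}" "\<Union>?E2 \<subseteq> {..<n}" using p1(4) p2(4) by (auto simp: simple_graph_def)
  from LUc_relabel[OF p1(1) this] show ?thesis unfolding p1(2,3) p2(3) by simp
 qed
 also have "... \<longleftrightarrow> LU_equivalent V E1 E2" using LU_iff_LUc[OF G] by simp
 finally show ?thesis using t unfolding n_def by blast
qed

text \<open>The only \<open>RepQ\<close> is the enumeration of tuples in \<open>solve_cmd\<close>,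
  so \<open>qpar n\<close> enters linearly.\<close>

lemma qdepth_main: "qdepth main_cmd = 1"
 by (simp add: main_cmd_def read_cmd_def root_cmd_def comp_cmd_def pass_cmd_def split_cmd_def try_cmd_def prop_cmd_def
   seed_cmd_def astep_cmd_def codes_cmd_def unit_cmd_def vstep_cmd_def mkc_cmd_def cons_cmd_def fill_cmd_def half_cmd_def
   dot_cmd_def out_cmd_def code_cmd_def solve_cmd_def tuple_cmd_def mark_cmd_def eqn_cmd_def row_cmd_def beta_cmd_def
   par_cmd_def inc_cmd_def)

lemma time_bound: "\<exists>c. \<forall>n\<ge>2. steps n * (1 + 2 * bit_length (xpar n)) <= n ^ (lg n + c)"
proof -
 have "pb (1 + 0) (%n. steps n * (1 + 2 * bit_length (xpar n)))" unfolding steps_def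
  by (intro pb_mult pb_add pb_ccost[of main_cmd, unfolded qdepth_main] pb_const pb_mult_0 pb_bit_length pb_le[OF pb_mult_0] pb_lg pb_id pb_le[OF pb_id]) simp_all
 then obtain c where c: "!!n. n \<ge> 2 ==> steps n * (1 + 2 * bit_length (xpar n)) <= n ^ c * qpar n" unfolding pb_def by auto
 have "steps n * (1 + 2 * bit_length (xpar n)) <= n ^ (lg n + (c + 4))" if n: "n \<ge> 2" for n
 proof -
  have "2 ^ 3 <= n ^ 3" using n by (rule power_mono) simp
  hence "n * 8 <= n * n ^ 3" by (intro mult_le_mono2) simp
  also have "... = n ^ 4" by (simp flip: power_Suc)
  finally have "n * 8 <= n ^ 4" .
  moreover have "2 * (n + 3) <= n * 8" using n by simp
  ultimately have le: "2 * (n + 3) <= n ^ 4" by (rule le_trans[rotated])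
  have "qpar n <= n ^ lg n * (2 * (n + 3))" by (rule qpar_le) (use n in simp)
  also have "... <= n ^ lg n * n ^ 4" by (rule mult_le_mono2[OF le])
  finally have "n ^ c * qpar n <= n ^ c * (n ^ lg n * n ^ 4)" by (rule mult_le_mono2)
  also have "... = n ^ (lg n + (c + 4))" by (simp add: power_add mult_ac)
  finally show ?thesis by (rule le_trans[OF c[OF n]])
 qed
 thus ?thesis by blast
qed

theorem theorem30:
  shows "\<exists>(p :: ram) (e :: nat \<Rightarrow> real).
           e \<in> O(\<lambda>_. 1) \<and>
           decides_LU_equivalence p \<and>
           runtime_bounded_by p (\<lambda>n. real n powr (log 2 (real n) + e n))"
proof -
 obtain c where c: "!!n. n \<ge> 2 ==> steps n * (1 + 2 * bit_length (xpar n)) <= n ^ (lg n + c)"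
  using time_bound by blast
 have "decides_LU_equivalence algorithm" unfolding decides_LU_equivalence_def using algorithm_run by blast
 moreover have "runtime_bounded_by algorithm (%n. real n powr (log 2 (real n) + (3 + real c)))"
  unfolding runtime_bounded_by_def
 proof (intro allI impI)
  fix V E1 E2 t s
  assume G: "simple_graph V E1" "simple_graph V E2" and n: "card V \<ge> 2" and ex: "exec algorithm (input_state V E1 E2) t s"
  let ?n = "card V"
  obtain t' s' where t': "exec algorithm (input_state V E1 E2) t' s'" "t' <= steps ?n * (1 + 2 * bit_length (xpar ?n))"
   using algorithm_run[OF G] by blast
  \<comment> \<open>The bound is known for one run; determinism extends it to every run.\<close>
  have "t = t'" using exec_deterministic[OF ex t'(1)] by simp
  hence "t <= ?n ^ (lg ?n + c)" using t'(2) c[OF n] by linarith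
  hence "real t <= real ?n ^ (lg ?n + c)" by (metis of_nat_le_iff of_nat_power)
  also have "... = real ?n powr real (lg ?n + c)" using n by (subst powr_realpow) simp_all
  also have "... <= real ?n powr (log 2 (real ?n) + (3 + real c))"
  proof (rule powr_mono)
   \<comment> \<open>This bounds \<open>lg ?n\<close> by the binary logarithm of \<open>?n\<close>
     plus 3, the 3 being \<open>log 2 8\<close>; with \<open>c\<close> it makes up the constant in
     the exponent.\<close>
   have "2 * (?n + 3) <= 8 * ?n" using n by simp
   with lg_upper[of ?n] have "2 ^ lg ?n <= 8 * ?n" by (rule le_trans)
   hence "(2 :: real) ^ lg ?n <= 8 * real ?n" by (metis of_nat_le_iff of_nat_mult of_nat_numeral of_nat_power)
   hence "real (lg ?n) <= log 2 (8 * real ?n)" using n by (subst le_log_iff) (simp_all add: powr_realpow)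
   also have "... = 3 + log 2 (real ?n)"
   proof -
    have "log 2 (8 :: real) = 3" using log_pow_cancel[of 2 3] by simp
    thus ?thesis using n by (subst log_mult) simp_all
   qed
   finally show "real (lg ?n + c) <= log 2 (real ?n) + (3 + real c)" by simp
  qed (use n in simp)
  finally show "real t <= real ?n powr (log 2 (real ?n) + (3 + real c))" .
 qed
 moreover have "(%_. 3 + real c) \<in> O(%_ :: nat. 1 :: real)" by simp
 ultimately show ?thesis by blast
qed

end
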